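(* Let $d\ge2$, let $u_0\in L^2(\mathbb{T}^d)$ be fixed, and for each $\nu\in(0,1)$ let $u_\nu\in L^3([0,1]\times\mathbb{T}^d)$ be a Leray--Hopf solution on $[0,1]\times\mathbb{T}^d$ of the $d$-dimensional Navier--Stokes equations with viscosity $\nu$, forcing $f_\nu$ and initial datum $u_0$. Suppose there exist $\alpha\in(0,1)$ and $\sigma>0$ such that $$\sup_{\nu\in(0,1)}\Big[\|u_\nu\|_{L^2_tB^\alpha_{2,\infty,x}}+\|f_\nu\|_{L^{1+\sigma}_tL^2_x}\Big]<\infty .$$ For $t\in[0,1]$ set $$\varepsilon_\nu(t)=\frac12\|u_0\|_{L^2(\mathbb{T}^d)}^2-\frac12\|u_\nu(t)\|_{L^2(\mathbb{T}^d)}^2+\int_0^t\langle f_\nu(r),u_\nu(r)\rangle\,dr,$$ and let $\ell_D=\ell_D(\nu)=\nu^L$, where $L<\frac{1}{2(1-\alpha)}$. Then for every $p\in[1,\infty)$ and every $\bullet\in\{I,L,T\}$, $$\lim_{\ell_I\to0}\ \limsup_{\nu\to0}\ \sup_{\ell\in[\ell_D,\ell_I]}\int_0^1\left|\int_0^t\frac{S^\nu_\bullet(r,\ell)}{\ell}\,dr+\varepsilon_\nu(t)\right|^p dt=0 .$$ If in addition there exists $\overline\alpha>0$ such that $u_\nu$ is bounded in $L^\infty_tB^{\overline\alpha}_{2,\infty,x}$ uniformly in $\nu\in(0,1)$, in which case $\sigma=0$ is also allowed in the hypothesis above (so that $f_\nu$ is only required to be uniformly bounded in $L^1_tL^2_x$),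 then for every $\bullet\in\{I,L,T\}$ $$\lim_{\ell_I\to0}\ \limsup_{\nu\to0}\ \sup_{\ell\in[\ell_D,\ell_I]}\ \sup_{t\in[0,1]}\left|\int_0^t\frac{S^\nu_\bullet(r,\ell)}{\ell}\,dr+\varepsilon_\nu(t)\right|=0 .$$
   Context: $\mathbb{T}^d$ is the $d$-dimensional flat torus; functions on it are identified with periodic functions on $\mathbb{R}^d$. Repeated indices are summed. $dy$ on the unit sphere $\mathbb{S}^{d-1}$ is surface measure, $|\mathbb{S}^{d-1}|$ its total mass. $\langle\cdot,\cdot\rangle$ is the $L^2(\mathbb{T}^d)$ inner product. Time norms are over $[0,1]$; $B^\alpha_{2,\infty,x}$ is the Besov space $B^\alpha_{2,\infty}(\mathbb{T}^d)$, with norm for $\alpha\in(0,1)$ equivalent to $\|v\|_{L^2}+\sup_{y\ne0}|y|^{-\alpha}\|v(\cdot+y)-v\|_{L^2}$. A supremum over the empty set (which occurs when $\ell_D>\ell_I$) is taken to be $0$. Define, for $y\ne0$, the matrices $$T_I^{ij}(y)=\delta^{ij},\qquad T_L^{ij}(y)=\frac{y^iy^j}{|y|^2},\qquad T_T^{ij}(y)=\delta^{ij}-\frac{y^iy^j}{|y|^2}.$$ With $\delta_{\ell y}u_\nu(t,x)=u_\nu(t,x+\ell y)-u_\nu(t,x)$, the structure functions are $$S_I^\nu(t,\ell)=\frac d4\int_{\mathbb{T}^d}\frac1{|\mathbb{S}^{d-1}|}\int_{\mathbb{S}^{d-1}}\big(\delta_{\ell y}u_\nu(t,x)\cdot y\big)\,|\delta_{\ell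 y}u_\nu(t,x)|^2\,dy\,dx,$$ $$S_L^\nu(t,\ell)=\frac{d(d+2)}{12}\int_{\mathbb{T}^d}\frac1{|\mathbb{S}^{d-1}|}\int_{\mathbb{S}^{d-1}}\big(\delta_{\ell y}u_\nu(t,x)\cdot y\big)\,|T_L(y)\,\delta_{\ell y}u_\nu(t,x)|^2\,dy\,dx,$$ $$S_T^\nu(t,\ell)=\frac{d(d+2)}{4(d-1)}\int_{\mathbb{T}^d}\frac1{|\mathbb{S}^{d-1}|}\int_{\mathbb{S}^{d-1}}\big(\delta_{\ell y}u_\nu(t,x)\cdot y\big)\,|T_T(y)\,\delta_{\ell y}u_\nu(t,x)|^2\,dy\,dx.$$ The Navier--Stokes equations with viscosity $\nu>0$ are $$\partial_tu+(u\cdot\nabla)u+\nabla p=\nu\Delta u+f,\qquad\operatorname{div}u=0,\qquad u|_{t=0}=u_0.$$ A weak solution on $[0,1]$ is a divergence-free $u\in C^0([0,1];L^2(\mathbb{T}^d))\cap L^2([0,1];\dot H^1(\mathbb{T}^d))$ which, together with an integrable scalar pressure $p$, satisfies for all $\phi=(\phi^i)\in C^\infty([0,1]\times\mathbb{T}^d;\mathbb{R}^d)$ $$\int_{\mathbb{T}^d}\big[\phi^i(0,x)u_0^i(x)-\phi^i(1,x)u^i(1,x)\big]dx+\int_{\mathbb{T}^d\times[0,1]}\phi^if^i\,dt\,dx=\int_{\mathbb{T}^d\times[0,1]}\big[-\partial_t\phi^i\,u^i-\partial_j\phi^i\,u^iu^j-\partial_i\phi^i\,p+\nu\,\partial_j\phi^i\,\partial_ju^i\big]dt\,dx.$$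 A Leray--Hopf solution is a weak solution satisfying, for every $t\in[0,1]$, the energy inequality $$\frac12\|u(t)\|_{L^2}^2+\nu\int_0^t\|\nabla u(r)\|_{L^2}^2\,dr\le\frac12\|u_0\|_{L^2}^2+\int_0^t\langle f(r),u(r)\rangle\,dr.$$ *)

theory Defs
  imports "HOL-Analysis.Analysis" "HOL-Probability.Essential_Supremum"
begin

section \<open>Functions on the torus and their norms\<close>

text \<open>
  The torus is the quotient of the Euclidean space by the integer lattice, so it has volume 1.
  Functions on it are functions on the whole space, periodic in each coordinate; integrals
  over the torus are integrals over a fundamental cell.  Elements of Lebesgue spaces are
  represented by Borel functions.
\<close>

definition periodic :: "(real ^ 'n \<Rightarrow> 'b) \<Rightarrow> bool" where
  "periodic v \<longleftrightarrow> (\<forall>x i. v (x + axis i 1) = v x)"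

definition torus :: "(real ^ 'n) measure" where
  "torus = restrict_space lborel {x. \<forall>i. 0 \<le> x $ i \<and> x $ i < 1}"

definition unit_time :: "real measure" where
  "unit_time = restrict_space lborel {0..1}"

definition torus_field :: "(real ^ 'n \<Rightarrow> 'b::topological_space) \<Rightarrow> bool" where
  "torus_field v \<longleftrightarrow> periodic v \<and> v \<in> borel_measurable torus"

definition spacetime_field :: "(real \<Rightarrow> real ^ 'n \<Rightarrow> 'b::topological_space) \<Rightarrow> bool" where
  "spacetime_field w \<longleftrightarrow>
     (\<forall>t\<in>{0..1}. periodic (w t)) \<and>
     (\<lambda>(t, x). w t x) \<in> borel_measurable (unit_time \<Otimes>\<^sub>M torus)"

text \<open>Only used with a positive exponent.\<close>

definition epowr :: "ennreal \<Rightarrow> real \<Rightarrow> ennreal" where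
  "epowr a q = (if a = \<infinity> then \<infinity> else ennreal (enn2real a powr q))"

text \<open>
  The integrand is extended-valued so that mixed norms in time and space
  can be written as nested Lebesgue norms.
\<close>

definition Lnorm :: "'a measure \<Rightarrow> real \<Rightarrow> ('a \<Rightarrow> ennreal) \<Rightarrow> ennreal" where
  "Lnorm M q g = epowr (\<integral>\<^sup>+ x. epowr (g x) q \<partial>M) (1 / q)"

definition L2 :: "(real ^ 'n \<Rightarrow> 'b::real_normed_vector) \<Rightarrow> ennreal" where
  "L2 v = Lnorm torus 2 (\<lambda>x. ennreal (norm (v x)))"

abbreviation l2norm :: "(real ^ 'n \<Rightarrow> 'b::real_normed_vector) \<Rightarrow> real" where
  "l2norm v \<equiv> enn2real (L2 v)"

definition l2inner :: "(real ^ 'n \<Rightarrow> 'b::euclidean_space) \<Rightarrow> (real ^ 'n \<Rightarrow> 'b) \<Rightarrow> real" where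
  "l2inner v w = (\<integral>x. v x \<bullet> w x \<partial>torus)"

definition increment :: "real ^ 'n \<Rightarrow> (real ^ 'n \<Rightarrow> 'b::real_normed_vector) \<Rightarrow> real ^ 'n \<Rightarrow> 'b" where
  "increment y v x = v (x + y) - v x"

text \<open>
  The norm of the Besov space with integrability 2, summability infinity and smoothness
  \<open>\<alpha> > 0\<close>, as a modulus of smoothness.  The order of the difference is the least integer
  exceeding \<open>\<alpha>\<close>; for \<open>\<alpha> \<ge> 1\<close> first differences would not describe this space.
  The lemma below records the case \<open>0 < \<alpha> < 1\<close>.
\<close>

definition besov :: "real \<Rightarrow> (real ^ 'n \<Rightarrow> 'b::real_normed_vector) \<Rightarrow> ennreal" where
  "besov \<alpha> v = L2 v +
     (SUP y\<in>-{0}. ennreal (norm y powr - \<alpha>) * L2 ((increment y ^^ (nat \<lfloor>\<alpha>\<rfloor> + 1)) v))"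

lemma besov_below_1:
  assumes "0 < \<alpha>" "\<alpha> < 1"
  shows "besov \<alpha> v =
    L2 v + (SUP y\<in>-{0}. ennreal (norm y powr - \<alpha>) * L2 (\<lambda>x. v (x + y) - v x))"
proof -
  have "\<lfloor>\<alpha>\<rfloor> = 0"
    using assms by (simp add: floor_eq_iff)
  then show ?thesis
    by (simp add: besov_def increment_def[abs_def])
qed


section \<open>Smooth functions\<close>

definition pd :: "'a \<Rightarrow> ('a::real_normed_vector \<Rightarrow> 'b::real_normed_vector) \<Rightarrow> 'a \<Rightarrow> 'b" where
  "pd e f x = frechet_derivative f (at x) e"

primrec Ck :: "nat \<Rightarrow> ('a::euclidean_space \<Rightarrow> 'b::real_normed_vector) \<Rightarrow> bool" where
  "Ck 0 f \<longleftrightarrow> continuous_on UNIV f"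
| "Ck (Suc k) f \<longleftrightarrow> (\<forall>x. f differentiable (at x)) \<and> (\<forall>e\<in>Basis. Ck k (pd e f))"

definition smooth :: "('a::euclidean_space \<Rightarrow> 'b::real_normed_vector) \<Rightarrow> bool" where
  "smooth f \<longleftrightarrow> (\<forall>k. Ck k f)"

abbreviation dt :: "(real \<times> (real ^ 'n) \<Rightarrow> 'b::real_normed_vector) \<Rightarrow> real \<times> (real ^ 'n) \<Rightarrow> 'b" where
  "dt \<equiv> pd (1, 0)"

abbreviation dx :: "'n \<Rightarrow> (real \<times> (real ^ 'n) \<Rightarrow> 'b::real_normed_vector) \<Rightarrow> real \<times> (real ^ 'n) \<Rightarrow> 'b" where
  "dx j \<equiv> pd (0, axis j 1)"

text \<open>
  Smooth functions on the closed slab of times in \<open>[0, 1]\<close> are the restrictions of functions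
  that are smooth for all times, so the weak formulation is tested with the latter.
\<close>

definition test_function :: "(real \<times> (real ^ 'n) \<Rightarrow> real ^ 'n) \<Rightarrow> bool" where
  "test_function \<phi> \<longleftrightarrow> smooth \<phi> \<and> (\<forall>t. periodic (\<lambda>x. \<phi> (t, x)))"


section \<open>Leray--Hopf solutions of the Navier--Stokes equations\<close>

definition weakly_divergence_free :: "(real ^ 'n \<Rightarrow> real ^ 'n) \<Rightarrow> bool" where
  "weakly_divergence_free v \<longleftrightarrow>
     (\<forall>\<psi> :: real ^ 'n \<Rightarrow> real. smooth \<psi> \<and> periodic \<psi> \<longrightarrow>
        (\<integral>x. (\<Sum>i\<in>UNIV. v x $ i * pd (axis i 1) \<psi> x) \<partial>torus) = 0)"

text \<open>The entry of \<open>G x\<close> in row \<open>i\<close> and column \<open>j\<close> is the \<open>j\<close>-th derivative of the \<open>i\<close>-th component.\<close>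

definition weak_gradient :: "(real ^ 'n \<Rightarrow> real ^ 'n) \<Rightarrow> (real ^ 'n \<Rightarrow> real ^ 'n ^ 'n) \<Rightarrow> bool" where
  "weak_gradient v G \<longleftrightarrow>
     (\<forall>\<psi> :: real ^ 'n \<Rightarrow> real. smooth \<psi> \<and> periodic \<psi> \<longrightarrow>
        (\<forall>i j. (\<integral>x. v x $ i * pd (axis j 1) \<psi> x \<partial>torus) = - (\<integral>x. G x $ i $ j * \<psi> x \<partial>torus)))"

definition continuous_L2 :: "(real \<Rightarrow> real ^ 'n \<Rightarrow> 'b::real_normed_vector) \<Rightarrow> bool" where
  "continuous_L2 u \<longleftrightarrow>
     (\<forall>t\<in>{0..1}. L2 (u t) < \<infinity> \<and>
        ((\<lambda>s. L2 (\<lambda>x. u s x - u t x)) \<longlongrightarrow> 0) (at t within {0..1}))"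

text \<open>The fields \<open>G\<close> and \<open>q\<close> are the spatial gradient of \<open>u\<close> and the pressure.\<close>

definition weak_solution ::
  "real \<Rightarrow> (real ^ 'n \<Rightarrow> real ^ 'n) \<Rightarrow> (real \<Rightarrow> real ^ 'n \<Rightarrow> real ^ 'n) \<Rightarrow>
   (real \<Rightarrow> real ^ 'n \<Rightarrow> real ^ 'n) \<Rightarrow> (real \<Rightarrow> real ^ 'n \<Rightarrow> real ^ 'n ^ 'n) \<Rightarrow>
   (real \<Rightarrow> real ^ 'n \<Rightarrow> real) \<Rightarrow> bool" where
  "weak_solution \<nu> u0 f u G q \<longleftrightarrow>
     spacetime_field u \<and> continuous_L2 u \<and>
     (\<forall>t\<in>{0..1}. weakly_divergence_free (u t)) \<and>
     spacetime_field G \<and> (AE t in unit_time. weak_gradient (u t) (G t)) \<and>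
     Lnorm unit_time 2 (\<lambda>t. L2 (G t)) < \<infinity> \<and>
     spacetime_field q \<and> integrable (unit_time \<Otimes>\<^sub>M torus) (\<lambda>(t, x). q t x) \<and>
     (\<forall>\<phi>. test_function \<phi> \<longrightarrow>
        (\<integral>x. (\<Sum>i\<in>UNIV. \<phi> (0, x) $ i * u0 x $ i - \<phi> (1, x) $ i * u 1 x $ i) \<partial>torus)
        + (\<integral>(t, x). (\<Sum>i\<in>UNIV. \<phi> (t, x) $ i * f t x $ i) \<partial>(unit_time \<Otimes>\<^sub>M torus))
        = (\<integral>(t, x).
             - (\<Sum>i\<in>UNIV. dt \<phi> (t, x) $ i * u t x $ i)
             - (\<Sum>i\<in>UNIV. \<Sum>j\<in>UNIV. dx j \<phi> (t, x) $ i * u t x $ i * u t x $ j)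
             - (\<Sum>i\<in>UNIV. dx i \<phi> (t, x) $ i * q t x)
             + \<nu> * (\<Sum>i\<in>UNIV. \<Sum>j\<in>UNIV. dx j \<phi> (t, x) $ i * G t x $ i $ j)
           \<partial>(unit_time \<Otimes>\<^sub>M torus)))"

definition leray_hopf ::
  "real \<Rightarrow> (real ^ 'n \<Rightarrow> real ^ 'n) \<Rightarrow> (real \<Rightarrow> real ^ 'n \<Rightarrow> real ^ 'n) \<Rightarrow>
   (real \<Rightarrow> real ^ 'n \<Rightarrow> real ^ 'n) \<Rightarrow> bool" where
  "leray_hopf \<nu> u0 f u \<longleftrightarrow>
     (\<exists>G q. weak_solution \<nu> u0 f u G q \<and>
        (\<forall>t\<in>{0..1}.
           1 / 2 * (l2norm (u t))\<^sup>2 + \<nu> * (LINT r:{0..t}|lborel. (l2norm (G r))\<^sup>2)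
           \<le> 1 / 2 * (l2norm u0)\<^sup>2 + (LINT r:{0..t}|lborel. l2inner (f r) (u r))))"

definition energy_defect ::
  "(real ^ 'n \<Rightarrow> real ^ 'n) \<Rightarrow> (real \<Rightarrow> real ^ 'n \<Rightarrow> real ^ 'n) \<Rightarrow>
   (real \<Rightarrow> real ^ 'n \<Rightarrow> real ^ 'n) \<Rightarrow> real \<Rightarrow> real" where
  "energy_defect u0 f u t =
     1 / 2 * (l2norm u0)\<^sup>2 - 1 / 2 * (l2norm (u t))\<^sup>2
     + (LINT r:{0..t}|lborel. l2inner (f r) (u r))"


section \<open>Structure functions\<close>

text \<open>
  The surface measure of the unit sphere: the area of a set is the dimension times the volume
  of the cone over it inside the unit ball.
\<close>

definition sphere_measure :: "(real ^ 'n) measure" where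
  "sphere_measure =
     density (distr (restrict_space lborel (ball 0 1 - {0})) borel (\<lambda>x. x /\<^sub>R norm x))
             (\<lambda>_. ennreal (real CARD('n)))"

definition sphere_average :: "(real ^ 'n \<Rightarrow> real) \<Rightarrow> real" where
  "sphere_average g = 1 / measure sphere_measure (UNIV :: (real ^ 'n) set) * (\<integral>y. g y \<partial>sphere_measure)"

datatype kind = Kind_I | Kind_L | Kind_T

primrec T_matrix :: "kind \<Rightarrow> real ^ 'n \<Rightarrow> real ^ 'n ^ 'n" where
  "T_matrix Kind_I y = mat 1"
| "T_matrix Kind_L y = (\<chi> i j. y $ i * y $ j / (norm y)\<^sup>2)"
| "T_matrix Kind_T y = mat 1 - (\<chi> i j. y $ i * y $ j / (norm y)\<^sup>2)"

primrec prefactor :: "kind \<Rightarrow> real \<Rightarrow> real" where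
  "prefactor Kind_I d = d / 4"
| "prefactor Kind_L d = d * (d + 2) / 12"
| "prefactor Kind_T d = d * (d + 2) / (4 * (d - 1))"

definition structure_function :: "kind \<Rightarrow> (real ^ 'n \<Rightarrow> real ^ 'n) \<Rightarrow> real \<Rightarrow> real" where
  "structure_function b v l =
     prefactor b (real CARD('n)) *
     (\<integral>x. sphere_average (\<lambda>y.
        (increment (l *\<^sub>R y) v x \<bullet> y) * (norm (T_matrix b y *v increment (l *\<^sub>R y) v x))\<^sup>2)
      \<partial>torus)"

definition discrepancy ::
  "kind \<Rightarrow> (real ^ 'n \<Rightarrow> real ^ 'n) \<Rightarrow> (real \<Rightarrow> real ^ 'n \<Rightarrow> real ^ 'n) \<Rightarrow>
   (real \<Rightarrow> real ^ 'n \<Rightarrow> real ^ 'n) \<Rightarrow> real \<Rightarrow> real \<Rightarrow> real" where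
  "discrepancy b u0 f u l t =
     \<bar>(LINT r:{0..t}|lborel. structure_function b (u r) l / l) + energy_defect u0 f u t\<bar>"

end

(*
For each kind there is an even matrix kernel, quadratic inside the ball of radius l and zero
outside, such that testing the equation with the kernel convolved with u turns the cubic term
into -S(l)/l: by div u = 0 the velocities may be replaced by their increments, the derivative
of the kernel inside the ball vanishes against three equal increments, and its jump on the
sphere leaves the sphere average.  The kernel has total mass equal to the identity matrix, and
its divergence is a gradient, so the pressure drops out.
Comparing the resulting balance with the energy defect, every remaining term carries the
L2 modulus of continuity omega(l) of u.  The viscous one is at most
(nu/l) |grad u| omega(l) = O(nu^(1/2) l^(alpha-1)), small for l >= nu^L because
L < 1/(2(1-alpha)).  The forcing is split at height l^(-alpha/2), which uses sigma > 0; the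
terms at a single time are only small after integration in time.  A uniform Besov bound of
any positive order gives a uniform modulus of continuity, by log-convexity of
j |-> |D_y^j u| for the difference operator D_y, and then all terms are small uniformly in time.
*)
theory Submission
  imports Defs "HOL-Probability.Probability" "HOL-Real_Asymp.Real_Asymp"
begin

text \<open>The kernel convolved with \<open>u\<close> is not an admissible test function: the
  kernel jumps across a sphere and \<open>u\<close> is not smooth. Trigonometric polynomials remove
  both defects. The kernel is convolved with normalised powers of a nonnegative trigonometric
  polynomial. The result splits into a finite sum of products g(x) h(y), so the mollified quadratic
  form of \<open>u\<close> is a finite sum of products of scalar functions of time. Testing with t^k
  times a trigonometric polynomial shows that each of them is an indefinite integral, and the
  product rule in time replaces testing with \<open>u\<close> itself. To remove the mollification,
  every term is written as a kernel functional applied to a mean of a correlation function.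
  Correlations are continuous, even the cubic ones of a field in L3, so functionals with integrable
  weights on the ball and on its sphere pass to the limit. The prefactors come from two facts. A
  product of three increments yields three placements of the kernel derivative, each with two signs;
  one placement drops out by incompressibility, leaving four copies of the flux. The unit mass of
  the kernel fixes the remaining factor.\<close>

lemmas L1_add = Bochner_Integration.integrable_add
 and L1_bound = Bochner_Integration.integrable_bound
 and L1_diff = Bochner_Integration.integrable_diff
 and L1_sum = Bochner_Integration.integrable_sum
 and lint_add = Bochner_Integration.integral_add
 and lint_cong = Bochner_Integration.integral_cong
 and lint_diff = Bochner_Integration.integral_diff
 and lint_mult_right_zero = Bochner_Integration.integral_mult_right_zero
 and lint_sum = Bochner_Integration.integral_sum
 and lint_zero = Bochner_Integration.integral_zero
 and continuous_borel = borel_measurable_continuous_onI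

section \<open>Integration of periodic functions\<close>

definition cell :: "(real ^ 'n) set" where
 "cell = {x. \<forall>i. 0 \<le> x $ i \<and> x $ i < 1}"

definition lattice :: "(real ^ 'n) set" where
 "lattice = {k. \<forall>i. k $ i \<in> \<int>}"

text \<open>The representative of a point in the cell. Composition with it turns a function that is
  measurable on the torus into a Borel function on the whole space.\<close>

definition vfrac :: "real ^ 'n \<Rightarrow> real ^ 'n" where
 "vfrac x = (\<chi> i. frac (x $ i))"

lemma cell_borel [measurable]: "(cell :: (real ^ 'n) set) \<in> sets borel"
 unfolding cell_def by measurable

lemma torus_cell: "torus = restrict_space lborel cell"
 by (simp add: torus_def cell_def)

lemma countable_lattice: "countable (lattice :: (real ^ 'n) set)"
proof -
 have "(lattice :: (real ^ 'n) set) \<subseteq> range (\<lambda>f::'n \<Rightarrow> int. \<chi> i. of_int (f i))"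
 proof
  fix k :: "real ^ 'n" assume "k \<in> lattice"
  then have "\<forall>i. of_int \<lfloor>k $ i\<rfloor> = k $ i" by (auto simp: lattice_def elim: Ints_cases)
  then have "k = (\<chi> i. of_int ((\<lambda>i. \<lfloor>k $ i\<rfloor>) i))" by (simp only: vec_eq_iff vec_lambda_beta simp_thms)
  then show "k \<in> range (\<lambda>f::'n \<Rightarrow> int. \<chi> i. of_int (f i))" by (intro image_eqI[of _ _ "\<lambda>i. \<lfloor>k $ i\<rfloor>"]) auto
 qed
 then show ?thesis by (rule countable_subset) simp
qed

lemma lattice_uminus: "k \<in> lattice \<Longrightarrow> - k \<in> lattice"
 by (auto simp: lattice_def)

text \<open>Periodicity only speaks of one unit step along one axis, so the shift is built up:
  natural multiples, then integer multiples, then a sum over the coordinates.\<close>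

lemma periodic_lattice:
 fixes v :: "real ^ 'n \<Rightarrow> 'b"
 assumes v: "periodic v" and k: "k \<in> lattice"
 shows "v (x + k) = v x"
proof -
 have pos: "v (x + real m *\<^sub>R axis i 1) = v x" for x m i
 proof (induction m)
  case (Suc m)
  have "v (x + real (Suc m) *\<^sub>R axis i 1) = v ((x + real m *\<^sub>R axis i 1) + axis i 1)"
   by (simp add: algebra_simps)
  then show ?case using Suc v by (simp only: periodic_def)
 qed simp
 have int: "v (x + of_int m *\<^sub>R axis i 1) = v x" for x m i
 proof (cases m rule: int_cases2)
  case (nonneg n)
  then show ?thesis using pos[of x n i] by simp
 next
  case (nonpos n)
  have "v ((x + of_int m *\<^sub>R axis i 1) + real n *\<^sub>R axis i 1) = v (x + of_int m *\<^sub>R axis i 1)"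
   by (rule pos)
  moreover have "(x + of_int m *\<^sub>R axis i 1) + real n *\<^sub>R axis i 1 = x"
   using nonpos by simp
  ultimately show ?thesis by (simp only:)
 qed
 have "v (x + (\<Sum>i\<in>I. k $ i *\<^sub>R axis i 1)) = v x" if "finite I" for I x
  using that
 proof (induction I arbitrary: x)
  case (insert i I)
  obtain m where m: "k $ i = of_int m" using k by (auto simp: lattice_def elim: Ints_cases)
  show ?case using insert int[of "x + (\<Sum>i\<in>I. k $ i *\<^sub>R axis i 1)" m i]
   by (simp add: m add_ac)
 qed simp
 from this[OF finite, of x UNIV]
 show ?thesis using basis_expansion[of k] by (simp add: scalar_mult_eq_scaleR)
qed

lemma vfrac_cell: "vfrac x \<in> cell"
 by (simp add: vfrac_def cell_def frac_ge_0 frac_lt_1)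

lemma vfrac_lattice: "vfrac x - x \<in> lattice"
 by (simp add: vfrac_def lattice_def frac_def)

lemma vfrac_id: "x \<in> cell \<Longrightarrow> vfrac x = x"
 by (simp add: vfrac_def cell_def vec_eq_iff frac_eq)

lemma periodic_vfrac: "periodic v \<Longrightarrow> v (vfrac x) = v x"
 using periodic_lattice[of v "vfrac x - x" x] vfrac_lattice[of x] by simp

lemma vfrac_borel [measurable]: "(vfrac :: real ^ 'n \<Rightarrow> real ^ 'n) \<in> borel_measurable borel"
proof -
 have "(\<lambda>x::real ^ 'n. vfrac x \<bullet> b) \<in> borel_measurable borel" if "b \<in> Basis" for b
 proof -
  obtain i where b: "b = axis i 1" using \<open>b \<in> Basis\<close> by (auto simp: Basis_vec_def)
  show ?thesis by (simp add: b inner_axis vfrac_def frac_def)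
 qed
 then show ?thesis by (rule borel_measurable_euclidean_space[THEN iffD2, rule_format])
qed

text \<open>The half-open cell is a fundamental domain: the coordinates of the shift are forced to
  be minus the integer parts of those of \<open>x\<close>.\<close>

lemma lattice_cell_unique: "\<exists>!k. k \<in> lattice \<and> x + k \<in> (cell :: (real ^ 'n) set)"
proof (intro ex1I[of _ "vfrac x - x"] conjI)
 show "vfrac x - x \<in> lattice" by (rule vfrac_lattice)
 show "x + (vfrac x - x) \<in> cell" using vfrac_cell[of x] by simp
next
 fix k :: "real ^ 'n" assume k: "k \<in> lattice \<and> x + k \<in> cell"
 have "frac (x $ i) = x $ i + k $ i" for i
 proof -
  obtain m where m: "k $ i = of_int m" using k by (auto simp: lattice_def elim: Ints_cases)
  have "\<lfloor>x $ i\<rfloor> = - m" using k unfolding cell_def floor_eq_iff by (auto simp: m dest!: spec[of _ i])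
  then show ?thesis by (simp add: frac_def m)
 qed
 then show "k = vfrac x - x" by (simp add: vec_eq_iff vfrac_def)
qed

section \<open>Fundamental domains and the invariance of the torus integral\<close>

lemma nn_integral_lborel_shift:
 fixes f :: "real ^ 'n \<Rightarrow> ennreal"
 assumes [measurable]: "f \<in> borel_measurable borel"
 shows "(\<integral>\<^sup>+x. f (x + c) \<partial>lborel) = (\<integral>\<^sup>+x. f x \<partial>lborel)"
proof -
 have "(\<integral>\<^sup>+x. f x \<partial>lborel) = (\<integral>\<^sup>+x. f x \<partial>distr lborel borel ((+) c))"
  by (simp add: lborel_distr_plus)
 also have "\<dots> = (\<integral>\<^sup>+x. f (c + x) \<partial>lborel)" by (subst nn_integral_distr) auto
 finally show ?thesis by (simp add: add.commute)
qed

text \<open>\<open>F\<close> and \<open>H\<close> are partitions of unity under lattice translation.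
  Insert the sum over the translates of \<open>H\<close>, shift each summand by its lattice vector,
  which leaves \<open>g\<close> unchanged, and collect the translates of \<open>F\<close>.\<close>

lemma nn_integral_fundamental_domain:
 fixes g F H :: "real ^ 'n \<Rightarrow> ennreal"
 assumes [measurable]: "g \<in> borel_measurable borel" "F \<in> borel_measurable borel" "H \<in> borel_measurable borel"
  and g: "periodic g"
  and F: "\<And>x. (\<integral>\<^sup>+k. F (x + k) \<partial>count_space lattice) = 1"
  and H: "\<And>x. (\<integral>\<^sup>+k. H (x + k) \<partial>count_space lattice) = 1"
 shows "(\<integral>\<^sup>+x. F x * g x \<partial>lborel) = (\<integral>\<^sup>+x. H x * g x \<partial>lborel)"
proof -
 have "(\<integral>\<^sup>+x. F x * g x \<partial>lborel) = (\<integral>\<^sup>+x. \<integral>\<^sup>+k. (F x * g x) * H (x + k) \<partial>count_space lattice \<partial>lborel)"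
  by (simp add: nn_integral_cmult H)
 also have "\<dots> = (\<integral>\<^sup>+k. \<integral>\<^sup>+x. (F x * g x) * H (x + k) \<partial>lborel \<partial>count_space lattice)"
  by (rule nn_integral_count_space_nn_integral[OF countable_lattice]) simp
 also have "\<dots> = (\<integral>\<^sup>+k. \<integral>\<^sup>+x. (F (x + - k) * g x) * H x \<partial>lborel \<partial>count_space lattice)"
 proof (rule nn_integral_cong)
  fix k :: "real ^ 'n" assume "k \<in> space (count_space lattice)"
  then have k: "k \<in> lattice" by simp
  have "(\<integral>\<^sup>+x. (F x * g x) * H (x + k) \<partial>lborel) = (\<integral>\<^sup>+x. (F (x + - k) * g (x + - k)) * H ((x + - k) + k) \<partial>lborel)"
   by (rule nn_integral_lborel_shift[symmetric, where f="\<lambda>x. (F x * g x) * H (x + k)"]) simp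
  also have "\<dots> = (\<integral>\<^sup>+x. (F (x + - k) * g x) * H x \<partial>lborel)"
   using periodic_lattice[OF g lattice_uminus[OF k]] by (intro nn_integral_cong) simp
  finally show "(\<integral>\<^sup>+x. (F x * g x) * H (x + k) \<partial>lborel) = (\<integral>\<^sup>+x. (F (x + - k) * g x) * H x \<partial>lborel)" .
 qed
 also have "\<dots> = (\<integral>\<^sup>+x. \<integral>\<^sup>+k. (F (x + - k) * g x) * H x \<partial>count_space lattice \<partial>lborel)"
  by (rule nn_integral_count_space_nn_integral[OF countable_lattice, symmetric]) simp
 also have "\<dots> = (\<integral>\<^sup>+x. H x * g x \<partial>lborel)"
 proof (rule nn_integral_cong)
  fix x :: "real ^ 'n"
  have "bij_betw uminus lattice (lattice :: (real ^ 'n) set)"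
   by (rule bij_betwI[where g=uminus]) (auto intro: lattice_uminus)
  then have "(\<integral>\<^sup>+k. F (x + - k) \<partial>count_space lattice) = (\<integral>\<^sup>+k. F (x + k) \<partial>count_space lattice)"
   by (rule nn_integral_bij_count_space)
  then show "(\<integral>\<^sup>+k. (F (x + - k) * g x) * H x \<partial>count_space lattice) = H x * g x"
   using F[of x] by (simp add: nn_integral_multc nn_integral_cmult mult.commute)
 qed
 finally show ?thesis .
qed

lemma tile_sum:
 fixes A :: "(real ^ 'n) set"
 assumes "\<exists>!k. k \<in> lattice \<and> x + k \<in> A"
 shows "(\<integral>\<^sup>+k. indicator A (x + k) \<partial>count_space lattice) = 1"
proof -
 obtain k0 where k0: "k0 \<in> lattice" and uniq: "\<And>k. k \<in> lattice \<Longrightarrow> x + k \<in> A \<longleftrightarrow> k = k0"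
  using assms by metis
 have "(\<integral>\<^sup>+k. indicator A (x + k) \<partial>count_space lattice) = (\<integral>\<^sup>+k. indicator {k0} k \<partial>count_space lattice)"
 proof (rule nn_integral_cong)
  fix k :: "real ^ 'n" assume "k \<in> space (count_space lattice)"
  then have "x + k \<in> A \<longleftrightarrow> k = k0" by (intro uniq) (simp only: space_count_space)
  then show "indicator A (x + k) = (indicator {k0} k :: ennreal)" by (simp add: indicator_def)
 qed
 also have "\<dots> = 1" using k0 by (subst nn_integral_indicator) auto
 finally show ?thesis .
qed

lemma nn_integral_torus:
 assumes "g \<in> borel_measurable borel"
 shows "(\<integral>\<^sup>+x. g x \<partial>torus) = (\<integral>\<^sup>+x. indicator cell x * g x \<partial>lborel)"
 using assms by (simp add: torus_cell nn_integral_restrict_space mult.commute)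

text \<open>The preimage of the cell under \<open>x \<mapsto> s (x - y)\<close> is again a
  fundamental domain. The sign \<open>s\<close> treats translations and reflections
  together.\<close>

lemma nn_integral_torus_affine:
 fixes g :: "real ^ 'n \<Rightarrow> ennreal"
 assumes [measurable]: "g \<in> borel_measurable borel" and g: "periodic g" and s: "s = 1 \<or> s = - 1"
 shows "(\<integral>\<^sup>+x. g (s *\<^sub>R x + y) \<partial>torus) = (\<integral>\<^sup>+x. g x \<partial>torus)"
proof -
 have s2: "s * s = 1" using s by auto
 have inv: "s *\<^sub>R (s *\<^sub>R x) = x" for x :: "real ^ 'n" using s2 by simp
 have refl: "(\<integral>\<^sup>+x. h (s *\<^sub>R x) \<partial>lborel) = (\<integral>\<^sup>+x. h x \<partial>lborel)"
  if [measurable]: "h \<in> borel_measurable borel" for h :: "real ^ 'n \<Rightarrow> ennreal"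
  using s
 proof
  assume "s = - 1"
  have "(\<integral>\<^sup>+x. h x \<partial>lborel) = (\<integral>\<^sup>+x. h x \<partial>distr lborel borel (\<lambda>x. - x))"
   using lborel_affine[of "- 1" "0 :: real ^ 'n"] by (simp add: density_1)
  also have "\<dots> = (\<integral>\<^sup>+x. h (- x) \<partial>lborel)" by (subst nn_integral_distr) auto
  finally show ?thesis using \<open>s = - 1\<close> by simp
 qed simp
 have "(\<integral>\<^sup>+x. g (s *\<^sub>R x + y) \<partial>torus) = (\<integral>\<^sup>+x. indicator cell x * g (s *\<^sub>R x + y) \<partial>lborel)"
  by (simp add: nn_integral_torus)
 also have "\<dots> = (\<integral>\<^sup>+x. indicator cell (s *\<^sub>R x) * g (x + y) \<partial>lborel)"
  using refl[of "\<lambda>x. indicator cell (s *\<^sub>R x) * g (x + y)"] by (simp add: s2)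
 also have "\<dots> = (\<integral>\<^sup>+x. indicator cell (s *\<^sub>R (x - y)) * g x \<partial>lborel)"
  using nn_integral_lborel_shift[of "\<lambda>x. indicator cell (s *\<^sub>R (x - y)) * g x" y] by simp
 also have "\<dots> = (\<integral>\<^sup>+x. indicator ((\<lambda>x. s *\<^sub>R (x - y)) -` cell) x * g x \<partial>lborel)"
  by (intro nn_integral_cong) (simp split: split_indicator)
 also have "\<dots> = (\<integral>\<^sup>+x. indicator cell x * g x \<partial>lborel)"
 proof (rule nn_integral_fundamental_domain[OF _ _ _ g tile_sum tile_sum])
  show "\<exists>!k. k \<in> lattice \<and> x + k \<in> (\<lambda>x. s *\<^sub>R (x - y)) -` (cell :: (real ^ 'n) set)" for x
  proof -
   obtain k where k: "k \<in> lattice" "s *\<^sub>R (x - y) + k \<in> cell"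
     "\<And>k'. k' \<in> lattice \<Longrightarrow> s *\<^sub>R (x - y) + k' \<in> cell \<Longrightarrow> k' = k"
    using lattice_cell_unique[of "s *\<^sub>R (x - y)"] by blast
   have sl: "s *\<^sub>R k' \<in> lattice" if "k' \<in> lattice" for k' :: "real ^ 'n"
    using that s lattice_uminus by auto
   have eq: "s *\<^sub>R (x + k' - y) = s *\<^sub>R (x - y) + s *\<^sub>R k'" for k' :: "real ^ 'n"
    by (simp add: algebra_simps)
   show ?thesis
   proof (rule ex1I[of _ "s *\<^sub>R k"])
    show "s *\<^sub>R k \<in> lattice \<and> x + s *\<^sub>R k \<in> (\<lambda>x. s *\<^sub>R (x - y)) -` cell"
    proof
     show "s *\<^sub>R k \<in> lattice" by (intro sl k(1))
     show "x + s *\<^sub>R k \<in> (\<lambda>x. s *\<^sub>R (x - y)) -` cell"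
      using k(2) by (simp only: vimage_eq eq inv)
    qed
    fix k' assume k': "k' \<in> lattice \<and> x + k' \<in> (\<lambda>x. s *\<^sub>R (x - y)) -` cell"
    then have "s *\<^sub>R (x - y) + s *\<^sub>R k' \<in> cell" by (simp only: eq vimage_eq)
    then have "s *\<^sub>R k' = k" by (intro k(3) sl conjunct1[OF k'])
    then show "k' = s *\<^sub>R k" using inv[of k'] by (simp only:)
   qed
  qed
  show "\<exists>!k. k \<in> lattice \<and> x + k \<in> cell" for x :: "real ^ 'n" by (rule lattice_cell_unique)
  show "indicator ((\<lambda>x. s *\<^sub>R (x - y)) -` (cell :: (real ^ 'n) set)) \<in> borel_measurable borel"
   by (intro borel_measurable_indicator measurable_sets_borel[of _ borel]) auto
 qed auto
 finally show ?thesis by (simp add: nn_integral_torus)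
qed

lemma emeasure_cell: "emeasure lborel (cell :: (real ^ 'n) set) = 1"
proof -
 let ?one = "(\<chi> i. 1) :: real ^ 'n"
 have b: "\<And>b :: real ^ 'n. b \<in> Basis \<Longrightarrow> ?one \<bullet> b = 1"
  by (auto simp: Basis_vec_def inner_axis)
 have "emeasure lborel (box 0 ?one) = 1" "emeasure lborel (cbox 0 ?one) = 1"
  using b by (simp_all add: emeasure_lborel_box_eq emeasure_lborel_cbox_eq)
 moreover have "emeasure lborel (box 0 ?one) \<le> emeasure lborel (cell :: (real ^ 'n) set)"
  by (intro emeasure_mono) (auto simp: mem_box_cart cell_def less_imp_le)
 moreover have "emeasure lborel (cell :: (real ^ 'n) set) \<le> emeasure lborel (cbox 0 ?one)"
  by (intro emeasure_mono) (auto simp: mem_box_cart cell_def less_imp_le)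
 ultimately show ?thesis by simp
qed

lemma space_torus: "space torus = cell"
 by (simp add: torus_cell space_restrict_space)

lemma borel_measurable_torus: "g \<in> borel_measurable borel \<Longrightarrow> g \<in> borel_measurable torus"
 by (simp add: torus_cell measurable_restrict_space1)

interpretation torus: prob_space torus
 by standard (simp add: space_torus, simp add: torus_cell emeasure_restrict_space emeasure_cell)

lemma vfrac_torus [measurable]: "vfrac \<in> measurable borel torus"
 unfolding torus_cell by (rule measurable_restrict_space2) (auto simp: vfrac_cell)

lemma torus_field_borel:
 assumes "torus_field v"
 shows "v \<in> borel_measurable borel"
proof -
 have "(\<lambda>x. v (vfrac x)) \<in> borel_measurable borel"
  using measurable_compose[OF vfrac_torus] assms by (auto simp: torus_field_def)
 then show ?thesis using assms by (simp add: periodic_vfrac torus_field_def)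
qed

text \<open>Stating the invariance for the measure makes it available for all kinds of integrals.\<close>

lemma distr_torus_affine:
 fixes y :: "real ^ 'n"
 assumes s: "s = 1 \<or> s = - 1"
 shows "distr torus torus (\<lambda>x. vfrac (s *\<^sub>R x + y)) = torus"
proof (rule measure_eqI)
 have m [measurable]: "(\<lambda>x. vfrac (s *\<^sub>R x + y)) \<in> measurable torus torus"
  unfolding torus_cell
  by (intro measurable_restrict_space2 measurable_restrict_space1)
    (auto simp: vfrac_cell simp flip: torus_cell)
 fix A assume "A \<in> sets (distr torus torus (\<lambda>x. vfrac (s *\<^sub>R x + y)))"
 then have A [measurable]: "A \<in> sets torus" by simp
 have per: "periodic (\<lambda>x. indicator A (vfrac x) :: ennreal)"
 proof -
  have "vfrac (x + axis i 1) = vfrac x" for x :: "real ^ 'n" and i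
   by (auto simp: vec_eq_iff vfrac_def axis_def frac_def)
  then show ?thesis by (simp add: periodic_def)
 qed
 have "emeasure (distr torus torus (\<lambda>x. vfrac (s *\<^sub>R x + y))) A
   = (\<integral>\<^sup>+x. indicator A (vfrac (s *\<^sub>R x + y)) \<partial>torus)"
  by (subst nn_integral_indicator[symmetric], simp, subst nn_integral_distr) auto
 also have "\<dots> = (\<integral>\<^sup>+x. indicator A (vfrac x) \<partial>torus)"
  by (rule nn_integral_torus_affine[OF _ per s]) measurable
 also have "\<dots> = (\<integral>\<^sup>+x. indicator A x \<partial>torus)"
  by (intro nn_integral_cong) (simp add: space_torus vfrac_id)
 finally show "emeasure (distr torus torus (\<lambda>x. vfrac (s *\<^sub>R x + y))) A = emeasure torus A" by simp
qed simp

lemma integral_torus_affine: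
 fixes g :: "real ^ 'n \<Rightarrow> 'b::{banach, second_countable_topology}"
 assumes [measurable]: "g \<in> borel_measurable borel" and g: "periodic g" and s: "s = 1 \<or> s = - 1"
 shows "(\<integral>x. g (s *\<^sub>R x + y) \<partial>torus) = (\<integral>x. g x \<partial>torus)"
  and "integrable torus (\<lambda>x. g (s *\<^sub>R x + y)) \<longleftrightarrow> integrable torus g"
proof -
 have m: "(\<lambda>x. vfrac (s *\<^sub>R x + y)) \<in> measurable torus torus"
  unfolding torus_cell
  by (intro measurable_restrict_space2 measurable_restrict_space1)
    (auto simp: vfrac_cell simp flip: torus_cell)
 have gt: "g \<in> borel_measurable torus" by (rule borel_measurable_torus) simp
 have "(\<integral>x. g x \<partial>torus) = (\<integral>x. g (vfrac (s *\<^sub>R x + y)) \<partial>torus)"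
  by (subst distr_torus_affine[OF s, of y, symmetric], subst integral_distr[OF m gt]) simp
 then show "(\<integral>x. g (s *\<^sub>R x + y) \<partial>torus) = (\<integral>x. g x \<partial>torus)"
  by (simp add: periodic_vfrac[OF g])
 have "integrable torus g \<longleftrightarrow> integrable torus (\<lambda>x. g (vfrac (s *\<^sub>R x + y)))"
  by (subst distr_torus_affine[OF s, of y, symmetric], subst integrable_distr_eq[OF m gt]) simp
 then show "integrable torus (\<lambda>x. g (s *\<^sub>R x + y)) \<longleftrightarrow> integrable torus g"
  by (simp add: periodic_vfrac[OF g])
qed

lemmas integral_torus_shift = integral_torus_affine[where s=1, simplified]
lemmas integral_torus_reflect = integral_torus_affine[where s="-1", simplified]

section \<open>Correlations of functions on the torus\<close>

lemma integrable_boundI: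
 fixes f g :: "'a \<Rightarrow> real"
 assumes "integrable M g" "f \<in> borel_measurable M" "\<And>x. x \<in> space M \<Longrightarrow> \<bar>f x\<bar> \<le> g x"
 shows "integrable M f"
 using assms by (intro L1_bound[OF assms(1,2)] AE_I2) fastforce

lemma dominated_convergence_real:
 fixes s :: "nat \<Rightarrow> 'a \<Rightarrow> real"
 assumes "integrable M w" "f \<in> borel_measurable M" "\<And>n. s n \<in> borel_measurable M"
  and "AE x in M. (\<lambda>n. s n x) \<longlonglongrightarrow> f x"
  and "\<And>n x. x \<in> space M \<Longrightarrow> \<bar>s n x\<bar> \<le> w x"
 shows "(\<lambda>n. \<integral>x. s n x \<partial>M) \<longlonglongrightarrow> (\<integral>x. f x \<partial>M)"
 using assms by (intro integral_dominated_convergence[where w=w]) (auto intro: AE_I2)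

lemma integral_lborel_shift:
 fixes f :: "real ^ 'n \<Rightarrow> real"
 assumes [measurable]: "f \<in> borel_measurable borel"
 shows "(\<integral>x. f (x + c) \<partial>lborel) = (\<integral>x. f x \<partial>lborel)"
  and "integrable lborel (\<lambda>x. f (x + c)) \<longleftrightarrow> integrable lborel f"
proof -
 have "(\<integral>x. f x \<partial>lborel) = (\<integral>x. f x \<partial>distr lborel borel ((+) c))" by (simp add: lborel_distr_plus)
 also have "\<dots> = (\<integral>x. f (c + x) \<partial>lborel)" by (subst integral_distr) auto
 finally show "(\<integral>x. f (x + c) \<partial>lborel) = (\<integral>x. f x \<partial>lborel)" by (simp add: add.commute)
 have "integrable lborel f \<longleftrightarrow> integrable (distr lborel borel ((+) c)) f" by (simp add: lborel_distr_plus)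
 also have "\<dots> \<longleftrightarrow> integrable lborel (\<lambda>x. f (c + x))" by (subst integrable_distr_eq) auto
 finally show "integrable lborel (\<lambda>x. f (x + c)) \<longleftrightarrow> integrable lborel f" by (simp add: add.commute)
qed

lemma integral_torus_le_lborel:
 fixes f :: "real ^ 'n \<Rightarrow> real"
 assumes "integrable lborel f" "\<And>x. 0 \<le> f x"
 shows "(\<integral>x. f x \<partial>torus) \<le> (\<integral>x. f x \<partial>lborel)" and "integrable torus f"
proof -
 have i: "integrable lborel (\<lambda>x. indicator cell x *\<^sub>R f x)"
  using assms(1) by (rule integrable_mult_indicator[rotated]) simp
 have "(\<integral>x. f x \<partial>torus) = (\<integral>x. indicator cell x *\<^sub>R f x \<partial>lborel)"
  unfolding torus_cell by (rule integral_restrict_space) simp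
 also have "\<dots> \<le> (\<integral>x. f x \<partial>lborel)"
  using assms by (intro integral_mono i) (auto split: split_indicator)
 finally show "(\<integral>x. f x \<partial>torus) \<le> (\<integral>x. f x \<partial>lborel)" .
 show "integrable torus f"
  unfolding torus_cell using i by (subst integrable_restrict_space) (auto simp: set_integrable_def)
qed

section \<open>Continuity of translations in Lebesgue spaces on the torus\<close>

lemma norm_cell: "x \<in> cell \<Longrightarrow> norm (x :: real ^ 'n) \<le> real CARD('n)"
proof -
 assume x: "x \<in> cell"
 have "norm x \<le> (\<Sum>i\<in>UNIV. \<bar>x $ i\<bar>)" by (rule norm_le_l1_cart)
 also have "\<dots> \<le> (\<Sum>i\<in>(UNIV :: 'n set). 1)"
  using x by (intro sum_mono) (auto simp: cell_def less_imp_le)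
 finally show ?thesis by simp
qed

text \<open>Approximation almost everywhere by continuous functions, which are uniformly continuous
  on a compact ball. The ball of radius d + 1 contains the cell and its translates by vectors
  shorter than 1.\<close>

lemma translation_continuous_bounded:
 fixes v :: "real ^ 'n \<Rightarrow> real"
 assumes [measurable]: "v \<in> borel_measurable borel" and M: "\<And>x. \<bar>v x\<bar> \<le> M" and e: "0 < e"
 shows "\<exists>d>0. \<forall>y. norm y < d \<longrightarrow> (\<integral>x. \<bar>v (x - y) - v x\<bar> \<partial>torus) < e"
proof -
 let ?B = "cball 0 (real CARD('n) + 1) :: (real ^ 'n) set"
 have M0: "0 \<le> M" using M[of 0] by linarith
 have "v measurable_on UNIV"
  by (rule lebesgue_measurable_imp_measurable_on_real) (auto intro: measurable_completion)
 then obtain N g where N: "negligible N" and g: "\<And>n. continuous_on UNIV (g n)"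
  and lim: "\<And>x. x \<notin> N \<Longrightarrow> (\<lambda>n. g n x :: real) \<longlonglongrightarrow> v x"
  by (auto simp: measurable_on_def)
 \<comment> \<open>Clipping at \<open>M\<close> gives a common bound for dominated convergence and
   keeps the limit, since \<open>v\<close> itself lies between \<open>- M\<close> and
   \<open>M\<close>.\<close>
 define h where "h n x = max (- M) (min M (g n x))" for n x
 have hc: "continuous_on UNIV (h n)" for n
  unfolding h_def by (intro continuous_intros g)
 have [measurable]: "h n \<in> borel_measurable borel" for n
  by (rule continuous_borel[OF hc])
 have hM: "\<bar>h n x\<bar> \<le> M" for n x using M0 by (auto simp: h_def)
 have hl: "(\<lambda>n. h n x) \<longlonglongrightarrow> v x" if "x \<notin> N" for x
 proof -
  have "(\<lambda>n. h n x) \<longlonglongrightarrow> max (- M) (min M (v x))"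
   unfolding h_def by (intro tendsto_intros lim that)
  moreover have "max (- M) (min M (v x)) = v x" using M[of x] by auto
  ultimately show ?thesis by simp
 qed
 \<comment> \<open>The approximants need not be periodic. The error is therefore cut off to a ball
   and integrated over the whole space, where it may be shifted freely.\<close>
 define k where "k n x = \<bar>h n x - v x\<bar> * indicator ?B x" for n x
 have [measurable]: "k n \<in> borel_measurable borel" for n unfolding k_def by (intro borel_measurable_times borel_measurable_indicator) auto
 have kM: "\<bar>k n x\<bar> \<le> 2 * M * indicator ?B x" for n x
  using hM[of n x] M[of x] by (auto simp: k_def split: split_indicator)
 have iB: "integrable lborel (\<lambda>x. 2 * M * indicator ?B x)"
  by (intro integrable_mult_right integrable_real_indicator) (auto intro!: emeasure_bounded_finite[OF bounded_cball, unfolded infinity_ennreal_def])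
 have ik: "integrable lborel (k n)" for n
  by (rule L1_bound[OF iB]) (use kM M0 in \<open>auto intro!: AE_I2\<close>)
 have "AE x in lebesgue. x \<notin> N" using N by (auto simp: negligible_iff_null_sets intro: AE_not_in)
 then have aeN: "AE x in lborel. x \<notin> N" by (simp add: AE_completion_iff)
 have "(\<lambda>n. \<integral>x. k n x \<partial>lborel) \<longlonglongrightarrow> (\<integral>x. 0 \<partial>(lborel :: (real ^ 'n) measure))"
 proof (rule dominated_convergence_real[where w="\<lambda>x. 2 * M * indicator ?B x"])
  show "AE x in lborel. (\<lambda>n. k n x) \<longlonglongrightarrow> 0"
   using aeN
  proof eventually_elim
   case (elim x)
   have "(\<lambda>n. \<bar>h n x - v x\<bar> * indicator ?B x) \<longlonglongrightarrow> \<bar>v x - v x\<bar> * indicator ?B x"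
    by (intro tendsto_intros hl elim)
   then show ?case by (simp add: k_def)
  qed
  show "\<bar>k n x\<bar> \<le> 2 * M * indicator ?B x" for n x by (rule kM)
 qed (use iB in auto)
 then have lim0: "(\<lambda>n. \<integral>x. k n x \<partial>lborel) \<longlonglongrightarrow> 0"
  by (simp only: lint_zero)
 have "0 < e / 4" using e by simp
 from order_tendstoD(2)[OF lim0 this]
 obtain n where n: "(\<integral>x. k n x \<partial>lborel) < e / 4" unfolding eventually_sequentially by blast
 have "uniformly_continuous_on ?B (h n)"
  by (rule compact_uniformly_continuous[OF continuous_on_subset[OF hc]]) auto
 then obtain d where d: "0 < d" "\<And>x x'. x \<in> ?B \<Longrightarrow> x' \<in> ?B \<Longrightarrow> dist x' x < d \<Longrightarrow> dist (h n x') (h n x) < e / 4"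
  using e unfolding uniformly_continuous_on_def by (metis divide_pos_pos zero_less_numeral)
 show ?thesis
 proof (intro exI[of _ "min d 1"] conjI allI impI)
  show "0 < min d 1" using d by simp
  fix y :: "real ^ 'n" assume y: "norm y < min d 1"
  have ky: "integrable lborel (\<lambda>x. k n (x - y))"
   using integral_lborel_shift(2)[of "k n" "- y"] ik by simp
  have k0: "0 \<le> k n x" for x by (simp add: k_def)
  have it: "integrable torus (\<lambda>x. k n (x - y))" "integrable torus (k n)"
   using integral_torus_le_lborel(2)[OF ky] integral_torus_le_lborel(2)[OF ik] k0 by auto
  have "(\<integral>x. \<bar>v (x - y) - v x\<bar> \<partial>torus) \<le> (\<integral>x. k n (x - y) + e / 4 + k n x \<partial>torus)"
  proof (rule integral_mono)
   show "integrable torus (\<lambda>x. \<bar>v (x - y) - v x\<bar>)"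
   proof (rule torus.integrable_const_bound[where B="2 * M"])
    have "norm \<bar>v (x - y) - v x\<bar> \<le> 2 * M" for x using M[of x] M[of "x - y"] by auto
    then show "AE x in torus. norm \<bar>v (x - y) - v x\<bar> \<le> 2 * M" by (intro AE_I2)
   qed (auto intro!: borel_measurable_torus)
   show "integrable torus (\<lambda>x. k n (x - y) + e / 4 + k n x)" using it by auto
   fix x :: "real ^ 'n" assume "x \<in> space torus"
   then have x: "norm x \<le> real CARD('n)" using norm_cell by (simp add: space_torus)
   then have "x \<in> ?B" "x - y \<in> ?B" using y norm_triangle_ineq4[of x y] by auto
   moreover have "dist (h n (x - y)) (h n x) < e / 4"
    using y by (intro d calculation) (simp add: dist_norm)
   ultimately show "\<bar>v (x - y) - v x\<bar> \<le> k n (x - y) + e / 4 + k n x"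
    unfolding k_def dist_real_def by simp argo
  qed
  also have "\<dots> = (\<integral>x. k n (x - y) \<partial>torus) + e / 4 + (\<integral>x. k n x \<partial>torus)"
   using it by (simp add: torus.prob_space)
  also have "\<dots> \<le> (\<integral>x. k n (x - y) \<partial>lborel) + e / 4 + (\<integral>x. k n x \<partial>lborel)"
   using integral_torus_le_lborel(1)[OF ky] integral_torus_le_lborel(1)[OF ik] k0 by fastforce
  also have "(\<integral>x. k n (x - y) \<partial>lborel) = (\<integral>x. k n x \<partial>lborel)"
   using integral_lborel_shift(1)[of "k n" "- y"] by simp
  also have "(\<integral>x. k n x \<partial>lborel) + e / 4 + (\<integral>x. k n x \<partial>lborel) < e" using n e by simp
  finally show "(\<integral>x. \<bar>v (x - y) - v x\<bar> \<partial>torus) < e" .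
 qed
qed

text \<open>Natural exponents avoid real powers; the applications take p = 1, 2 and 3.\<close>

definition in_Lp :: "nat \<Rightarrow> (real ^ 'n \<Rightarrow> real) \<Rightarrow> bool" where
 "in_Lp p v \<longleftrightarrow> v \<in> borel_measurable borel \<and> periodic v \<and> integrable torus (\<lambda>x. \<bar>v x\<bar> ^ p)"

lemma in_LpD:
 assumes "in_Lp p v"
 shows "v \<in> borel_measurable borel" "periodic v" "integrable torus (\<lambda>x. \<bar>v x\<bar> ^ p)"
 using assms by (auto simp: in_Lp_def)

lemma in_Lp_mono:
 assumes v: "in_Lp p v" and "q \<le> p"
 shows "in_Lp q v"
proof -
 note [measurable] = in_LpD(1)[OF v]
 have b: "\<bar>v x\<bar> ^ q \<le> 1 + \<bar>v x\<bar> ^ p" for x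
 proof (cases "\<bar>v x\<bar> \<le> 1")
  case True then show ?thesis by (simp add: power_le_one add_increasing2)
 next
  case False
  then have "\<bar>v x\<bar> ^ q \<le> \<bar>v x\<bar> ^ p" using \<open>q \<le> p\<close> by (intro power_increasing) auto
  then show ?thesis by simp
 qed
 have "integrable torus (\<lambda>x. \<bar>v x\<bar> ^ q)"
  by (rule integrable_boundI[where g="\<lambda>x. 1 + \<bar>v x\<bar> ^ p"])
    (use b in_LpD(3)[OF v] in \<open>auto intro!: borel_measurable_torus\<close>)
 then show ?thesis using v by (simp add: in_Lp_def)
qed

lemma periodic_compose: "periodic v \<Longrightarrow> periodic (\<lambda>x. f (v x))"
 by (simp add: periodic_def)

lemma periodic_compose2: "periodic v \<Longrightarrow> periodic w \<Longrightarrow> periodic (\<lambda>x. f (v x) (w x))"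
 by (simp add: periodic_def)

lemma periodic_shift: "periodic v \<Longrightarrow> periodic (\<lambda>x. v (x + y))"
 by (simp add: periodic_def add.commute add.left_commute) (metis add.assoc add.commute)

lemma periodic_shift': "periodic v \<Longrightarrow> periodic (\<lambda>x. v (x - y))"
 using periodic_shift[of v "- y"] by simp

lemma in_Lp_shift:
 assumes v: "in_Lp p v" shows "in_Lp p (\<lambda>x. v (x + y))"
proof -
 note [measurable] = in_LpD(1)[OF v]
 have "integrable torus (\<lambda>x. \<bar>v (x + y)\<bar> ^ p)"
  using in_LpD[OF v] integral_torus_shift(2)[of "\<lambda>x. \<bar>v x\<bar> ^ p" y] periodic_compose[of v "\<lambda>a. \<bar>a\<bar> ^ p"]
  by simp
 then show ?thesis using in_LpD[OF v] by (simp add: in_Lp_def periodic_shift)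
qed

lemma in_Lp_shift': "in_Lp p v \<Longrightarrow> in_Lp p (\<lambda>x. v (x - y))"
 using in_Lp_shift[of p v "- y"] by simp

lemma integral_shift_power:
 assumes v: "in_Lp p v"
 shows "(\<integral>x. \<bar>v (x - y)\<bar> ^ p \<partial>torus) = (\<integral>x. \<bar>v x\<bar> ^ p \<partial>torus)"
proof -
 note [measurable] = in_LpD(1)[OF v]
 show ?thesis
  using in_LpD[OF v] integral_torus_shift(1)[of "\<lambda>x. \<bar>v x\<bar> ^ p" "- y"] periodic_compose[of v "\<lambda>a. \<bar>a\<bar> ^ p"]
  by simp
qed

lemma power_add3_le:
 fixes a b c :: real
 assumes "0 \<le> a" "0 \<le> b" "0 \<le> c"
 shows "(a + b + c) ^ p \<le> 3 ^ p * (a ^ p + b ^ p + c ^ p)"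
proof -
 define m where "m = max a (max b c)"
 have "(a + b + c) ^ p \<le> (3 * m) ^ p" using assms by (intro power_mono) (auto simp: m_def)
 also have "\<dots> = 3 ^ p * m ^ p" by (simp add: power_mult_distrib)
 also have "m ^ p \<le> a ^ p + b ^ p + c ^ p" using assms by (auto simp: m_def max_def)
 finally show ?thesis by simp
qed

lemma in_Lp_diff:
 assumes v: "in_Lp p v" and w: "in_Lp p w"
 shows "in_Lp p (\<lambda>x. v x - w x)"
proof -
 note [measurable] = in_LpD(1)[OF v] in_LpD(1)[OF w]
 have b: "\<bar>v x - w x\<bar> ^ p \<le> 3 ^ p * (\<bar>v x\<bar> ^ p + \<bar>w x\<bar> ^ p + 0 ^ p)" for x
  using power_mono[OF abs_triangle_ineq4[of "v x" "w x"], of p] power_add3_le[of "\<bar>v x\<bar>" "\<bar>w x\<bar>" 0 p]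
  by simp
 have "integrable torus (\<lambda>x. \<bar>v x - w x\<bar> ^ p)"
  by (rule integrable_boundI[where g="\<lambda>x. 3 ^ p * (\<bar>v x\<bar> ^ p + \<bar>w x\<bar> ^ p + 0 ^ p)"])
    (use b in_LpD(3)[OF v] in_LpD(3)[OF w] in \<open>auto intro!: borel_measurable_torus\<close>)
 then show ?thesis using in_LpD[OF v] in_LpD[OF w] by (simp add: in_Lp_def periodic_def)
qed

text \<open>Truncate \<open>v\<close> at height \<open>n\<close>: the remainder is small in the p-th
  power by dominated convergence, and the truncated part is covered by the bounded case. The shift
  is split into three pieces, each allowed a third of \<open>e\<close> after the factor
  \<open>3 ^ p\<close> of \<open>power_add3_le\<close>.\<close>

lemma translation_continuous:
 fixes v :: "real ^ 'n \<Rightarrow> real"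
 assumes v: "in_Lp (Suc q) v" and e: "0 < e"
 shows "\<exists>d>0. \<forall>y. norm y < d \<longrightarrow> (\<integral>x. \<bar>v (x - y) - v x\<bar> ^ Suc q \<partial>torus) < e"
proof -
 let ?p = "Suc q"
 note [measurable] = in_LpD(1)[OF v]
 define w where "w n x = max (- real n) (min (real n) (v x))" for n x
 have [measurable]: "w n \<in> borel_measurable borel" for n unfolding w_def by measurable
 have wn: "\<bar>w n x\<bar> \<le> real n" "\<bar>w n x\<bar> \<le> \<bar>v x\<bar>" "\<bar>v x - w n x\<bar> \<le> \<bar>v x\<bar>" for n x by (auto simp: w_def)
 have pw: "periodic (w n)" for n
  unfolding w_def using in_LpD(2)[OF v] by (rule periodic_compose[where f="\<lambda>a. max (- real n) (min (real n) a)"])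
 have wLp: "in_Lp ?p (w n)" for n
  unfolding in_Lp_def using pw in_LpD(3)[OF v] wn(2)
  by (auto intro!: L1_bound[OF in_LpD(3)[OF v]] AE_I2 borel_measurable_torus power_mono simp del: power_Suc)
 have dLp: "in_Lp ?p (\<lambda>x. v x - w n x)" for n by (rule in_Lp_diff[OF v wLp])
 have "(\<lambda>n. \<integral>x. \<bar>v x - w n x\<bar> ^ ?p \<partial>torus) \<longlonglongrightarrow> (\<integral>x. 0 \<partial>(torus :: (real ^ 'n) measure))"
 proof (rule dominated_convergence_real[where w="\<lambda>x. \<bar>v x\<bar> ^ ?p"])
  show "AE x in torus. (\<lambda>n. \<bar>v x - w n x\<bar> ^ ?p) \<longlonglongrightarrow> 0"
  proof (rule AE_I2)
   fix x :: "real ^ 'n"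
   obtain n0 :: nat where "\<bar>v x\<bar> \<le> real n0" using real_arch_simple by blast
   then have "\<forall>n\<ge>n0. \<bar>v x - w n x\<bar> ^ ?p = 0" by (auto simp: w_def)
   then show "(\<lambda>n. \<bar>v x - w n x\<bar> ^ ?p) \<longlonglongrightarrow> 0"
    by (intro tendsto_eventually) (auto simp: eventually_sequentially)
  qed
  show "\<bar>\<bar>v x - w n x\<bar> ^ ?p\<bar> \<le> \<bar>v x\<bar> ^ ?p" for n x
   using power_mono[OF wn(3)[of x n], of ?p] by (simp add: power_abs del: power_Suc)
 qed (auto simp: in_LpD(3)[OF v] intro!: borel_measurable_torus simp del: power_Suc)
 then have lim: "(\<lambda>n. \<integral>x. \<bar>v x - w n x\<bar> ^ ?p \<partial>torus) \<longlonglongrightarrow> 0"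
  by (simp only: lint_zero)
 have e': "0 < e / (3 * 3 ^ ?p)" using e by simp
 have "\<forall>\<^sub>F n in sequentially. (\<integral>x. \<bar>v x - w n x\<bar> ^ ?p \<partial>torus) < e / (3 * 3 ^ ?p)"
  by (rule order_tendstoD(2)[OF lim e'])
 then obtain n where n: "(\<integral>x. \<bar>v x - w n x\<bar> ^ ?p \<partial>torus) < e / (3 * 3 ^ ?p)"
  unfolding eventually_sequentially by blast
 \<comment> \<open>Differences of \<open>w n\<close> are at most 2n, so their power of order q + 1
   is at most \<open>C\<close> times their absolute value. The added 1 keeps \<open>C\<close>
   positive when n = 0.\<close>
 define C where "C = (2 * real n + 1) ^ q"
 have C: "0 < C" by (simp add: C_def)
 obtain d where d: "0 < d" "\<And>y. norm y < d \<Longrightarrow> (\<integral>x. \<bar>w n (x - y) - w n x\<bar> \<partial>torus) < e / (3 * 3 ^ ?p) / C"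
  using translation_continuous_bounded[OF \<open>w n \<in> borel_measurable borel\<close> wn(1) divide_pos_pos[OF e' C]]
  by blast
 show ?thesis
 proof (intro exI[of _ d] conjI allI impI d(1))
  fix y :: "real ^ 'n" assume y: "norm y < d"
  let ?D = "\<lambda>x. \<bar>v x - w n x\<bar> ^ ?p"
  have i1: "integrable torus (\<lambda>x. ?D (x - y))" "integrable torus ?D"
   using in_LpD(3)[OF in_Lp_shift'[OF dLp]] in_LpD(3)[OF dLp] by auto
  have i2: "integrable torus (\<lambda>x. \<bar>w n (x - y) - w n x\<bar>)"
   using in_LpD(3)[OF in_Lp_mono[OF in_Lp_diff[OF in_Lp_shift'[OF wLp] wLp], where q=1]] by simp
  have "(\<integral>x. \<bar>v (x - y) - v x\<bar> ^ ?p \<partial>torus)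
    \<le> (\<integral>x. 3 ^ ?p * (?D (x - y) + C * \<bar>w n (x - y) - w n x\<bar> + ?D x) \<partial>torus)"
  proof (rule integral_mono)
   show "integrable torus (\<lambda>x. \<bar>v (x - y) - v x\<bar> ^ ?p)"
    by (rule in_LpD(3)[OF in_Lp_diff[OF in_Lp_shift'[OF v] v]])
   show "integrable torus (\<lambda>x. 3 ^ ?p * (?D (x - y) + C * \<bar>w n (x - y) - w n x\<bar> + ?D x))"
    by (intro integrable_mult_right L1_add i1 i2)
   fix x
   have "\<bar>v (x - y) - v x\<bar> \<le> \<bar>v (x - y) - w n (x - y)\<bar> + \<bar>w n (x - y) - w n x\<bar> + \<bar>v x - w n x\<bar>" by linarith
   then have "\<bar>v (x - y) - v x\<bar> ^ ?p \<le> (\<bar>v (x - y) - w n (x - y)\<bar> + \<bar>w n (x - y) - w n x\<bar> + \<bar>v x - w n x\<bar>) ^ ?p"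
    by (intro power_mono) auto
   also have "\<dots> \<le> 3 ^ ?p * (?D (x - y) + \<bar>w n (x - y) - w n x\<bar> ^ ?p + ?D x)" by (intro power_add3_le) auto
   also have "\<bar>w n (x - y) - w n x\<bar> ^ ?p \<le> C * \<bar>w n (x - y) - w n x\<bar>"
   proof -
    have "\<bar>w n (x - y) - w n x\<bar> ^ q \<le> C"
     unfolding C_def using wn(1)[of n x] wn(1)[of n "x - y"] by (intro power_mono) auto
    then show ?thesis unfolding power_Suc2 by (intro mult_right_mono) auto
   qed
   finally show "\<bar>v (x - y) - v x\<bar> ^ ?p \<le> 3 ^ ?p * (?D (x - y) + C * \<bar>w n (x - y) - w n x\<bar> + ?D x)"
    by (simp del: power_Suc)
  qed
  also have "\<dots> = 3 ^ ?p * ((\<integral>x. ?D x \<partial>torus) + C * (\<integral>x. \<bar>w n (x - y) - w n x\<bar> \<partial>torus) + (\<integral>x. ?D x \<partial>torus))"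
   using i1 i2 integral_shift_power[OF dLp[of n], of y] by (simp del: power_Suc)
  also have "\<dots> < 3 ^ ?p * (e / (3 * 3 ^ ?p) + C * (e / (3 * 3 ^ ?p) / C) + e / (3 * 3 ^ ?p))"
   using n d(2)[OF y] C by (intro mult_strict_left_mono add_strict_mono) (auto simp del: power_Suc)
  also have "\<dots> = e" using C by (simp add: field_simps del: power_Suc)
  finally show "(\<integral>x. \<bar>v (x - y) - v x\<bar> ^ ?p \<partial>torus) < e" .
 qed
qed

section \<open>Correlation functions\<close>

definition corr :: "(real ^ 'n \<Rightarrow> real) \<Rightarrow> (real ^ 'n \<Rightarrow> real) \<Rightarrow> real ^ 'n \<Rightarrow> real" where
 "corr h v y = (\<integral>x. h x * v (x - y) \<partial>torus)"

text \<open>Young's inequality for the conjugate exponents (q + 1) / q and q + 1, without roots and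
  without the sharp constant: compare \<open>w\<close> with \<open>r * a\<close>. The parameter
  \<open>r\<close> shifts the weight between the two terms.\<close>

lemma young_power:
 fixes a w r :: real
 assumes "0 \<le> a" "0 \<le> w" "0 < r"
 shows "a ^ q * w \<le> r * a ^ Suc q + w ^ Suc q / r ^ q"
proof (cases "w \<le> r * a")
 case True
 then have "a ^ q * w \<le> r * a ^ Suc q" using assms mult_left_mono[OF True, of "a ^ q"] by (simp add: algebra_simps)
 moreover have "0 \<le> w ^ Suc q / r ^ q" using assms by (simp del: power_Suc)
 ultimately show ?thesis by linarith
next
 case False
 then have "a \<le> w / r" using assms by (simp add: field_simps)
 then have "a ^ q * w \<le> (w / r) ^ q * w" using assms by (intro mult_right_mono power_mono) auto
 also have "\<dots> = w ^ Suc q / r ^ q" by (simp add: power_divide)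
 moreover have "0 \<le> r * a ^ Suc q" using assms by (simp del: power_Suc)
 ultimately show ?thesis by linarith
qed

text \<open>Domination by the q-th power of \<open>a\<close> says that \<open>h\<close> lies in the
  dual of the space of order q + 1. In the cubic case q = 2, \<open>a\<close> is the length of the
  field and \<open>h\<close> a product of two components.\<close>

lemma integrable_mult_conjugate:
 fixes h v a :: "real ^ 'n \<Rightarrow> real"
 assumes [measurable]: "h \<in> borel_measurable borel" and h: "\<And>x. \<bar>h x\<bar> \<le> \<bar>a x\<bar> ^ q"
  and a: "in_Lp (Suc q) a" and v: "in_Lp (Suc q) v" and r: "0 < r"
 shows "integrable torus (\<lambda>x. h x * v x)"
  and "\<bar>\<integral>x. h x * v x \<partial>torus\<bar> \<le> r * (\<integral>x. \<bar>a x\<bar> ^ Suc q \<partial>torus) + (\<integral>x. \<bar>v x\<bar> ^ Suc q \<partial>torus) / r ^ q"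
proof -
 note [measurable] = in_LpD(1)[OF v] in_LpD(1)[OF a]
 have b: "\<bar>h x * v x\<bar> \<le> r * \<bar>a x\<bar> ^ Suc q + \<bar>v x\<bar> ^ Suc q / r ^ q" for x
  using mult_right_mono[OF h[of x], of "\<bar>v x\<bar>"] young_power[of "\<bar>a x\<bar>" "\<bar>v x\<bar>" r q] r
  by (simp add: abs_mult del: power_Suc)
 have i: "integrable torus (\<lambda>x. r * \<bar>a x\<bar> ^ Suc q + \<bar>v x\<bar> ^ Suc q / r ^ q)"
  using in_LpD(3)[OF a] in_LpD(3)[OF v] by (simp del: power_Suc)
 show ii: "integrable torus (\<lambda>x. h x * v x)"
  by (rule L1_bound[OF i])
    (use b in \<open>auto intro!: AE_I2 borel_measurable_torus simp del: power_Suc intro: order_trans[OF _ abs_ge_self]\<close>)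
 have "\<bar>\<integral>x. h x * v x \<partial>torus\<bar> \<le> (\<integral>x. \<bar>h x * v x\<bar> \<partial>torus)" by (rule integral_abs_bound)
 also have "\<dots> \<le> (\<integral>x. r * \<bar>a x\<bar> ^ Suc q + \<bar>v x\<bar> ^ Suc q / r ^ q \<partial>torus)"
  using ii i b by (intro integral_mono integrable_abs) auto
 also have "\<dots> = r * (\<integral>x. \<bar>a x\<bar> ^ Suc q \<partial>torus) + (\<integral>x. \<bar>v x\<bar> ^ Suc q \<partial>torus) / r ^ q"
  using in_LpD(3)[OF a] in_LpD(3)[OF v] by (simp del: power_Suc)
 finally show "\<bar>\<integral>x. h x * v x \<partial>torus\<bar> \<le> \<dots>" .
qed

lemma corr_continuous:
 fixes h v a :: "real ^ 'n \<Rightarrow> real"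
 assumes hm [measurable]: "h \<in> borel_measurable borel" and h: "\<And>x. \<bar>h x\<bar> \<le> \<bar>a x\<bar> ^ q"
  and a: "in_Lp (Suc q) a" and v: "in_Lp (Suc q) v"
 shows "continuous_on UNIV (corr h v)"
proof (unfold continuous_on_iff, safe)
 fix z :: "real ^ 'n" and e :: real assume e: "0 < e"
 note [measurable] = in_LpD(1)[OF v]
 let ?A = "\<integral>x. \<bar>a x\<bar> ^ Suc q \<partial>torus"
 have A: "0 \<le> ?A" by (simp del: power_Suc)
 \<comment> \<open>Small enough that the term with \<open>a\<close> stays below e / 2. The added 1
   covers the case that \<open>a\<close> has integral 0.\<close>
 define r where "r = e / (2 * (?A + 1))"
 have r: "0 < r" "r * ?A < e / 2"
  proof -
  have "0 < e / (2 * (A + 1))" "e / (2 * (A + 1)) * A < e / 2" if "0 \<le> A" for A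
   using e that by (auto simp: field_simps add_pos_nonneg)
  from this[OF A] show "0 < r" "r * ?A < e / 2" by (simp_all only: r_def)
 qed
 obtain d where d: "0 < d" "\<And>y. norm y < d \<Longrightarrow> (\<integral>x. \<bar>v (x - y) - v x\<bar> ^ Suc q \<partial>torus) < e / 2 * r ^ q"
  using translation_continuous[OF v, of "e / 2 * r ^ q"] e r by (auto simp del: power_Suc)
 have "dist (corr h v y) (corr h v z) < e" if y: "dist y z < d" for y
 proof -
  let ?w = "\<lambda>x. v (x - y) - v (x - z)"
  have w: "in_Lp (Suc q) ?w" by (intro in_Lp_diff in_Lp_shift' v)
  have "(\<integral>x. \<bar>?w x\<bar> ^ Suc q \<partial>torus) = (\<integral>x. \<bar>v (x - (y - z)) - v x\<bar> ^ Suc q \<partial>torus)"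
   using integral_shift_power[OF in_Lp_diff[OF in_Lp_shift'[OF v, of "y - z"] v], of z]
   by (simp add: algebra_simps del: power_Suc)
  also have "\<dots> < e / 2 * r ^ q" using y by (intro d) (simp add: dist_norm)
  finally have "(\<integral>x. \<bar>?w x\<bar> ^ Suc q \<partial>torus) / r ^ q < e / 2" using r by (simp add: field_simps del: power_Suc)
  moreover have "corr h v y - corr h v z = (\<integral>x. h x * ?w x \<partial>torus)"
   using integrable_mult_conjugate(1)[OF hm h a in_Lp_shift'[OF v] zero_less_one]
   by (simp add: corr_def algebra_simps flip: lint_diff)
  ultimately show ?thesis
   using integrable_mult_conjugate(2)[OF hm h a w r(1)] r(2) unfolding dist_real_def by linarith
 qed
 then show "\<exists>d>0. \<forall>y\<in>UNIV. dist y z < d \<longrightarrow> dist (corr h v y) (corr h v z) < e" using d(1) by blast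
qed

lemma corr_bound:
 fixes h v a :: "real ^ 'n \<Rightarrow> real"
 assumes "h \<in> borel_measurable borel" and "\<And>x. \<bar>h x\<bar> \<le> \<bar>a x\<bar> ^ q"
  and "in_Lp (Suc q) a" and v: "in_Lp (Suc q) v"
 shows "\<bar>corr h v y\<bar> \<le> (\<integral>x. \<bar>a x\<bar> ^ Suc q \<partial>torus) + (\<integral>x. \<bar>v x\<bar> ^ Suc q \<partial>torus)"
 using integrable_mult_conjugate(2)[OF assms(1-3) in_Lp_shift'[OF v] zero_less_one, of y]
  integral_shift_power[OF v, of y] by (simp add: corr_def del: power_Suc)

definition nrm :: "(real ^ 'n \<Rightarrow> real) \<Rightarrow> real" where
 "nrm v = sqrt (\<integral>x. (v x)\<^sup>2 \<partial>torus)"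

lemma nrm_nonneg [simp]: "0 \<le> nrm v" by (simp add: nrm_def)

lemma in_L2_integrable: "in_Lp 2 v \<Longrightarrow> integrable torus (\<lambda>x. (v x)\<^sup>2)"
 using in_LpD(3)[of 2 v] by simp

text \<open>Integrate the elementary inequality \<open>h v \<le> r h^2 / 2 + v^2 / (2 r)\<close> and
  optimise over \<open>r\<close>.\<close>

lemma cauchy_schwarz_torus:
 assumes h: "in_Lp 2 h" and v: "in_Lp 2 v"
 shows "integrable torus (\<lambda>x. h x * v x)" and "\<bar>\<integral>x. h x * v x \<partial>torus\<bar> \<le> nrm h * nrm v"
proof -
 show i: "integrable torus (\<lambda>x. h x * v x)"
  using integrable_mult_conjugate(1)[of h h 1 v 1] in_LpD(1)[OF h] h v by (simp add: numeral_2_eq_2)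
 have pos: "(\<integral>x. h x * v x \<partial>torus) \<le> r * (nrm h)\<^sup>2 / 2 + (nrm v)\<^sup>2 / (2 * r)"
  if "0 < r" "in_Lp 2 h" "integrable torus (\<lambda>x. h x * v x)" for r h
 proof -
  have "(\<integral>x. h x * v x \<partial>torus) \<le> (\<integral>x. r * (h x)\<^sup>2 / 2 + (v x)\<^sup>2 / (2 * r) \<partial>torus)"
  proof (rule integral_mono)
   fix x
   have "0 \<le> (r * h x - v x)\<^sup>2 / (2 * r)" using that by simp
   also have "\<dots> = r * (h x)\<^sup>2 / 2 + (v x)\<^sup>2 / (2 * r) - h x * v x"
    using that by (simp add: field_simps power2_eq_square)
   finally show "h x * v x \<le> r * (h x)\<^sup>2 / 2 + (v x)\<^sup>2 / (2 * r)" by simp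
  qed (use that in_L2_integrable[OF v] in_L2_integrable[OF that(2)] in auto)
  then show ?thesis
   using in_L2_integrable[OF v] in_L2_integrable[OF that(2)] by (simp add: nrm_def)
 qed
 have main: "(\<integral>x. h x * v x \<partial>torus) \<le> nrm h * nrm v"
  if hh: "in_Lp 2 h" "integrable torus (\<lambda>x. h x * v x)" for h
 proof (rule field_le_epsilon)
  fix e :: real assume "0 < e"
  define a b where "a = nrm h" and "b = nrm v"
  have ab: "0 \<le> a" "0 \<le> b" by (auto simp: a_def b_def)
  show "(\<integral>x. h x * v x \<partial>torus) \<le> nrm h * nrm v + e"
  proof (cases "a = 0")
   case True
   have "(\<integral>x. h x * v x \<partial>torus) \<le> b\<^sup>2 / (2 * (b\<^sup>2 / e + 1))"
    using pos[OF _ hh, of "b\<^sup>2 / e + 1"] True \<open>0 < e\<close> by (simp add: a_def b_def add_nonneg_pos)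
   also have "\<dots> \<le> e" using \<open>0 < e\<close> by (simp add: field_simps add_nonneg_pos add_pos_nonneg)
   finally show ?thesis using True by (simp add: a_def)
  next
   case False
   \<comment> \<open>The optimal parameter would be b / a. Replacing \<open>b\<close> by
     \<open>b + e / a\<close> keeps it positive when b = 0 and costs exactly
     \<open>e\<close>.\<close>
   have c: "0 < b + e / a" using ab False \<open>0 < e\<close> by (simp add: add_nonneg_pos)
   have "b\<^sup>2 / (2 * ((b + e / a) / a)) \<le> a * (b + e / a) / 2"
   proof -
    have "b\<^sup>2 \<le> (b + e / a)\<^sup>2" using ab \<open>0 < e\<close> by (intro power_mono) auto
    then have "a * b\<^sup>2 / (2 * (b + e / a)) \<le> a * (b + e / a)\<^sup>2 / (2 * (b + e / a))"
     using ab c by (intro divide_right_mono mult_left_mono) auto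
    also have "\<dots> = a * (b + e / a) / 2"
    proof -
     have "a * c\<^sup>2 / (2 * c) = a * c / 2" if "0 < c" for c :: real
      using that by (simp add: power2_eq_square)
     from this[OF c] show ?thesis .
    qed
    finally show ?thesis by (simp add: field_simps)
   qed
   moreover have "(b + e / a) / a * a\<^sup>2 / 2 = a * (b + e / a) / 2"
    using False by (simp add: power2_eq_square)
   moreover have "a * (b + e / a) = a * b + e" using False by (simp add: field_simps)
   moreover have "0 < (b + e / a) / a" using c ab False by simp
   note pos[OF this hh, folded a_def b_def]
   ultimately show ?thesis unfolding a_def[symmetric] b_def[symmetric] by argo
  qed
 qed
 have n: "in_Lp 2 (\<lambda>x. - h x)" "nrm (\<lambda>x. - h x) = nrm h"
  using h by (auto simp: in_Lp_def periodic_def nrm_def)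
 show "\<bar>\<integral>x. h x * v x \<partial>torus\<bar> \<le> nrm h * nrm v"
  using main[OF h i] main[OF n(1)] i n(2) by simp
qed

lemma nrm_shift: "in_Lp 2 v \<Longrightarrow> nrm (\<lambda>x. v (x - y)) = nrm v"
 using integral_shift_power[of 2 v y] by (simp add: nrm_def)

lemma corr_L2:
 assumes h: "in_Lp 2 h" and v: "in_Lp 2 v"
 shows "continuous_on UNIV (corr h v)" and "\<bar>corr h v y\<bar> \<le> nrm h * nrm v"
  and "\<bar>corr h v y - corr h v 0\<bar> \<le> nrm h * nrm (\<lambda>x. v (x - y) - v x)"
proof -
 show "continuous_on UNIV (corr h v)"
  using corr_continuous[of h h 1 v] in_LpD(1)[OF h] h v by (simp add: numeral_2_eq_2)
 show "\<bar>corr h v y\<bar> \<le> nrm h * nrm v"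
  using cauchy_schwarz_torus(2)[OF h in_Lp_shift'[OF v]] nrm_shift[OF v] by (simp add: corr_def)
 have "corr h v y - corr h v 0 = (\<integral>x. h x * (v (x - y) - v x) \<partial>torus)"
  using cauchy_schwarz_torus(1)[OF h in_Lp_shift'[OF v, of y]] cauchy_schwarz_torus(1)[OF h v]
  by (simp add: corr_def algebra_simps flip: lint_diff)
 then show "\<bar>corr h v y - corr h v 0\<bar> \<le> nrm h * nrm (\<lambda>x. v (x - y) - v x)"
  using cauchy_schwarz_torus(2)[OF h in_Lp_diff[OF in_Lp_shift'[OF v] v]] by simp
qed

lemma borel_pair_torus:
 assumes "F \<in> borel_measurable (borel \<Otimes>\<^sub>M borel)"
 shows "F \<in> borel_measurable (torus \<Otimes>\<^sub>M torus)"
proof -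
 have id: "(\<lambda>x. x) \<in> measurable torus borel" by (rule borel_measurable_torus) simp
 have "(\<lambda>p. (fst p, snd p)) \<in> measurable (torus \<Otimes>\<^sub>M torus) (borel \<Otimes>\<^sub>M borel)"
  by (intro measurable_Pair measurable_compose[OF measurable_fst id] measurable_compose[OF measurable_snd id])
 from measurable_compose[OF this assms] show ?thesis by simp
qed

section \<open>Convolutions on the torus\<close>

definition conv :: "(real ^ 'n \<Rightarrow> real) \<Rightarrow> (real ^ 'n \<Rightarrow> real) \<Rightarrow> real ^ 'n \<Rightarrow> real" where
 "conv m v x = (\<integral>y. m (x - y) * v y \<partial>torus)"

lemma conv_alt:
 assumes [measurable]: "m \<in> borel_measurable borel" "v \<in> borel_measurable borel"
  and m: "periodic m" and v: "periodic v"
 shows "conv m v x = (\<integral>y. m y * v (x - y) \<partial>torus)"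
proof -
 have "periodic (\<lambda>y. m y * v (x - y))"
 proof (unfold periodic_def, safe)
  fix y :: "real ^ 'a" and i
  have "v (x - (y + axis i 1)) = v (x - (y + axis i 1) + axis i 1)" using v by (simp only: periodic_def)
  then have "v (x - (y + axis i 1)) = v (x - y)" by (simp add: algebra_simps)
  then show "m (y + axis i 1) * v (x - (y + axis i 1)) = m y * v (x - y)"
   using m by (simp add: periodic_def algebra_simps)
 qed
 from integral_torus_reflect(1)[OF _ this, of x] show ?thesis by (simp add: conv_def)
qed

text \<open>Fubini's theorem after a reflection. Every spatial pairing in the balance thereby
  becomes an integral of a kernel against one correlation function.\<close>

lemma pair_conv_corr:
 fixes h v m :: "real ^ 'n \<Rightarrow> real"
 assumes h: "in_Lp 1 h" and v: "in_Lp 1 v"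
  and [measurable]: "m \<in> borel_measurable borel" and m: "periodic m" "\<And>x. \<bar>m x\<bar> \<le> C"
 shows "(\<integral>x. h x * conv m v x \<partial>torus) = (\<integral>y. m y * corr h v y \<partial>torus)"
  and "integrable torus (\<lambda>x. h x * conv m v x)"
proof -
 interpret P: pair_sigma_finite "torus :: (real ^ 'n) measure" "torus :: (real ^ 'n) measure" ..
 note [measurable] = in_LpD(1)[OF v] in_LpD(1)[OF h]
 have C: "0 \<le> C" using m(2)[of 0] by linarith
 have ih: "integrable torus (\<lambda>x. \<bar>h x\<bar>)" and iv: "integrable torus (\<lambda>x. \<bar>v (z - x)\<bar>)" for z
  using in_LpD(3)[OF h] in_LpD(3)[OF v] integral_torus_reflect(2)[of "\<lambda>x. \<bar>v x\<bar>" z]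
   periodic_compose[OF in_LpD(2)[OF v], of abs]
  by auto
 have eqv: "(\<integral>y. \<bar>v (x - y)\<bar> \<partial>torus) = (\<integral>y. \<bar>v y\<bar> \<partial>torus)" for x
  using integral_torus_reflect(1)[of "\<lambda>x. \<bar>v x\<bar>" x] periodic_compose[OF in_LpD(2)[OF v], of abs] by simp
 let ?F = "\<lambda>(x, y). h x * (m y * v (x - y))"
 have meas: "?F \<in> borel_measurable (torus \<Otimes>\<^sub>M torus)"
  by (rule borel_pair_torus) measurable
 have i1: "integrable torus (\<lambda>y. m y * v (x - y))" for x
 proof (rule L1_bound[OF integrable_mult_right[OF iv[of x], of C]])
  show "(\<lambda>y. m y * v (x - y)) \<in> borel_measurable torus" by (rule borel_measurable_torus) measurable
  show "AE y in torus. norm (m y * v (x - y)) \<le> norm (C * \<bar>v (x - y)\<bar>)"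
   using m(2) C by (intro AE_I2) (simp add: abs_mult mult_right_mono)
 qed
 have bnd: "(\<integral>y. norm (?F (x, y)) \<partial>torus) \<le> \<bar>h x\<bar> * (C * (\<integral>y. \<bar>v y\<bar> \<partial>torus))" for x
 proof -
  have "(\<integral>y. norm (?F (x, y)) \<partial>torus) = \<bar>h x\<bar> * (\<integral>y. \<bar>m y * v (x - y)\<bar> \<partial>torus)"
   by (simp add: abs_mult mult.assoc)
  also have "(\<integral>y. \<bar>m y * v (x - y)\<bar> \<partial>torus) \<le> (\<integral>y. C * \<bar>v (x - y)\<bar> \<partial>torus)"
   using m(2) by (intro integral_mono integrable_abs i1 integrable_mult_right iv)
    (simp add: abs_mult mult_right_mono)
  also have "\<dots> = C * (\<integral>y. \<bar>v y\<bar> \<partial>torus)" by (simp add: eqv)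
  finally show ?thesis by (simp add: mult_left_mono)
 qed
 have int: "integrable (torus \<Otimes>\<^sub>M torus) ?F"
 proof (rule P.Fubini_integrable[OF meas])
  show "integrable torus (\<lambda>x. \<integral>y. norm (?F (x, y)) \<partial>torus)"
  proof (rule L1_bound[OF integrable_mult_left[OF ih]])
   show "(\<lambda>x. \<integral>y. norm (?F (x, y)) \<partial>torus) \<in> borel_measurable torus"
    by (rule torus.borel_measurable_lebesgue_integral) (use meas in \<open>simp add: split_def\<close>)
   show "AE x in torus. norm (\<integral>y. norm (?F (x, y)) \<partial>torus) \<le> norm (\<bar>h x\<bar> * (C * (\<integral>y. \<bar>v y\<bar> \<partial>torus)))"
    using bnd C by (intro AE_I2) (simp add: abs_mult)
  qed
  show "AE x in torus. integrable torus (\<lambda>y. ?F (x, y))" using i1 by (intro AE_I2) simp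
 qed
 have cx: "conv m v x = (\<integral>y. m y * v (x - y) \<partial>torus)" for x
  by (rule conv_alt) (use in_LpD[OF v] m in auto)
 have "(\<integral>x. h x * conv m v x \<partial>torus) = (\<integral>x. \<integral>y. ?F (x, y) \<partial>torus \<partial>torus)"
  by (simp add: cx)
 also have "\<dots> = (\<integral>y. \<integral>x. ?F (x, y) \<partial>torus \<partial>torus)"
  using P.Fubini_integral[of "\<lambda>x y. ?F (x, y)"] int by simp
 also have "\<dots> = (\<integral>y. m y * corr h v y \<partial>torus)"
  by (simp add: corr_def mult.left_commute[of "h _"])
 finally show "(\<integral>x. h x * conv m v x \<partial>torus) = (\<integral>y. m y * corr h v y \<partial>torus)" .
 have "integrable torus (\<lambda>x. \<integral>y. ?F (x, y) \<partial>torus)" by (rule P.integrable_fst'[OF int])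
 then show "integrable torus (\<lambda>x. h x * conv m v x)" by (simp add: cx)
qed

section \<open>The divergence theorem on balls\<close>

lemma ball_borel [measurable]:
 "ball a r \<in> sets (borel :: 'a::metric_space measure)" "cball a r \<in> sets (borel :: 'a::metric_space measure)"
 by auto

lemma integral_lborel_scale:
 fixes f :: "real ^ 'n \<Rightarrow> real"
 assumes [measurable]: "f \<in> borel_measurable borel" and c: "0 < c"
 shows "(\<integral>x. f x \<partial>lborel) = c ^ CARD('n) * (\<integral>x. f (c *\<^sub>R x) \<partial>lborel)"
proof -
 have "(\<integral>x. f x \<partial>lborel) = (\<integral>x. f x \<partial>density (distr lborel borel (\<lambda>x. c *\<^sub>R x)) (\<lambda>_. ennreal (c ^ CARD('n))))"
  using lborel_affine[of c "0 :: real ^ 'n"] c by (simp add: DIM_cart)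
 also have "\<dots> = (\<integral>x. c ^ CARD('n) * f (c *\<^sub>R x) \<partial>lborel)"
  using c by (subst integral_density) (auto simp: integral_distr)
 finally show ?thesis by simp
qed

text \<open>Unfolds the cone definition of surface measure: a surface integral is d times the
  integral over the unit ball of a function of the direction. The origin, removed in that
  definition, is a null set.\<close>

lemma integral_sphere_measure:
 fixes g :: "real ^ 'n \<Rightarrow> real"
 assumes [measurable]: "g \<in> borel_measurable borel"
 shows "(\<integral>y. g y \<partial>sphere_measure)
  = real CARD('n) * (\<integral>x. indicator (ball 0 1) x * g (x /\<^sub>R norm x) \<partial>lborel)"
proof -
 let ?R = "restrict_space lborel (ball 0 1 - {0 :: real ^ 'n})"
 have [measurable]: "(\<lambda>x :: real ^ 'n. x /\<^sub>R norm x) \<in> borel_measurable borel" by measurable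
 have m: "(\<lambda>x. x /\<^sub>R norm x) \<in> measurable ?R borel"
  by (rule measurable_restrict_space1) simp
 have "(\<integral>y. g y \<partial>sphere_measure) = real CARD('n) * (\<integral>x. g (x /\<^sub>R norm x) \<partial>?R)"
  unfolding sphere_measure_def
  by (subst integral_density) (auto simp: integral_distr[OF m])
 also have "(\<integral>x. g (x /\<^sub>R norm x) \<partial>?R) = (\<integral>x. indicator (ball 0 1 - {0}) x *\<^sub>R g (x /\<^sub>R norm x) \<partial>lborel)"
  by (rule integral_restrict_space) simp
 also have "\<dots> = (\<integral>x. indicator (ball 0 1) x * g (x /\<^sub>R norm x) \<partial>lborel)"
 proof (rule integral_cong_AE)
  have "AE x in lborel. x \<noteq> (0 :: real ^ 'n)" by (rule AE_lborel_singleton)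
  then show "AE x in lborel. indicator (ball 0 1 - {0}) x *\<^sub>R g (x /\<^sub>R norm x) = indicator (ball 0 1) x * g (x /\<^sub>R norm x)"
   by eventually_elim (simp split: split_indicator)
 qed simp_all
 finally show ?thesis .
qed

lemma integral_ball_homogeneous:
 fixes G :: "real ^ 'n \<Rightarrow> real"
 assumes [measurable]: "G \<in> borel_measurable borel" and r: "0 < r"
 shows "(\<integral>x. indicator (ball 0 r) x * G (x /\<^sub>R norm x) \<partial>lborel)
  = r ^ CARD('n) * (\<integral>x. indicator (ball 0 1) x * G (x /\<^sub>R norm x) \<partial>lborel)"
proof -
 have [measurable]: "(\<lambda>x :: real ^ 'n. x /\<^sub>R norm x) \<in> borel_measurable borel" by measurable
 have eq: "(r *\<^sub>R x) /\<^sub>R norm (r *\<^sub>R x) = x /\<^sub>R norm x" for x :: "real ^ 'n"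
 proof -
  have "inverse (norm (r *\<^sub>R x)) * r = inverse (norm x)" using r by (cases "x = 0") (auto simp: field_simps)
  then show ?thesis by (simp only: scaleR_scaleR)
 qed
 have "(\<integral>x. indicator (ball 0 r) x * G (x /\<^sub>R norm x) \<partial>lborel)
   = r ^ CARD('n) * (\<integral>x. indicator (ball 0 r) (r *\<^sub>R x) * G ((r *\<^sub>R x) /\<^sub>R norm (r *\<^sub>R x)) \<partial>lborel)"
  using r by (intro integral_lborel_scale) simp_all
 also have "(\<lambda>x :: real ^ 'n. indicator (ball 0 r) (r *\<^sub>R x) * G ((r *\<^sub>R x) /\<^sub>R norm (r *\<^sub>R x)))
   = (\<lambda>x. indicator (ball 0 1) x * G (x /\<^sub>R norm x))"
  using r by (simp only: eq) (auto simp: fun_eq_iff indicator_def)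
 finally show ?thesis .
qed

section \<open>Integration by parts on a ball, with a linear ramp in place of the indicator\<close>

definition cutoff :: "real \<Rightarrow> real \<Rightarrow> real ^ 'n \<Rightarrow> real" where
 "cutoff l \<epsilon> x = max 0 (min 1 ((l - norm x) / \<epsilon>))"

lemma cutoff_lipschitz:
 assumes "0 < \<epsilon>" shows "\<bar>cutoff l \<epsilon> x - cutoff l \<epsilon> y\<bar> \<le> norm (x - y) / \<epsilon>"
proof -
 have "\<bar>max 0 (min 1 a) - max 0 (min 1 b)\<bar> \<le> \<bar>a - b\<bar>" for a b :: real by linarith
 from this[of "(l - norm x) / \<epsilon>" "(l - norm y) / \<epsilon>"]
 have "\<bar>cutoff l \<epsilon> x - cutoff l \<epsilon> y\<bar> \<le> \<bar>(norm y - norm x) / \<epsilon>\<bar>"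
  by (simp add: cutoff_def diff_divide_distrib)
 also have "\<dots> \<le> norm (x - y) / \<epsilon>"
  using assms norm_triangle_ineq3[of y x] by (simp add: divide_right_mono norm_minus_commute)
 finally show ?thesis .
qed

lemma continuous_cutoff: "continuous_on UNIV (cutoff l \<epsilon>)"
 unfolding cutoff_def divide_inverse by (intro continuous_intros)

text \<open>The two excluded spheres are the kinks of the ramp. They are null sets, so the formula
  holds almost everywhere.\<close>

lemma cutoff_derivative:
 fixes x :: "real ^ 'n"
 assumes \<epsilon>: "0 < \<epsilon>" "\<epsilon> < l" and x: "norm x \<noteq> l" "norm x \<noteq> l - \<epsilon>"
 shows "((\<lambda>t. cutoff l \<epsilon> (x + t *\<^sub>R axis k 1)) has_real_derivative
   - (indicator (ball 0 l - ball 0 (l - \<epsilon>)) x * (x $ k / norm x)) / \<epsilon>) (at 0)"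
proof -
 let ?e = "axis k 1 :: real ^ 'n"
 have cont: "continuous (at 0) (\<lambda>t::real. norm (x + t *\<^sub>R ?e))" by (intro continuous_intros)
 have near: "\<forall>\<^sub>F t in nhds 0. norm (x + t *\<^sub>R ?e) \<in> S" if "open S" "norm x \<in> S" for S
  using that cont unfolding continuous_at tendsto_def
  by (subst eventually_nhds_conv_at) auto
 consider "norm x < l - \<epsilon>" | "l < norm x" | "l - \<epsilon> < norm x" "norm x < l" using x by linarith
 then show ?thesis
 proof cases
  case 1
  have "\<forall>\<^sub>F t in nhds 0. norm (x + t *\<^sub>R ?e) \<in> {..<l - \<epsilon>}" using 1 by (intro near) auto
  then have "\<forall>\<^sub>F t in nhds 0. cutoff l \<epsilon> (x + t *\<^sub>R ?e) = 1"
   by eventually_elim (use \<epsilon> in \<open>auto simp: cutoff_def field_simps\<close>)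
  then have "((\<lambda>t. cutoff l \<epsilon> (x + t *\<^sub>R ?e)) has_real_derivative 0) (at 0)"
   by (subst DERIV_cong_ev[OF refl _ refl]) auto
  then show ?thesis using 1 by (simp add: indicator_def)
 next
  case 2
  have "\<forall>\<^sub>F t in nhds 0. norm (x + t *\<^sub>R ?e) \<in> {l<..}" using 2 by (intro near) auto
  then have "\<forall>\<^sub>F t in nhds 0. cutoff l \<epsilon> (x + t *\<^sub>R ?e) = 0"
   by eventually_elim (use \<epsilon> in \<open>auto simp: cutoff_def field_simps\<close>)
  then have "((\<lambda>t. cutoff l \<epsilon> (x + t *\<^sub>R ?e)) has_real_derivative 0) (at 0)"
   by (subst DERIV_cong_ev[OF refl _ refl]) auto
  then show ?thesis using 2 by (simp add: indicator_def)
 next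
  case 3
  have "\<forall>\<^sub>F t in nhds 0. norm (x + t *\<^sub>R ?e) \<in> {l - \<epsilon><..<l}" using 3 by (intro near) auto
  then have ev: "\<forall>\<^sub>F t in nhds 0. cutoff l \<epsilon> (x + t *\<^sub>R ?e) = (l - norm (x + t *\<^sub>R ?e)) / \<epsilon>"
   by eventually_elim (use \<epsilon> in \<open>auto simp: cutoff_def field_simps\<close>)
  have x0: "x \<noteq> 0" using 3 \<epsilon> by auto
  have "((\<lambda>t. norm (x + t *\<^sub>R ?e)) has_derivative (\<lambda>t. (t *\<^sub>R ?e) \<bullet> sgn x)) (at 0)"
   by (rule has_derivative_compose[of "\<lambda>t. x + t *\<^sub>R ?e", where g=norm, simplified])
     (auto intro!: derivative_eq_intros has_derivative_norm[OF x0])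
  then have "((\<lambda>t. norm (x + t *\<^sub>R ?e)) has_real_derivative (x $ k / norm x)) (at 0)"
   unfolding has_field_derivative_def
   by (rule has_derivative_eq_rhs) (simp add: fun_eq_iff inner_axis' sgn_div_norm divide_inverse)
  then have "((\<lambda>t. (l - norm (x + t *\<^sub>R ?e)) / \<epsilon>) has_real_derivative (0 - x $ k / norm x) / \<epsilon>) (at 0)"
   by (intro DERIV_cdivide DERIV_diff DERIV_const)
  then have "((\<lambda>t. cutoff l \<epsilon> (x + t *\<^sub>R ?e)) has_real_derivative (0 - x $ k / norm x) / \<epsilon>) (at 0)"
   by (subst DERIV_cong_ev[OF refl ev refl])
  then show ?thesis using 3 by (simp add: indicator_def)
 qed
qed

lemma AE_norm_neq: "AE x in lborel. norm (x :: real ^ 'n) \<noteq> r"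
proof -
 have "negligible (sphere (0 :: real ^ 'n) r)" by (rule negligible_sphere)
 then have "AE x in lebesgue. x \<notin> sphere (0 :: real ^ 'n) r"
  unfolding negligible_iff_null_sets by (rule AE_not_in)
 then show ?thesis by (simp add: AE_completion_iff)
qed

lemma continuous_bound_cball:
 fixes f :: "real ^ 'n \<Rightarrow> real"
 assumes "continuous_on UNIV f"
 obtains B where "\<And>x. norm x \<le> r \<Longrightarrow> \<bar>f x\<bar> \<le> B"
proof -
 have "compact (f ` cball 0 r)"
  by (intro compact_continuous_image continuous_on_subset[OF assms]) auto
 then have "bounded (f ` cball 0 r)" by (rule compact_imp_bounded)
 then obtain a where "\<forall>y\<in>f ` cball 0 r. norm y \<le> a" unfolding bounded_iff by blast
 then show thesis by (intro that[of a]) auto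
qed

lemma integrable_continuous_ball:
 fixes f :: "real ^ 'n \<Rightarrow> real"
 assumes f: "continuous_on UNIV f"
 shows "integrable lborel (\<lambda>x. indicator (cball 0 r) x * f x)"
  and "integrable lborel (\<lambda>x. indicator (ball 0 r) x * f x)"
proof -
 obtain B where B: "\<And>x. norm x \<le> r \<Longrightarrow> \<bar>f x\<bar> \<le> \<bar>B\<bar>"
  using continuous_bound_cball[OF f, where r=r] by (metis abs_ge_self order_trans)
 have [measurable]: "f \<in> borel_measurable borel" by (rule continuous_borel[OF f])
 have i: "integrable lborel (\<lambda>x. \<bar>B\<bar> * indicator (cball 0 r) x)"
  by (intro integrable_mult_right integrable_real_indicator)
    (auto intro!: emeasure_bounded_finite[OF bounded_cball, unfolded infinity_ennreal_def])
 show "integrable lborel (\<lambda>x. indicator (cball 0 r) x * f x)"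
  using B by (intro integrable_boundI[OF i]) (simp_all split: split_indicator)
 show "integrable lborel (\<lambda>x. indicator (ball 0 r) x * f x)"
  using B by (intro integrable_boundI[OF i]) (simp_all split: split_indicator)
qed

text \<open>The difference quotients of the compactly supported function
  \<open>cutoff l \<epsilon> x * w x\<close> have integral 0 by translation invariance. They are
  uniformly bounded because both factors are Lipschitz on bounded sets along the axis, so dominated
  convergence gives integral 0 for the product-rule derivative as well.\<close>

lemma cutoff_divergence:
 fixes w D :: "real ^ 'n \<Rightarrow> real"
 assumes w: "continuous_on UNIV w" and D: "continuous_on UNIV D"
  and der: "\<And>x. ((\<lambda>t. w (x + t *\<^sub>R axis k 1)) has_real_derivative D x) (at 0)"
  and \<epsilon>: "0 < \<epsilon>" "\<epsilon> < l"
 shows "(\<integral>x. cutoff l \<epsilon> x * D x \<partial>lborel)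
  = (\<integral>x. indicator (ball 0 l - ball 0 (l - \<epsilon>)) x * (x $ k / norm x) * w x \<partial>lborel) / \<epsilon>"
proof -
 let ?e = "axis k 1 :: real ^ 'n"
 let ?S = "indicator (ball 0 l - ball 0 (l - \<epsilon>)) :: real ^ 'n \<Rightarrow> real"
 note [measurable] = continuous_borel[OF w] continuous_borel[OF D]
  continuous_borel[OF continuous_cutoff]
 define g where "g x = cutoff l \<epsilon> x * w x" for x
 have gc: "continuous_on UNIV g" unfolding g_def by (intro continuous_intros continuous_cutoff w)
 have gm [measurable]: "g \<in> borel_measurable borel" by (rule continuous_borel[OF gc])
 have g0: "g x = 0" if "x \<notin> cball 0 l" for x
 proof -
  have "(l - norm x) / \<epsilon> \<le> 0" using that \<epsilon> by (simp add: field_simps)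
  then show ?thesis by (simp add: g_def cutoff_def)
 qed
 have gi: "integrable lborel g"
 proof -
  have "g = (\<lambda>x. indicator (cball 0 l) x * g x)" using g0 by (auto simp: fun_eq_iff indicator_def)
  then show ?thesis using integrable_continuous_ball(1)[OF gc, of l] by simp
 qed
 \<comment> \<open>Quotients with step at most 1 vanish outside radius l + 1, and evaluating them
   inside involves points of norm at most l + 2.\<close>
 define B where "B = cball (0 :: real ^ 'n) (l + 2)"
 obtain W1 where W1: "\<And>x. norm x \<le> l + 2 \<Longrightarrow> \<bar>w x\<bar> \<le> W1" using continuous_bound_cball[OF w, where r="l + 2"] by blast
 obtain W2 where W2: "\<And>x. norm x \<le> l + 2 \<Longrightarrow> \<bar>D x\<bar> \<le> W2" using continuous_bound_cball[OF D, where r="l + 2"] by blast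
 define W where "W = max W1 W2"
 have W: "\<bar>w x\<bar> \<le> W" "\<bar>D x\<bar> \<le> W" if "x \<in> B" for x
  using W1[of x] W2[of x] that by (auto simp: B_def W_def)
 have W0: "0 \<le> W" using W(1)[of 0] \<epsilon> by (auto simp: B_def)
 have wl: "\<bar>w (x + h *\<^sub>R ?e) - w x\<bar> \<le> W * h" if hx: "x \<in> cball 0 (l + 1)" "0 < h" "h \<le> 1" for x h
 proof -
  have d: "((\<lambda>t. w (x + t *\<^sub>R ?e)) has_real_derivative D (x + t *\<^sub>R ?e)) (at t)" for t
   using DERIV_shift[of "\<lambda>s. w (x + s *\<^sub>R ?e)" "D (x + t *\<^sub>R ?e)" 0 t] der[of "x + t *\<^sub>R ?e"]
   by (simp add: algebra_simps)
  obtain z where z: "0 < z" "z < h" "w (x + h *\<^sub>R ?e) - w (x + 0 *\<^sub>R ?e) = (h - 0) * D (x + z *\<^sub>R ?e)"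
   using MVT2[of 0 h "\<lambda>t. w (x + t *\<^sub>R ?e)" "\<lambda>t. D (x + t *\<^sub>R ?e)"] hx(2) d by auto
  have "x + z *\<^sub>R ?e \<in> B"
   using hx z norm_triangle_ineq[of x "z *\<^sub>R ?e"] by (auto simp: B_def)
  then show ?thesis using z W(2)[of "x + z *\<^sub>R ?e"] hx by (simp add: abs_mult mult.commute mult_left_mono)
 qed
 define h where "h m = 1 / (1 + real m)" for m
 have h: "0 < h m" "h m \<le> 1" for m by (auto simp: h_def)
 have h0: "filterlim h (at 0) sequentially"
 proof (rule filterlim_atI)
  show "h \<longlonglongrightarrow> 0" unfolding h_def using LIMSEQ_inverse_real_of_nat by (simp add: inverse_eq_divide)
  show "\<forall>\<^sub>F m in sequentially. h m \<noteq> 0" by (auto simp: h_def)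
 qed
 define q where "q m x = (g (x + h m *\<^sub>R ?e) - g x) / h m" for m x
 have [measurable]: "q m \<in> borel_measurable borel" for m unfolding q_def by measurable
 have bound: "\<bar>q m x\<bar> \<le> (W + W / \<epsilon>) * indicator (cball 0 (l + 1)) x" for m x
 proof (cases "x \<in> cball 0 (l + 1)")
  case True
  then have xB: "x + h m *\<^sub>R ?e \<in> B"
   using h[of m] norm_triangle_ineq[of x "h m *\<^sub>R ?e"] by (auto simp: B_def)
  have "g (x + h m *\<^sub>R ?e) - g x
    = (cutoff l \<epsilon> (x + h m *\<^sub>R ?e) - cutoff l \<epsilon> x) * w (x + h m *\<^sub>R ?e) + cutoff l \<epsilon> x * (w (x + h m *\<^sub>R ?e) - w x)"
   by (simp add: g_def algebra_simps)
  also have "\<bar>\<dots>\<bar> \<le> \<bar>cutoff l \<epsilon> (x + h m *\<^sub>R ?e) - cutoff l \<epsilon> x\<bar> * \<bar>w (x + h m *\<^sub>R ?e)\<bar> + \<bar>cutoff l \<epsilon> x\<bar> * \<bar>w (x + h m *\<^sub>R ?e) - w x\<bar>"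
   by (rule order_trans[OF abs_triangle_ineq]) (simp add: abs_mult)
  also have "\<dots> \<le> (h m / \<epsilon>) * W + 1 * (W * h m)"
  proof (intro add_mono mult_mono)
   show "\<bar>cutoff l \<epsilon> (x + h m *\<^sub>R ?e) - cutoff l \<epsilon> x\<bar> \<le> h m / \<epsilon>"
    using cutoff_lipschitz[OF \<epsilon>(1), of l "x + h m *\<^sub>R ?e" x] h[of m] by simp
  qed (use W(1)[OF xB] W0 h[of m] \<epsilon> wl[OF True h] in \<open>auto simp: cutoff_def\<close>)
  finally have "\<bar>g (x + h m *\<^sub>R ?e) - g x\<bar> \<le> (W + W / \<epsilon>) * h m" by (simp add: algebra_simps)
  then show ?thesis using h[of m] True by (simp add: q_def abs_divide pos_divide_le_eq)
 next
  case False
  then have "x + h m *\<^sub>R ?e \<notin> cball 0 l"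
   using h[of m] norm_triangle_ineq2[of x "- (h m *\<^sub>R ?e)"] by auto
  then show ?thesis using g0 False by (simp add: q_def)
 qed
 have zero: "(\<integral>x. q m x \<partial>lborel) = 0" for m
  using gi integral_lborel_shift[OF gm, of "h m *\<^sub>R ?e"] by (simp add: q_def)
 have S: "?S x * (x $ k / norm x) / \<epsilon> * w x = ?S x * (x $ k / norm x) * w x / \<epsilon>" for x by simp
 let ?q = "\<lambda>x. cutoff l \<epsilon> x * D x - ?S x * (x $ k / norm x) * w x / \<epsilon>"
 have "(\<lambda>m. \<integral>x. q m x \<partial>lborel) \<longlonglongrightarrow> (\<integral>x. ?q x \<partial>lborel)"
 proof (rule dominated_convergence_real[where w="\<lambda>x. (W + W / \<epsilon>) * indicator (cball 0 (l + 1)) x"])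
  show "integrable lborel (\<lambda>x::real ^ 'n. (W + W / \<epsilon>) * indicator (cball 0 (l + 1)) x)"
   using integrable_continuous_ball(1)[OF continuous_on_const, of "l + 1" "W + W / \<epsilon>"]
   by (simp add: mult.commute)
  show "AE x in lborel. (\<lambda>m. q m x) \<longlonglongrightarrow> ?q x"
   using AE_norm_neq[of l] AE_norm_neq[of "l - \<epsilon>"]
  proof eventually_elim
   case (elim x)
   have "((\<lambda>t. g (x + t *\<^sub>R ?e)) has_real_derivative ?q x) (at 0)"
    unfolding g_def
    by (rule DERIV_cong[OF DERIV_mult[OF cutoff_derivative[OF \<epsilon> elim] der]])
      (simp add: algebra_simps)
   then have "(\<lambda>t. (g (x + (0 + t) *\<^sub>R ?e) - g (x + 0 *\<^sub>R ?e)) / t) \<midarrow>0\<rightarrow> ?q x"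
    unfolding DERIV_def .
   from filterlim_compose[OF this h0] show ?case by (simp add: q_def)
  qed
 qed (use bound in \<open>auto\<close>)
 then have "(\<integral>x. ?q x \<partial>lborel) = 0"
  by (simp add: zero LIMSEQ_const_iff)
 moreover have "integrable lborel (\<lambda>x. cutoff l \<epsilon> x * D x)"
 proof (rule integrable_boundI)
  show "integrable lborel (\<lambda>x. indicator (cball 0 l) x * \<bar>D x\<bar>)"
   by (intro integrable_continuous_ball continuous_intros D)
  show "\<bar>cutoff l \<epsilon> x * D x\<bar> \<le> indicator (cball 0 l) x * \<bar>D x\<bar>" for x
  proof (cases "norm x \<le> l")
   case True then show ?thesis by (auto simp: abs_mult cutoff_def intro!: mult_left_le_one_le)
  next
   case False
   then have "(l - norm x) / \<epsilon> \<le> 0" using \<epsilon> by (simp add: field_simps)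
   then show ?thesis by (simp add: cutoff_def)
  qed
 qed simp
 moreover have "integrable lborel (\<lambda>x. ?S x * (x $ k / norm x) * w x / \<epsilon>)"
 proof (rule integrable_boundI)
  show "integrable lborel (\<lambda>x. indicator (ball 0 l) x * (\<bar>w x\<bar> / \<epsilon>))"
   using \<epsilon> by (intro integrable_continuous_ball continuous_intros w) auto
  show "\<bar>?S x * (x $ k / norm x) * w x / \<epsilon>\<bar> \<le> indicator (ball 0 l) x * (\<bar>w x\<bar> / \<epsilon>)" for x
  proof -
   have "\<bar>x $ k / norm x\<bar> \<le> 1" using component_le_norm_cart[of x k] by (simp add: divide_le_eq_1 abs_divide)
   then have "\<bar>?S x\<bar> * \<bar>x $ k / norm x\<bar> \<le> indicator (ball 0 l) x * 1"
    by (intro mult_mono) (auto split: split_indicator)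
   from mult_right_mono[OF this, of "\<bar>w x\<bar> / \<epsilon>"] \<epsilon> show ?thesis by (simp add: abs_mult)
  qed
 qed measurable
 ultimately have "(\<integral>x. cutoff l \<epsilon> x * D x \<partial>lborel) - (\<integral>x. ?S x * (x $ k / norm x) * w x / \<epsilon> \<partial>lborel) = 0"
  by (simp only: lint_diff)
 from this[THEN iffD2[OF eq_iff_diff_eq_0]] show ?thesis by (simp only: integral_divide_zero)
qed

text \<open>Let the ramp steepen. The shell integral of a function of the direction alone is a
  difference of two homogeneous ball integrals; divided by the width it becomes a difference
  quotient of r^d at r = l, whence the factor d l^(d-1), whose d is absorbed by the surface
  measure.\<close>

lemma ball_divergence:
 fixes w D :: "real ^ 'n \<Rightarrow> real"
 assumes w: "continuous_on UNIV w" and D: "continuous_on UNIV D"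
  and der: "\<And>x. ((\<lambda>t. w (x + t *\<^sub>R axis k 1)) has_real_derivative D x) (at 0)"
  and l: "0 < l"
 shows "(\<integral>x. indicator (ball 0 l) x * D x \<partial>lborel)
  = l ^ (CARD('n) - 1) * (\<integral>y. w (l *\<^sub>R y) * y $ k \<partial>sphere_measure)"
proof -
 let ?d = "CARD('n)"
 note [measurable] = continuous_borel[OF w] continuous_borel[OF D]
  continuous_borel[OF continuous_cutoff]
 have nm [measurable]: "(\<lambda>x :: real ^ 'n. x /\<^sub>R norm x) \<in> borel_measurable borel" by measurable
 define \<epsilon> where "\<epsilon> m = l / (2 + real m)" for m
 have \<epsilon>: "0 < \<epsilon> m" "\<epsilon> m < l" for m
 proof -
  have "l * 1 < l * (2 + real m)" using l by (intro mult_strict_left_mono) auto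
  then show "0 < \<epsilon> m" "\<epsilon> m < l" using l by (auto simp: \<epsilon>_def divide_less_eq)
 qed
 have \<epsilon>0: "\<epsilon> \<longlonglongrightarrow> 0" unfolding \<epsilon>_def by real_asymp
 define G where "G y = w (l *\<^sub>R y) * y $ k" for y
 have [measurable]: "G \<in> borel_measurable borel" unfolding G_def by measurable
 define I where "I = (\<integral>x. indicator (ball 0 1) x * G (x /\<^sub>R norm x) \<partial>lborel)"
 let ?S = "\<lambda>m. indicator (ball 0 l - ball 0 (l - \<epsilon> m)) :: real ^ 'n \<Rightarrow> real"
 have lim1: "(\<lambda>m. \<integral>x. cutoff l (\<epsilon> m) x * D x \<partial>lborel) \<longlonglongrightarrow> (\<integral>x. indicator (ball 0 l) x * D x \<partial>lborel)"
 proof (rule dominated_convergence_real[where w="\<lambda>x. indicator (cball 0 l) x * \<bar>D x\<bar>"])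
  show "integrable lborel (\<lambda>x. indicator (cball 0 l) x * \<bar>D x\<bar>)"
   by (intro integrable_continuous_ball continuous_intros D)
  show "\<bar>cutoff l (\<epsilon> m) x * D x\<bar> \<le> indicator (cball 0 l) x * \<bar>D x\<bar>" for m x
  proof (cases "norm x \<le> l")
   case True then show ?thesis by (auto simp: abs_mult cutoff_def intro!: mult_left_le_one_le)
  next
   case False
   then have "(l - norm x) / \<epsilon> m \<le> 0" using \<epsilon>[of m] by (simp add: field_simps)
   then show ?thesis by (simp add: cutoff_def)
  qed
  show "AE x in lborel. (\<lambda>m. cutoff l (\<epsilon> m) x * D x) \<longlonglongrightarrow> indicator (ball 0 l) x * D x"
  proof (rule AE_I2)
   fix x :: "real ^ 'n"
   have "\<forall>\<^sub>F m in sequentially. cutoff l (\<epsilon> m) x = indicator (ball 0 l) x"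
   proof (cases "norm x < l")
    case True
    then have "\<forall>\<^sub>F m in sequentially. \<epsilon> m < l - norm x" by (intro order_tendstoD(2)[OF \<epsilon>0]) simp
    then show ?thesis
    proof eventually_elim
     case (elim m)
     then show ?case using True \<epsilon>[of m] by (auto simp: cutoff_def field_simps)
    qed
   next
    case False
    then have "(l - norm x) / \<epsilon> m \<le> 0" for m using \<epsilon>[of m] by (simp add: field_simps)
    then have "cutoff l (\<epsilon> m) x = 0" for m
     unfolding cutoff_def by (intro max_absorb1 min.coboundedI2)
    then show ?thesis using False by simp
   qed
   then have "\<forall>\<^sub>F m in sequentially. cutoff l (\<epsilon> m) x * D x = indicator (ball 0 l) x * D x"
    by eventually_elim simp
   then show "(\<lambda>m. cutoff l (\<epsilon> m) x * D x) \<longlonglongrightarrow> indicator (ball 0 l) x * D x"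
    by (rule tendsto_eventually)
  qed
 qed auto
 have shell: "(\<integral>x. ?S m x * G (x /\<^sub>R norm x) \<partial>lborel) = (l ^ ?d - (l - \<epsilon> m) ^ ?d) * I"
  and shell_int: "integrable lborel (\<lambda>x. ?S m x * G (x /\<^sub>R norm x))"
  and shell_vol: "(\<integral>x. ?S m x \<partial>lborel) = (l ^ ?d - (l - \<epsilon> m) ^ ?d) * (\<integral>x. indicator (ball (0::real ^ 'n) 1) x \<partial>lborel)"
  and shell_vol_int: "integrable lborel (?S m)" for m
 proof -
  have "continuous_on UNIV (\<lambda>y. w (l *\<^sub>R y))"
   by (intro continuous_on_compose2[OF w] continuous_intros) auto
  from continuous_bound_cball[OF this, where r=1]
  obtain B where B: "\<And>x. norm x \<le> 1 \<Longrightarrow> \<bar>w (l *\<^sub>R x)\<bar> \<le> B" by blast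
  have GB: "\<bar>G (x /\<^sub>R norm x)\<bar> \<le> B" for x :: "real ^ 'n"
  proof -
   have n1: "norm (x /\<^sub>R norm x) \<le> 1" by (cases "x = 0") auto
   have "\<bar>(x /\<^sub>R norm x) $ k\<bar> \<le> 1" using component_le_norm_cart[of "x /\<^sub>R norm x" k] n1 by linarith
   then have "\<bar>w (l *\<^sub>R (x /\<^sub>R norm x))\<bar> * \<bar>(x /\<^sub>R norm x) $ k\<bar> \<le> B * 1"
    using B[OF n1] by (intro mult_mono) auto
   then show ?thesis by (simp add: G_def abs_mult)
  qed
  have ib: "integrable lborel (\<lambda>x. indicator (ball 0 r) x * G (x /\<^sub>R norm x))" for r
   by (rule integrable_boundI[OF integrable_continuous_ball(2)[OF continuous_on_const[of _ B], of r]])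
     (use GB in \<open>auto split: split_indicator\<close>)
  have iv: "integrable lborel (indicator (ball (0::real ^ 'n) r) :: _ \<Rightarrow> real)" for r
   using integrable_continuous_ball(2)[OF continuous_on_const[of _ 1], of r] by simp
  have Seq: "?S m x = indicator (ball 0 l) x - indicator (ball 0 (l - \<epsilon> m)) x" for x
   using \<epsilon>[of m] by (auto split: split_indicator)
  have le: "0 < l - \<epsilon> m" using \<epsilon>[of m] by simp
  show "integrable lborel (\<lambda>x. ?S m x * G (x /\<^sub>R norm x))" "integrable lborel (?S m)"
   using ib iv L1_diff[OF iv[of l] iv[of "l - \<epsilon> m"]]
   unfolding Seq[abs_def] by (simp_all add: left_diff_distrib)
  show "(\<integral>x. ?S m x * G (x /\<^sub>R norm x) \<partial>lborel) = (l ^ ?d - (l - \<epsilon> m) ^ ?d) * I"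
   using ib integral_ball_homogeneous[of G l] integral_ball_homogeneous[of G "l - \<epsilon> m"] l le
   by (simp add: Seq left_diff_distrib I_def)
  show "(\<integral>x. ?S m x \<partial>lborel) = (l ^ ?d - (l - \<epsilon> m) ^ ?d) * (\<integral>x. indicator (ball (0::real ^ 'n) 1) x \<partial>lborel)"
   using iv integral_ball_homogeneous[where G="\<lambda>_ :: real ^ 'n. 1" and r=l] integral_ball_homogeneous[where G="\<lambda>_ :: real ^ 'n. 1" and r="l - \<epsilon> m"] l le
   by (simp only: Seq) (simp add: left_diff_distrib)
 qed
 define V :: real where "V = (\<integral>x. indicator (ball (0::real ^ 'n) 1) x \<partial>(lborel :: (real ^ 'n) measure))"
 define R where "R m = (l ^ ?d - (l - \<epsilon> m) ^ ?d) / \<epsilon> m" for m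
 have Rlim: "R \<longlonglongrightarrow> real ?d * l ^ (?d - 1)"
 proof -
  have "((\<lambda>x. x ^ ?d) has_real_derivative real ?d * l ^ (?d - 1)) (at l)"
   using DERIV_pow[of ?d l] by simp
  then have "(\<lambda>t. ((l + t) ^ ?d - l ^ ?d) / t) \<midarrow>0\<rightarrow> real ?d * l ^ (?d - 1)" unfolding DERIV_def .
  moreover have "filterlim (\<lambda>m. - \<epsilon> m) (at 0) sequentially"
   using tendsto_minus[OF \<epsilon>0] \<epsilon>(1) by (intro filterlim_atI) (auto simp: less_imp_neq[symmetric] intro!: always_eventually dest: less_imp_neq)
  ultimately have "(\<lambda>m. ((l + - \<epsilon> m) ^ ?d - l ^ ?d) / - \<epsilon> m) \<longlonglongrightarrow> real ?d * l ^ (?d - 1)"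
   by (rule filterlim_compose)
  moreover have "((l + - \<epsilon> m) ^ ?d - l ^ ?d) / - \<epsilon> m = R m" for m
   unfolding R_def minus_divide_left[symmetric] minus_divide_right[symmetric] by (simp add: minus_divide_left)
  ultimately show ?thesis by simp
 qed
 have lim2: "(\<lambda>m. (\<integral>x. ?S m x * (x $ k / norm x) * w x \<partial>lborel) / \<epsilon> m) \<longlonglongrightarrow> real ?d * l ^ (?d - 1) * I"
 proof -
  \<comment> \<open>On a thin shell \<open>w\<close> is compared with its value at the radial
    projection onto the outer sphere; uniform continuity makes the difference at most \<eta>, and
    the volume of the shell divided by its width stays bounded by K V.\<close>
  have err: "(\<lambda>m. (\<integral>x. ?S m x * (x $ k / norm x) * w x \<partial>lborel) / \<epsilon> m - R m * I) \<longlonglongrightarrow> 0"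
  proof (rule LIMSEQ_I)
   fix e :: real assume "0 < e"
   have V0: "0 \<le> V" by (simp add: V_def)
   define K where "K = real ?d * l ^ (?d - 1) + 1"
   have K: "0 < K" using l by (simp add: K_def add_nonneg_pos)
   define \<eta> where "\<eta> = e / (2 * (K * V + 1))"
   have \<eta>: "0 < \<eta>" "K * V * \<eta> < e"
   proof -
    have KV: "0 \<le> K * V" using K V0 by simp
    have "0 < e / (2 * (A + 1)) \<and> A * (e / (2 * (A + 1))) < e" if "0 \<le> A" for A
    proof -
     have "0 \<le> A * e" using that \<open>0 < e\<close> by simp
     then have "A * e + e * 2 > 0" "A * e < (2 * (A + 1)) * e" using \<open>0 < e\<close> by (auto simp: algebra_simps intro: add_nonneg_pos)
     then show ?thesis using that \<open>0 < e\<close> by (simp add: divide_less_eq mult.commute)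
    qed
    from this[OF KV] show "0 < \<eta>" "K * V * \<eta> < e" by (simp_all add: \<eta>_def)
   qed
   have "uniformly_continuous_on (cball 0 l) w"
    by (rule compact_uniformly_continuous[OF continuous_on_subset[OF w]]) auto
   then obtain \<delta> where \<delta>: "0 < \<delta>" "\<And>x y. x \<in> cball 0 l \<Longrightarrow> y \<in> cball 0 l \<Longrightarrow> dist y x < \<delta> \<Longrightarrow> dist (w y) (w x) < \<eta>"
    using \<eta>(1) unfolding uniformly_continuous_on_def by metis
   have "\<forall>\<^sub>F m in sequentially. R m < K"
    by (rule order_tendstoD(2)[OF Rlim]) (simp add: K_def)
   moreover have "\<forall>\<^sub>F m in sequentially. \<epsilon> m < \<delta>" by (rule order_tendstoD(2)[OF \<epsilon>0 \<delta>(1)])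
   ultimately have "\<forall>\<^sub>F m in sequentially. norm ((\<integral>x. ?S m x * (x $ k / norm x) * w x \<partial>lborel) / \<epsilon> m - R m * I - 0) < e"
   proof eventually_elim
    case (elim m)
    have pt: "\<bar>?S m x * (x $ k / norm x) * w x - ?S m x * G (x /\<^sub>R norm x)\<bar> \<le> \<eta> * ?S m x" for x
    proof (cases "x \<in> ball 0 l - ball 0 (l - \<epsilon> m)")
     case True
     then have x: "norm x < l" "l - \<epsilon> m \<le> norm x" by auto
     then have x0: "x \<noteq> 0" using \<epsilon>[of m] by auto
     have "l *\<^sub>R (x /\<^sub>R norm x) - x = ((l - norm x) / norm x) *\<^sub>R x"
      using x0 by (simp add: algebra_simps divide_inverse)
     then have "dist (l *\<^sub>R (x /\<^sub>R norm x)) x = l - norm x" using x x0 by (simp add: dist_norm)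
     then have "dist (w (l *\<^sub>R (x /\<^sub>R norm x))) (w x) < \<eta>"
      using x elim l x0 by (intro \<delta>(2)) auto
     then have "\<bar>w x - w (l *\<^sub>R (x /\<^sub>R norm x))\<bar> \<le> \<eta>" by (simp add: dist_real_def)
     moreover have "\<bar>x $ k / norm x\<bar> \<le> 1" using component_le_norm_cart[of x k] by (simp add: divide_le_eq_1 abs_divide)
     ultimately have "\<bar>x $ k / norm x\<bar> * \<bar>w x - w (l *\<^sub>R (x /\<^sub>R norm x))\<bar> \<le> 1 * \<eta>" by (intro mult_mono) auto
     moreover have "(x $ k / norm x) * w x - G (x /\<^sub>R norm x) = (x $ k / norm x) * (w x - w (l *\<^sub>R (x /\<^sub>R norm x)))"
      by (simp add: G_def divide_inverse algebra_simps)
     ultimately show ?thesis using True by (simp add: abs_mult)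
    qed simp
    have "(\<integral>x. ?S m x * (x $ k / norm x) * w x \<partial>lborel) / \<epsilon> m - R m * I
      = (\<integral>x. ?S m x * (x $ k / norm x) * w x - ?S m x * G (x /\<^sub>R norm x) \<partial>lborel) / \<epsilon> m"
    proof -
     have "integrable lborel (\<lambda>x. (?S m x * (x $ k / norm x) * w x - ?S m x * G (x /\<^sub>R norm x)) + ?S m x * G (x /\<^sub>R norm x))"
      by (intro L1_add shell_int
         integrable_boundI[OF integrable_mult_right[OF shell_vol_int[of m], of \<eta>]] pt) measurable
     then have "integrable lborel (\<lambda>x. ?S m x * (x $ k / norm x) * w x)" by simp
     then show ?thesis using shell[of m] shell_int[of m]
      by (simp add: R_def) (simp add: diff_divide_distrib[symmetric])
    qed
    also have "\<bar>\<dots>\<bar> \<le> (\<integral>x. \<eta> * ?S m x \<partial>lborel) / \<epsilon> m"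
    proof -
     have "\<bar>\<integral>x. ?S m x * (x $ k / norm x) * w x - ?S m x * G (x /\<^sub>R norm x) \<partial>lborel\<bar> \<le> (\<integral>x. \<eta> * ?S m x \<partial>lborel)"
      by (rule order_trans[OF integral_abs_bound integral_mono])
        (use pt shell_vol_int[of m] in \<open>auto intro!: integrable_abs integrable_boundI[OF integrable_mult_right[OF shell_vol_int[of m], of \<eta>]]\<close>)
     then show ?thesis using \<epsilon>[of m] by (simp add: divide_right_mono)
    qed
    also have "\<dots> = \<eta> * (R m * V)" using shell_vol[of m] by (simp add: V_def R_def)
    also have "\<dots> \<le> \<eta> * (K * V)" using elim V0 \<eta> by (intro mult_left_mono mult_right_mono) auto
    also have "\<dots> < e" using \<eta> by (simp add: mult.commute)
    finally show ?case by simp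
   qed
   then show "\<exists>no. \<forall>m\<ge>no. norm ((\<integral>x. ?S m x * (x $ k / norm x) * w x \<partial>lborel) / \<epsilon> m - R m * I - 0) < e"
    by (simp add: eventually_sequentially)
  qed
  from tendsto_add[OF this tendsto_mult_right[OF Rlim, of I]]
  show ?thesis by simp
 qed
 have "(\<integral>x. indicator (ball 0 l) x * D x \<partial>lborel) = real ?d * l ^ (?d - 1) * I"
  by (rule LIMSEQ_unique[OF lim1]) (use lim2 in \<open>simp add: cutoff_divergence[OF w D der \<epsilon>]\<close>)
 then show ?thesis using integral_sphere_measure[of G] by (simp add: G_def I_def)
qed

section \<open>Trigonometric polynomials\<close>

text \<open>The algebra generated by the coordinate sines and cosines. Given by rules so that
  periodicity, boundedness, smoothness and separation of variables are rule inductions, with no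
  Fourier coefficients.\<close>

inductive trig :: "(real ^ 'n \<Rightarrow> real) \<Rightarrow> bool" where
 const: "trig (\<lambda>x. c)"
| cos: "trig (\<lambda>x. cos (2 * pi * x $ i))"
| sin: "trig (\<lambda>x. sin (2 * pi * x $ i))"
| add: "trig f \<Longrightarrow> trig g \<Longrightarrow> trig (\<lambda>x. f x + g x)"
| mult: "trig f \<Longrightarrow> trig g \<Longrightarrow> trig (\<lambda>x. f x * g x)"

lemma trig_cmult: "trig f \<Longrightarrow> trig (\<lambda>x. c * f x)"
 by (rule trig.mult[OF trig.const])

lemma trig_uminus: "trig f \<Longrightarrow> trig (\<lambda>x. - f x)"
 using trig_cmult[of f "- 1"] by simp

lemma trig_diff: "trig f \<Longrightarrow> trig g \<Longrightarrow> trig (\<lambda>x. f x - g x)"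
 using trig.add[OF _ trig_uminus, of f g] by simp

lemma trig_sum: "(\<And>k. k \<in> K \<Longrightarrow> trig (f k)) \<Longrightarrow> trig (\<lambda>x. \<Sum>k\<in>K. f k x)"
proof (induction K rule: infinite_finite_induct)
 case (insert k K)
 then have "trig (\<lambda>x. f k x + (\<Sum>k\<in>K. f k x))" by (intro trig.add) auto
 then show ?case using insert by simp
qed (auto intro: trig.const)

lemma trig_power: "trig f \<Longrightarrow> trig (\<lambda>x. f x ^ N)"
 by (induction N) (auto intro: trig.const trig.mult)

lemma sum_axis: "(\<Sum>j\<in>UNIV. f j * axis k c $ j) = f k * (c :: real)"
 by (simp add: axis_def if_distrib[of "\<lambda>a. _ * a"] cong: if_cong)

text \<open>Stated with some coefficients \<open>D\<close>, since the induction has to produce them;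
  only afterwards are they identified with the partial derivatives \<open>pd\<close>.\<close>

lemma trig_has_derivative:
 assumes "trig f"
 shows "\<exists>D. (\<forall>k. trig (D k)) \<and> (\<forall>x. (f has_derivative (\<lambda>h. \<Sum>k\<in>UNIV. D k x * h $ k)) (at x))"
 using assms
proof induction
 case (const c)
 show ?case by (rule exI[of _ "\<lambda>k x. 0"]) (auto intro: trig.const)
next
 case (cos i)
 show ?case
 proof (intro exI[of _ "\<lambda>k x. if k = i then - 2 * pi * sin (2 * pi * x $ i) else 0"] conjI allI)
  show "trig (\<lambda>x. if k = i then - 2 * pi * sin (2 * pi * x $ i) else 0)" for k
   by (cases "k = i") (auto intro: trig.const trig_uminus trig_cmult[OF trig.sin, of "2 * pi", simplified])
  show "((\<lambda>x. cos (2 * pi * x $ i)) has_derivative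
    (\<lambda>h. \<Sum>k\<in>UNIV. (if k = i then - 2 * pi * sin (2 * pi * x $ i) else 0) * h $ k)) (at x)" for x
   by (auto intro!: derivative_eq_intros bounded_linear.has_derivative[OF bounded_linear_vec_nth]
      simp: if_distrib[of "\<lambda>a. a * _"] cong: if_cong)
 qed
next
 case (sin i)
 show ?case
 proof (intro exI[of _ "\<lambda>k x. if k = i then 2 * pi * cos (2 * pi * x $ i) else 0"] conjI allI)
  show "trig (\<lambda>x. if k = i then 2 * pi * cos (2 * pi * x $ i) else 0)" for k
   by (cases "k = i") (auto intro: trig.const trig_cmult[OF trig.cos])
  show "((\<lambda>x. sin (2 * pi * x $ i)) has_derivative
    (\<lambda>h. \<Sum>k\<in>UNIV. (if k = i then 2 * pi * cos (2 * pi * x $ i) else 0) * h $ k)) (at x)" for x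
   by (auto intro!: derivative_eq_intros bounded_linear.has_derivative[OF bounded_linear_vec_nth]
      simp: if_distrib[of "\<lambda>a. a * _"] cong: if_cong)
 qed
next
 case (add f g)
 obtain D E where D: "\<And>k. trig (D k)" "\<And>x. (f has_derivative (\<lambda>h. \<Sum>k\<in>UNIV. D k x * h $ k)) (at x)"
  and E: "\<And>k. trig (E k)" "\<And>x. (g has_derivative (\<lambda>h. \<Sum>k\<in>UNIV. E k x * h $ k)) (at x)"
  using add.IH by blast
 show ?case
 proof (intro exI[of _ "\<lambda>k x. D k x + E k x"] conjI allI)
  show "trig (\<lambda>x. D k x + E k x)" for k by (intro trig.add D E)
  show "((\<lambda>x. f x + g x) has_derivative (\<lambda>h. \<Sum>k\<in>UNIV. (D k x + E k x) * h $ k)) (at x)" for x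
   by (rule has_derivative_eq_rhs[OF has_derivative_add[OF D(2) E(2)]])
     (simp add: fun_eq_iff sum.distrib distrib_right)
 qed
next
 case (mult f g)
 obtain D E where D: "\<And>k. trig (D k)" "\<And>x. (f has_derivative (\<lambda>h. \<Sum>k\<in>UNIV. D k x * h $ k)) (at x)"
  and E: "\<And>k. trig (E k)" "\<And>x. (g has_derivative (\<lambda>h. \<Sum>k\<in>UNIV. E k x * h $ k)) (at x)"
  using mult.IH by blast
 show ?case
 proof (intro exI[of _ "\<lambda>k x. f x * E k x + D k x * g x"] conjI allI)
  show "trig (\<lambda>x. f x * E k x + D k x * g x)" for k by (intro trig.add trig.mult D E mult.hyps)
  show "((\<lambda>x. f x * g x) has_derivative (\<lambda>h. \<Sum>k\<in>UNIV. (f x * E k x + D k x * g x) * h $ k)) (at x)" for x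
   by (rule has_derivative_eq_rhs[OF has_derivative_mult[OF D(2) E(2)]])
     (auto simp: fun_eq_iff sum_distrib_left sum_distrib_right algebra_simps simp flip: sum.distrib)
 qed
qed

lemma trig_pd:
 fixes f :: "real ^ 'n \<Rightarrow> real"
 assumes "trig f"
 shows "trig (pd (axis k 1) f)"
  and "(f has_derivative (\<lambda>h. \<Sum>k\<in>UNIV. pd (axis k 1) f x * h $ k)) (at x)"
  and "f differentiable (at x)"
  and "((\<lambda>t. f (x + t *\<^sub>R axis k 1)) has_real_derivative pd (axis k 1) f x) (at 0)"
proof -
 obtain D where D: "\<And>k. trig (D k)" "\<And>x. (f has_derivative (\<lambda>h. \<Sum>k\<in>UNIV. D k x * h $ k)) (at x)"
  using trig_has_derivative[OF assms] by blast
 have eq: "pd (axis k 1) f x = D k x" for k x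
  by (simp add: pd_def sum_axis flip: frechet_derivative_at[OF D(2)])
 then have "pd (axis k 1) f = D k" for k by (simp add: fun_eq_iff)
 then show "trig (pd (axis k 1) f)"
  and "(f has_derivative (\<lambda>h. \<Sum>k\<in>UNIV. pd (axis k 1) f x * h $ k)) (at x)"
  using D by simp_all
 show "f differentiable (at x)" using D(2) by (auto simp: differentiable_def)
 have "((\<lambda>t. f (x + t *\<^sub>R axis k 1)) has_derivative (\<lambda>t. \<Sum>j\<in>UNIV. D j x * (t *\<^sub>R axis k 1) $ j)) (at 0)"
  by (rule has_derivative_compose[of "\<lambda>t. x + t *\<^sub>R axis k 1" _ _ _ f, simplified])
    (auto intro!: derivative_eq_intros D)
 then show "((\<lambda>t. f (x + t *\<^sub>R axis k 1)) has_real_derivative pd (axis k 1) f x) (at 0)"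
  unfolding has_field_derivative_def
  by (rule has_derivative_eq_rhs)
    (simp add: fun_eq_iff eq sum_axis mult.left_commute[of "D _ _"] flip: sum_distrib_left)
qed

lemma pd_eqI:
 assumes "(f has_derivative f') (at x)" shows "pd e f x = f' e"
 using frechet_derivative_at[OF assms] by (simp add: pd_def)

lemma trig_Ck: "trig f \<Longrightarrow> Ck n f"
proof (induction n arbitrary: f)
 case 0
 then show ?case using trig_pd(3)[OF 0]
  by (auto intro!: continuous_at_imp_continuous_on differentiable_imp_continuous_within)
next
 case (Suc n)
 then show ?case using trig_pd(1,3)[OF Suc.prems] by (auto simp: Basis_vec_def)
qed

lemma trig_smooth: "trig f \<Longrightarrow> smooth f"
 by (simp add: smooth_def trig_Ck)

lemma trig_continuous: "trig f \<Longrightarrow> continuous_on UNIV f"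
 using trig_Ck[of f 0] by simp

lemma trig_borel: "trig f \<Longrightarrow> f \<in> borel_measurable borel"
 by (rule continuous_borel[OF trig_continuous])

lemma trig_periodic: "trig f \<Longrightarrow> periodic f"
proof (induction rule: trig.induct)
 case (cos i)
 have "cos (2 * pi * (x $ i + 1)) = cos (2 * pi * x $ i)" for x :: "real ^ 'a"
  using cos_periodic[of "2 * pi * x $ i"] by (simp add: algebra_simps)
 then show ?case by (auto simp: periodic_def axis_def)
next
 case (sin i)
 have "sin (2 * pi * (x $ i + 1)) = sin (2 * pi * x $ i)" for x :: "real ^ 'a"
  using sin_periodic[of "2 * pi * x $ i"] by (simp add: algebra_simps)
 then show ?case by (auto simp: periodic_def axis_def)
qed (auto simp: periodic_def)

lemma trig_bounded: "trig f \<Longrightarrow> \<exists>B. \<forall>x. \<bar>f x\<bar> \<le> B"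
proof (induction rule: trig.induct)
 case (add f g)
 then obtain A B where AB: "\<And>x. \<bar>f x\<bar> \<le> A" "\<And>x. \<bar>g x\<bar> \<le> B" by blast
 have "\<bar>f x + g x\<bar> \<le> A + B" for x using AB(1)[of x] AB(2)[of x] by linarith
 then show ?case by blast
next
 case (mult f g)
 then obtain A B where AB: "\<And>x. \<bar>f x\<bar> \<le> A" "\<And>x. \<bar>g x\<bar> \<le> B" by blast
 have "\<bar>f x * g x\<bar> \<le> A * B" for x
  using mult_mono[OF AB(1)[of x] AB(2)[of x]] AB(1)[of x] by (simp add: abs_mult)
 then show ?case by blast
qed (auto intro: exI[of _ 1])

lemma trig_reflect: "trig f \<Longrightarrow> trig (\<lambda>y. f (x - y))"
proof (induction rule: trig.induct)
 case (cos i)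
 have "trig (\<lambda>y. cos (2 * pi * x $ i) * cos (2 * pi * y $ i) + sin (2 * pi * x $ i) * sin (2 * pi * y $ i))"
  by (intro trig.add trig_cmult trig.cos trig.sin)
 then show ?case by (simp add: right_diff_distrib cos_diff)
next
 case (sin i)
 have "trig (\<lambda>y. sin (2 * pi * x $ i) * cos (2 * pi * y $ i) - cos (2 * pi * x $ i) * sin (2 * pi * y $ i))"
  by (intro trig_diff trig_cmult trig.cos trig.sin)
 then show ?case by (simp add: right_diff_distrib sin_diff)
qed (auto intro: trig.intros)

lemma pd_reflect:
 fixes f :: "real ^ 'n \<Rightarrow> real"
 assumes "trig f"
 shows "pd (axis k 1) (\<lambda>y. f (x - y)) y = - pd (axis k 1) f (x - y)"
proof -
 have "((\<lambda>y. f (x - y)) has_derivative (\<lambda>h. \<Sum>k\<in>UNIV. pd (axis k 1) f (x - y) * (- h) $ k)) (at y)"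
  by (rule has_derivative_compose[of "\<lambda>y. x - y" _ _ _ f, simplified])
    (auto intro!: derivative_eq_intros trig_pd(2)[OF assms])
 from pd_eqI[OF this, of "axis k 1"] show ?thesis
  by (simp add: sum_negf sum_axis)
qed

text \<open>Separation of variables in the convolution kernel \<open>f (x - y)\<close>.\<close>

inductive separable :: "(real ^ 'n \<Rightarrow> real ^ 'n \<Rightarrow> real) \<Rightarrow> bool" where
 tensor: "trig g \<Longrightarrow> trig h \<Longrightarrow> separable (\<lambda>x y. g x * h y)"
| plus: "separable F \<Longrightarrow> separable G \<Longrightarrow> separable (\<lambda>x y. F x y + G x y)"

lemma separable_mult: "separable F \<Longrightarrow> separable G \<Longrightarrow> separable (\<lambda>x y. F x y * G x y)"
proof (induction arbitrary: G rule: separable.induct)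
 case (tensor g h)
 from \<open>separable G\<close> tensor.hyps show ?case
 proof (induction rule: separable.induct)
  case (tensor g' h')
  have "separable (\<lambda>x y. (g x * g' x) * (h y * h' y))"
   by (intro separable.tensor trig.mult tensor)
  then show ?case by (simp add: mult_ac)
 next
  case (plus F G)
  then have "separable (\<lambda>x y. g x * h y * F x y + g x * h y * G x y)" by (intro separable.plus)
  then show ?case by (simp add: distrib_left)
 qed
next
 case (plus F F')
 then have "separable (\<lambda>x y. F x y * G x y + F' x y * G x y)" by (intro separable.plus)
 then show ?case by (simp add: distrib_right)
qed

lemma trig_separable: "trig f \<Longrightarrow> separable (\<lambda>x y. f (x - y))"
proof (induction rule: trig.induct)
 case (const c)
 show ?case using separable.tensor[OF trig.const[of c] trig.const[of 1]] by simp
next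
 case (cos i)
 have "separable (\<lambda>x y. cos (2 * pi * x $ i) * cos (2 * pi * y $ i) + sin (2 * pi * x $ i) * sin (2 * pi * y $ i))"
  by (intro separable.intros trig.cos trig.sin)
 then show ?case by (simp add: right_diff_distrib cos_diff)
next
 case (sin i)
 have "separable (\<lambda>x y. sin (2 * pi * x $ i) * cos (2 * pi * y $ i) + (- cos (2 * pi * x $ i)) * sin (2 * pi * y $ i))"
  by (intro separable.intros trig_uminus trig.cos trig.sin)
 then show ?case by (simp add: right_diff_distrib sin_diff)
qed (auto intro: separable.plus separable_mult)

lemma separable_sum:
 "separable F \<Longrightarrow> \<exists>n g h. (\<forall>k<n::nat. trig (g k) \<and> trig (h k)) \<and> (\<forall>x y. F x y = (\<Sum>k<n. g k x * h k y))"
proof (induction rule: separable.induct)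
 case (tensor g h)
 then show ?case by (intro exI[of _ 1] exI[of _ "\<lambda>_. g"] exI[of _ "\<lambda>_. h"]) auto
next
 case (plus F G)
 from plus.IH(1) obtain n g h where gh: "\<forall>k<n::nat. trig (g k) \<and> trig (h k)" "\<forall>x y. F x y = (\<Sum>k<n. g k x * h k y)" by blast
 from plus.IH(2) obtain m g' h' where gh': "\<forall>k<m::nat. trig (g' k) \<and> trig (h' k)" "\<forall>x y. G x y = (\<Sum>k<m. g' k x * h' k y)" by blast
 let ?g = "\<lambda>k. if k < n then g k else g' (k - n)" and ?h = "\<lambda>k. if k < n then h k else h' (k - n)"
 have "(\<Sum>k<n + m. ?g k x * ?h k y) = (\<Sum>k<n. g k x * h k y) + (\<Sum>k<m. g' k x * h' k y)" for x y
 proof -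
  have "(\<Sum>k<n + m. ?g k x * ?h k y) = (\<Sum>k<n. ?g k x * ?h k y) + (\<Sum>k=n..<n + m. ?g k x * ?h k y)"
   using sum.atLeastLessThan_concat[of 0 n "n + m" "\<lambda>k. ?g k x * ?h k y"] by (simp add: atLeast0LessThan)
  also have "(\<Sum>k=n..<n + m. ?g k x * ?h k y) = (\<Sum>k<m. g' k x * h' k y)"
   using sum.shift_bounds_nat_ivl[of "\<lambda>k. ?g k x * ?h k y" 0 n m] by (simp add: atLeast0LessThan add.commute)
  finally show ?thesis by simp
 qed
 then show ?case using gh gh'
  by (intro exI[of _ "n + m"] exI[of _ ?g] exI[of _ ?h]) auto
qed

subsection \<open>An approximate identity\<close>

definition bump :: "real ^ 'n \<Rightarrow> real" where
 "bump y = (\<Sum>i\<in>UNIV. 1 + cos (2 * pi * y $ i)) / (2 * real CARD('n))"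

text \<open>Not the classical Fejer kernel: normalised powers of a trigonometric polynomial with
  values in [0, 1] that equals 1 exactly at lattice points. Powers concentrate there, and no
  explicit Fourier sums are needed.\<close>

definition fejer :: "nat \<Rightarrow> real ^ 'n \<Rightarrow> real" where
 "fejer N y = bump y ^ N / (\<integral>x. bump x ^ N \<partial>(torus :: (real ^ 'n) measure))"

lemma trig_bump: "trig bump"
proof -
 have "trig (\<lambda>y :: real ^ 'n. (1 / (2 * real CARD('n))) * (\<Sum>i\<in>UNIV. 1 + cos (2 * pi * y $ i)))"
  by (intro trig_cmult trig_sum trig.add trig.const trig.cos)
 then show ?thesis by (simp add: bump_def[abs_def])
qed

lemma bump_bounds: "0 \<le> bump y" "bump y \<le> 1"
proof -
 have "0 \<le> (\<Sum>i\<in>(UNIV :: 'a set). 1 + cos (2 * pi * y $ i))"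
  by (intro sum_nonneg) (use cos_ge_minus_one in \<open>smt (verit)\<close>)
 then show "0 \<le> bump y" by (simp add: bump_def)
 have "(\<Sum>i\<in>(UNIV :: 'a set). 1 + cos (2 * pi * y $ i)) \<le> (\<Sum>i\<in>(UNIV :: 'a set). 2)"
  by (intro sum_mono) (use cos_le_one in \<open>smt (verit)\<close>)
 then show "bump y \<le> 1" by (simp add: bump_def divide_le_eq)
qed

lemma bump_eq_1_lattice:
 assumes "bump (y :: real ^ 'n) = 1" shows "y \<in> lattice"
proof -
 have "(\<Sum>i\<in>(UNIV :: 'n set). 1 - cos (2 * pi * y $ i)) = 0"
  using assms by (simp add: bump_def sum_subtractf sum.distrib field_simps)
 then have "1 - cos (2 * pi * y $ i) = 0" for i
  by (subst (asm) sum_nonneg_eq_0_iff) auto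
 then have "cos (2 * pi * y $ i) = 1" for i by (metis eq_iff_diff_eq_0)
 then have "\<exists>n::int. 2 * pi * y $ i = of_int n * 2 * pi" for i
  by (simp add: cos_one_2pi_int)
 then have "\<exists>n::int. y $ i = of_int n" for i
  by (simp add: mult.commute[of _ pi] mult.left_commute)
 then show ?thesis by (auto simp: lattice_def Ints_def)
qed

lemma trig_integrable: "trig f \<Longrightarrow> integrable torus f"
 using trig_bounded[of f]
 by (auto intro!: torus.integrable_const_bound borel_measurable_torus trig_borel AE_I2)

lemma cube_measure:
 assumes s: "0 < s" "s < 1"
 shows "measure torus (cbox 0 (\<chi> i. s) :: (real ^ 'n) set) = s ^ CARD('n)"
proof -
 have sub: "cbox 0 (\<chi> i. s) \<subseteq> (cell :: (real ^ 'n) set)"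
  using s by (auto simp: mem_box_cart cell_def) (meson le_less_trans)
 have "measure torus (cbox 0 (\<chi> i. s) :: (real ^ 'n) set) = measure lborel (cbox 0 (\<chi> i. s) :: (real ^ 'n) set)"
  unfolding torus_cell by (rule measure_restrict_space) (use sub in auto)
 also have "\<dots> = s ^ CARD('n)"
 proof -
  have b: "(\<chi> i. s) \<bullet> b = s" if "b \<in> Basis" for b :: "real ^ 'n"
   using that by (auto simp: Basis_vec_def inner_axis)
  show ?thesis using s by (simp add: measure_lborel_cbox_eq b DIM_cart)
 qed
 finally show ?thesis .
qed

text \<open>On a small cube at the origin the bump exceeds \<open>q\<close>. This lower rate beats
  the decay r^N, with r < q, of the powers away from the lattice.\<close>

lemma bump_power_integral_lower:
 assumes "q < 1" "0 \<le> q"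
 shows "\<exists>c>0. \<forall>N. c * q ^ N \<le> (\<integral>x. bump x ^ N \<partial>(torus :: (real ^ 'n) measure))"
proof -
 have "continuous (at (0 :: real ^ 'n)) bump"
  using trig_continuous[OF trig_bump] continuous_on_eq_continuous_at[OF open_UNIV] by blast
 moreover have "bump (0 :: real ^ 'n) = 1" by (simp add: bump_def)
 ultimately have "\<forall>\<^sub>F y in nhds (0 :: real ^ 'n). q < bump y"
  using assms by (auto simp: continuous_at eventually_nhds_conv_at dest!: order_tendstoD(1)[where a=q])
 then obtain d where d: "0 < d" "\<And>y :: real ^ 'n. norm y < d \<Longrightarrow> q < bump y"
  by (auto simp: eventually_nhds_metric)
 \<comment> \<open>The sum of the coordinates bounds the norm on the cube by d / 2, so the cube lies
   where \<open>bump\<close> exceeds \<open>q\<close>; side at most 1 / 2 keeps it inside the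
   cell.\<close>
 define s where "s = min (1 / 2) (d / (2 * real CARD('n)))"
 have s: "0 < s" "s < 1" using d by (auto simp: s_def)
 have near: "q \<le> bump y" if "y \<in> cbox 0 (\<chi> i. s)" for y :: "real ^ 'n"
 proof -
  have "norm y \<le> (\<Sum>i\<in>UNIV. \<bar>y $ i\<bar>)" by (rule norm_le_l1_cart)
  also have "\<dots> \<le> (\<Sum>i\<in>(UNIV :: 'n set). d / (2 * real CARD('n)))"
   using that by (intro sum_mono) (auto simp: mem_box_cart s_def)
  also have "\<dots> < d" using d by simp
  finally show ?thesis using d(2)[of y] by simp
 qed
 have [measurable]: "bump \<in> borel_measurable (torus :: (real ^ 'n) measure)"
  by (intro borel_measurable_torus trig_borel trig_bump)
 have sets: "cbox 0 (\<chi> i. s) \<in> sets (torus :: (real ^ 'n) measure)"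
  using s unfolding torus_cell
  by (subst sets_restrict_space_iff) (auto simp: mem_box_cart cell_def, meson le_less_trans)
 show ?thesis
 proof (intro exI[of _ "s ^ CARD('n)"] conjI allI)
  show "0 < s ^ CARD('n)" using s by simp
  fix N
  have "s ^ CARD('n) * q ^ N = (\<integral>x. q ^ N * indicator (cbox 0 (\<chi> i. s)) x \<partial>(torus :: (real ^ 'n) measure))"
   using sets cube_measure[OF s, where 'n='n] by simp
  also have "\<dots> \<le> (\<integral>x. bump x ^ N \<partial>(torus :: (real ^ 'n) measure))"
  proof (rule integral_mono)
   show "integrable torus (\<lambda>x :: real ^ 'n. bump x ^ N)" by (intro trig_integrable trig_power trig_bump)
   show "integrable torus (\<lambda>x :: real ^ 'n. q ^ N * indicator (cbox 0 (\<chi> i. s)) x)"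
    using sets by (intro integrable_mult_right integrable_real_indicator) (auto simp: torus.emeasure_finite less_top[symmetric])
   show "q ^ N * indicator (cbox 0 (\<chi> i. s)) x \<le> bump x ^ N" for x :: "real ^ 'n"
    using near[of x] assms bump_bounds(1)[of x] by (auto split: split_indicator intro: power_mono)
  qed
  finally show "s ^ CARD('n) * q ^ N \<le> (\<integral>x. bump x ^ N \<partial>(torus :: (real ^ 'n) measure))" .
 qed
qed

lemma bump_power_integral_pos: "0 < (\<integral>x. bump x ^ N \<partial>(torus :: (real ^ 'n) measure))"
proof -
 obtain c where c: "0 < c" "\<forall>N. c * (1 / 2) ^ N \<le> (\<integral>x. bump x ^ N \<partial>(torus :: (real ^ 'n) measure))"
  using bump_power_integral_lower[of "1 / 2", where 'n='n] by auto
 have "0 < c * (1 / 2) ^ N" using c by simp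
 then show ?thesis using c(2) by (meson less_le_trans)
qed

lemma trig_fejer: "trig (fejer N)"
 unfolding fejer_def[abs_def] divide_inverse by (intro trig.mult trig.const trig_power trig_bump)

lemma fejer_nonneg: "0 \<le> fejer N (y :: real ^ 'n)"
 using bump_power_integral_pos[of N, where 'n='n] bump_bounds(1)[of y] by (simp add: fejer_def)

lemma fejer_even: "fejer N (- y) = fejer N y"
 by (simp add: fejer_def bump_def)

lemma fejer_integral: "(\<integral>y. fejer N y \<partial>(torus :: (real ^ 'n) measure)) = 1"
 using bump_power_integral_pos[of N, where 'n='n] by (simp add: fejer_def)

lemma periodic_continuous_bounded:
 fixes E :: "real ^ 'n \<Rightarrow> real"
 assumes "continuous_on UNIV E" "periodic E"
 shows "\<exists>B. \<forall>y. \<bar>E y\<bar> \<le> B"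
proof -
 have "bounded (E ` cball 0 (real CARD('n)))"
  by (intro compact_imp_bounded compact_continuous_image continuous_on_subset[OF assms(1)]) auto
 then obtain B where "\<forall>y\<in>E ` cball 0 (real CARD('n)). norm y \<le> B" unfolding bounded_iff by blast
 then have "\<bar>E (vfrac y)\<bar> \<le> B" for y using norm_cell[OF vfrac_cell[of y]] by auto
 then show ?thesis using periodic_vfrac[OF assms(2)] by auto
qed

lemma fejer_average:
 fixes E :: "real ^ 'n \<Rightarrow> real"
 assumes E: "continuous_on UNIV E" "periodic E"
 shows "(\<integral>y. fejer N (y - z) * E y \<partial>torus) = (\<integral>y. fejer N y * E (y + z) \<partial>torus)"
  and "integrable torus (\<lambda>y. fejer N (y - z) * E y)"
  and "(\<And>y. \<bar>E y\<bar> \<le> B) \<Longrightarrow> \<bar>\<integral>y. fejer N (y - z) * E y \<partial>torus\<bar> \<le> B"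
proof -
 note [measurable] = trig_borel[OF trig_fejer] continuous_borel[OF E(1)]
 have p: "periodic (\<lambda>y. fejer N (y - z) * E y)"
  by (intro periodic_compose2[where f="(*)"] periodic_shift' trig_periodic trig_fejer E)
 show eq: "(\<integral>y. fejer N (y - z) * E y \<partial>torus) = (\<integral>y. fejer N y * E (y + z) \<partial>torus)"
  using integral_torus_shift(1)[OF _ p, of z] by simp
 obtain B' where B': "\<And>y. \<bar>E y\<bar> \<le> B'" using periodic_continuous_bounded[OF E] by blast
 have i: "integrable torus (\<lambda>y. fejer N y * E (y + z))"
 proof (rule integrable_boundI[where g="\<lambda>y. B' * fejer N y"])
  show "\<bar>fejer N y * E (y + z)\<bar> \<le> B' * fejer N y" for y
   using mult_left_mono[OF B'[of "y + z"] fejer_nonneg[of N y]] fejer_nonneg[of N y] by (simp add: abs_mult mult.commute)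
 qed (auto intro!: trig_integrable trig_fejer borel_measurable_torus)
 show "integrable torus (\<lambda>y. fejer N (y - z) * E y)"
  using integral_torus_shift(2)[OF _ p, of z] i by simp
 assume B: "\<And>y. \<bar>E y\<bar> \<le> B"
 have "\<bar>\<integral>y. fejer N y * E (y + z) \<partial>torus\<bar> \<le> (\<integral>y. \<bar>fejer N y * E (y + z)\<bar> \<partial>torus)"
  by (rule integral_abs_bound)
 also have "\<dots> \<le> (\<integral>y. B * fejer N y \<partial>(torus :: (real ^ 'n) measure))"
 proof (rule integral_mono)
  show "\<bar>fejer N y * E (y + z)\<bar> \<le> B * fejer N y" for y
   using mult_left_mono[OF B[of "y + z"] fejer_nonneg[of N y]] fejer_nonneg[of N y] by (simp add: abs_mult mult.commute)
 qed (use i in \<open>auto intro!: trig_integrable trig_fejer\<close>)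
 finally show "\<bar>\<integral>y. fejer N (y - z) * E y \<partial>torus\<bar> \<le> B" by (simp add: eq fejer_integral)
qed

text \<open>Where \<open>E\<close> is within e / 2 of its value at \<open>z\<close>, positivity and
  unit mass suffice; elsewhere the normalised power is at most a constant times (r / q)^N.\<close>

lemma fejer_limit:
 fixes E :: "real ^ 'n \<Rightarrow> real"
 assumes E: "continuous_on UNIV E" "periodic E"
 shows "(\<lambda>N. \<integral>y. fejer N (y - z) * E y \<partial>torus) \<longlonglongrightarrow> E z"
proof (rule LIMSEQ_I)
 fix e :: real assume e: "0 < e"
 note [measurable] = trig_borel[OF trig_fejer] continuous_borel[OF E(1)]
 define h where "h y = \<bar>E (y + z) - E z\<bar>" for y
 have hc: "continuous_on UNIV h"
  unfolding h_def by (intro continuous_intros continuous_on_compose2[OF E(1)]) auto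
 have hp: "periodic h" unfolding h_def by (rule periodic_compose[OF periodic_shift[OF E(2)]])
 obtain H where H: "\<And>y. \<bar>h y\<bar> \<le> H" using periodic_continuous_bounded[OF hc hp] by blast
 have H0: "0 \<le> H" using H[of 0] by simp
 \<comment> \<open>This set contains no lattice point, because \<open>h\<close> is periodic and
   vanishes at the origin. By compactness the bump attains a maximum below 1 on it.\<close>
 define S where "S = cball 0 (real CARD('n)) \<inter> {y. e / 2 \<le> h y}"
 have S: "compact S"
 proof -
  have "closed {y. e / 2 \<le> h y}" by (intro closed_Collect_le continuous_intros hc)
  then show ?thesis unfolding S_def by (intro compact_Int_closed) auto
 qed
 have lt: "bump y < 1" if "y \<in> S" for y
 proof -
  have "bump y \<noteq> 1"
  proof
   assume "bump y = 1"
   then have "h (0 + y) = h 0" by (intro periodic_lattice[OF hp] bump_eq_1_lattice)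
   then show False using that e by (simp add: S_def h_def)
  qed
  then show ?thesis using bump_bounds(2)[of y] by simp
 qed
 obtain r where r: "r < 1" "0 \<le> r" "\<And>y. y \<in> S \<Longrightarrow> bump y \<le> r"
 proof (cases "S = {}")
  case True then show ?thesis using that[of 0] by auto
 next
  case False
  then obtain y where "y \<in> S" "\<And>x. x \<in> S \<Longrightarrow> bump x \<le> bump y"
   using continuous_attains_sup[OF S _ continuous_on_subset[OF trig_continuous[OF trig_bump]]] by auto
  then show ?thesis using that[of "bump y"] lt bump_bounds(1)[of y] by auto
 qed
 \<comment> \<open>Any number strictly between \<open>r\<close> and 1 serves.\<close>
 define q where "q = (1 + r) / 2"
 have q: "r < q" "q < 1" "0 < q" using r by (auto simp: q_def)
 obtain c where c: "0 < c" "\<And>N. c * q ^ N \<le> (\<integral>x. bump x ^ N \<partial>(torus :: (real ^ 'n) measure))"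
  using bump_power_integral_lower[of q, where 'n='n] q by auto
 have pt: "fejer N y * h y \<le> e / 2 * fejer N y + H * (r / q) ^ N / c" if "y \<in> cell" for N y
 proof (cases "e / 2 \<le> h y")
  case True
  then have "y \<in> S" using norm_cell[OF that] by (simp add: S_def)
  then have "fejer N y \<le> r ^ N / (c * q ^ N)"
   unfolding fejer_def using r c q bump_bounds(1)[of y] by (intro frac_le power_mono) auto
  then have "fejer N y * h y \<le> (r ^ N / (c * q ^ N)) * H"
   using H[of y] fejer_nonneg[of N y] c q r by (intro mult_mono) (auto simp: h_def)
  also have "\<dots> = H * (r / q) ^ N / c" by (simp add: power_divide mult_ac)
  finally show ?thesis using fejer_nonneg[of N y] e by (smt (verit) mult_nonneg_nonneg half_gt_zero)
 next
  case False
  then have "fejer N y * h y \<le> fejer N y * (e / 2)" using fejer_nonneg[of N y] by (intro mult_left_mono) auto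
  moreover have "0 \<le> H * (r / q) ^ N / c" using H0 r q c by simp
  ultimately show ?thesis by (simp add: mult.commute)
 qed
 have hi: "integrable torus (\<lambda>y. fejer N y * h y)" for N
  using fejer_average(2)[OF hc hp, of N 0] by simp
 have bound: "\<bar>(\<integral>y. fejer N (y - z) * E y \<partial>torus) - E z\<bar> \<le> e / 2 + H * (r / q) ^ N / c" for N
 proof -
  have iE: "integrable torus (\<lambda>y. fejer N y * E (y + z))"
  proof -
   have "continuous_on UNIV (\<lambda>y. E (y + z))" by (intro continuous_on_compose2[OF E(1)] continuous_intros) auto
   from fejer_average(2)[OF this periodic_shift[OF E(2)], of N 0] show ?thesis by simp
  qed
  have iF: "integrable torus (fejer N :: real ^ 'n \<Rightarrow> real)" by (intro trig_integrable trig_fejer)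
  have "(\<integral>y. fejer N (y - z) * E y \<partial>torus) - E z = (\<integral>y. fejer N y * E (y + z) \<partial>torus) - (\<integral>y. fejer N y * E z \<partial>(torus :: (real ^ 'n) measure))"
   by (simp add: fejer_average(1)[OF E] fejer_integral)
  also have "\<dots> = (\<integral>y. fejer N y * (E (y + z) - E z) \<partial>torus)"
   using iE iF by (simp add: algebra_simps)
  also have "\<bar>\<dots>\<bar> \<le> (\<integral>y. \<bar>fejer N y * (E (y + z) - E z)\<bar> \<partial>torus)" by (rule integral_abs_bound)
  also have "\<dots> = (\<integral>y. fejer N y * h y \<partial>torus)" by (simp add: abs_mult h_def abs_of_nonneg[OF fejer_nonneg])
  also have "\<dots> \<le> (\<integral>y. e / 2 * fejer N y + H * (r / q) ^ N / c \<partial>(torus :: (real ^ 'n) measure))"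
   using pt iF hi by (intro integral_mono) (auto simp: space_torus)
  also have "\<dots> = e / 2 + H * (r / q) ^ N / c" using iF by (simp add: fejer_integral torus.prob_space)
  finally show ?thesis .
 qed
 have "(\<lambda>N. H * (r / q) ^ N / c) \<longlonglongrightarrow> H * 0 / c"
  using r q c(1) by (intro tendsto_intros LIMSEQ_power_zero) auto
 then have "\<forall>\<^sub>F N in sequentially. H * (r / q) ^ N / c < e / 2"
  using e by (intro order_tendstoD(2)[where y="H * 0 / c" and a="e / 2"]) auto
 then show "\<exists>no. \<forall>N\<ge>no. norm ((\<integral>y. fejer N (y - z) * E y \<partial>torus) - E z) < e"
  unfolding eventually_sequentially using bound by (smt (verit) field_sum_of_halves real_norm_def)
qed

section \<open>Functionals concentrated on a ball\<close>

text \<open>The first kernel weights the boundary sphere, parametrised by the directions of the points of the unit ball.\<close>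

definition ball_functional :: "real \<Rightarrow> real \<Rightarrow> ((real ^ 'n \<Rightarrow> real) \<Rightarrow> real) \<Rightarrow> bool" where
 "ball_functional l M \<Phi> \<longleftrightarrow>
   (\<exists>\<kappa>1 \<kappa>2. integrable lborel \<kappa>1 \<and> integrable lborel \<kappa>2 \<and> (\<forall>x. l \<le> norm x \<longrightarrow> \<kappa>2 x = 0) \<and>
    (\<integral>x. \<bar>\<kappa>1 x\<bar> \<partial>lborel) + (\<integral>x. \<bar>\<kappa>2 x\<bar> \<partial>lborel) \<le> M \<and>
    (\<forall>E\<in>borel_measurable borel.
      \<Phi> E = (\<integral>x. \<kappa>1 x * E (l *\<^sub>R (x /\<^sub>R norm x)) \<partial>lborel) + (\<integral>x. \<kappa>2 x * E x \<partial>lborel)))"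

lemma unit_vector_borel [measurable]: "(\<lambda>x :: real ^ 'n. l *\<^sub>R (x /\<^sub>R norm x)) \<in> borel_measurable borel"
 by measurable

lemma unit_vector_component_borel [measurable]: "(\<lambda>x :: real ^ 'n. (x /\<^sub>R norm x) $ k) \<in> borel_measurable borel"
 unfolding vector_scaleR_component by measurable

lemma norm_unit_vector: "0 \<le> l \<Longrightarrow> norm (l *\<^sub>R (x /\<^sub>R norm x)) \<le> l"
 by (cases "x = 0") (auto simp: mult.assoc)

lemma weighted_integral_bound:
 fixes \<kappa> E :: "real ^ 'n \<Rightarrow> real"
 assumes \<kappa>: "integrable lborel \<kappa>" and [measurable]: "E \<in> borel_measurable borel"
  and B: "\<And>x. \<kappa> x \<noteq> 0 \<Longrightarrow> \<bar>E x\<bar> \<le> B"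
 shows "integrable lborel (\<lambda>x. \<kappa> x * E x)"
  and "\<bar>\<integral>x. \<kappa> x * E x \<partial>lborel\<bar> \<le> (\<integral>x. \<bar>\<kappa> x\<bar> \<partial>lborel) * B"
proof -
 have [measurable]: "\<kappa> \<in> borel_measurable borel" using borel_measurable_integrable[OF \<kappa>] by simp
 have b: "\<bar>\<kappa> x * E x\<bar> \<le> \<bar>\<kappa> x\<bar> * B" for x
  using B[of x] by (cases "\<kappa> x = 0") (auto simp: abs_mult mult_left_mono)
 have i: "integrable lborel (\<lambda>x. \<bar>\<kappa> x\<bar> * B)" using \<kappa> by simp
 show ii: "integrable lborel (\<lambda>x. \<kappa> x * E x)" by (rule integrable_boundI[OF i]) (use b in auto)
 have "\<bar>\<integral>x. \<kappa> x * E x \<partial>lborel\<bar> \<le> (\<integral>x. \<bar>\<kappa> x * E x\<bar> \<partial>lborel)" by (rule integral_abs_bound)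
 also have "\<dots> \<le> (\<integral>x. \<bar>\<kappa> x\<bar> * B \<partial>lborel)" by (rule integral_mono) (use ii i b in auto)
 finally show "\<bar>\<integral>x. \<kappa> x * E x \<partial>lborel\<bar> \<le> (\<integral>x. \<bar>\<kappa> x\<bar> \<partial>lborel) * B" by simp
qed

text \<open>Only the values on the closed ball count; this is how smallness at scale
  \<open>l\<close> enters all later estimates.\<close>

lemma ball_functional_bound:
 fixes \<Phi> :: "(real ^ 'n \<Rightarrow> real) \<Rightarrow> real"
 assumes \<Phi>: "ball_functional l M \<Phi>" and l: "0 \<le> l" and [measurable]: "E \<in> borel_measurable borel"
  and B: "\<And>x. norm x \<le> l \<Longrightarrow> \<bar>E x\<bar> \<le> B"
 shows "\<bar>\<Phi> E\<bar> \<le> M * B"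
proof -
 obtain \<kappa>1 \<kappa>2 where k: "integrable lborel \<kappa>1" "integrable lborel \<kappa>2" "\<And>x. l \<le> norm x \<Longrightarrow> \<kappa>2 x = 0"
   "(\<integral>x. \<bar>\<kappa>1 x\<bar> \<partial>lborel) + (\<integral>x. \<bar>\<kappa>2 x\<bar> \<partial>lborel) \<le> M"
   "\<Phi> E = (\<integral>x. \<kappa>1 x * E (l *\<^sub>R (x /\<^sub>R norm x)) \<partial>lborel) + (\<integral>x. \<kappa>2 x * E x \<partial>lborel)"
  using \<Phi> assms(3) unfolding ball_functional_def by blast
 have B0: "0 \<le> B" using B[of 0] l by simp
 have "\<bar>\<Phi> E\<bar> \<le> (\<integral>x. \<bar>\<kappa>1 x\<bar> \<partial>lborel) * B + (\<integral>x. \<bar>\<kappa>2 x\<bar> \<partial>lborel) * B"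
  unfolding k(5)
 proof (rule order_trans[OF abs_triangle_ineq add_mono])
  show "\<bar>\<integral>x. \<kappa>1 x * E (l *\<^sub>R (x /\<^sub>R norm x)) \<partial>lborel\<bar> \<le> (\<integral>x. \<bar>\<kappa>1 x\<bar> \<partial>lborel) * B"
   by (rule weighted_integral_bound(2)[OF k(1) _ B[OF norm_unit_vector[OF l]]]) measurable
  show "\<bar>\<integral>x. \<kappa>2 x * E x \<partial>lborel\<bar> \<le> (\<integral>x. \<bar>\<kappa>2 x\<bar> \<partial>lborel) * B"
  proof (rule weighted_integral_bound(2)[OF k(2)])
   show "\<bar>E x\<bar> \<le> B" if "\<kappa>2 x \<noteq> 0" for x using k(3)[of x] B[of x] that by linarith
  qed measurable
 qed
 also have "\<dots> \<le> M * B" using k(4) B0 by (simp add: mult_right_mono flip: distrib_right)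
 finally show ?thesis .
qed

lemma ball_functional_linear:
 fixes \<Phi> :: "(real ^ 'n \<Rightarrow> real) \<Rightarrow> real"
 assumes \<Phi>: "ball_functional l M \<Phi>" and l: "0 \<le> l"
  and E: "continuous_on UNIV E" and F: "continuous_on UNIV F"
 shows "\<Phi> (\<lambda>x. r * E x + s * F x) = r * \<Phi> E + s * \<Phi> F"
proof -
 note [measurable] = continuous_borel[OF E] continuous_borel[OF F]
 obtain \<kappa>1 \<kappa>2 where k: "integrable lborel \<kappa>1" "integrable lborel \<kappa>2" "\<And>x. l \<le> norm x \<Longrightarrow> \<kappa>2 x = 0"
   "\<And>E. E \<in> borel_measurable borel \<Longrightarrow>
   \<Phi> E = (\<integral>x. \<kappa>1 x * E (l *\<^sub>R (x /\<^sub>R norm x)) \<partial>lborel) + (\<integral>x. \<kappa>2 x * E x \<partial>lborel)"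
  using \<Phi> unfolding ball_functional_def by blast
 have i: "integrable lborel (\<lambda>x. \<kappa>1 x * G (l *\<^sub>R (x /\<^sub>R norm x)))" "integrable lborel (\<lambda>x. \<kappa>2 x * G x)"
  if G: "continuous_on UNIV G" for G
 proof -
  note [measurable] = continuous_borel[OF G]
  obtain B where B: "\<And>x. norm x \<le> l \<Longrightarrow> \<bar>G x\<bar> \<le> B" using continuous_bound_cball[OF G, where r=l] by blast
  show "integrable lborel (\<lambda>x. \<kappa>1 x * G (l *\<^sub>R (x /\<^sub>R norm x)))"
   by (rule weighted_integral_bound(1)[OF k(1) _ B[OF norm_unit_vector[OF l]]]) measurable
  show "integrable lborel (\<lambda>x. \<kappa>2 x * G x)"
  proof (rule weighted_integral_bound(1)[OF k(2)])
   show "\<bar>G x\<bar> \<le> B" if "\<kappa>2 x \<noteq> 0" for x using k(3)[of x] B[of x] that by linarith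
  qed measurable
 qed
 show ?thesis
  using i[OF E] i[OF F]
  by (simp add: k(4) distrib_left mult.left_commute[of _ r] mult.left_commute[of _ s])
qed

lemma borel_pair_torus_lborel:
 assumes "F \<in> borel_measurable (borel \<Otimes>\<^sub>M borel)"
 shows "F \<in> borel_measurable (torus \<Otimes>\<^sub>M lborel)"
proof -
 have id: "(\<lambda>x. x) \<in> measurable torus borel" by (rule borel_measurable_torus) simp
 have "(\<lambda>p. (fst p, snd p)) \<in> measurable (torus \<Otimes>\<^sub>M lborel) (borel \<Otimes>\<^sub>M borel)"
  by (intro measurable_Pair measurable_compose[OF measurable_fst id]) simp
 from measurable_compose[OF this assms] show ?thesis by simp
qed

lemma fubini_torus_lborel:
 fixes \<kappa> F C :: "real ^ 'n \<Rightarrow> real" and \<phi> :: "real ^ 'n \<Rightarrow> real ^ 'n"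
 assumes \<kappa>: "integrable lborel \<kappa>" and [measurable]: "\<phi> \<in> borel_measurable borel"
  "F \<in> borel_measurable borel" "C \<in> borel_measurable borel"
  and F: "\<And>x. \<bar>F x\<bar> \<le> A" and C: "\<And>x. \<bar>C x\<bar> \<le> B"
 shows "(\<integral>y. (\<integral>x. \<kappa> x * F (y - \<phi> x) \<partial>lborel) * C y \<partial>torus) = (\<integral>x. \<kappa> x * (\<integral>y. F (y - \<phi> x) * C y \<partial>torus) \<partial>lborel)"
  and "integrable torus (\<lambda>y. (\<integral>x. \<kappa> x * F (y - \<phi> x) \<partial>lborel) * C y)"
proof -
 interpret P: pair_sigma_finite "torus :: (real ^ 'n) measure" "lborel :: (real ^ 'n) measure" ..
 have [measurable]: "\<kappa> \<in> borel_measurable borel" using borel_measurable_integrable[OF \<kappa>] by simp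
 have A0: "0 \<le> A" and B0: "0 \<le> B" using F[of 0] C[of 0] by linarith+
 let ?f = "\<lambda>(y, x). \<kappa> x * F (y - \<phi> x) * C y"
 have meas: "?f \<in> borel_measurable (torus \<Otimes>\<^sub>M lborel)" by (rule borel_pair_torus_lborel) measurable
 have b: "\<bar>\<kappa> x * F (y - \<phi> x) * C y\<bar> \<le> \<bar>\<kappa> x\<bar> * (A * B)" for x y
  using mult_mono[OF F[of "y - \<phi> x"] C[of y]] A0 by (simp add: abs_mult mult.assoc mult_left_mono)
 have ik: "integrable lborel (\<lambda>x. \<bar>\<kappa> x\<bar> * (A * B))" using \<kappa> by simp
 have i1: "integrable lborel (\<lambda>x. \<kappa> x * F (y - \<phi> x) * C y)" for y
  by (rule integrable_boundI[OF ik]) (use b in auto)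
 have int: "integrable (torus \<Otimes>\<^sub>M lborel) ?f"
 proof (rule P.Fubini_integrable[OF meas])
  show "integrable torus (\<lambda>y. \<integral>x. norm (?f (y, x)) \<partial>lborel)"
  proof (rule integrable_boundI)
   show "integrable torus (\<lambda>y :: real ^ 'n. \<integral>x. \<bar>\<kappa> x\<bar> * (A * B) \<partial>lborel)" by simp
   show "(\<lambda>y. \<integral>x. norm (?f (y, x)) \<partial>lborel) \<in> borel_measurable torus"
    by (rule lborel.borel_measurable_lebesgue_integral) (use meas in \<open>simp add: split_def\<close>)
   show "\<bar>\<integral>x. norm (?f (y, x)) \<partial>lborel\<bar> \<le> (\<integral>x. \<bar>\<kappa> x\<bar> * (A * B) \<partial>lborel)" for y
    using integral_mono[OF integrable_norm[OF i1[of y]] ik] b by simp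
  qed
  show "AE y in torus. integrable lborel (\<lambda>x. ?f (y, x))" using i1 by simp
 qed
 have "(\<integral>y. (\<integral>x. \<kappa> x * F (y - \<phi> x) \<partial>lborel) * C y \<partial>torus) = (\<integral>y. \<integral>x. ?f (y, x) \<partial>lborel \<partial>torus)"
  by simp
 also have "\<dots> = (\<integral>x. \<integral>y. ?f (y, x) \<partial>torus \<partial>lborel)"
  using P.Fubini_integral[of "\<lambda>y x. ?f (y, x)"] int by simp
 also have "\<dots> = (\<integral>x. \<kappa> x * (\<integral>y. F (y - \<phi> x) * C y \<partial>torus) \<partial>lborel)"
  by (simp add: mult.assoc)
 finally show "(\<integral>y. (\<integral>x. \<kappa> x * F (y - \<phi> x) \<partial>lborel) * C y \<partial>torus) = (\<integral>x. \<kappa> x * (\<integral>y. F (y - \<phi> x) * C y \<partial>torus) \<partial>lborel)" .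
 have "integrable torus (\<lambda>y. \<integral>x. ?f (y, x) \<partial>lborel)" by (rule P.integrable_fst'[OF int])
 then show "integrable torus (\<lambda>y. (\<integral>x. \<kappa> x * F (y - \<phi> x) \<partial>lborel) * C y)" by simp
qed

text \<open>Separation of variables turns the average into a finite combination of trigonometric
  polynomials in \<open>z\<close>.\<close>

lemma continuous_average:
 fixes F C :: "real ^ 'n \<Rightarrow> real"
 assumes F: "trig F" and C: "continuous_on UNIV C" "periodic C"
 shows "continuous_on UNIV (\<lambda>z. \<integral>y. F (y - z) * C y \<partial>torus)"
proof -
 obtain n g h where gh: "\<And>k. k < n \<Longrightarrow> trig (g k) \<and> trig (h k)" and eq: "\<And>x y. F (x - y) = (\<Sum>k<n::nat. g k x * h k y)"
  using separable_sum[OF trig_separable[OF F]] by blast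
 obtain B where B: "\<And>x. \<bar>C x\<bar> \<le> B" using periodic_continuous_bounded[OF C] by blast
 have i: "integrable torus (\<lambda>y. g k y * C y)" if k: "k < n" for k
 proof -
  have gk: "trig (g k)" using gh[OF k] by blast
  obtain A where A: "\<And>x. \<bar>g k x\<bar> \<le> A" using trig_bounded[OF gk] by blast
  have "\<bar>g k y * C y\<bar> \<le> A * B" for y using mult_mono[OF A[of y] B[of y]] A[of y] by (simp add: abs_mult)
  then show ?thesis
   using continuous_borel[OF C(1)] trig_borel[OF gk]
   by (intro torus.integrable_const_bound[where B="A * B"]) (auto intro!: AE_I2 borel_measurable_torus)
 qed
 have "(\<integral>y. F (y - z) * C y \<partial>torus) = (\<Sum>k<n. h k z * (\<integral>y. g k y * C y \<partial>torus))" for z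
 proof -
  have "(\<integral>y. F (y - z) * C y \<partial>torus) = (\<integral>y. (\<Sum>k<n. h k z * (g k y * C y)) \<partial>torus)"
   by (simp add: eq sum_distrib_right sum_distrib_left mult_ac)
  also have "\<dots> = (\<Sum>k<n. h k z * (\<integral>y. g k y * C y \<partial>torus))"
   using i by (subst lint_sum) auto
  finally show ?thesis .
 qed
 then show ?thesis using gh
  by (simp only:) (intro continuous_on_sum continuous_on_mult continuous_on_const trig_continuous, blast)
qed

text \<open>Transfers a functional from the approximate identity to the mean of \<open>C\<close>, so
  that the mollification parameter sits only in the function to which a fixed functional is
  applied.\<close>

lemma ball_functional_fubini:
 fixes \<Phi> :: "(real ^ 'n \<Rightarrow> real) \<Rightarrow> real"
 assumes \<Phi>: "ball_functional l M \<Phi>" and F: "trig F" and C: "continuous_on UNIV C" "periodic C"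
 shows "(\<integral>y. \<Phi> (\<lambda>z. F (y - z)) * C y \<partial>torus) = \<Phi> (\<lambda>z. \<integral>y. F (y - z) * C y \<partial>torus)"
proof -
 note [measurable] = continuous_borel[OF C(1)] trig_borel[OF F]
  continuous_borel[OF continuous_average[OF F C]]
 obtain A where A: "\<And>x. \<bar>F x\<bar> \<le> A" using trig_bounded[OF F] by blast
 obtain B where B: "\<And>x. \<bar>C x\<bar> \<le> B" using periodic_continuous_bounded[OF C] by blast
 obtain \<kappa>1 \<kappa>2 where k: "integrable lborel \<kappa>1" "integrable lborel \<kappa>2" and
   eq: "\<And>E. E \<in> borel_measurable borel \<Longrightarrow>
   \<Phi> E = (\<integral>x. \<kappa>1 x * E (l *\<^sub>R (x /\<^sub>R norm x)) \<partial>lborel) + (\<integral>x. \<kappa>2 x * E x \<partial>lborel)"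
  using \<Phi> unfolding ball_functional_def by blast
 note f1 = fubini_torus_lborel[where F=F and C=C, OF k(1) unit_vector_borel[of l] _ _ A B]
 have id: "(\<lambda>x :: real ^ 'n. x) \<in> borel_measurable borel" by simp
 note f2 = fubini_torus_lborel[where F=F and C=C, OF k(2) id _ _ A B]
 have "\<Phi> (\<lambda>z. F (y - z)) = (\<integral>x. \<kappa>1 x * F (y - l *\<^sub>R (x /\<^sub>R norm x)) \<partial>lborel) + (\<integral>x. \<kappa>2 x * F (y - x) \<partial>lborel)" for y
  by (rule eq) measurable
 then have "(\<integral>y. \<Phi> (\<lambda>z. F (y - z)) * C y \<partial>torus)
   = (\<integral>y. (\<integral>x. \<kappa>1 x * F (y - l *\<^sub>R (x /\<^sub>R norm x)) \<partial>lborel) * C y + (\<integral>x. \<kappa>2 x * F (y - x) \<partial>lborel) * C y \<partial>torus)"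
  by (simp add: distrib_right)
 also have "\<dots> = (\<integral>y. (\<integral>x. \<kappa>1 x * F (y - l *\<^sub>R (x /\<^sub>R norm x)) \<partial>lborel) * C y \<partial>torus)
   + (\<integral>y. (\<integral>x. \<kappa>2 x * F (y - x) \<partial>lborel) * C y \<partial>torus)"
  using f1(2) f2(2) by (intro lint_add) simp_all
 also have "\<dots> = (\<integral>x. \<kappa>1 x * (\<integral>y. F (y - l *\<^sub>R (x /\<^sub>R norm x)) * C y \<partial>torus) \<partial>lborel)
   + (\<integral>x. \<kappa>2 x * (\<integral>y. F (y - x) * C y \<partial>torus) \<partial>lborel)"
  using f1(1) f2(1) by simp
 also have "\<dots> = \<Phi> (\<lambda>z. \<integral>y. F (y - z) * C y \<partial>torus)" by (rule eq[symmetric]) measurable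
 finally show ?thesis .
qed

text \<open>Dominated convergence under the integrable weights: the means converge pointwise and are
  bounded by any bound of \<open>C\<close>.\<close>

lemma ball_functional_limit:
 fixes \<Phi> :: "(real ^ 'n \<Rightarrow> real) \<Rightarrow> real"
 assumes \<Phi>: "ball_functional l M \<Phi>" and C: "continuous_on UNIV C" "periodic C"
 shows "(\<lambda>N. \<Phi> (\<lambda>z. \<integral>y. fejer N (y - z) * C y \<partial>torus)) \<longlonglongrightarrow> \<Phi> C"
proof -
 note [measurable] = continuous_borel[OF C(1)]
  continuous_borel[OF continuous_average[OF trig_fejer C]]
 obtain B where B: "\<And>x. \<bar>C x\<bar> \<le> B" using periodic_continuous_bounded[OF C] by blast
 obtain \<kappa>1 \<kappa>2 where k: "integrable lborel \<kappa>1" "integrable lborel \<kappa>2" and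
   eq: "\<And>E. E \<in> borel_measurable borel \<Longrightarrow>
   \<Phi> E = (\<integral>x. \<kappa>1 x * E (l *\<^sub>R (x /\<^sub>R norm x)) \<partial>lborel) + (\<integral>x. \<kappa>2 x * E x \<partial>lborel)"
  using \<Phi> unfolding ball_functional_def by blast
 have lim: "(\<lambda>N. \<integral>x. \<kappa> x * (\<integral>y. fejer N (y - \<phi> x) * C y \<partial>torus) \<partial>lborel) \<longlonglongrightarrow> (\<integral>x. \<kappa> x * C (\<phi> x) \<partial>lborel)"
  if \<kappa>: "integrable lborel \<kappa>" and [measurable]: "\<phi> \<in> borel_measurable borel" for \<kappa> and \<phi> :: "real ^ 'n \<Rightarrow> real ^ 'n"
 proof -
  have [measurable]: "\<kappa> \<in> borel_measurable borel" using borel_measurable_integrable[OF \<kappa>] by simp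
  have [measurable]: "(\<lambda>x. \<integral>y. fejer N (y - \<phi> x) * C y \<partial>torus) \<in> borel_measurable borel" for N
   by (rule measurable_compose[of \<phi> borel borel "\<lambda>z. \<integral>y. fejer N (y - z) * C y \<partial>torus"]) measurable
  show ?thesis
  proof (rule dominated_convergence_real[where w="\<lambda>x. \<bar>\<kappa> x\<bar> * B"])
   show "integrable lborel (\<lambda>x. \<bar>\<kappa> x\<bar> * B)" using \<kappa> by simp
   show "AE x in lborel. (\<lambda>N. \<kappa> x * (\<integral>y. fejer N (y - \<phi> x) * C y \<partial>torus)) \<longlonglongrightarrow> \<kappa> x * C (\<phi> x)"
    by (intro AE_I2 tendsto_intros fejer_limit C)
   show "\<bar>\<kappa> x * (\<integral>y. fejer N (y - \<phi> x) * C y \<partial>torus)\<bar> \<le> \<bar>\<kappa> x\<bar> * B" for N x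
    using fejer_average(3)[OF C B, of N "\<phi> x"] by (simp add: abs_mult mult_left_mono)
  qed measurable
 qed
 have e: "\<Phi> (\<lambda>z. \<integral>y. fejer N (y - z) * C y \<partial>torus) = (\<integral>x. \<kappa>1 x * (\<integral>y. fejer N (y - l *\<^sub>R (x /\<^sub>R norm x)) * C y \<partial>torus) \<partial>lborel)
   + (\<integral>x. \<kappa>2 x * (\<integral>y. fejer N (y - x) * C y \<partial>torus) \<partial>lborel)" for N
  by (rule eq) measurable
 have e': "\<Phi> C = (\<integral>x. \<kappa>1 x * C (l *\<^sub>R (x /\<^sub>R norm x)) \<partial>lborel) + (\<integral>x. \<kappa>2 x * C x \<partial>lborel)"
  by (rule eq) measurable
 show ?thesis unfolding e e'
  by (intro tendsto_add lim[OF k(1)] lim[OF k(2), of "\<lambda>x. x"]) measurable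
qed

section \<open>Weights on a ball and their distributional derivatives\<close>

definition wint :: "real \<Rightarrow> (real ^ 'n \<Rightarrow> real) \<Rightarrow> (real ^ 'n \<Rightarrow> real) \<Rightarrow> real" where
 "wint l \<rho> E = (\<integral>x. indicator (ball 0 l) x * \<rho> x * E x \<partial>lborel)"

text \<open>For differentiable \<open>E\<close> this is the integral over the ball of
  \<open>\<rho>\<close> times the k-th derivative of \<open>E\<close>, rewritten by the divergence
  theorem. The rewritten form needs no derivative of \<open>E\<close> and so applies to correlations
  that are only continuous.\<close>

definition wbd :: "real \<Rightarrow> 'n \<Rightarrow> (real ^ 'n \<Rightarrow> real) \<Rightarrow> (real ^ 'n \<Rightarrow> real) \<Rightarrow> (real ^ 'n \<Rightarrow> real) \<Rightarrow> real" where
 "wbd l k \<rho> \<rho>' E = l ^ (CARD('n) - 1) * (\<integral>y. \<rho> (l *\<^sub>R y) * y $ k * E (l *\<^sub>R y) \<partial>sphere_measure) - wint l \<rho>' E"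

definition unit_ball_volume :: "'n::finite itself \<Rightarrow> real" where
 "unit_ball_volume _ = measure lborel (ball 0 1 :: (real ^ 'n) set)"

lemma ball_volume:
 assumes "0 < l"
 shows "(\<integral>x. indicator (ball (0 :: real ^ 'n) l) x \<partial>lborel) = l ^ CARD('n) * unit_ball_volume TYPE('n::finite)"
  and "integrable lborel (indicator (ball (0 :: real ^ 'n) l) :: _ \<Rightarrow> real)"
 using integral_ball_homogeneous[where G="\<lambda>_ :: real ^ 'n. 1" and r=l] assms
  integrable_continuous_ball(2)[OF continuous_on_const[of UNIV "1 :: real"], of l]
 by (simp_all add: unit_ball_volume_def)

lemma unit_ball_volume_pos: "0 < unit_ball_volume TYPE('n::finite)"
 using content_ball_pos[of 1 "0 :: real ^ 'n"] by (simp add: unit_ball_volume_def)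

lemma wint_functional:
 fixes \<rho> :: "real ^ 'n \<Rightarrow> real"
 assumes \<rho>: "continuous_on UNIV \<rho>" and l: "0 < l" and R: "\<And>x. norm x \<le> l \<Longrightarrow> \<bar>\<rho> x\<bar> \<le> R"
 shows "ball_functional l (R * l ^ CARD('n) * unit_ball_volume TYPE('n)) (wint l \<rho>)"
proof -
 note [measurable] = continuous_borel[OF \<rho>]
 let ?k = "\<lambda>x. indicator (ball 0 l) x * \<rho> x"
 have i: "integrable lborel ?k" by (rule integrable_continuous_ball(2)[OF \<rho>])
 have "(\<integral>x. \<bar>?k x\<bar> \<partial>lborel) \<le> (\<integral>x. R * indicator (ball (0 :: real ^ 'n) l) x \<partial>lborel)"
  using i ball_volume(2)[OF l, where 'n='n] R by (intro integral_mono) (auto split: split_indicator)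
 also have "\<dots> = R * l ^ CARD('n) * unit_ball_volume TYPE('n)"
  by (simp only: lint_mult_right_zero ball_volume(1)[OF l] mult.assoc)
 finally have b: "(\<integral>x. \<bar>?k x\<bar> \<partial>lborel) \<le> R * l ^ CARD('n) * unit_ball_volume TYPE('n)" .
 show ?thesis
  unfolding ball_functional_def wint_def
  by (intro exI[of _ "\<lambda>_. 0"] exI[of _ ?k]) (use i b in auto)
qed

text \<open>The sphere term contributes at most the area d V l^(d-1) times the bound of the weight,
  the interior term the volume V l^d times the bound of its derivative.\<close>

lemma wbd_functional:
 fixes \<rho> :: "real ^ 'n \<Rightarrow> real"
 assumes \<rho>: "continuous_on UNIV \<rho>" and \<rho>': "continuous_on UNIV \<rho>'" and l: "0 < l"
  and R: "\<And>x. norm x \<le> l \<Longrightarrow> \<bar>\<rho> x\<bar> \<le> R" and R': "\<And>x. norm x \<le> l \<Longrightarrow> \<bar>\<rho>' x\<bar> \<le> R'"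
 shows "ball_functional l ((real CARD('n) * l ^ (CARD('n) - 1) * R + R' * l ^ CARD('n)) * unit_ball_volume TYPE('n)) (wbd l k \<rho> \<rho>')"
proof -
 note [measurable] = continuous_borel[OF \<rho>] continuous_borel[OF \<rho>']
 let ?c = "real CARD('n) * l ^ (CARD('n) - 1)"
 define \<kappa>1 where "\<kappa>1 x = ?c * (indicator (ball 0 1) x * (\<rho> (l *\<^sub>R (x /\<^sub>R norm x)) * (x /\<^sub>R norm x) $ k))" for x
 define \<kappa>2 where "\<kappa>2 x = - (indicator (ball 0 l) x * \<rho>' x)" for x
 have [measurable]: "\<kappa>1 \<in> borel_measurable borel" unfolding \<kappa>1_def by measurable
 have R0: "0 \<le> R" using R[of 0] l by simp
 have b1: "\<bar>\<kappa>1 x\<bar> \<le> (?c * R) * indicator (ball 0 1) x" for x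
 proof -
  have "\<bar>(x /\<^sub>R norm x) $ k\<bar> \<le> 1"
   using component_le_norm_cart[of "x /\<^sub>R norm x" k] norm_unit_vector[of 1 x] by simp
  then have "\<bar>\<rho> (l *\<^sub>R (x /\<^sub>R norm x))\<bar> * \<bar>(x /\<^sub>R norm x) $ k\<bar> \<le> R * 1"
   using R[OF norm_unit_vector[of l x]] l R0 by (intro mult_mono) auto
  then have "?c * (\<bar>\<rho> (l *\<^sub>R (x /\<^sub>R norm x))\<bar> * \<bar>(x /\<^sub>R norm x) $ k\<bar>) \<le> ?c * R"
   using l by (intro mult_left_mono) auto
  then show ?thesis using l by (simp add: \<kappa>1_def abs_mult split: split_indicator)
 qed
 have iv: "integrable lborel (\<lambda>x :: real ^ 'n. (?c * R) * indicator (ball 0 1) x)"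
  using ball_volume(2)[of 1, where 'n='n] by (intro integrable_mult_right) simp
 have i1: "integrable lborel \<kappa>1" by (rule integrable_boundI[OF iv]) (use b1 in auto)
 have i2: "integrable lborel \<kappa>2" unfolding \<kappa>2_def using integrable_continuous_ball(2)[OF \<rho>'] by simp
 have "(\<integral>x. \<bar>\<kappa>1 x\<bar> \<partial>lborel) \<le> (\<integral>x. (?c * R) * indicator (ball (0 :: real ^ 'n) 1) x \<partial>lborel)"
  using i1 iv b1 by (intro integral_mono) auto
 also have "\<dots> = ?c * R * unit_ball_volume TYPE('n)"
  by (simp only: lint_mult_right_zero ball_volume(1)[OF zero_less_one] power_one mult_1)
 finally have B1: "(\<integral>x. \<bar>\<kappa>1 x\<bar> \<partial>lborel) \<le> ?c * R * unit_ball_volume TYPE('n)" .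
 have "(\<integral>x. \<bar>\<kappa>2 x\<bar> \<partial>lborel) \<le> (\<integral>x. R' * indicator (ball (0 :: real ^ 'n) l) x \<partial>lborel)"
  proof (rule integral_mono)
  show "\<bar>\<kappa>2 x\<bar> \<le> R' * indicator (ball 0 l) x" for x using R'[of x] by (auto simp: \<kappa>2_def split: split_indicator)
 qed (use i2 ball_volume(2)[OF l, where 'n='n] in auto)
 also have "\<dots> = R' * l ^ CARD('n) * unit_ball_volume TYPE('n)"
  by (simp only: lint_mult_right_zero ball_volume(1)[OF l] mult.assoc)
 finally have B2: "(\<integral>x. \<bar>\<kappa>2 x\<bar> \<partial>lborel) \<le> R' * l ^ CARD('n) * unit_ball_volume TYPE('n)" .
 have "wbd l k \<rho> \<rho>' E = (\<integral>x. \<kappa>1 x * E (l *\<^sub>R (x /\<^sub>R norm x)) \<partial>lborel) + (\<integral>x. \<kappa>2 x * E x \<partial>lborel)"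
  if [measurable]: "E \<in> borel_measurable borel" for E
 proof -
  have "(\<integral>y. \<rho> (l *\<^sub>R y) * y $ k * E (l *\<^sub>R y) \<partial>sphere_measure) = real CARD('n) * (\<integral>x. indicator (ball 0 1) x *
    (\<rho> (l *\<^sub>R (x /\<^sub>R norm x)) * (x /\<^sub>R norm x) $ k * E (l *\<^sub>R (x /\<^sub>R norm x))) \<partial>lborel)"
   by (rule integral_sphere_measure) measurable
  then have "l ^ (CARD('n) - 1) * (\<integral>y. \<rho> (l *\<^sub>R y) * y $ k * E (l *\<^sub>R y) \<partial>sphere_measure) = (\<integral>x. \<kappa>1 x * E (l *\<^sub>R (x /\<^sub>R norm x)) \<partial>lborel)"
   by (simp add: \<kappa>1_def mult.assoc mult.left_commute[of _ "l ^ _"] del: integral_mult_right_zero vector_scaleR_component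
      flip: integral_mult_right_zero)
  moreover have "wint l \<rho>' E = - (\<integral>x. \<kappa>2 x * E x \<partial>lborel)" by (simp add: wint_def \<kappa>2_def)
  ultimately show ?thesis by (simp add: wbd_def)
 qed
 then show ?thesis
  unfolding ball_functional_def
  by (intro exI[of _ \<kappa>1] exI[of _ \<kappa>2] conjI) (use i1 i2 B1 B2 in \<open>auto simp: \<kappa>2_def algebra_simps\<close>)
qed

text \<open>Exactly what \<open>ball_divergence\<close> asks of a function and its derivative along
  one axis.\<close>

definition partial_derivative :: "'n \<Rightarrow> (real ^ 'n \<Rightarrow> real) \<Rightarrow> (real ^ 'n \<Rightarrow> real) \<Rightarrow> bool" where
 "partial_derivative k w D \<longleftrightarrow> continuous_on UNIV w \<and> continuous_on UNIV D \<and>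
   (\<forall>x. ((\<lambda>t. w (x + t *\<^sub>R axis k 1)) has_real_derivative D x) (at 0))"

lemma partial_derivative_mult:
 assumes "partial_derivative k w D" "partial_derivative k v E"
 shows "partial_derivative k (\<lambda>x. w x * v x) (\<lambda>x. D x * v x + w x * E x)"
 using assms unfolding partial_derivative_def
 by (auto intro!: continuous_intros derivative_eq_intros simp: mult.commute)

lemma wint_derivative:
 fixes \<rho> :: "real ^ 'n \<Rightarrow> real"
 assumes \<rho>: "partial_derivative k \<rho> \<rho>'" and E: "partial_derivative k E D" and l: "0 < l"
 shows "wint l \<rho> D = wbd l k \<rho> \<rho>' E"
proof -
 have p: "partial_derivative k (\<lambda>x. \<rho> x * E x) (\<lambda>x. \<rho>' x * E x + \<rho> x * D x)"
  by (rule partial_derivative_mult[OF \<rho> E])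
 have c: "continuous_on UNIV \<rho>" "continuous_on UNIV \<rho>'" "continuous_on UNIV E" "continuous_on UNIV D"
  using \<rho> E by (auto simp: partial_derivative_def)
 have i: "integrable lborel (\<lambda>x. indicator (ball 0 l) x * (\<rho>' x * E x))" "integrable lborel (\<lambda>x. indicator (ball 0 l) x * (\<rho> x * D x))"
  by (intro integrable_continuous_ball continuous_intros c)+
 have "(\<integral>x. indicator (ball 0 l) x * (\<rho>' x * E x + \<rho> x * D x) \<partial>lborel)
  = l ^ (CARD('n) - 1) * (\<integral>y. (\<rho> (l *\<^sub>R y) * E (l *\<^sub>R y)) * y $ k \<partial>sphere_measure)"
  using p l unfolding partial_derivative_def by (intro ball_divergence) auto
 then show ?thesis
  using i by (simp add: wbd_def wint_def distrib_left mult.assoc mult.commute[of "E _" "_ $ _"])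
qed

section \<open>Mollified weights as trigonometric polynomials\<close>

definition mol :: "nat \<Rightarrow> real \<Rightarrow> (real ^ 'n \<Rightarrow> real) \<Rightarrow> real ^ 'n \<Rightarrow> real" where
 "mol N l \<rho> y = wint l \<rho> (\<lambda>z. fejer N (y - z))"

lemma trig_partial_derivative: "trig f \<Longrightarrow> partial_derivative k f (pd (axis k 1) f)"
 using trig_pd[of f] by (simp add: partial_derivative_def trig_continuous)

text \<open>After separating the variables of \<open>fejer N (y - z)\<close>, the integral over
  \<open>z\<close> only produces constant coefficients.\<close>

lemma trig_mol:
 fixes \<rho> :: "real ^ 'n \<Rightarrow> real"
 assumes \<rho>: "continuous_on UNIV \<rho>"
 shows "trig (mol N l \<rho>)"
  and "pd (axis k 1) (mol N l \<rho>) y = wint l \<rho> (\<lambda>z. pd (axis k 1) (fejer N) (y - z))"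
proof -
 obtain n g h where gh: "\<And>k. k < n \<Longrightarrow> trig (g k) \<and> trig (h k)"
  and eq: "\<And>x y :: real ^ 'n. fejer N (x - y) = (\<Sum>k<n::nat. g k x * h k y)"
  using separable_sum[OF trig_separable[OF trig_fejer]] by blast
 have i: "integrable lborel (\<lambda>x. indicator (ball 0 l) x * \<rho> x * h m x)" if "m < n" for m
  using integrable_continuous_ball(2)[OF continuous_on_mult[OF \<rho> trig_continuous], of "h m"] gh[OF that]
  by (simp add: mult.assoc)
 have w: "wint l \<rho> (\<lambda>z. \<Sum>m<n. c m * h m z) = (\<Sum>m<n. c m * wint l \<rho> (h m))" for c
 proof -
  have "wint l \<rho> (\<lambda>z. \<Sum>m<n. c m * h m z) = (\<integral>x. (\<Sum>m<n. c m * (indicator (ball 0 l) x * \<rho> x * h m x)) \<partial>lborel)"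
   by (simp add: wint_def sum_distrib_left mult_ac)
  also have "\<dots> = (\<Sum>m<n. c m * wint l \<rho> (h m))"
   using i by (subst lint_sum) (auto simp: wint_def)
  finally show ?thesis .
 qed
 have sum_pd: "pd (axis k 1) (\<lambda>y. \<Sum>m<n. g m y * c m) y = (\<Sum>m<n. pd (axis k 1) (g m) y * c m)" for c :: "nat \<Rightarrow> real" and y
 proof -
  have "((\<lambda>y. \<Sum>m<n. g m y * c m) has_derivative (\<lambda>h. \<Sum>m<n. (\<Sum>k\<in>UNIV. pd (axis k 1) (g m) y * h $ k) * c m)) (at y)"
   using gh by (intro has_derivative_sum has_derivative_mult_left trig_pd(2)) auto
  from pd_eqI[OF this, of "axis k 1"] show ?thesis by (simp add: sum_axis)
 qed
 have m: "mol N l \<rho> = (\<lambda>y. \<Sum>m<n. g m y * wint l \<rho> (h m))"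
  by (simp add: fun_eq_iff mol_def eq w)
 show "trig (mol N l \<rho>)" unfolding m using gh by (intro trig_sum trig.mult trig.const) auto
 have "pd (axis k 1) (fejer N) (y - z) = (\<Sum>m<n. pd (axis k 1) (g m) y * h m z)" for z
 proof -
  have "((\<lambda>y. fejer N (y - z)) has_derivative (\<lambda>h. \<Sum>k\<in>UNIV. pd (axis k 1) (fejer N) (y - z) * h $ k)) (at y)"
   by (rule has_derivative_compose[of "\<lambda>y. y - z" _ _ _ "fejer N", simplified])
     (auto intro!: derivative_eq_intros trig_pd(2)[OF trig_fejer])
  from pd_eqI[OF this, of "axis k 1"]
  have "pd (axis k 1) (fejer N) (y - z) = pd (axis k 1) (\<lambda>y. fejer N (y - z)) y" by (simp add: sum_axis)
  also have "\<dots> = (\<Sum>m<n. pd (axis k 1) (g m) y * h m z)" using sum_pd[of "\<lambda>m. h m z" y] by (simp add: eq)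
  finally show ?thesis .
 qed
 then show "pd (axis k 1) (mol N l \<rho>) y = wint l \<rho> (\<lambda>z. pd (axis k 1) (fejer N) (y - z))"
  unfolding m by (simp add: sum_pd w)
qed

text \<open>Differentiating \<open>fejer N (y - z)\<close> in \<open>y\<close> or in
  \<open>z\<close> differs by a sign; the divergence theorem then moves the derivative onto the
  discontinuous weight.\<close>

lemma pd_mol:
 fixes \<rho> :: "real ^ 'n \<Rightarrow> real"
 assumes \<rho>: "partial_derivative k \<rho> \<rho>'" and l: "0 < l"
 shows "pd (axis k 1) (mol N l \<rho>) y = - wbd l k \<rho> \<rho>' (\<lambda>z. fejer N (y - z))"
proof -
 have c: "continuous_on UNIV \<rho>" using \<rho> by (simp add: partial_derivative_def)
 have "partial_derivative k (\<lambda>z. fejer N (y - z)) (pd (axis k 1) (\<lambda>z. fejer N (y - z)))"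
  by (intro trig_partial_derivative trig_reflect trig_fejer)
 from wint_derivative[OF \<rho> this l]
 have "wint l \<rho> (\<lambda>z. - pd (axis k 1) (fejer N) (y - z)) = wbd l k \<rho> \<rho>' (\<lambda>z. fejer N (y - z))"
  by (simp only: ext[OF pd_reflect[OF trig_fejer]])
 then show ?thesis by (simp add: trig_mol(2)[OF c] wint_def)
qed

lemma mol_even:
 assumes "\<And>z. \<rho> (- z) = \<rho> z" and [measurable]: "\<rho> \<in> borel_measurable borel"
 shows "mol N l \<rho> (- y) = mol N l \<rho> (y :: real ^ 'n)"
proof -
 note [measurable] = trig_borel[OF trig_fejer]
 have "mol N l \<rho> y = (\<integral>x. indicator (ball 0 l) x * \<rho> x * fejer N (y - x) \<partial>distr lborel borel (\<lambda>x. - x))"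
  using lborel_affine[of "- 1" "0 :: real ^ 'n"] by (simp add: mol_def wint_def density_1)
 also have "\<dots> = (\<integral>x. indicator (ball 0 l) (- x) * \<rho> (- x) * fejer N (y - - x) \<partial>lborel)"
  by (subst integral_distr) auto
 also have "\<dots> = (\<integral>x. indicator (ball 0 l) x * \<rho> x * fejer N (- y - x) \<partial>lborel)"
 proof (rule lint_cong[OF refl])
  fix x :: "real ^ 'n"
  have "fejer N (y - - x) = fejer N (- y - x)" using fejer_even[of N "y + x"] by simp
  then show "indicator (ball 0 l) (- x) * \<rho> (- x) * fejer N (y - - x) = indicator (ball 0 l) x * \<rho> x * fejer N (- y - x)"
   by (simp add: assms indicator_def)
 qed
 finally show ?thesis by (simp add: mol_def wint_def)
qed

section \<open>The isotropic kernels\<close>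

lemma sphere_integral_cong:
 fixes g h :: "real ^ 'n \<Rightarrow> real"
 assumes [measurable]: "g \<in> borel_measurable borel" "h \<in> borel_measurable borel"
  and eq: "\<And>y. norm y = 1 \<Longrightarrow> g y = h y"
 shows "(\<integral>y. g y \<partial>sphere_measure) = (\<integral>y. h y \<partial>sphere_measure)"
proof -
 have "(\<integral>x. indicator (ball 0 1) x * g (x /\<^sub>R norm x) \<partial>lborel) = (\<integral>x. indicator (ball 0 1) x * h (x /\<^sub>R norm x) \<partial>lborel)"
 proof (rule integral_cong_AE)
  have "AE x in lborel. x \<noteq> (0 :: real ^ 'n)" by (rule AE_lborel_singleton)
  then show "AE x in lborel. indicator (ball 0 1) x * g (x /\<^sub>R norm x) = indicator (ball 0 1) x * h (x /\<^sub>R norm x)"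
  proof eventually_elim
   case (elim x)
   then have "norm (x /\<^sub>R norm x) = 1" by simp
   from eq[OF this] show ?case by simp
  qed
 qed measurable
 then show ?thesis by (simp add: integral_sphere_measure)
qed

definition sphere_weight :: "real ^ 'n \<Rightarrow> real" where
 "sphere_weight x = real CARD('n) * indicator (ball 0 1) x"

lemma sphere_integral_alt:
 fixes g :: "real ^ 'n \<Rightarrow> real"
 assumes "g \<in> borel_measurable borel"
 shows "(\<integral>y. g y \<partial>sphere_measure) = (\<integral>x. sphere_weight x * g (x /\<^sub>R norm x) \<partial>lborel)"
 by (simp add: integral_sphere_measure[OF assms] sphere_weight_def mult.assoc)

lemma sphere_weight_integrable: "integrable lborel (sphere_weight :: real ^ 'n \<Rightarrow> real)"
 unfolding sphere_weight_def using ball_volume(2)[of 1, where 'n='n] by simp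

lemma sphere_continuous_integrable:
 fixes g :: "real ^ 'n \<Rightarrow> real"
 assumes "continuous_on UNIV g"
 shows "integrable lborel (\<lambda>x. sphere_weight x * g (x /\<^sub>R norm x))"
proof -
 note [measurable] = continuous_borel[OF assms]
 obtain B where B: "\<And>x. norm x \<le> 1 \<Longrightarrow> \<bar>g x\<bar> \<le> B" using continuous_bound_cball[OF assms, where r=1] by blast
 show ?thesis
  by (rule weighted_integral_bound(1)[OF sphere_weight_integrable _ B[OF norm_unit_vector[of 1, simplified scaleR_one, OF zero_le_one]]]) measurable
qed

lemma sphere_integral_sum:
 fixes g :: "'i \<Rightarrow> real ^ 'n \<Rightarrow> real"
 assumes "\<And>i. i \<in> I \<Longrightarrow> continuous_on UNIV (g i)"
 shows "(\<integral>y. (\<Sum>i\<in>I. g i y) \<partial>sphere_measure) = (\<Sum>i\<in>I. \<integral>y. g i y \<partial>sphere_measure)"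
proof -
 have m: "g i \<in> borel_measurable borel" if "i \<in> I" for i by (rule continuous_borel[OF assms[OF that]])
 have "(\<integral>y. (\<Sum>i\<in>I. g i y) \<partial>sphere_measure) = (\<integral>x. (\<Sum>i\<in>I. sphere_weight x * g i (x /\<^sub>R norm x)) \<partial>lborel)"
  using m by (subst sphere_integral_alt) (auto simp: sum_distrib_left intro: borel_measurable_sum)
 also have "\<dots> = (\<Sum>i\<in>I. \<integral>x. sphere_weight x * g i (x /\<^sub>R norm x) \<partial>lborel)"
  using assms by (intro lint_sum sphere_continuous_integrable)
 also have "\<dots> = (\<Sum>i\<in>I. \<integral>y. g i y \<partial>sphere_measure)"
  by (intro sum.cong refl sphere_integral_alt[symmetric] m)
 finally show ?thesis .
qed

lemma sphere_measure_total:
 "measure sphere_measure (UNIV :: (real ^ 'n) set) = real CARD('n) * unit_ball_volume TYPE('n)"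
proof -
 have "space sphere_measure = (UNIV :: (real ^ 'n) set)" by (simp add: sphere_measure_def)
 then have "measure sphere_measure (UNIV :: (real ^ 'n) set) = (\<integral>y. 1 \<partial>(sphere_measure :: (real ^ 'n) measure))"
  by simp
 also have "\<dots> = real CARD('n) * unit_ball_volume TYPE('n)"
  using integral_sphere_measure[of "\<lambda>_ :: real ^ 'n. 1"] ball_volume(1)[of 1, where 'n='n] by simp
 finally show ?thesis .
qed

text \<open>The matrix a I + c (z z^T - |z|^2 I). Once \<open>c\<close> multiplies z z^T, the
  coefficient of |z|^2 is forced: only with it does the gradient vanish after symmetrisation in all
  three indices.\<close>

definition kmat :: "real \<Rightarrow> real \<Rightarrow> 'n \<Rightarrow> 'n \<Rightarrow> real ^ 'n \<Rightarrow> real" where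
 "kmat a c i j z = (if i = j then a - c * (norm z)\<^sup>2 else 0) + c * z $ i * z $ j"

definition dkmat :: "real \<Rightarrow> 'n \<Rightarrow> 'n \<Rightarrow> 'n \<Rightarrow> real ^ 'n \<Rightarrow> real" where
 "dkmat c k i j z = (if i = j then - 2 * c * z $ k else 0)
   + ((if k = i then c * z $ j else 0) + (if k = j then c * z $ i else 0))"

lemma continuous_component: "continuous_on S (\<lambda>z :: real ^ 'n. z $ i)"
 by (intro continuous_intros)

lemma partial_component:
 "partial_derivative k (\<lambda>z :: real ^ 'n. z $ i) (\<lambda>z. if k = i then 1 else 0)"
 unfolding partial_derivative_def
 by (auto intro!: continuous_intros derivative_eq_intros simp: axis_def)

lemma partial_norm_square:
 "partial_derivative k (\<lambda>z :: real ^ 'n. (norm z)\<^sup>2) (\<lambda>z. 2 * z $ k)"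
proof -
 have "(norm (z + t *\<^sub>R axis k 1))\<^sup>2 = (norm z)\<^sup>2 + (2 * t * z $ k + t\<^sup>2)" for z :: "real ^ 'n" and t
 proof -
  have "axis k 1 \<bullet> (axis k 1 :: real ^ 'n) = 1" "z \<bullet> axis k 1 = z $ k" "axis k 1 \<bullet> z = z $ k"
   by (simp_all add: inner_axis inner_axis' axis_nth)
  then show ?thesis
   unfolding power2_norm_eq_inner inner_add_left inner_add_right inner_scaleR_left inner_scaleR_right
   by (simp only:) (simp add: power2_eq_square algebra_simps)
 qed
 then show ?thesis
  unfolding partial_derivative_def by (auto intro!: continuous_intros derivative_eq_intros)
qed

lemma partial_const: "partial_derivative k (\<lambda>z. r) (\<lambda>z. 0)"
 by (simp add: partial_derivative_def)

lemma partial_add: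
 "partial_derivative k f D \<Longrightarrow> partial_derivative k g E \<Longrightarrow> partial_derivative k (\<lambda>z. f z + g z) (\<lambda>z. D z + E z)"
 unfolding partial_derivative_def by (auto intro!: continuous_intros derivative_eq_intros)

lemma partial_kmat: "partial_derivative k (kmat a c i j) (dkmat c k i j)"
proof -
 have d: "partial_derivative k (\<lambda>z :: real ^ 'a. if i = j then a - c * (norm z)\<^sup>2 else 0) (\<lambda>z. if i = j then - 2 * c * z $ k else 0)"
 proof (cases "i = j")
  case True
  have "partial_derivative k (\<lambda>z :: real ^ 'a. a + (- c) * (norm z)\<^sup>2) (\<lambda>z. 0 + (0 * (norm z)\<^sup>2 + (- c) * (2 * z $ k)))"
   by (intro partial_add partial_derivative_mult partial_const partial_norm_square)
  then show ?thesis using True by (simp add: mult_ac)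
 qed (simp add: partial_const)
 have "partial_derivative k (kmat a c i j) (\<lambda>z. (if i = j then - 2 * c * z $ k else 0)
   + ((0 * z $ i + c * (if k = i then 1 else 0)) * z $ j + (c * z $ i) * (if k = j then 1 else 0)))"
  unfolding kmat_def by (intro partial_add d partial_derivative_mult partial_const partial_component)
 also have "(\<lambda>z. (if i = j then - 2 * c * z $ k else 0)
   + ((0 * z $ i + c * (if k = i then 1 else 0)) * z $ j + (c * z $ i) * (if k = j then 1 else 0))) = dkmat c k i j"
  by (auto simp: dkmat_def fun_eq_iff)
 finally show ?thesis .
qed

lemma continuous_kmat: "continuous_on UNIV (kmat a c i j)" and continuous_dkmat: "continuous_on UNIV (dkmat c k i j)"
 using partial_kmat[of k a c i j] by (auto simp: partial_derivative_def)

lemma kmat_even: "kmat a c i j (- z) = kmat a c i j z" and dkmat_odd: "dkmat c k i j (- z) = - dkmat c k i j z"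
 by (simp_all add: kmat_def dkmat_def)

lemma kmat_sym: "kmat a c i j = kmat a c j i" and dkmat_sym: "dkmat c k i j = dkmat c k j i"
 by (auto simp: kmat_def dkmat_def fun_eq_iff)

lemma kmat_bound:
 assumes "norm z \<le> l" shows "\<bar>kmat a c i j z\<bar> \<le> \<bar>a\<bar> + 2 * \<bar>c\<bar> * l\<^sup>2"
proof -
 have n: "(norm z)\<^sup>2 \<le> l\<^sup>2" using assms by (intro power_mono) auto
 have "\<bar>z $ i * z $ j\<bar> \<le> norm z * norm z"
  unfolding abs_mult by (intro mult_mono component_le_norm_cart) auto
 then have "\<bar>c * z $ i * z $ j\<bar> \<le> \<bar>c\<bar> * l\<^sup>2"
  using n by (simp add: abs_mult mult.assoc power2_eq_square mult_left_mono)
 moreover have "\<bar>c * (norm z)\<^sup>2\<bar> \<le> \<bar>c\<bar> * l\<^sup>2" using n by (simp add: abs_mult mult_left_mono)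
 ultimately show ?thesis by (auto simp: kmat_def)
qed

lemma dkmat_bound:
 assumes "norm z \<le> l" shows "\<bar>dkmat c k i j z\<bar> \<le> 4 * \<bar>c\<bar> * l"
proof -
 have "\<bar>c * z $ m\<bar> \<le> \<bar>c\<bar> * l" for m
  using component_le_norm_cart[of z m] assms by (simp add: abs_mult mult_left_mono)
 moreover have "0 \<le> \<bar>c\<bar> * l" using assms norm_ge_zero[of z] by (intro mult_nonneg_nonneg) linarith+
 ultimately have "\<bar>c * z $ i\<bar> \<le> \<bar>c\<bar> * l" "\<bar>c * z $ j\<bar> \<le> \<bar>c\<bar> * l" "\<bar>c * z $ k\<bar> \<le> \<bar>c\<bar> * l" "0 \<le> \<bar>c\<bar> * l"
  by blast+
 then show ?thesis by (auto simp: dkmat_def mult.commute[of l])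
qed

abbreviation kint where "kint a c l i j \<equiv> wint l (kmat a c i j)"
abbreviation kbd where "kbd a c l k i j \<equiv> wbd l k (kmat a c i j) (dkmat c k i j)"

text \<open>Both constants are scale invariant up to the factor \<open>1 / l\<close> for the weights \<open>a\<close> and \<open>c\<close> below.\<close>

lemma kint_functional:
 fixes i j :: "'n::finite"
 assumes "0 < l"
 shows "ball_functional l ((\<bar>a\<bar> + 2 * \<bar>c\<bar> * l\<^sup>2) * l ^ CARD('n) * unit_ball_volume TYPE('n)) (kint a c l i j)"
 by (rule wint_functional[OF continuous_kmat assms kmat_bound])

lemma kbd_functional:
 fixes i j k :: "'n::finite"
 assumes "0 < l"
 shows "ball_functional l ((real CARD('n) * l ^ (CARD('n) - 1) * (\<bar>a\<bar> + 2 * \<bar>c\<bar> * l\<^sup>2) + 4 * \<bar>c\<bar> * l * l ^ CARD('n))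
  * unit_ball_volume TYPE('n)) (kbd a c l k i j)"
 by (rule wbd_functional[OF continuous_kmat continuous_dkmat assms kmat_bound dkmat_bound])

text \<open>The mollified kernel against \<open>C\<close> equals the sharp kernel against the mean
  of \<open>C\<close>; the sign in the second part is that of \<open>pd_mol\<close>.\<close>

lemma kmol_pairing:
 fixes C :: "real ^ 'n \<Rightarrow> real"
 assumes l: "0 < l" and C: "continuous_on UNIV C" "periodic C"
 shows "(\<integral>y. mol N l (kmat a c i j) y * C y \<partial>torus) = kint a c l i j (\<lambda>z. \<integral>y. fejer N (y - z) * C y \<partial>torus)"
  and "(\<integral>y. pd (axis k 1) (mol N l (kmat a c i j)) y * C y \<partial>torus) = - kbd a c l k i j (\<lambda>z. \<integral>y. fejer N (y - z) * C y \<partial>torus)"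
 using ball_functional_fubini[OF kint_functional[OF l, where a=a and c=c and i=i and j=j] trig_fejer[of N] C]
  ball_functional_fubini[OF kbd_functional[OF l, where a=a and c=c and k=k and i=i and j=j] trig_fejer[of N] C]
 by (simp_all add: mol_def pd_mol[OF partial_kmat l])

lemma integral_lborel_reflect:
 fixes f :: "real ^ 'n \<Rightarrow> real"
 assumes [measurable]: "f \<in> borel_measurable borel"
 shows "(\<integral>x. f (- x) \<partial>lborel) = (\<integral>x. f x \<partial>lborel)"
proof -
 have "(\<integral>x. f x \<partial>lborel) = (\<integral>x. f x \<partial>distr lborel borel (\<lambda>x. - x))"
  using lborel_affine[of "- 1" "0 :: real ^ 'n"] by (simp add: density_1)
 also have "\<dots> = (\<integral>x. f (- x) \<partial>lborel)" by (subst integral_distr) auto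
 finally show ?thesis by simp
qed

text \<open>The kernel is even; its gradient and the outer normal are odd.\<close>

lemma kbd_reflect:
 fixes E :: "real ^ 'n \<Rightarrow> real"
 assumes [measurable]: "E \<in> borel_measurable borel"
 shows "kbd a c l k i j (\<lambda>z. E (- z)) = - kbd a c l k i j E"
proof -
 note [measurable] = continuous_borel[OF continuous_kmat] continuous_borel[OF continuous_dkmat]
 have 1: "(\<integral>y. kmat a c i j (l *\<^sub>R y) * y $ k * E (- (l *\<^sub>R y)) \<partial>sphere_measure)
   = - (\<integral>y. kmat a c i j (l *\<^sub>R y) * y $ k * E (l *\<^sub>R y) \<partial>sphere_measure)"
 proof -
  let ?f = "\<lambda>x. sphere_weight x * (kmat a c i j (l *\<^sub>R (x /\<^sub>R norm x)) * (x /\<^sub>R norm x) $ k * E (l *\<^sub>R (x /\<^sub>R norm x)))"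
  have [measurable]: "(sphere_weight :: real ^ 'n \<Rightarrow> real) \<in> borel_measurable borel" unfolding sphere_weight_def by measurable
  let ?g = "\<lambda>x. sphere_weight x * (kmat a c i j (l *\<^sub>R (x /\<^sub>R norm x)) * (x /\<^sub>R norm x) $ k * E (- (l *\<^sub>R (x /\<^sub>R norm x))))"
  have f: "?f (- x) = - ?g x" for x
  proof -
   have e: "l *\<^sub>R ((- x) /\<^sub>R norm (- x)) = - (l *\<^sub>R (x /\<^sub>R norm x))" "((- x) /\<^sub>R norm (- x)) $ k = - ((x /\<^sub>R norm x) $ k)"
    by simp_all
   have w: "sphere_weight (- x) = sphere_weight x" by (simp add: sphere_weight_def indicator_def)
   show ?thesis unfolding e w kmat_even by (simp only: mult_minus_left mult_minus_right)
  qed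
  have "(\<integral>x. ?f (- x) \<partial>lborel) = (\<integral>x. ?f x \<partial>lborel)" by (rule integral_lborel_reflect) measurable
  then have "(\<integral>x. ?g x \<partial>lborel) = - (\<integral>x. ?f x \<partial>lborel)" unfolding f Bochner_Integration.integral_minus by simp
  moreover have "(\<integral>y. kmat a c i j (l *\<^sub>R y) * y $ k * E (- (l *\<^sub>R y)) \<partial>sphere_measure) = (\<integral>x. ?g x \<partial>lborel)"
   by (rule sphere_integral_alt) measurable
  moreover have "(\<integral>y. kmat a c i j (l *\<^sub>R y) * y $ k * E (l *\<^sub>R y) \<partial>sphere_measure) = (\<integral>x. ?f x \<partial>lborel)"
   by (rule sphere_integral_alt) measurable
  ultimately show ?thesis by simp
 qed
 have 2: "wint l (dkmat c k i j) (\<lambda>z. E (- z)) = - wint l (dkmat c k i j) E"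
 proof -
  let ?f = "\<lambda>x. indicator (ball 0 l) x * dkmat c k i j x * E x"
  have "(\<integral>x. ?f (- x) \<partial>lborel) = (\<integral>x. ?f x \<partial>lborel)" by (rule integral_lborel_reflect) measurable
  moreover have "?f (- x) = - (indicator (ball 0 l) x * dkmat c k i j x * E (- x))" for x
   by (simp add: indicator_def dkmat_odd)
  ultimately show ?thesis by (simp add: wint_def)
 qed
 show ?thesis using 1 2 by (simp add: wbd_def)
qed

text \<open>Moments of the ball from the divergence theorem for \<open>z\<^sub>j\<close> and \<open>|z|\<^sup>2 z\<^sub>j\<close>.\<close>

lemma ball_second_moment:
 fixes i j :: "'n::finite"
 assumes l: "0 < l"
 shows "(\<integral>z. indicator (ball (0 :: real ^ 'n) l) z * (z $ i * z $ j) \<partial>lborel)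
   = (if i = j then unit_ball_volume TYPE('n) * l ^ (CARD('n) + 2) / (real CARD('n) + 2) else 0)"
  and "(\<integral>z. indicator (ball (0 :: real ^ 'n) l) z * (norm z)\<^sup>2 \<partial>lborel)
   = real CARD('n) * unit_ball_volume TYPE('n) * l ^ (CARD('n) + 2) / (real CARD('n) + 2)"
proof -
 let ?d = "CARD('n)" and ?V = "unit_ball_volume TYPE('n)"
 define M where "M k j = (\<integral>z. indicator (ball (0 :: real ^ 'n) l) z * (z $ k * z $ j) \<partial>lborel)" for k j :: 'n
 define m where "m = (\<integral>z. indicator (ball (0 :: real ^ 'n) l) z * (norm z)\<^sup>2 \<partial>lborel)"
 have iM: "integrable lborel (\<lambda>z :: real ^ 'n. indicator (ball 0 l) z * (z $ k * z $ j))" for k j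
  by (intro integrable_continuous_ball continuous_intros)
 have im: "integrable lborel (\<lambda>z :: real ^ 'n. indicator (ball 0 l) z * (norm z)\<^sup>2)"
  by (intro integrable_continuous_ball continuous_intros)
 have d1: "l ^ (?d - 1) * l = l ^ ?d" by (simp add: power_eq_if)
 have S: "(\<integral>y. y $ j * y $ k \<partial>(sphere_measure :: (real ^ 'n) measure)) = (if j = k then ?V else 0)" for j k
 proof -
  have "(\<integral>z. indicator (ball (0 :: real ^ 'n) l) z * (if k = j then 1 else 0) \<partial>lborel)
   = l ^ (?d - 1) * (\<integral>y. (l *\<^sub>R y) $ j * y $ k \<partial>sphere_measure)"
   using partial_component[of k j] l unfolding partial_derivative_def by (intro ball_divergence) auto
  also have "\<dots> = l ^ ?d * (\<integral>y. y $ j * y $ k \<partial>sphere_measure)" by (simp add: mult.assoc flip: d1)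
  finally have "l ^ ?d * (\<integral>y. y $ j * y $ k \<partial>(sphere_measure :: (real ^ 'n) measure)) = (if k = j then l ^ ?d * ?V else 0)"
   using ball_volume(1)[OF l, where 'n='n] by (auto split: if_splits)
  then show ?thesis using l by (auto split: if_splits)
 qed
 have eq: "2 * M k j + (if k = j then m else 0) = (if k = j then ?V * l ^ (?d + 2) else 0)" for k j
 proof -
  have p: "partial_derivative k (\<lambda>z :: real ^ 'n. (norm z)\<^sup>2 * z $ j) (\<lambda>z. 2 * z $ k * z $ j + (norm z)\<^sup>2 * (if k = j then 1 else 0))"
   by (intro partial_derivative_mult partial_norm_square partial_component)
  have "(\<integral>z. indicator (ball 0 l) z * (2 * z $ k * z $ j + (norm z)\<^sup>2 * (if k = j then 1 else 0)) \<partial>(lborel :: (real ^ 'n) measure))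
   = l ^ (?d - 1) * (\<integral>y. ((norm (l *\<^sub>R y))\<^sup>2 * (l *\<^sub>R y) $ j) * y $ k \<partial>sphere_measure)"
   using p l unfolding partial_derivative_def by (intro ball_divergence) auto
  also have "(\<integral>y. ((norm (l *\<^sub>R y))\<^sup>2 * (l *\<^sub>R y) $ j) * y $ k \<partial>(sphere_measure :: (real ^ 'n) measure))
    = (\<integral>y. l ^ 3 * (y $ j * y $ k) \<partial>sphere_measure)"
   by (rule sphere_integral_cong) (auto simp: power_mult_distrib power2_eq_square power3_eq_cube)
  also have "\<dots> = l ^ 3 * (if j = k then ?V else 0)" by (simp add: S)
  also have "l ^ (?d - 1) * (l ^ 3 * (if j = k then ?V else 0)) = (if k = j then ?V * l ^ (?d + 2) else 0)"
   using d1 by (auto simp: power3_eq_cube power2_eq_square mult_ac)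
  also have "(\<integral>z. indicator (ball 0 l) z * (2 * z $ k * z $ j + (norm z)\<^sup>2 * (if k = j then 1 else 0)) \<partial>(lborel :: (real ^ 'n) measure))
   = 2 * M k j + (if k = j then m else 0)"
  proof -
   have "(\<integral>z. indicator (ball 0 l) z * (2 * z $ k * z $ j + (norm z)\<^sup>2 * (if k = j then 1 else 0)) \<partial>(lborel :: (real ^ 'n) measure))
    = (\<integral>z. 2 * (indicator (ball 0 l) z * (z $ k * z $ j)) + (if k = j then 1 else 0) * (indicator (ball 0 l) z * (norm z)\<^sup>2) \<partial>(lborel :: (real ^ 'n) measure))"
    by (intro lint_cong) (auto simp: algebra_simps)
   also have "\<dots> = 2 * M k j + (if k = j then 1 else 0) * m"
    unfolding M_def m_def
    by (subst lint_add[OF integrable_mult_right[OF iM] integrable_mult_right[OF im]]) simp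
   finally show ?thesis by simp
  qed
  finally show ?thesis .
 qed
 \<comment> \<open>The divergence theorem relates each moment \<open>M k j\<close> to
   \<open>m\<close>; this trace relation closes the linear system.\<close>
 have "m = (\<Sum>k\<in>UNIV. M k k)"
 proof -
  have "m = (\<integral>z. (\<Sum>k\<in>UNIV. indicator (ball 0 l) z * (z $ k * z $ k)) \<partial>(lborel :: (real ^ 'n) measure))"
   unfolding m_def by (simp add: power2_norm_eq_inner inner_vec_def sum_distrib_left)
  also have "\<dots> = (\<Sum>k\<in>UNIV. M k k)"
   unfolding M_def by (rule lint_sum) (rule iM)
  finally show ?thesis .
 qed
 moreover have "M k k = (?V * l ^ (?d + 2) - m) / 2" for k using eq[of k k] by simp
 ultimately have "m = real ?d * ((?V * l ^ (?d + 2) - m) / 2)" by simp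
 then have m: "m = real ?d * ?V * l ^ (?d + 2) / (real ?d + 2)" by (simp add: field_simps)
 then show "(\<integral>z. indicator (ball (0 :: real ^ 'n) l) z * (norm z)\<^sup>2 \<partial>lborel) = real ?d * ?V * l ^ (?d + 2) / (real ?d + 2)"
  by (simp add: m_def)
 have "2 * M i j = (if i = j then 2 * (?V * l ^ (?d + 2) / (real ?d + 2)) else 0)"
 proof -
  have "X - D * X / (D + 2) = 2 * (X / (D + 2))" if "0 \<le> D" for X D :: real
   using that by (simp add: field_simps)
  from this[of "real ?d" "?V * l ^ (?d + 2)"] show ?thesis
   using eq[of i j] m by (auto simp: mult.assoc)
 qed
 then show "(\<integral>z. indicator (ball (0 :: real ^ 'n) l) z * (z $ i * z $ j) \<partial>lborel)
   = (if i = j then ?V * l ^ (?d + 2) / (real ?d + 2) else 0)"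
  by (auto simp: M_def)
qed

text \<open>
 The kernel attached to a kind reproduces, as boundary density on the sphere of radius \<open>l\<close>,
 the quadratic form \<open>wt1 |\<delta>|\<^sup>2 + wt2 (\<delta> \<cdot> y)\<^sup>2\<close> of the matrix of that kind.
\<close>

primrec wt1 :: "kind \<Rightarrow> real" where "wt1 Kind_I = 1" | "wt1 Kind_L = 0" | "wt1 Kind_T = 1"
primrec wt2 :: "kind \<Rightarrow> real" where "wt2 Kind_I = 0" | "wt2 Kind_L = 1" | "wt2 Kind_T = - 1"
text \<open>Normalises the mass: the second moments of the ball give it the value wt3 (wt1 + wt2 -
  wt2 (d - 1) / (d + 2)), which has to be 1. The same number is four times \<open>prefactor\<close>
  divided by d.\<close>

primrec wt3 :: "kind \<Rightarrow> real \<Rightarrow> real" where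
 "wt3 Kind_I d = 1" | "wt3 Kind_L d = (d + 2) / 3" | "wt3 Kind_T d = (d + 2) / (d - 1)"

text \<open>With \<open>kerC\<close> this solves \<open>a - c * l^2 = r * wt1\<close> and
  \<open>c * l^2 = r * wt2\<close> for \<open>r = wt3 / (V * l^d)\<close>, where V is the volume of
  the unit ball: the values of the kernel on the sphere of radius \<open>l\<close> are
  prescribed.\<close>

definition kerA :: "'n::finite itself \<Rightarrow> kind \<Rightarrow> real \<Rightarrow> real" where
 "kerA _ b l = wt3 b (real CARD('n)) * (wt1 b + wt2 b) / (unit_ball_volume TYPE('n) * l ^ CARD('n))"
definition kerC :: "'n::finite itself \<Rightarrow> kind \<Rightarrow> real \<Rightarrow> real" where
 "kerC _ b l = wt3 b (real CARD('n)) * wt2 b / (unit_ball_volume TYPE('n) * l ^ CARD('n) * l\<^sup>2)"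

lemma kint_normalised:
 fixes i j :: "'n::finite"
 assumes l: "0 < l" and d: "2 \<le> CARD('n)"
 shows "kint (kerA TYPE('n) b l) (kerC TYPE('n) b l) l i j (\<lambda>_. 1) = (if i = j then 1 else 0)"
proof -
 let ?d = "CARD('n)" and ?V = "unit_ball_volume TYPE('n)"
 let ?a = "kerA TYPE('n) b l" and ?c = "kerC TYPE('n) b l"
 have V: "0 < ?V" by (rule unit_ball_volume_pos)
 have i: "integrable lborel (\<lambda>z :: real ^ 'n. indicator (ball 0 l) z * (z $ i * z $ j))"
   "integrable lborel (\<lambda>z :: real ^ 'n. indicator (ball 0 l) z * (norm z)\<^sup>2)"
  by (intro integrable_continuous_ball continuous_intros)+
 note iv = ball_volume(2)[OF l, where 'n='n]
 have "kint ?a ?c l i j (\<lambda>_. 1) = (\<integral>z. (if i = j then ?a else 0) * indicator (ball 0 l) z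
   + (if i = j then - ?c else 0) * (indicator (ball 0 l) z * (norm z)\<^sup>2) + ?c * (indicator (ball 0 l) z * (z $ i * z $ j)) \<partial>(lborel :: (real ^ 'n) measure))"
  unfolding wint_def by (intro lint_cong) (auto simp: kmat_def algebra_simps)
 also have "\<dots> = (if i = j then ?a else 0) * (l ^ ?d * ?V)
   + (if i = j then - ?c else 0) * (real ?d * ?V * l ^ (?d + 2) / (real ?d + 2)) + ?c * (if i = j then ?V * l ^ (?d + 2) / (real ?d + 2) else 0)"
  by (simp only: lint_add integrable_mult_right i iv L1_add
    lint_mult_right_zero ball_second_moment[OF l] ball_volume(1)[OF l])
 also have "\<dots> = (if i = j then 1 else 0)"
 proof (cases "i = j")
  case True
  have "?a * (l ^ ?d * ?V) = wt3 b (real ?d) * (wt1 b + wt2 b)"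
   using V l by (simp add: kerA_def)
  moreover have c: "?c * (?V * l ^ (?d + 2)) = wt3 b (real ?d) * wt2 b"
   using V l by (simp add: kerC_def power_add power2_eq_square)
  moreover have "- ?c * (real ?d * ?V * l ^ (?d + 2) / (real ?d + 2)) + ?c * (?V * l ^ (?d + 2) / (real ?d + 2))
    = - (real ?d - 1) / (real ?d + 2) * (?c * (?V * l ^ (?d + 2)))"
  proof -
   have "- c * (D * V * P / (D + 2)) + c * (V * P / (D + 2)) = - (D - 1) / (D + 2) * (c * (V * P))" for c D V P :: real
    by (simp add: divide_inverse algebra_simps)
   then show ?thesis .
  qed
  moreover have "wt3 b (real ?d) * (wt1 b + wt2 b) + - (real ?d - 1) / (real ?d + 2) * (wt3 b (real ?d) * wt2 b) = 1"
  proof -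
   have D: "real ?d + 2 \<noteq> 0" "real ?d - 1 \<noteq> 0" "2 \<le> real ?d" using d by linarith+
   show ?thesis
   proof (cases b)
    case Kind_I
    then show ?thesis by simp
   next
    case Kind_L
    then show ?thesis using D by (simp add: field_simps)
   next
    case Kind_T
    have "(1 - D) / (D - 1) = - 1" if "D - 1 \<noteq> 0" for D :: real
     using that by (simp add: divide_eq_eq)
    from this[OF D(2)] show ?thesis using Kind_T D by simp
   qed
  qed
  ultimately show ?thesis using True by simp
 qed simp
 finally show ?thesis .
qed

text \<open>The kernels do not see the pressure because their divergence is a gradient.\<close>

definition kgrad :: "'n::finite itself \<Rightarrow> real \<Rightarrow> real \<Rightarrow> real \<Rightarrow> real ^ 'n \<Rightarrow> real" where
 "kgrad _ a c l z = a - c * (real CARD('n) - 1) / 2 * (l\<^sup>2 - (norm z)\<^sup>2)"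

lemma partial_kgrad:
 "partial_derivative j (kgrad TYPE('n::finite) a c l) (\<lambda>z. c * (real CARD('n) - 1) * z $ j)"
proof -
 let ?r = "c * (real CARD('n) - 1) / 2"
 have "partial_derivative j (\<lambda>z :: real ^ 'n. (a - ?r * l\<^sup>2) + ?r * (norm z)\<^sup>2) (\<lambda>z. 0 + (0 * (norm z)\<^sup>2 + ?r * (2 * z $ j)))"
  by (intro partial_add partial_derivative_mult partial_const partial_norm_square)
 moreover have "(\<lambda>z :: real ^ 'n. (a - ?r * l\<^sup>2) + ?r * (norm z)\<^sup>2) = kgrad TYPE('n) a c l"
  by (simp add: kgrad_def fun_eq_iff field_simps)
 moreover have "(\<lambda>z :: real ^ 'n. 0 + (0 * (norm z)\<^sup>2 + ?r * (2 * z $ j))) = (\<lambda>z. c * (real CARD('n) - 1) * z $ j)"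
  by (simp add: mult.assoc)
 ultimately show ?thesis by (simp only:)
qed

text \<open>Two comparisons. Inside the ball both sides have the density c (d - 1) z_j. On the
  sphere the normal component of the matrix is a y_j, and the additive constant in
  \<open>kgrad\<close> is chosen to give it the value \<open>a\<close> there, so the jumps agree
  too.\<close>

lemma kmol_divergence:
 fixes j :: "'n::finite"
 assumes l: "0 < l"
 shows "(\<Sum>i\<in>UNIV. pd (axis i 1) (mol N l (kmat a c i j)) y) = pd (axis j 1) (mol N l (kgrad TYPE('n) a c l)) y"
proof -
 define E where "E z = fejer N (y - z)" for z :: "real ^ 'n"
 have E: "continuous_on UNIV E" unfolding E_def by (intro trig_continuous trig_reflect trig_fejer)
 note [measurable] = continuous_borel[OF E] continuous_borel[OF continuous_kmat]
 have int: "(\<Sum>i\<in>UNIV. wint l (dkmat c i i j) E) = wint l (\<lambda>z. c * (real CARD('n) - 1) * z $ j) E"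
 proof -
  have s: "(\<Sum>i\<in>UNIV. dkmat c i i j z) = c * (real CARD('n) - 1) * z $ j" for z :: "real ^ 'n"
   by (simp add: dkmat_def sum.distrib) (simp add: algebra_simps)
  have "(\<Sum>i\<in>UNIV. wint l (dkmat c i i j) E) = (\<integral>z. (\<Sum>i\<in>UNIV. indicator (ball 0 l) z * dkmat c i i j z * E z) \<partial>lborel)"
   unfolding wint_def
   using integrable_continuous_ball(2)[OF continuous_on_mult[OF continuous_dkmat E]]
   by (intro lint_sum[symmetric]) (simp add: mult.assoc)
  then show ?thesis by (simp add: wint_def s flip: sum_distrib_right sum_distrib_left)
 qed
 have bd: "(\<Sum>i\<in>UNIV. \<integral>x. kmat a c i j (l *\<^sub>R x) * x $ i * E (l *\<^sub>R x) \<partial>sphere_measure)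
   = (\<integral>x. kgrad TYPE('n) a c l (l *\<^sub>R x) * x $ j * E (l *\<^sub>R x) \<partial>sphere_measure)"
 proof -
  have "(\<Sum>i\<in>UNIV. \<integral>x. kmat a c i j (l *\<^sub>R x) * x $ i * E (l *\<^sub>R x) \<partial>sphere_measure)
   = (\<integral>x. (\<Sum>i\<in>UNIV. kmat a c i j (l *\<^sub>R x) * x $ i * E (l *\<^sub>R x)) \<partial>sphere_measure)"
   by (intro sphere_integral_sum[symmetric] continuous_intros continuous_on_compose2[OF continuous_kmat] continuous_on_compose2[OF E]) auto
  also have "\<dots> = (\<integral>x. kgrad TYPE('n) a c l (l *\<^sub>R x) * x $ j * E (l *\<^sub>R x) \<partial>sphere_measure)"
  proof (rule sphere_integral_cong)
   fix x :: "real ^ 'n" assume x: "norm x = 1"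
   have "kmat a c i j (l *\<^sub>R x) * x $ i = (if i = j then (a - c * l\<^sup>2) * x $ j else 0) + c * l\<^sup>2 * x $ j * (x $ i * x $ i)" for i
    by (auto simp: kmat_def x power_mult_distrib power2_eq_square algebra_simps)
   then have "(\<Sum>i\<in>UNIV. kmat a c i j (l *\<^sub>R x) * x $ i) = (a - c * l\<^sup>2) * x $ j + c * l\<^sup>2 * x $ j * (\<Sum>i\<in>UNIV. x $ i * x $ i)"
    by (simp add: sum.distrib sum_distrib_left)
   also have "(\<Sum>i\<in>UNIV. x $ i * x $ i) = 1"
    using x by (simp add: norm_eq_1 inner_vec_def)
   finally have "(\<Sum>i\<in>UNIV. kmat a c i j (l *\<^sub>R x) * x $ i) = a * x $ j" by (simp add: algebra_simps)
   then show "(\<Sum>i\<in>UNIV. kmat a c i j (l *\<^sub>R x) * x $ i * E (l *\<^sub>R x)) = kgrad TYPE('n) a c l (l *\<^sub>R x) * x $ j * E (l *\<^sub>R x)"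
    using x by (simp add: kgrad_def power_mult_distrib flip: sum_distrib_right)
  qed (auto simp: kgrad_def)
  finally show ?thesis .
 qed
 have "(\<Sum>i\<in>UNIV. pd (axis i 1) (mol N l (kmat a c i j)) y) = - (\<Sum>i\<in>UNIV. kbd a c l i i j E)"
  by (simp add: pd_mol[OF partial_kmat l] sum_negf E_def[abs_def])
 also have "\<dots> = - wbd l j (kgrad TYPE('n) a c l) (\<lambda>z. c * (real CARD('n) - 1) * z $ j) E"
  using int bd by (simp add: wbd_def sum_subtractf flip: sum_distrib_left)
 also have "\<dots> = pd (axis j 1) (mol N l (kgrad TYPE('n) a c l)) y"
  by (simp add: pd_mol[OF partial_kgrad l] E_def[abs_def])
 finally show ?thesis .
qed

section \<open>The energy flux at a fixed time\<close>

lemma borel_measurable_component [measurable (raw)]: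
 fixes f :: "'a \<Rightarrow> real ^ 'n"
 assumes "f \<in> borel_measurable M"
 shows "(\<lambda>x. f x $ i) \<in> borel_measurable M"
 by (rule measurable_compose[OF assms continuous_borel[OF continuous_component]])

text \<open>\<open>Kind_L\<close> projects onto the line of \<open>y\<close> and
  \<open>Kind_T\<close> onto its complement, so this is Pythagoras. At y = 0 both sides agree
  because division by 0 gives 0.\<close>

lemma T_matrix_norm:
 fixes y \<delta> :: "real ^ 'n"
 shows "(norm (T_matrix b y *v \<delta>))\<^sup>2 = wt1 b * (norm \<delta>)\<^sup>2 + wt2 b * ((\<delta> \<bullet> y)\<^sup>2 / (norm y)\<^sup>2)"
proof -
 have L: "T_matrix Kind_L y *v \<delta> = ((\<delta> \<bullet> y) / (norm y)\<^sup>2) *\<^sub>R y"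
  by (simp add: vec_eq_iff matrix_vector_mult_def inner_vec_def sum_distrib_left sum_divide_distrib mult_ac)
 have T: "T_matrix Kind_T y *v \<delta> = \<delta> - T_matrix Kind_L y *v \<delta>"
  by (simp add: matrix_vector_mult_diff_rdistrib)
 have nL: "(norm (((\<delta> \<bullet> y) / (norm y)\<^sup>2) *\<^sub>R y))\<^sup>2 = (\<delta> \<bullet> y)\<^sup>2 / (norm y)\<^sup>2"
 proof -
  have "(norm (s *\<^sub>R y))\<^sup>2 = s\<^sup>2 * (norm y)\<^sup>2" for s by (simp add: power_mult_distrib)
  moreover have "(s / N)\<^sup>2 * N = s\<^sup>2 / N" for s N :: real by (cases "N = 0") (simp_all add: power2_eq_square)
  ultimately show ?thesis by (simp only:)
 qed
 show ?thesis
 proof (cases b)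
  case Kind_I then show ?thesis by simp
 next
  case Kind_L show ?thesis unfolding Kind_L L nL by simp
 next
  case Kind_T
  have "(norm (\<delta> - ((\<delta> \<bullet> y) / (norm y)\<^sup>2) *\<^sub>R y))\<^sup>2
    = (norm \<delta>)\<^sup>2 - 2 * (((\<delta> \<bullet> y) / (norm y)\<^sup>2) * (\<delta> \<bullet> y)) + (norm (((\<delta> \<bullet> y) / (norm y)\<^sup>2) *\<^sub>R y))\<^sup>2"
  proof -
   have "(norm (\<delta> - w))\<^sup>2 = (norm \<delta>)\<^sup>2 - 2 * (\<delta> \<bullet> w) + (norm w)\<^sup>2" for w :: "real ^ 'n"
    by (simp add: power2_norm_eq_inner inner_diff_left inner_diff_right inner_commute)
   then show ?thesis by (simp only: inner_scaleR_right)
  qed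
  also have "\<dots> = (norm \<delta>)\<^sup>2 - (\<delta> \<bullet> y)\<^sup>2 / (norm y)\<^sup>2" unfolding nL by (simp add: power2_eq_square)
  finally show ?thesis unfolding Kind_T T L by simp
 qed
qed

lemma integral_sum3:
 fixes f :: "'i::finite \<Rightarrow> 'j::finite \<Rightarrow> 'k::finite \<Rightarrow> 'a \<Rightarrow> real"
 assumes "\<And>i j k. integrable M (f i j k)"
 shows "(\<integral>x. (\<Sum>i\<in>UNIV. \<Sum>j\<in>UNIV. \<Sum>k\<in>UNIV. f i j k x) \<partial>M) = (\<Sum>i\<in>UNIV. \<Sum>j\<in>UNIV. \<Sum>k\<in>UNIV. \<integral>x. f i j k x \<partial>M)"
 using assms by (simp add: lint_sum L1_sum)

section \<open>Triple correlations of a divergence-free field at a fixed time\<close>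

locale cubic_field =
 fixes v :: "real ^ 'n \<Rightarrow> real ^ 'n"
 assumes v_borel [measurable]: "v \<in> borel_measurable borel" and v_periodic: "periodic v"
  and v_cube: "integrable torus (\<lambda>x. (norm (v x)) ^ 3)"
  and v_div: "weakly_divergence_free v"
begin

lemma norm_L3: "in_Lp 3 (\<lambda>x. norm (v x))"
 using v_cube v_periodic by (auto simp: in_Lp_def periodic_def)

lemma comp_L3: "in_Lp 3 (\<lambda>x. v x $ i)"
 unfolding in_Lp_def
proof (intro conjI)
 show "integrable torus (\<lambda>x. \<bar>v x $ i\<bar> ^ 3)"
  by (rule integrable_boundI[OF v_cube])
    (auto intro!: borel_measurable_torus power_mono component_le_norm_cart)
qed (use v_periodic in \<open>auto simp: periodic_def\<close>)

definition cub :: "'n \<Rightarrow> 'n \<Rightarrow> 'n \<Rightarrow> real ^ 'n \<Rightarrow> real" where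
 "cub i k j = corr (\<lambda>x. v x $ i * v x $ k) (\<lambda>x. v x $ j)"

lemma prod_bound: "\<bar>v x $ i * v x $ k\<bar> \<le> \<bar>norm (v x)\<bar> ^ 2"
proof -
 have "\<bar>v x $ i\<bar> * \<bar>v x $ k\<bar> \<le> norm (v x) * norm (v x)"
  by (intro mult_mono component_le_norm_cart) auto
 then show ?thesis by (simp add: abs_mult power2_eq_square)
qed

lemma prod_L1: "in_Lp 1 (\<lambda>x. v x $ i * v x $ k)"
proof -
 have i2: "integrable torus (\<lambda>x. \<bar>norm (v x)\<bar> ^ 2)" using in_LpD(3)[OF in_Lp_mono[OF norm_L3, of 2]] by simp
 have "integrable torus (\<lambda>x. \<bar>v x $ i * v x $ k\<bar> ^ 1)"
  by (rule integrable_boundI[OF i2]) (use prod_bound in \<open>auto intro!: borel_measurable_torus\<close>)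
 then show ?thesis using v_periodic by (auto simp: in_Lp_def periodic_def)
qed

lemma cub_continuous: "continuous_on UNIV (cub i k j)"
 unfolding cub_def
 by (rule corr_continuous[where q=2 and a="\<lambda>x. norm (v x)"])
   (use prod_bound norm_L3 comp_L3 in \<open>auto simp: numeral_3_eq_3 numeral_2_eq_2\<close>)

lemma corr_periodic: "periodic w \<Longrightarrow> periodic (corr h w)"
proof -
 assume w: "periodic w"
 have "w (x - (y + axis i 1)) = w (x - y)" for x y i
 proof -
  have "w (x - (y + axis i 1)) = w (x - (y + axis i 1) + axis i 1)" using w by (simp only: periodic_def)
  then show ?thesis by (simp add: algebra_simps)
 qed
 then show ?thesis by (simp add: periodic_def corr_def)
qed

lemma cub_periodic: "periodic (cub i k j)"
 unfolding cub_def by (rule corr_periodic) (use v_periodic in \<open>simp add: periodic_def\<close>)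

lemma cub_bound: "\<bar>cub i k j y\<bar> \<le> 2 * (\<integral>x. (norm (v x)) ^ 3 \<partial>torus)"
proof -
 have "\<bar>cub i k j y\<bar> \<le> (\<integral>x. \<bar>norm (v x)\<bar> ^ Suc 2 \<partial>torus) + (\<integral>x. \<bar>v x $ j\<bar> ^ Suc 2 \<partial>torus)"
  unfolding cub_def
  by (rule corr_bound) (use prod_bound norm_L3 comp_L3 in \<open>auto simp: numeral_3_eq_3 numeral_2_eq_2\<close>)
 also have "(\<integral>x. \<bar>v x $ j\<bar> ^ Suc 2 \<partial>torus) \<le> (\<integral>x. (norm (v x)) ^ 3 \<partial>torus)"
 proof (rule integral_mono)
  show "\<bar>v x $ j\<bar> ^ Suc 2 \<le> (norm (v x)) ^ 3" for x
   using power_mono[OF component_le_norm_cart abs_ge_zero, of "v x" j 3] by (simp add: numeral_3_eq_3 numeral_2_eq_2)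
 qed (use in_LpD(3)[OF comp_L3[of j]] v_cube in \<open>simp_all add: numeral_3_eq_3 numeral_2_eq_2\<close>)
 finally show ?thesis by (simp add: numeral_3_eq_3 numeral_2_eq_2)
qed

text \<open>For fixed \<open>x\<close> the function \<open>m (x - y)\<close> of \<open>y\<close> is
  a test function for the divergence.\<close>

lemma divergence_conv:
 assumes m: "trig m"
 shows "(\<Sum>k\<in>UNIV. conv (pd (axis k 1) m) (\<lambda>x. v x $ k) x) = 0"
proof -
 have i: "integrable torus (\<lambda>y. pd (axis k 1) m (x - y) * v y $ k)" for k
 proof -
  obtain B where B: "\<And>y. \<bar>pd (axis k 1) m y\<bar> \<le> B" using trig_bounded[OF trig_pd(1)[OF m]] by blast
  note [measurable] = trig_borel[OF trig_pd(1)[OF m]]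
  have "integrable torus (\<lambda>y. B * \<bar>v y $ k\<bar>)"
   using in_LpD(3)[OF in_Lp_mono[OF comp_L3, of 1]] by simp
  then show ?thesis
   by (rule integrable_boundI) (use B in \<open>auto intro!: borel_measurable_torus mult_right_mono simp: abs_mult\<close>)
 qed
 have p: "periodic (\<lambda>y. m (x - y))" by (rule trig_periodic[OF trig_reflect[OF m]])
 have "(\<Sum>k\<in>UNIV. conv (pd (axis k 1) m) (\<lambda>x. v x $ k) x) = (\<integral>y. (\<Sum>k\<in>UNIV. pd (axis k 1) m (x - y) * v y $ k) \<partial>torus)"
  unfolding conv_def using i by (intro lint_sum[symmetric])
 also have "\<dots> = - (\<integral>y. (\<Sum>k\<in>UNIV. v y $ k * pd (axis k 1) (\<lambda>y. m (x - y)) y) \<partial>torus)"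
  by (simp add: pd_reflect[OF m] sum_negf mult.commute)
 also have "\<dots> = 0"
  using v_div trig_smooth[OF trig_reflect[OF m, of x]] p unfolding weakly_divergence_free_def by simp
 finally show ?thesis .
qed

text \<open>The derivative index is contracted with the component that stands alone in the
  correlation, so the divergence of the field appears. The sharp kernel is reached from mollified
  ones, for which the derivative can be taken inside the convolution.\<close>

lemma kbd_divergence_free:
 assumes l: "0 < l"
 shows "(\<Sum>k\<in>UNIV. kbd a c l k i j (cub p q k)) = 0"
proof -
 have z: "(\<Sum>k\<in>UNIV. kbd a c l k i j (\<lambda>z. \<integral>y. fejer N (y - z) * cub p q k y \<partial>torus)) = 0" for N
 proof -
  let ?m = "mol N l (kmat a c i j)"
  have m: "trig ?m" by (rule trig_mol(1)[OF continuous_kmat])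
  have b: "\<exists>B. \<forall>x. \<bar>pd (axis k 1) ?m x\<bar> \<le> B" for k by (rule trig_bounded[OF trig_pd(1)[OF m]])
  have pc: "(\<integral>x. (v x $ p * v x $ q) * conv (pd (axis k 1) ?m) (\<lambda>x. v x $ k) x \<partial>torus) = (\<integral>y. pd (axis k 1) ?m y * cub p q k y \<partial>torus)"
     "integrable torus (\<lambda>x. (v x $ p * v x $ q) * conv (pd (axis k 1) ?m) (\<lambda>x. v x $ k) x)" for k
  proof -
   obtain B where B: "\<And>x. \<bar>pd (axis k 1) ?m x\<bar> \<le> B" using b by blast
   note P = pair_conv_corr[OF prod_L1[of p q] in_Lp_mono[OF comp_L3[of k]] trig_borel[OF trig_pd(1)[OF m]] trig_periodic[OF trig_pd(1)[OF m]] B]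
   show "(\<integral>x. (v x $ p * v x $ q) * conv (pd (axis k 1) ?m) (\<lambda>x. v x $ k) x \<partial>torus) = (\<integral>y. pd (axis k 1) ?m y * cub p q k y \<partial>torus)"
    unfolding cub_def by (rule P(1)) simp
   show "integrable torus (\<lambda>x. (v x $ p * v x $ q) * conv (pd (axis k 1) ?m) (\<lambda>x. v x $ k) x)"
    by (rule P(2)) simp
  qed
  have "(\<Sum>k\<in>UNIV. kbd a c l k i j (\<lambda>z. \<integral>y. fejer N (y - z) * cub p q k y \<partial>torus))
    = - (\<Sum>k\<in>UNIV. \<integral>y. pd (axis k 1) ?m y * cub p q k y \<partial>torus)"
   by (simp add: kmol_pairing(2)[OF l cub_continuous cub_periodic] sum_negf)
  also have "\<dots> = - (\<integral>x. (\<Sum>k\<in>UNIV. (v x $ p * v x $ q) * conv (pd (axis k 1) ?m) (\<lambda>x. v x $ k) x) \<partial>torus)"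
   using pc by (simp add: lint_sum)
  also have "\<dots> = 0" by (simp add: divergence_conv[OF m] flip: sum_distrib_left)
  finally show ?thesis .
 qed
 have "(\<lambda>N. \<Sum>k\<in>UNIV. kbd a c l k i j (\<lambda>z. \<integral>y. fejer N (y - z) * cub p q k y \<partial>torus)) \<longlonglongrightarrow> (\<Sum>k\<in>UNIV. kbd a c l k i j (cub p q k))"
  by (intro tendsto_sum ball_functional_limit[OF kbd_functional[OF l]] cub_continuous cub_periodic)
 then show ?thesis unfolding z by (simp add: LIMSEQ_const_iff)
qed

definition inc3 :: "'n \<Rightarrow> 'n \<Rightarrow> 'n \<Rightarrow> real ^ 'n \<Rightarrow> real" where
 "inc3 i j k y = (\<integral>x. increment y v x $ i * increment y v x $ j * increment y v x $ k \<partial>torus)"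

lemma triple_integrable:
 "integrable torus (\<lambda>x. v x $ i * v x $ j * v (x + y) $ k)" "(\<integral>x. v x $ i * v x $ j * v (x + y) $ k \<partial>torus) = cub i j k (- y)"
 "integrable torus (\<lambda>x. v (x + y) $ i * v (x + y) $ j * v x $ k)" "(\<integral>x. v (x + y) $ i * v (x + y) $ j * v x $ k \<partial>torus) = cub i j k y"
proof -
 have int: "integrable torus (\<lambda>x. v x $ i * v x $ j * v (x - z) $ k)" for z
  by (rule integrable_mult_conjugate(1)[where q=2 and a="\<lambda>x. norm (v x)" and r=1, OF _ prod_bound])
    (use norm_L3 in_Lp_shift'[OF comp_L3] in \<open>auto simp: numeral_3_eq_3 numeral_2_eq_2\<close>)
 show "integrable torus (\<lambda>x. v x $ i * v x $ j * v (x + y) $ k)" using int[of "- y"] by simp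
 show "(\<integral>x. v x $ i * v x $ j * v (x + y) $ k \<partial>torus) = cub i j k (- y)" by (simp add: cub_def corr_def)
 let ?g = "\<lambda>x. v x $ i * v x $ j * v (x - y) $ k"
 have p: "periodic ?g"
  using v_periodic periodic_shift'[OF v_periodic, of y] by (simp add: periodic_def)
 show "integrable torus (\<lambda>x. v (x + y) $ i * v (x + y) $ j * v x $ k)"
  using integral_torus_shift(2)[OF _ p, of y] int[of y] by simp
 show "(\<integral>x. v (x + y) $ i * v (x + y) $ j * v x $ k \<partial>torus) = cub i j k y"
  using integral_torus_shift(1)[OF _ p, of y] by (simp add: cub_def corr_def)
qed

text \<open>Expand the product of three differences. The two pure cubes cancel by translation
  invariance; of the mixed terms, those with two factors at \<open>x\<close> give correlations at
  \<open>- y\<close>, those with two factors at \<open>x + y\<close> give correlations at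
  \<open>y\<close>.\<close>

lemma inc3_cub:
 "inc3 i j k y = (cub i j k (- y) + cub i k j (- y) + cub j k i (- y)) - (cub i j k y + cub i k j y + cub j k i y)"
 and inc3_integrable: "integrable torus (\<lambda>x. increment y v x $ i * increment y v x $ j * increment y v x $ k)"
proof -
 have t0: "integrable torus (\<lambda>x. v x $ i * v x $ j * v x $ k)"
  using triple_integrable(1)[of i j 0 k] by simp
 have p0: "periodic (\<lambda>x. v x $ i * v x $ j * v x $ k)" using v_periodic by (simp add: periodic_def)
 have t1: "integrable torus (\<lambda>x. v (x + y) $ i * v (x + y) $ j * v (x + y) $ k)"
  using integral_torus_shift(2)[OF _ p0, of y] t0 by simp
 have t1': "(\<integral>x. v (x + y) $ i * v (x + y) $ j * v (x + y) $ k \<partial>torus) = (\<integral>x. v x $ i * v x $ j * v x $ k \<partial>torus)"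
  using integral_torus_shift(1)[OF _ p0, of y] by simp
 note ti = triple_integrable(1)[of i j y k] triple_integrable(1)[of i k y j] triple_integrable(1)[of j k y i]
  triple_integrable(3)[of y i j k] triple_integrable(3)[of y i k j] triple_integrable(3)[of y j k i]
 let ?e = "\<lambda>x. ((v (x + y) $ i * v (x + y) $ j * v (x + y) $ k - v x $ i * v x $ j * v x $ k)
   + (v x $ i * v x $ j * v (x + y) $ k + v x $ i * v x $ k * v (x + y) $ j + v x $ j * v x $ k * v (x + y) $ i))
   - (v (x + y) $ i * v (x + y) $ j * v x $ k + v (x + y) $ i * v (x + y) $ k * v x $ j + v (x + y) $ j * v (x + y) $ k * v x $ i)"
 have e: "increment y v x $ i * increment y v x $ j * increment y v x $ k = ?e x" for x
  by (simp add: increment_def algebra_simps)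
 have "integrable torus ?e"
  by (intro L1_add L1_diff t0 t1 ti)
 then show "integrable torus (\<lambda>x. increment y v x $ i * increment y v x $ j * increment y v x $ k)" by (simp only: e)
 have "(\<integral>x. ?e x \<partial>torus) = (((\<integral>x. v (x + y) $ i * v (x + y) $ j * v (x + y) $ k \<partial>torus) - (\<integral>x. v x $ i * v x $ j * v x $ k \<partial>torus))
   + (cub i j k (- y) + cub i k j (- y) + cub j k i (- y))) - (cub i j k y + cub i k j y + cub j k i y)"
  by (simp only: lint_add lint_diff L1_add
    L1_diff t0 t1 ti triple_integrable(2,4))
 then show "inc3 i j k y = (cub i j k (- y) + cub i k j (- y) + cub j k i (- y)) - (cub i j k y + cub i k j y + cub j k i y)"
  unfolding inc3_def e t1' by simp
qed

lemma inc3_continuous: "continuous_on UNIV (inc3 i j k)"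
proof -
 have c: "continuous_on UNIV (\<lambda>y. cub i j k (- y))" for i j k
  by (intro continuous_on_compose2[OF cub_continuous] continuous_intros) auto
 have "continuous_on UNIV (\<lambda>y. (cub i j k (- y) + cub i k j (- y) + cub j k i (- y)) - (cub i j k y + cub i k j y + cub j k i y))"
  by (intro continuous_intros c cub_continuous)
 moreover have "inc3 i j k = (\<lambda>y. (cub i j k (- y) + cub i k j (- y) + cub j k i (- y)) - (cub i j k y + cub i k j y + cub j k i y))"
  by (rule ext) (rule inc3_cub)
 ultimately show ?thesis by (simp only:)
qed

lemma inc3_sym: "inc3 i j k y = inc3 j i k y" "inc3 i j k y = inc3 i k j y"
 by (simp_all add: inc3_def mult_ac)

text \<open>Here the derivative index sits in the product, as in the term u_i u_k d_k of the weak
  formulation; minus this is the limit of the nonlinear term of the mollified balance.\<close>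

definition flux :: "real \<Rightarrow> real \<Rightarrow> real \<Rightarrow> real" where
 "flux a c l = (\<Sum>i\<in>UNIV. \<Sum>j\<in>UNIV. \<Sum>k\<in>UNIV. kbd a c l k i j (cub i k j))"

text \<open>The tensor is P(- y) - P(y) with P the sum of three correlations, so oddness of
  \<open>kbd\<close> gives the factor - 2. One of the three vanishes by incompressibility; the other
  two are both the flux, by the symmetry of the kernel in \<open>i\<close> and
  \<open>j\<close>.\<close>

lemma kbd_inc3:
 assumes l: "0 < l"
 shows "(\<Sum>i\<in>UNIV. \<Sum>j\<in>UNIV. \<Sum>k\<in>UNIV. kbd a c l k i j (inc3 i j k)) = - 4 * flux a c l"
proof -
 have lin: "kbd a c l k i j (\<lambda>x. r * E x + s * F x) = r * kbd a c l k i j E + s * kbd a c l k i j F"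
  if "continuous_on UNIV E" "continuous_on UNIV F" for i j k r s E F
  by (rule ball_functional_linear[OF kbd_functional[OF l] less_imp_le[OF l] that])
 let ?B = "\<lambda>i j k. kbd a c l k i j"
 have one: "?B i j k (inc3 i j k) = - 2 * (?B i j k (cub i j k) + ?B i j k (cub i k j) + ?B i j k (cub j k i))" for i j k
 proof -
  define P where "P y = cub i j k y + cub i k j y + cub j k i y" for y
  have Pc: "continuous_on UNIV P" unfolding P_def by (intro continuous_intros cub_continuous)
  have Pc': "continuous_on UNIV (\<lambda>y. P (- y))" by (intro continuous_on_compose2[OF Pc] continuous_intros) auto
  have "inc3 i j k = (\<lambda>y. 1 * P (- y) + (- 1) * P y)" by (simp add: fun_eq_iff inc3_cub P_def)
  then have "?B i j k (inc3 i j k) = ?B i j k (\<lambda>y. P (- y)) - ?B i j k P"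
   using lin[OF Pc' Pc, of k i j 1 "- 1"] by simp
  also have "\<dots> = - 2 * ?B i j k P" by (simp add: kbd_reflect[OF continuous_borel[OF Pc]])
  also have "?B i j k P = ?B i j k (cub i j k) + ?B i j k (cub i k j) + ?B i j k (cub j k i)"
  proof -
   have c2: "continuous_on UNIV (\<lambda>y. cub i j k y + cub i k j y)" by (intro continuous_intros cub_continuous)
   show ?thesis
    using lin[OF c2 cub_continuous[of j k i], of k i j 1 1] lin[OF cub_continuous[of i j k] cub_continuous[of i k j], of k i j 1 1]
    by (simp add: P_def[abs_def])
  qed
  finally show ?thesis .
 qed
 have "(\<Sum>i\<in>UNIV. \<Sum>j\<in>UNIV. \<Sum>k\<in>UNIV. ?B i j k (inc3 i j k))
   = - 2 * ((\<Sum>i\<in>UNIV. \<Sum>j\<in>UNIV. \<Sum>k\<in>UNIV. ?B i j k (cub i j k)) + flux a c l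
    + (\<Sum>i\<in>UNIV. \<Sum>j\<in>UNIV. \<Sum>k\<in>UNIV. ?B i j k (cub j k i)))"
  unfolding one by (simp only: flux_def sum.distrib sum_distrib_left[symmetric])
 also have "(\<Sum>i\<in>UNIV. \<Sum>j\<in>UNIV. \<Sum>k\<in>UNIV. ?B i j k (cub i j k)) = 0"
  by (simp add: kbd_divergence_free[OF l])
 also have "(\<Sum>i\<in>UNIV. \<Sum>j\<in>UNIV. \<Sum>k\<in>UNIV. ?B i j k (cub j k i)) = flux a c l"
 proof -
  have "(\<Sum>i\<in>UNIV. \<Sum>j\<in>UNIV. \<Sum>k\<in>UNIV. ?B i j k (cub j k i)) = (\<Sum>j\<in>UNIV. \<Sum>i\<in>UNIV. \<Sum>k\<in>UNIV. ?B i j k (cub j k i))"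
   by (rule sum.swap)
  also have "\<dots> = flux a c l" unfolding flux_def by (intro sum.cong refl) (simp add: kmat_sym[of a c] dkmat_sym[of c])
  finally show ?thesis .
 qed
 finally show ?thesis by simp
qed

lemma increment_cube_bound:
 "integrable torus (\<lambda>x. (norm (increment y v x)) ^ 3)"
 "(\<integral>x. (norm (increment y v x)) ^ 3 \<partial>torus) \<le> 27 * (2 * (\<integral>x. (norm (v x)) ^ 3 \<partial>torus))"
proof -
 have s: "integrable torus (\<lambda>x. (norm (v (x + y))) ^ 3)" using in_LpD(3)[OF in_Lp_shift[OF norm_L3, of y]] by simp
 have s': "(\<integral>x. (norm (v (x + y))) ^ 3 \<partial>torus) = (\<integral>x. (norm (v x)) ^ 3 \<partial>torus)"
  using integral_shift_power[OF norm_L3, of "- y"] by simp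
 have b: "(norm (increment y v x)) ^ 3 \<le> 27 * ((norm (v (x + y))) ^ 3 + (norm (v x)) ^ 3)" for x
 proof -
  have "(norm (increment y v x)) ^ 3 \<le> (norm (v (x + y)) + norm (v x) + 0) ^ 3"
   using norm_triangle_ineq4[of "v (x + y)" "v x"] by (intro power_mono) (auto simp: increment_def)
  also have "\<dots> \<le> 3 ^ 3 * ((norm (v (x + y))) ^ 3 + (norm (v x)) ^ 3 + 0 ^ 3)" by (rule power_add3_le) auto
  finally show ?thesis by simp
 qed
 have i: "integrable torus (\<lambda>x. 27 * ((norm (v (x + y))) ^ 3 + (norm (v x)) ^ 3))" using s v_cube by simp
 show ii: "integrable torus (\<lambda>x. (norm (increment y v x)) ^ 3)"
  by (rule integrable_boundI[OF i]) (use b in \<open>auto simp: increment_def intro!: borel_measurable_torus\<close>)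
 have "(\<integral>x. (norm (increment y v x)) ^ 3 \<partial>torus) \<le> (\<integral>x. 27 * ((norm (v (x + y))) ^ 3 + (norm (v x)) ^ 3) \<partial>torus)"
  by (rule integral_mono[OF ii i b])
 then show "(\<integral>x. (norm (increment y v x)) ^ 3 \<partial>torus) \<le> 27 * (2 * (\<integral>x. (norm (v x)) ^ 3 \<partial>torus))"
  using s s' v_cube by simp
qed

section \<open>From the flux to the structure functions\<close>

definition longitudinal :: "kind \<Rightarrow> real \<Rightarrow> real ^ 'n \<Rightarrow> real ^ 'n \<Rightarrow> real" where
 "longitudinal b l y x = (increment (l *\<^sub>R y) v x \<bullet> y)
   * (wt1 b * (norm (increment (l *\<^sub>R y) v x))\<^sup>2 + wt2 b * ((increment (l *\<^sub>R y) v x \<bullet> y)\<^sup>2 / (norm y)\<^sup>2))"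

text \<open>The spherical average has to be outermost, because the kernel functional integrates over
  displacements a tensor already integrated in space. The cubic bound on increments, uniform in the
  displacement, justifies Fubini's theorem.\<close>

lemma structure_function_swap:
 "structure_function b v l = prefactor b (real CARD('n)) / (real CARD('n) * unit_ball_volume TYPE('n))
   * (\<integral>w. sphere_weight w * (\<integral>x. longitudinal b l (w /\<^sub>R norm w) x \<partial>torus) \<partial>lborel)"
proof -
 interpret P: pair_sigma_finite "torus :: (real ^ 'n) measure" "lborel :: (real ^ 'n) measure" ..
 let ?f = "\<lambda>(x, w). sphere_weight w * longitudinal b l (w /\<^sub>R norm w) x"
 have [measurable]: "(sphere_weight :: real ^ 'n \<Rightarrow> real) \<in> borel_measurable borel" unfolding sphere_weight_def by measurable
 have meas: "?f \<in> borel_measurable (torus \<Otimes>\<^sub>M lborel)"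
  unfolding longitudinal_def increment_def by (rule borel_pair_torus_lborel) measurable
 have w1: "\<bar>wt1 b\<bar> \<le> 1" "\<bar>wt2 b\<bar> \<le> 1" by (cases b; simp)+
 have bnd: "\<bar>longitudinal b l (w /\<^sub>R norm w) x\<bar> \<le> 2 * (norm (increment (l *\<^sub>R (w /\<^sub>R norm w)) v x)) ^ 3" for w x
 proof -
  let ?y = "w /\<^sub>R norm w" and ?d = "increment (l *\<^sub>R (w /\<^sub>R norm w)) v x"
  have y: "norm ?y \<le> 1" using norm_unit_vector[of 1 w] by simp
  have dy: "\<bar>?d \<bullet> ?y\<bar> \<le> norm ?d * norm ?y" by (rule Cauchy_Schwarz_ineq2)
  also have "\<dots> \<le> norm ?d * 1" using y by (intro mult_left_mono) auto
  finally have dy1: "\<bar>?d \<bullet> ?y\<bar> \<le> norm ?d" by simp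
  have "(?d \<bullet> ?y)\<^sup>2 / (norm ?y)\<^sup>2 \<le> (norm ?d)\<^sup>2"
  proof (cases "norm ?y = 0")
   case False
   have "(?d \<bullet> ?y)\<^sup>2 \<le> (norm ?d * norm ?y)\<^sup>2" using dy by (metis abs_ge_zero power2_abs power_mono)
   then show ?thesis using False by (simp add: divide_le_eq power_mult_distrib del: norm_scaleR norm_eq_zero)
  qed (simp del: norm_scaleR norm_eq_zero)
  moreover have "\<bar>wt1 b * (norm ?d)\<^sup>2 + wt2 b * ((?d \<bullet> ?y)\<^sup>2 / (norm ?y)\<^sup>2)\<bar>
    \<le> \<bar>wt1 b\<bar> * (norm ?d)\<^sup>2 + \<bar>wt2 b\<bar> * ((?d \<bullet> ?y)\<^sup>2 / (norm ?y)\<^sup>2)"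
   by (rule order_trans[OF abs_triangle_ineq]) (simp add: abs_mult)
  moreover have "\<bar>wt1 b\<bar> * (norm ?d)\<^sup>2 \<le> 1 * (norm ?d)\<^sup>2" using w1 by (intro mult_right_mono) auto
  moreover have "\<bar>wt2 b\<bar> * ((?d \<bullet> ?y)\<^sup>2 / (norm ?y)\<^sup>2) \<le> 1 * ((?d \<bullet> ?y)\<^sup>2 / (norm ?y)\<^sup>2)" using w1 by (intro mult_right_mono) auto
  ultimately have "\<bar>wt1 b * (norm ?d)\<^sup>2 + wt2 b * ((?d \<bullet> ?y)\<^sup>2 / (norm ?y)\<^sup>2)\<bar> \<le> 2 * (norm ?d)\<^sup>2" by linarith
  then have "\<bar>?d \<bullet> ?y\<bar> * \<bar>wt1 b * (norm ?d)\<^sup>2 + wt2 b * ((?d \<bullet> ?y)\<^sup>2 / (norm ?y)\<^sup>2)\<bar> \<le> norm ?d * (2 * (norm ?d)\<^sup>2)"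
   using dy1 by (intro mult_mono) auto
  then show ?thesis unfolding longitudinal_def abs_mult by (simp add: power3_eq_cube power2_eq_square mult_ac)
 qed
 have li: "integrable torus (longitudinal b l (w /\<^sub>R norm w))" for w
  by (rule integrable_boundI[OF integrable_mult_right[OF increment_cube_bound(1)] _ bnd])
    (unfold longitudinal_def increment_def, intro borel_measurable_torus, measurable)
 let ?K = "2 * (27 * (2 * (\<integral>x. (norm (v x)) ^ 3 \<partial>torus)))"
 have lb: "(\<integral>x. \<bar>longitudinal b l (w /\<^sub>R norm w) x\<bar> \<partial>torus) \<le> ?K" for w
 proof -
  have "(\<integral>x. \<bar>longitudinal b l (w /\<^sub>R norm w) x\<bar> \<partial>torus) \<le> (\<integral>x. 2 * (norm (increment (l *\<^sub>R (w /\<^sub>R norm w)) v x)) ^ 3 \<partial>torus)"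
   by (intro integral_mono integrable_abs li integrable_mult_right increment_cube_bound bnd)
  also have "\<dots> \<le> ?K" using increment_cube_bound(2)[of "l *\<^sub>R (w /\<^sub>R norm w)"] by simp
  finally show ?thesis .
 qed
 have sw: "0 \<le> sphere_weight w" for w :: "real ^ 'n" by (simp add: sphere_weight_def)
 have int: "integrable (torus \<Otimes>\<^sub>M lborel) ?f"
 proof -
  interpret Q: pair_sigma_finite "lborel :: (real ^ 'n) measure" "torus :: (real ^ 'n) measure" ..
  have meas': "(\<lambda>(w, x). ?f (x, w)) \<in> borel_measurable (lborel \<Otimes>\<^sub>M torus)"
   using measurable_compose[OF measurable_pair_swap' meas] by (simp add: split_def)
  have "integrable (lborel \<Otimes>\<^sub>M torus) (\<lambda>(w, x). ?f (x, w))"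
  proof (rule Q.Fubini_integrable[OF meas'])
   show "integrable lborel (\<lambda>w. \<integral>x. norm ((\<lambda>(w, x). ?f (x, w)) (w, x)) \<partial>torus)"
   proof (rule integrable_boundI[OF integrable_mult_left[OF sphere_weight_integrable, of ?K]])
    show "(\<lambda>w. \<integral>x. norm ((\<lambda>(w, x). ?f (x, w)) (w, x)) \<partial>torus) \<in> borel_measurable lborel"
     by (rule torus.borel_measurable_lebesgue_integral) (use meas' in \<open>simp add: split_def\<close>)
    show "\<bar>\<integral>x. norm ((\<lambda>(w, x). ?f (x, w)) (w, x)) \<partial>torus\<bar> \<le> sphere_weight w * ?K" for w
     using mult_left_mono[OF lb[of w] sw[of w]] sw[of w] by (simp add: abs_mult)
   qed
   show "AE w in lborel. integrable torus (\<lambda>x. (\<lambda>(w, x). ?f (x, w)) (w, x))" using li by simp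
  qed
  then show ?thesis using P.integrable_product_swap_iff[of ?f] by (simp add: split_def)
 qed
 have sa: "sphere_average (\<lambda>y. (increment (l *\<^sub>R y) v x \<bullet> y) * (norm (T_matrix b y *v increment (l *\<^sub>R y) v x))\<^sup>2)
   = 1 / (real CARD('n) * unit_ball_volume TYPE('n)) * (\<integral>w. ?f (x, w) \<partial>lborel)" for x
 proof -
  have "(\<integral>y. longitudinal b l y x \<partial>sphere_measure) = (\<integral>w. sphere_weight w * longitudinal b l (w /\<^sub>R norm w) x \<partial>lborel)"
   unfolding longitudinal_def increment_def by (rule sphere_integral_alt) measurable
  then show ?thesis by (simp add: sphere_average_def T_matrix_norm sphere_measure_total longitudinal_def)
 qed
 have "structure_function b v l = prefactor b (real CARD('n)) / (real CARD('n) * unit_ball_volume TYPE('n)) * (\<integral>x. \<integral>w. ?f (x, w) \<partial>lborel \<partial>torus)"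
  unfolding structure_function_def sa by simp
 also have "(\<integral>x. \<integral>w. ?f (x, w) \<partial>lborel \<partial>torus) = (\<integral>w. \<integral>x. ?f (x, w) \<partial>torus \<partial>lborel)"
  using P.Fubini_integral[of "\<lambda>x w. ?f (x, w)"] int by simp
 also have "\<dots> = (\<integral>w. sphere_weight w * (\<integral>x. longitudinal b l (w /\<^sub>R norm w) x \<partial>torus) \<partial>lborel)"
  by simp
 finally show ?thesis .
qed

text \<open>Full symmetry of \<open>inc3\<close> reduces all three contractions to the same trace,
  with coefficients - 2, 1 and 1.\<close>

lemma dkmat_inc3: "(\<Sum>i\<in>UNIV. \<Sum>j\<in>UNIV. \<Sum>k\<in>UNIV. dkmat c k i j z * inc3 i j k z') = 0"
proof -
 let ?F = "\<lambda>i j k. inc3 i j k z'"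
 have "(\<Sum>i\<in>UNIV. \<Sum>j\<in>UNIV. \<Sum>k\<in>UNIV. dkmat c k i j z * ?F i j k)
   = (\<Sum>i\<in>UNIV. \<Sum>j\<in>UNIV. \<Sum>k\<in>UNIV. (if i = j then - 2 * c * z $ k * ?F i j k else 0))
   + ((\<Sum>i\<in>UNIV. \<Sum>j\<in>UNIV. \<Sum>k\<in>UNIV. (if k = i then c * z $ j * ?F i j k else 0))
   + (\<Sum>i\<in>UNIV. \<Sum>j\<in>UNIV. \<Sum>k\<in>UNIV. (if k = j then c * z $ i * ?F i j k else 0)))"
  by (simp only: sum.distrib[symmetric]) (intro sum.cong refl, auto simp: dkmat_def algebra_simps)
 also have "(\<Sum>i\<in>UNIV. \<Sum>j\<in>UNIV. \<Sum>k\<in>UNIV. (if k = i then c * z $ j * ?F i j k else 0)) = (\<Sum>i\<in>UNIV. \<Sum>k\<in>UNIV. c * z $ k * ?F i i k)"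
  by (simp add: inc3_sym(2)[of _ _ _ z'])
 also have "(\<Sum>i\<in>UNIV. \<Sum>j\<in>UNIV. \<Sum>k\<in>UNIV. (if k = j then c * z $ i * ?F i j k else 0)) = (\<Sum>i\<in>UNIV. \<Sum>k\<in>UNIV. c * z $ k * ?F i i k)"
 proof -
  have "(\<Sum>i\<in>UNIV. \<Sum>j\<in>UNIV. \<Sum>k\<in>UNIV. (if k = j then c * z $ i * ?F i j k else 0)) = (\<Sum>i\<in>UNIV. \<Sum>j\<in>UNIV. c * z $ i * ?F i j j)"
   by simp
  also have "\<dots> = (\<Sum>j\<in>UNIV. \<Sum>i\<in>UNIV. c * z $ i * ?F i j j)" by (rule sum.swap)
  also have "\<dots> = (\<Sum>i\<in>UNIV. \<Sum>k\<in>UNIV. c * z $ k * ?F i i k)"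
   by (intro sum.cong refl) (metis inc3_sym)
  finally show ?thesis .
 qed
 also have "(\<Sum>i\<in>UNIV. \<Sum>j\<in>UNIV. \<Sum>k\<in>UNIV. (if i = j then - 2 * c * z $ k * ?F i j k else 0)) = (\<Sum>i\<in>UNIV. \<Sum>k\<in>UNIV. - 2 * c * z $ k * ?F i i k)"
 proof (rule sum.cong[OF refl])
  fix i
  have "(\<Sum>j\<in>UNIV. \<Sum>k\<in>UNIV. (if i = j then - 2 * c * z $ k * ?F i j k else 0)) = (\<Sum>j\<in>UNIV. if i = j then (\<Sum>k\<in>UNIV. - 2 * c * z $ k * ?F i j k) else 0)"
   by (intro sum.cong refl) auto
  then show "(\<Sum>j\<in>UNIV. \<Sum>k\<in>UNIV. (if i = j then - 2 * c * z $ k * ?F i j k else 0)) = (\<Sum>k\<in>UNIV. - 2 * c * z $ k * ?F i i k)"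
   by simp
 qed
 also have "(\<Sum>i\<in>UNIV. \<Sum>k\<in>UNIV. - 2 * c * z $ k * ?F i i k) + ((\<Sum>i\<in>UNIV. \<Sum>k\<in>UNIV. c * z $ k * ?F i i k) + (\<Sum>i\<in>UNIV. \<Sum>k\<in>UNIV. c * z $ k * ?F i i k)) = 0"
  by (simp add: sum.distrib[symmetric] algebra_simps)
 finally show ?thesis .
qed

text \<open>On the sphere the kernel is r (wt1 I + wt2 y y^T), so the contraction with three equal
  increments factors into the quadratic form and the component along \<open>y\<close>.\<close>

lemma kmat_inc3:
 assumes y: "norm y = 1" and ac: "a - c * l\<^sup>2 = r * wt1 b" "c * l\<^sup>2 = r * wt2 b"
 shows "(\<Sum>i\<in>UNIV. \<Sum>j\<in>UNIV. \<Sum>k\<in>UNIV. kmat a c i j (l *\<^sub>R y) * y $ k * inc3 i j k (l *\<^sub>R y))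
  = r * (\<integral>x. longitudinal b l y x \<partial>torus)"
proof -
 let ?d = "\<lambda>x. increment (l *\<^sub>R y) v x"
 have "(\<Sum>i\<in>UNIV. \<Sum>j\<in>UNIV. \<Sum>k\<in>UNIV. kmat a c i j (l *\<^sub>R y) * y $ k * inc3 i j k (l *\<^sub>R y))
  = (\<Sum>i\<in>UNIV. \<Sum>j\<in>UNIV. \<Sum>k\<in>UNIV. \<integral>x. kmat a c i j (l *\<^sub>R y) * y $ k * (?d x $ i * ?d x $ j * ?d x $ k) \<partial>torus)"
  by (simp add: inc3_def)
 also have "\<dots> = (\<integral>x. (\<Sum>i\<in>UNIV. \<Sum>j\<in>UNIV. \<Sum>k\<in>UNIV. kmat a c i j (l *\<^sub>R y) * y $ k * (?d x $ i * ?d x $ j * ?d x $ k)) \<partial>torus)"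
  using inc3_integrable[of "l *\<^sub>R y"]
  by (simp add: lint_sum L1_sum)
 also have "\<dots> = (\<integral>x. r * longitudinal b l y x \<partial>torus)"
 proof (rule lint_cong[OF refl])
  fix x
  have k: "(\<Sum>k\<in>UNIV. y $ k * ?d x $ k) = ?d x \<bullet> y" by (simp add: inner_vec_def mult.commute)
  have "kmat a c i j (l *\<^sub>R y) = (if i = j then r * wt1 b else 0) + (r * wt2 b) * (y $ i * y $ j)" for i j
   using y by (simp add: kmat_def power_mult_distrib flip: ac) (simp add: power2_eq_square)
  then have "(\<Sum>i\<in>UNIV. \<Sum>j\<in>UNIV. kmat a c i j (l *\<^sub>R y) * (?d x $ i * ?d x $ j))
   = (\<Sum>i\<in>UNIV. \<Sum>j\<in>UNIV. (if i = j then r * wt1 b * (?d x $ i * ?d x $ j) else 0))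
    + (\<Sum>i\<in>UNIV. \<Sum>j\<in>UNIV. (r * wt2 b) * ((y $ i * ?d x $ i) * (y $ j * ?d x $ j)))"
   by (simp only: sum.distrib[symmetric]) (intro sum.cong refl, auto simp: algebra_simps)
  also have "\<dots> = r * wt1 b * (\<Sum>i\<in>UNIV. ?d x $ i * ?d x $ i) + (r * wt2 b) * ((\<Sum>i\<in>UNIV. y $ i * ?d x $ i) * (\<Sum>i\<in>UNIV. y $ i * ?d x $ i))"
   unfolding sum_product sum_distrib_left[symmetric] by (simp add: sum_distrib_left)
  also have "\<dots> = r * wt1 b * (norm (?d x))\<^sup>2 + (r * wt2 b) * (?d x \<bullet> y)\<^sup>2"
  proof -
   have "(\<Sum>i\<in>UNIV. ?d x $ i * ?d x $ i) = (norm (?d x))\<^sup>2"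
    by (simp only: power2_norm_eq_inner inner_vec_def inner_real_def)
   then show ?thesis unfolding k by (simp add: power2_eq_square)
  qed
  finally have q: "(\<Sum>i\<in>UNIV. \<Sum>j\<in>UNIV. kmat a c i j (l *\<^sub>R y) * (?d x $ i * ?d x $ j)) = r * wt1 b * (norm (?d x))\<^sup>2 + (r * wt2 b) * (?d x \<bullet> y)\<^sup>2" .
  have "(\<Sum>i\<in>UNIV. \<Sum>j\<in>UNIV. \<Sum>k\<in>UNIV. kmat a c i j (l *\<^sub>R y) * y $ k * (?d x $ i * ?d x $ j * ?d x $ k))
   = (\<Sum>i\<in>UNIV. \<Sum>j\<in>UNIV. kmat a c i j (l *\<^sub>R y) * (?d x $ i * ?d x $ j)) * (\<Sum>k\<in>UNIV. y $ k * ?d x $ k)"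
   by (simp add: sum_distrib_left sum_distrib_right mult_ac)
  then show "(\<Sum>i\<in>UNIV. \<Sum>j\<in>UNIV. \<Sum>k\<in>UNIV. kmat a c i j (l *\<^sub>R y) * y $ k * (?d x $ i * ?d x $ j * ?d x $ k)) = r * longitudinal b l y x"
   unfolding q k by (simp add: longitudinal_def y algebra_simps)
 qed
 finally show ?thesis by simp
qed

text \<open>Only the sphere term of \<open>kbd\<close> survives in \<open>kbd_inc3\<close>. The four
  copies of the flux account for the 4 in the prefactors, and d times the ball volume is the area by
  which \<open>sphere_average\<close> divides.\<close>

theorem flux_structure_function:
 assumes l: "0 < l" and d: "2 \<le> CARD('n)"
 shows "- flux (kerA TYPE('n) b l) (kerC TYPE('n) b l) l = structure_function b v l / l"
proof -
 let ?a = "kerA TYPE('n) b l" and ?c = "kerC TYPE('n) b l" and ?d = "CARD('n)" and ?V = "unit_ball_volume TYPE('n)"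
 define r where "r = wt3 b (real ?d) / (?V * l ^ ?d)"
 have V: "0 < ?V" by (rule unit_ball_volume_pos)
 have c: "?c * l\<^sup>2 = r * wt2 b" using l V by (simp add: kerC_def r_def)
 have a: "?a - ?c * l\<^sup>2 = r * wt1 b" unfolding c by (simp add: kerA_def r_def distrib_left add_divide_distrib)
 let ?I = "\<integral>w. sphere_weight w * (\<integral>x. longitudinal b l (w /\<^sub>R norm w) x \<partial>torus) \<partial>lborel"
 have mF [measurable]: "inc3 i j k \<in> borel_measurable borel" for i j k
  by (rule continuous_borel[OF inc3_continuous])
 have mk [measurable]: "kmat ?a ?c i j \<in> borel_measurable borel" for i j
  by (rule continuous_borel[OF continuous_kmat])
 have sph: "(\<Sum>i\<in>UNIV. \<Sum>j\<in>UNIV. \<Sum>k\<in>UNIV. \<integral>y. kmat ?a ?c i j (l *\<^sub>R y) * y $ k * inc3 i j k (l *\<^sub>R y) \<partial>sphere_measure) = r * ?I"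
 proof -
  have cont: "continuous_on UNIV (\<lambda>y. kmat ?a ?c i j (l *\<^sub>R y) * y $ k * inc3 i j k (l *\<^sub>R y))" for i j k
   by (intro continuous_intros continuous_on_compose2[OF continuous_kmat] continuous_on_compose2[OF inc3_continuous]) auto
  have "(\<Sum>i\<in>UNIV. \<Sum>j\<in>UNIV. \<Sum>k\<in>UNIV. \<integral>y. kmat ?a ?c i j (l *\<^sub>R y) * y $ k * inc3 i j k (l *\<^sub>R y) \<partial>sphere_measure)
   = (\<integral>y. (\<Sum>i\<in>UNIV. \<Sum>j\<in>UNIV. \<Sum>k\<in>UNIV. kmat ?a ?c i j (l *\<^sub>R y) * y $ k * inc3 i j k (l *\<^sub>R y)) \<partial>sphere_measure)"
   by (simp add: sphere_integral_sum cont continuous_on_sum)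
  also have "\<dots> = (\<integral>w. sphere_weight w * (\<Sum>i\<in>UNIV. \<Sum>j\<in>UNIV. \<Sum>k\<in>UNIV. kmat ?a ?c i j (l *\<^sub>R (w /\<^sub>R norm w)) * (w /\<^sub>R norm w) $ k * inc3 i j k (l *\<^sub>R (w /\<^sub>R norm w))) \<partial>lborel)"
   by (rule sphere_integral_alt) measurable
  also have "\<dots> = (\<integral>w. r * (sphere_weight w * (\<integral>x. longitudinal b l (w /\<^sub>R norm w) x \<partial>torus)) \<partial>lborel)"
  proof (rule integral_cong_AE)
   have "AE w in lborel. w \<noteq> (0 :: real ^ 'n)" by (rule AE_lborel_singleton)
   then show "AE w in lborel. sphere_weight w * (\<Sum>i\<in>UNIV. \<Sum>j\<in>UNIV. \<Sum>k\<in>UNIV. kmat ?a ?c i j (l *\<^sub>R (w /\<^sub>R norm w)) * (w /\<^sub>R norm w) $ k * inc3 i j k (l *\<^sub>R (w /\<^sub>R norm w)))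
    = r * (sphere_weight w * (\<integral>x. longitudinal b l (w /\<^sub>R norm w) x \<partial>torus))"
   proof eventually_elim
    case (elim w)
    then have "norm (w /\<^sub>R norm w) = 1" by simp
    from kmat_inc3[OF this a c] show ?case by (simp only: mult.left_commute)
   qed
   have [measurable]: "(sphere_weight :: real ^ 'n \<Rightarrow> real) \<in> borel_measurable borel" unfolding sphere_weight_def by measurable
   show "(\<lambda>w. sphere_weight w * (\<Sum>i\<in>UNIV. \<Sum>j\<in>UNIV. \<Sum>k\<in>UNIV. kmat ?a ?c i j (l *\<^sub>R (w /\<^sub>R norm w)) * (w /\<^sub>R norm w) $ k * inc3 i j k (l *\<^sub>R (w /\<^sub>R norm w)))) \<in> borel_measurable lborel"
    by measurable
   have "(\<lambda>w. \<integral>x. longitudinal b l (w /\<^sub>R norm w) x \<partial>torus) \<in> borel_measurable borel"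
   proof (rule torus.borel_measurable_lebesgue_integral)
    have "(\<lambda>(x, w). longitudinal b l (w /\<^sub>R norm w) x) \<in> borel_measurable (torus \<Otimes>\<^sub>M lborel)"
     unfolding longitudinal_def increment_def by (rule borel_pair_torus_lborel) measurable
    from measurable_compose[OF measurable_pair_swap' this]
    show "(\<lambda>(w, x). longitudinal b l (w /\<^sub>R norm w) x) \<in> borel_measurable (borel \<Otimes>\<^sub>M torus)"
     by (simp add: split_def cong: measurable_cong_sets)
   qed
   then show "(\<lambda>w. r * (sphere_weight w * (\<integral>x. longitudinal b l (w /\<^sub>R norm w) x \<partial>torus))) \<in> borel_measurable lborel"
    by simp
  qed
  finally show ?thesis by simp
 qed
 have inn: "(\<Sum>i\<in>UNIV. \<Sum>j\<in>UNIV. \<Sum>k\<in>UNIV. wint l (dkmat ?c k i j) (inc3 i j k)) = 0"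
 proof -
  have i: "integrable lborel (\<lambda>z. indicator (ball 0 l) z * (dkmat ?c k i j z * inc3 i j k z))" for i j k
   by (intro integrable_continuous_ball continuous_intros continuous_dkmat inc3_continuous)
  have "(\<Sum>i\<in>UNIV. \<Sum>j\<in>UNIV. \<Sum>k\<in>UNIV. wint l (dkmat ?c k i j) (inc3 i j k))
   = (\<integral>z. (\<Sum>i\<in>UNIV. \<Sum>j\<in>UNIV. \<Sum>k\<in>UNIV. indicator (ball 0 l) z * (dkmat ?c k i j z * inc3 i j k z)) \<partial>lborel)"
   by (simp only: wint_def mult.assoc integral_sum3[OF i])
  also have "\<dots> = (\<integral>z. 0 \<partial>(lborel :: (real ^ 'n) measure))"
   by (simp only: sum_distrib_left[symmetric] dkmat_inc3 mult_zero_right)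
  also have "\<dots> = 0" by simp
  finally show ?thesis .
 qed
 have "- 4 * flux ?a ?c l = l ^ (?d - 1) * (r * ?I)"
  unfolding kbd_inc3[OF l, symmetric] wbd_def
  by (simp only: sum_subtractf inn sum_distrib_left[symmetric] sph diff_0_right)
 then have "- flux ?a ?c l = l ^ (?d - 1) * r * ?I / 4" by simp
 also have "l ^ (?d - 1) * r = wt3 b (real ?d) / (?V * l)"
 proof -
  have "l ^ ?d = l ^ (?d - 1) * l" by (simp add: power_eq_if)
  then show ?thesis using l V by (simp add: r_def)
 qed
 also have "wt3 b (real ?d) / (?V * l) * ?I / 4 = structure_function b v l / l"
 proof -
  have D: "real ?d \<noteq> 0" "real ?d - 1 \<noteq> 0" using d by linarith+
  have "wt3 b D / 4 = prefactor b D / D" if "D \<noteq> 0" for D :: real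
  proof -
   have c: "D * X / Y / D = X / Y" for X Y :: real using that by simp
   have m: "X / (D - 1) / 4 = X / (4 * (D - 1))" for X :: real by (simp only: divide_divide_eq_left mult.commute)
   show ?thesis
   proof (cases b)
    case Kind_I then show ?thesis using that by simp
   next
    case Kind_L then show ?thesis using c[of "D + 2" 12] by simp
   next
    case Kind_T then show ?thesis using c[of "D + 2" "4 * (D - 1)"] m[of "D + 2"] by (simp only: wt3.simps prefactor.simps)
   qed
  qed
  note p = this[OF D(1)]
  have 1: "W / X * I / 4 = (W / 4) / X * I" for W X I :: real by simp
  have 2: "P / D / (V * l) * I = (P / (D * V) * I) / l" for P D V I :: real by simp
  show ?thesis unfolding 1 p 2 structure_function_swap ..
 qed
 finally show ?thesis .
qed

end

section \<open>Functions of time\<close>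

lemma space_unit_time [simp]: "space unit_time = {0..1}"
 by (simp add: unit_time_def space_restrict_space)

interpretation unit_time: prob_space unit_time
 by standard (simp add: unit_time_def emeasure_restrict_space space_restrict_space)

text \<open>The indicator keeps all integrals on the single probability space
  \<open>unit_time\<close>, whatever the end point \<open>t\<close>.\<close>

definition tint :: "real \<Rightarrow> (real \<Rightarrow> real) \<Rightarrow> real" where
 "tint t \<phi> = (\<integral>r. indicator {0..t} r * \<phi> r \<partial>unit_time)"

lemma integral_unit_time: "(\<integral>r. \<phi> r \<partial>unit_time) = (LINT r:{0..1}|lborel. (\<phi> r :: real))"
 unfolding unit_time_def set_lebesgue_integral_def by (subst integral_restrict_space) auto

lemma integrable_unit_time: "integrable unit_time \<phi> \<longleftrightarrow> set_integrable lborel {0..1} (\<phi> :: real \<Rightarrow> real)"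
 unfolding unit_time_def by (subst integrable_restrict_space) (auto simp: set_integrable_def)

lemma set_integral_tint:
 assumes "t \<in> {0..1}"
 shows "(LINT r:{0..t}|lborel. \<phi> r) = tint t \<phi>"
 unfolding tint_def integral_unit_time set_lebesgue_integral_def
 using assms by (intro lint_cong) (auto simp: indicator_def)

lemma borel_measurable_unit_time: "f \<in> borel_measurable borel \<Longrightarrow> f \<in> borel_measurable unit_time"
 unfolding unit_time_def by (intro measurable_restrict_space1) simp

lemma indicator_unit_time [measurable]: "(indicator {0..t} :: real \<Rightarrow> real) \<in> borel_measurable unit_time"
 by (rule borel_measurable_unit_time) simp

lemma integrable_tint: "integrable unit_time \<phi> \<Longrightarrow> integrable unit_time (\<lambda>r. indicator {0..t} r * \<phi> r :: real)"
 by (rule integrable_real_mult_indicator[of "{0..t} \<inter> {0..1}", THEN Bochner_Integration.integrable_cong[THEN iffD1, rotated -1]])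
   (auto simp: unit_time_def sets_restrict_space indicator_def)

lemma continuous_unit_time:
 assumes c: "continuous_on {0..1} \<phi>"
 shows "\<phi> \<in> borel_measurable unit_time" and "integrable unit_time (\<phi> :: real \<Rightarrow> real)"
proof -
 show m: "\<phi> \<in> borel_measurable unit_time"
  using borel_measurable_continuous_on_restrict[OF c] unfolding unit_time_def
  by (simp cong: measurable_cong_sets add: sets_restrict_space)
 have "bounded (\<phi> ` {0..1})" by (intro compact_imp_bounded compact_continuous_image c) auto
 then obtain B where "\<forall>y\<in>\<phi> ` {0..1}. norm y \<le> B" unfolding bounded_iff by blast
 then have "AE r in unit_time. norm (\<phi> r) \<le> B" by (intro AE_I2) auto
 then show "integrable unit_time \<phi>" using m by (rule unit_time.integrable_const_bound)
qed

lemma integral_unit_time_HK: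
 assumes "integrable unit_time \<phi>" and t: "t \<in> {0..1}"
 shows "tint t \<phi> = integral {0..t} \<phi>" and "\<phi> integrable_on {0..t}"
proof -
 have i: "set_integrable lborel {0..1} \<phi>" using assms integrable_unit_time by simp
 have it: "set_integrable lborel {0..t} \<phi>" by (rule set_integrable_subset[OF i]) (use t in auto)
 show "tint t \<phi> = integral {0..t} \<phi>" "\<phi> integrable_on {0..t}"
  using set_borel_integral_eq_integral[OF it] set_integral_tint[OF t] by simp_all
qed

lemma tint_1: "tint 1 \<phi> = (\<integral>r. \<phi> r \<partial>unit_time)"
 unfolding tint_def by (intro lint_cong) auto

lemma continuous_tint:
 assumes "integrable unit_time \<phi>" shows "continuous_on {0..1} (\<lambda>t. tint t \<phi>)"
proof -
 have "continuous_on {0..1} (\<lambda>t. integral {0..t} \<phi>)"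
  by (rule indefinite_integral_continuous_1) (use integral_unit_time_HK(2)[OF assms, of 1] in simp)
 then show ?thesis by (rule continuous_on_eq) (simp add: integral_unit_time_HK(1)[OF assms])
qed

lemma tint_abs_le:
 assumes \<phi>: "integrable unit_time \<phi>"
 shows "\<bar>tint t \<phi>\<bar> \<le> (\<integral>r. \<bar>\<phi> r\<bar> \<partial>unit_time)"
proof -
 have "\<bar>tint t \<phi>\<bar> \<le> (\<integral>r. \<bar>indicator {0..t} r * \<phi> r\<bar> \<partial>unit_time)" unfolding tint_def by (rule integral_abs_bound)
 also have "\<dots> \<le> (\<integral>r. \<bar>\<phi> r\<bar> \<partial>unit_time)"
  using \<phi> by (intro integral_mono integrable_abs integrable_tint) (auto split: split_indicator)
 finally show ?thesis .
qed

lemma integrable_tensor: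
 fixes g h :: "real \<Rightarrow> real"
 assumes g: "integrable unit_time g" and h: "integrable unit_time h"
  and m: "F \<in> borel_measurable (unit_time \<Otimes>\<^sub>M unit_time)" and F: "\<And>r s. \<bar>F (r, s)\<bar> \<le> \<bar>g r\<bar> * \<bar>h s\<bar>"
 shows "integrable (unit_time \<Otimes>\<^sub>M unit_time) (F :: real \<times> real \<Rightarrow> real)"
proof -
 interpret P: pair_sigma_finite unit_time unit_time ..
 have i: "integrable unit_time (\<lambda>s. F (r, s))" if "r \<in> space unit_time" for r
  by (rule integrable_boundI[where g="\<lambda>s. \<bar>g r\<bar> * \<bar>h s\<bar>"])
    (use h F m that in \<open>auto intro: measurable_Pair2\<close>)
 show ?thesis
 proof (rule P.Fubini_integrable[OF m])
  show "integrable unit_time (\<lambda>r. \<integral>s. norm (F (r, s)) \<partial>unit_time)"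
  proof (rule integrable_boundI[where g="\<lambda>r. \<bar>g r\<bar> * (\<integral>s. \<bar>h s\<bar> \<partial>unit_time)"])
   show "integrable unit_time (\<lambda>r. \<bar>g r\<bar> * (\<integral>s. \<bar>h s\<bar> \<partial>unit_time))" using g by simp
   show "(\<lambda>r. \<integral>s. norm (F (r, s)) \<partial>unit_time) \<in> borel_measurable unit_time"
    by (rule unit_time.borel_measurable_lebesgue_integral) (use m in \<open>simp add: split_def\<close>)
   show "\<bar>\<integral>s. norm (F (r, s)) \<partial>unit_time\<bar> \<le> \<bar>g r\<bar> * (\<integral>s. \<bar>h s\<bar> \<partial>unit_time)" if "r \<in> space unit_time" for r
   proof -
    have "(\<integral>s. \<bar>F (r, s)\<bar> \<partial>unit_time) \<le> (\<integral>s. \<bar>g r\<bar> * \<bar>h s\<bar> \<partial>unit_time)"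
     using i[OF that] h F by (intro integral_mono) auto
    then show ?thesis by simp
   qed
  qed
  show "AE r in unit_time. integrable unit_time (\<lambda>s. F (r, s))" using i by (intro AE_I2)
 qed
qed

lemma AE_unit_time_neq: "AE r in unit_time. r \<noteq> s"
proof -
 have "AE r in lborel. r \<noteq> s" by (rule AE_lborel_singleton)
 then show ?thesis unfolding unit_time_def by (subst AE_restrict_space_iff) auto
qed

text \<open>Only integrability of the derivatives is available. The product of the two integrals is
  an integral over a square, split along the diagonal, which is a null set; each half is evaluated
  by Fubini's theorem in the matching order.\<close>

lemma product_rule:
 assumes g: "integrable unit_time g" and h: "integrable unit_time h" and t: "t \<in> {0..1}"
  and a: "\<And>r. r \<in> {0..1} \<Longrightarrow> a r = a0 + tint r g" and b: "\<And>r. r \<in> {0..1} \<Longrightarrow> b r = b0 + tint r h"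
 shows "a t * b t - a0 * b0 = tint t (\<lambda>r. g r * b r + a r * h r)"
  and "integrable unit_time (\<lambda>r. g r * b r + a r * h r)"
proof -
 interpret P: pair_sigma_finite unit_time unit_time ..
 have [measurable]: "g \<in> borel_measurable unit_time" "h \<in> borel_measurable unit_time" using g h by auto
 have id [measurable]: "(\<lambda>r. r) \<in> borel_measurable unit_time" by (rule borel_measurable_unit_time) simp
 have leq [measurable]: "(\<lambda>p. if snd p \<le> fst p then 1 else 0 :: real) \<in> borel_measurable (unit_time \<Otimes>\<^sub>M unit_time)"
 proof -
  have [measurable]: "fst \<in> borel_measurable (unit_time \<Otimes>\<^sub>M unit_time)" "snd \<in> borel_measurable (unit_time \<Otimes>\<^sub>M unit_time)"
   using measurable_compose[OF measurable_fst id] measurable_compose[OF measurable_snd id] by auto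
  show ?thesis by measurable
 qed
 have cb: "continuous_on {0..1} b" "continuous_on {0..1} a"
  using continuous_on_eq[OF continuous_on_add[OF continuous_on_const continuous_tint[OF h]], of b0 b]
   continuous_on_eq[OF continuous_on_add[OF continuous_on_const continuous_tint[OF g]], of a0 a] a b by auto
 have bounded_mult: "integrable unit_time (\<lambda>r. \<phi> r * c r)" if "integrable unit_time \<phi>" "continuous_on {0..1} c" for \<phi> c :: "real \<Rightarrow> real"
 proof -
  have "bounded (c ` {0..1})" by (intro compact_imp_bounded compact_continuous_image that) auto
  then obtain B where "\<forall>y\<in>c ` {0..1}. norm y \<le> B" unfolding bounded_iff by blast
  then have B: "\<And>r. r \<in> {0..1} \<Longrightarrow> \<bar>c r\<bar> \<le> B" by auto
  show ?thesis
  proof (rule integrable_boundI[where g="\<lambda>r. \<bar>\<phi> r\<bar> * B"])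
   show "(\<lambda>r. \<phi> r * c r) \<in> borel_measurable unit_time"
    using that continuous_unit_time(1)[OF that(2)] by (intro borel_measurable_times) auto
   show "\<bar>\<phi> r * c r\<bar> \<le> \<bar>\<phi> r\<bar> * B" if "r \<in> space unit_time" for r
    using B[of r] that by (simp add: abs_mult mult_left_mono)
  qed (use that in auto)
 qed
 have i1: "integrable unit_time (\<lambda>r. g r * b r)" by (rule bounded_mult[OF g cb(1)])
 have i2: "integrable unit_time (\<lambda>r. a r * h r)" using bounded_mult[OF h cb(2)] by (simp add: mult.commute)
 show "integrable unit_time (\<lambda>r. g r * b r + a r * h r)" using i1 i2 by simp
 let ?G = "\<lambda>r. indicator {0..t} r * g r" and ?H = "\<lambda>r. indicator {0..t} r * h r"
 let ?F = "\<lambda>p. ?G (fst p) * ?H (snd p)"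
 \<comment> \<open>The triangles below and above the diagonal.\<close>
 let ?L = "\<lambda>p. ?F p * (if snd p \<le> fst p then 1 else 0)" and ?U = "\<lambda>p. ?F p * (1 - (if snd p \<le> fst p then 1 else 0))"
 have iL: "integrable (unit_time \<Otimes>\<^sub>M unit_time) ?L" and iU: "integrable (unit_time \<Otimes>\<^sub>M unit_time) ?U"
  by (rule integrable_tensor[OF integrable_tint[OF g, of t] integrable_tint[OF h, of t]]; simp add: abs_mult)+
 have L: "(\<integral>p. ?L p \<partial>(unit_time \<Otimes>\<^sub>M unit_time)) = tint t (\<lambda>r. g r * tint r h)"
 proof -
  have "(\<integral>p. ?L p \<partial>(unit_time \<Otimes>\<^sub>M unit_time)) = (\<integral>r. \<integral>s. ?L (r, s) \<partial>unit_time \<partial>unit_time)"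
   by (rule P.integral_fst'[OF iL, symmetric])
  also have "\<dots> = (\<integral>r. indicator {0..t} r * (g r * tint r h) \<partial>unit_time)"
  proof (rule lint_cong[OF refl])
   fix r assume "r \<in> space unit_time"
   have "(\<integral>s. ?L (r, s) \<partial>unit_time) = (\<integral>s. ?G r * (indicator {0..r} s * h s) \<partial>unit_time)"
    by (intro lint_cong refl) (auto simp: indicator_def)
   then show "(\<integral>s. ?L (r, s) \<partial>unit_time) = indicator {0..t} r * (g r * tint r h)" by (simp add: tint_def mult.assoc)
  qed
  finally show ?thesis by (simp add: tint_def)
 qed
 have U: "(\<integral>p. ?U p \<partial>(unit_time \<Otimes>\<^sub>M unit_time)) = tint t (\<lambda>s. tint s g * h s)"
 proof -
  have "(\<integral>p. ?U p \<partial>(unit_time \<Otimes>\<^sub>M unit_time)) = (\<integral>s. \<integral>r. ?U (r, s) \<partial>unit_time \<partial>unit_time)"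
   using P.integral_snd[of "\<lambda>r s. ?U (r, s)"] iU by (simp add: split_def)
  also have "\<dots> = (\<integral>s. indicator {0..t} s * (tint s g * h s) \<partial>unit_time)"
  proof (rule lint_cong[OF refl])
   fix s assume "s \<in> space unit_time"
   have "(\<integral>r. ?U (r, s) \<partial>unit_time) = (\<integral>r. ?H s * (indicator {0..s} r * g r) \<partial>unit_time)"
   proof (rule integral_cong_AE)
    show "AE r in unit_time. ?U (r, s) = ?H s * (indicator {0..s} r * g r)"
     using AE_unit_time_neq[of s] by eventually_elim (auto simp: indicator_def)
    show "(\<lambda>r. ?U (r, s)) \<in> borel_measurable unit_time"
     using \<open>s \<in> space unit_time\<close> by (intro measurable_compose[OF _ borel_measurable_integrable[OF iU], of "\<lambda>r. (r, s)"]) auto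
   qed measurable
   also have "\<dots> = ?H s * tint s g" unfolding tint_def by (rule integral_mult_right_zero)
   also have "\<dots> = indicator {0..t} s * (tint s g * h s)" by simp
   finally show "(\<integral>r. ?U (r, s) \<partial>unit_time) = indicator {0..t} s * (tint s g * h s)" .
  qed
  finally show ?thesis by (simp add: tint_def)
 qed
 have iF: "integrable (unit_time \<Otimes>\<^sub>M unit_time) ?F"
  by (rule integrable_tensor[OF integrable_tint[OF g, of t] integrable_tint[OF h, of t]]; simp add: abs_mult)
 have "(\<integral>p. ?F p \<partial>(unit_time \<Otimes>\<^sub>M unit_time)) = (\<integral>r. \<integral>s. ?F (r, s) \<partial>unit_time \<partial>unit_time)"
  by (rule P.integral_fst'[OF iF, symmetric])
 also have "\<dots> = tint t g * tint t h" by (simp add: tint_def)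
 finally have F: "(\<integral>p. ?F p \<partial>(unit_time \<Otimes>\<^sub>M unit_time)) = tint t g * tint t h" .
 have "(\<integral>p. ?F p \<partial>(unit_time \<Otimes>\<^sub>M unit_time)) = (\<integral>p. ?L p + ?U p \<partial>(unit_time \<Otimes>\<^sub>M unit_time))"
  by (intro lint_cong refl) (simp add: algebra_simps)
 also have "\<dots> = tint t (\<lambda>r. g r * tint r h) + tint t (\<lambda>s. tint s g * h s)"
  using iL iU L U by simp
 finally have main: "tint t g * tint t h = tint t (\<lambda>r. g r * tint r h) + tint t (\<lambda>s. tint s g * h s)" using F by simp
 have c: "integrable unit_time (\<lambda>r. g r * tint r h)" "integrable unit_time (\<lambda>r. tint r g * h r)"
  using bounded_mult[OF g continuous_tint[OF h]] bounded_mult[OF h continuous_tint[OF g]] by (simp_all add: mult.commute)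
 have "tint t (\<lambda>r. g r * b r + a r * h r) = (\<integral>r. b0 * (indicator {0..t} r * g r) + indicator {0..t} r * (g r * tint r h)
   + (a0 * (indicator {0..t} r * h r) + indicator {0..t} r * (tint r g * h r)) \<partial>unit_time)"
  unfolding tint_def[of t] by (intro lint_cong refl) (simp add: a b algebra_simps)
 also have "\<dots> = b0 * tint t g + tint t (\<lambda>r. g r * tint r h) + (a0 * tint t h + tint t (\<lambda>r. tint r g * h r))"
  using integrable_tint[OF g, of t] integrable_tint[OF h, of t] integrable_tint[OF c(1), of t] integrable_tint[OF c(2), of t]
  by (simp add: tint_def[of t])
 also have "\<dots> = a t * b t - a0 * b0" using main a[OF t] b[OF t] by (simp add: algebra_simps)
 finally show "a t * b t - a0 * b0 = tint t (\<lambda>r. g r * b r + a r * h r)" by simp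
qed

text \<open>Polynomials are uniformly dense, so \<open>b\<close> is orthogonal to itself; continuity
  turns the vanishing integral of its square into vanishing at every point.\<close>

lemma vanishing_moments:
 assumes b: "continuous_on {0..1} (b :: real \<Rightarrow> real)" and m: "\<And>k. (\<integral>r. r ^ k * b r \<partial>unit_time) = 0" and t: "t \<in> {0..1}"
 shows "b t = 0"
proof -
 have ib: "integrable unit_time (\<lambda>r. \<bar>b r\<bar>)" by (intro continuous_unit_time continuous_intros b)
 have sq: "(\<integral>r. b r * b r \<partial>unit_time) \<le> 0"
 proof (rule field_le_epsilon)
  fix e :: real assume e: "0 < e"
  define K where "K = (\<integral>r. \<bar>b r\<bar> \<partial>unit_time)"
  have K: "0 \<le> K" by (simp add: K_def)
  define \<eta> where "\<eta> = e / (K + 1)"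
  have \<eta>: "0 < \<eta>" using e K by (simp add: \<eta>_def)
  obtain p where p: "real_polynomial_function p" "\<And>x. x \<in> {0..1} \<Longrightarrow> \<bar>b x - p x\<bar> < \<eta>"
   using Stone_Weierstrass_real_polynomial_function[OF _ b \<eta>] by auto
  obtain c n where p_eq: "p = (\<lambda>x. \<Sum>i\<le>n. c i * x ^ i)" using p(1) real_polynomial_function_iff_sum by blast
  have pc: "continuous_on {0..1} p" unfolding p_eq by (intro continuous_intros)
  have ik: "integrable unit_time (\<lambda>r. r ^ k * b r)" for k by (intro continuous_unit_time continuous_intros b)
  have "(\<integral>r. p r * b r \<partial>unit_time) = (\<integral>r. (\<Sum>i\<le>n. c i * (r ^ i * b r)) \<partial>unit_time)"
   by (simp add: p_eq sum_distrib_right sum_distrib_left mult_ac)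
  also have "\<dots> = 0" using ik by (simp add: lint_sum m)
  finally have z: "(\<integral>r. p r * b r \<partial>unit_time) = 0" .
  have "(\<integral>r. b r * b r \<partial>unit_time) = (\<integral>r. (b r - p r) * b r \<partial>unit_time) + (\<integral>r. p r * b r \<partial>unit_time)"
   by (subst lint_add[symmetric])
     (auto intro!: continuous_unit_time continuous_intros b pc simp: algebra_simps)
  also have "(\<integral>r. (b r - p r) * b r \<partial>unit_time) \<le> (\<integral>r. \<eta> * \<bar>b r\<bar> \<partial>unit_time)"
  proof (rule integral_mono)
   fix r assume "r \<in> space unit_time"
   then have "\<bar>b r - p r\<bar> * \<bar>b r\<bar> \<le> \<eta> * \<bar>b r\<bar>" using p(2)[of r] by (intro mult_right_mono) auto
   then show "(b r - p r) * b r \<le> \<eta> * \<bar>b r\<bar>" by (metis abs_ge_self abs_mult order_trans)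
  qed (use ib in \<open>auto intro!: continuous_unit_time continuous_intros b pc\<close>)
  also have "\<dots> = \<eta> * K" by (simp add: K_def)
  also have "\<eta> * K \<le> e" using e K by (simp add: \<eta>_def field_simps)
  finally show "(\<integral>r. b r * b r \<partial>unit_time) \<le> 0 + e" using z by simp
 qed
 have c2: "continuous_on {0..1} (\<lambda>r. b r * b r)" by (intro continuous_intros b)
 have nn: "0 \<le> (\<integral>r. b r * b r \<partial>unit_time)" by (rule Bochner_Integration.integral_nonneg) simp
 have "(\<integral>r. b r * b r \<partial>unit_time) = integral {0..1} (\<lambda>r. b r * b r)"
  using integral_unit_time_HK(1)[OF continuous_unit_time(2)[OF c2], of 1] by (simp add: tint_1)
 then have "((\<lambda>r. b r * b r) has_integral 0) (cbox 0 1)"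
  using sq nn integrable_integral[OF integral_unit_time_HK(2)[OF continuous_unit_time(2)[OF c2], of 1]] by simp
 then have "b t * b t = 0"
  using c2 t by (intro has_integral_0_cbox_imp_0[of 0 1 "\<lambda>r. b r * b r"]) auto
 then show ?thesis by simp
qed

text \<open>The assumption is the weak formulation tested with powers of time. Integrating by parts,
  all moments of the defect \<open>B\<close> are multiples of its value at time 1, which is
  0.\<close>

lemma integral_from_moments:
 assumes a: "continuous_on {0..1} a" and g: "integrable unit_time g"
  and w: "\<And>k. (if k = 0 then a0 else 0) - a 1 + (\<integral>r. r ^ k * g r \<partial>unit_time) = - (\<integral>r. real k * r ^ (k - 1) * a r \<partial>unit_time)"
  and t: "t \<in> {0..1}"
 shows "a t = a0 + tint t g"
proof -
 define B where "B t = a t - a0 - tint t g" for t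
 have Bc: "continuous_on {0..1} B" unfolding B_def by (intro continuous_intros a continuous_tint g)
 \<comment> \<open>This is k = 0, a test function constant in time; the right-hand side then carries
   the factor 0.\<close>
 have B1: "B 1 = 0" using w[of 0] by (simp add: B_def tint_1)
 have mom: "(\<integral>r. r ^ k * B r \<partial>unit_time) = 0" for k
 proof -
  let ?h = "\<lambda>r :: real. real (Suc k) * r ^ k"
  have ih: "integrable unit_time ?h" by (intro continuous_unit_time continuous_intros)
  have pw: "r ^ Suc k = 0 + tint r ?h" if r: "r \<in> {0..1}" for r :: real
  proof -
   have "(?h has_integral (r ^ Suc k - 0 ^ Suc k)) {0..r}"
    using r by (intro fundamental_theorem_of_calculus) (auto intro!: derivative_eq_intros simp flip: has_real_derivative_iff_has_vector_derivative simp del: power_Suc)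
   then have "integral {0..r} ?h = r ^ Suc k - 0 ^ Suc k" by (rule integral_unique)
   then show ?thesis by (simp only: integral_unit_time_HK(1)[OF ih r]) simp
  qed
  have "tint 1 g * 1 ^ Suc k - 0 * 0 = tint 1 (\<lambda>r. g r * r ^ Suc k + tint r g * ?h r)"
   by (rule product_rule(1)[OF g ih]) (use pw in auto)
  also have "\<dots> = (\<integral>r. r ^ Suc k * g r + tint r g * ?h r \<partial>unit_time)" by (simp add: tint_1 mult.commute)
  also have "\<dots> = (\<integral>r. r ^ Suc k * g r \<partial>unit_time) + (\<integral>r. tint r g * ?h r \<partial>unit_time)"
  proof (rule lint_add)
   show "integrable unit_time (\<lambda>r. tint r g * ?h r)" by (intro continuous_unit_time continuous_intros continuous_tint g)
   show "integrable unit_time (\<lambda>r. r ^ Suc k * g r)"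
   proof (rule integrable_boundI[where g="\<lambda>r. \<bar>g r\<bar>"])
    show "(\<lambda>r. r ^ Suc k * g r) \<in> borel_measurable unit_time"
     by (rule borel_measurable_times[OF borel_measurable_unit_time borel_measurable_integrable[OF g]]) simp
    show "\<bar>r ^ Suc k * g r\<bar> \<le> \<bar>g r\<bar>" if "r \<in> space unit_time" for r
    proof -
     have "\<bar>r ^ Suc k\<bar> \<le> 1" using that by (simp add: power_abs power_le_one del: power_Suc)
     from mult_right_mono[OF this, of "\<bar>g r\<bar>"] show ?thesis by (simp add: abs_mult del: power_Suc)
    qed
   qed (use g in auto)
  qed
  finally have 1: "(\<integral>r. r ^ Suc k * g r \<partial>unit_time) = tint 1 g - (\<integral>r. tint r g * ?h r \<partial>unit_time)" by simp
  have 2: "- a 1 + (\<integral>r. r ^ Suc k * g r \<partial>unit_time) = - (\<integral>r. ?h r * a r \<partial>unit_time)"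
   using w[of "Suc k"] by simp
  have ia: "integrable unit_time (\<lambda>r. ?h r * a r)" "integrable unit_time (\<lambda>r. tint r g * ?h r)"
   by (intro continuous_unit_time continuous_intros a continuous_tint g)+
  have "(\<integral>r. ?h r * B r \<partial>unit_time) = (\<integral>r. ?h r * a r - a0 * ?h r - tint r g * ?h r \<partial>unit_time)"
   by (intro lint_cong refl) (simp add: B_def algebra_simps)
  also have "\<dots> = (\<integral>r. ?h r * a r \<partial>unit_time) - a0 * (\<integral>r. ?h r \<partial>unit_time) - (\<integral>r. tint r g * ?h r \<partial>unit_time)"
   using ia ih by (simp only: lint_diff L1_diff integrable_mult_right lint_mult_right_zero)
  also have "(\<integral>r. ?h r \<partial>unit_time) = 1" using pw[of 1] by (simp add: tint_1)
  also have "(\<integral>r. ?h r * a r \<partial>unit_time) - a0 * 1 - (\<integral>r. tint r g * ?h r \<partial>unit_time) = B 1"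
   using 1 2 by (simp add: B_def)
  finally have "(\<integral>r. real (Suc k) * (r ^ k * B r) \<partial>unit_time) = 0" using B1 by (simp add: mult.assoc)
  then show ?thesis by simp
 qed
 show ?thesis using vanishing_moments[OF Bc mom t] by (simp add: B_def)
qed

section \<open>Square-integrable fields\<close>

lemma epowr_ennreal: "0 \<le> a \<Longrightarrow> epowr (ennreal a) q = ennreal (a powr q)"
 by (simp add: epowr_def)

lemma epowr_inverse:
 assumes "0 < q" shows "epowr (epowr a (1 / q)) q = a"
proof (cases a)
 case (real r)
 then show ?thesis using assms by (simp add: epowr_def powr_powr)
qed (use assms in \<open>simp add: epowr_def\<close>)

lemma epowr_less_top: "epowr a q < \<top> \<longleftrightarrow> a < \<top>"
 by (simp add: epowr_def top.not_eq_extremum)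

lemma epowr_mono:
 assumes "a \<le> b" "0 \<le> q" shows "epowr a q \<le> epowr b q"
 using assms by (cases a; cases b) (auto simp: epowr_def powr_mono2 top_unique intro!: ennreal_leI)

lemma epowr_numeral_norm: "0 \<le> a \<Longrightarrow> epowr (ennreal a) (numeral n) = ennreal (a ^ numeral n)"
 by (cases "a = 0") (simp_all add: epowr_def powr_numeral)

definition vnrm :: "(real ^ 'n \<Rightarrow> 'b::real_normed_vector) \<Rightarrow> real" where
 "vnrm v = nrm (\<lambda>x. norm (v x))"

definition square_integrable :: "(real ^ 'n \<Rightarrow> 'b::{real_normed_vector, second_countable_topology}) \<Rightarrow> bool" where
 "square_integrable v \<longleftrightarrow> v \<in> borel_measurable borel \<and> periodic v \<and> integrable torus (\<lambda>x. (norm (v x))\<^sup>2)"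

lemma square_integrable_norm: "square_integrable v \<Longrightarrow> in_Lp 2 (\<lambda>x. norm (v x))"
 by (auto simp: square_integrable_def in_Lp_def periodic_def)

lemma L2_finite_iff:
 fixes v :: "real ^ 'n \<Rightarrow> 'b::{real_normed_vector, second_countable_topology}"
 assumes "v \<in> borel_measurable borel"
 shows "L2 v < \<infinity> \<longleftrightarrow> integrable torus (\<lambda>x. (norm (v x))\<^sup>2)"
 using borel_measurable_torus[OF assms]
 by (simp add: L2_def Lnorm_def epowr_less_top epowr_numeral_norm integrable_iff_bounded)

lemma L2_vnrm:
 assumes "integrable torus (\<lambda>x. (norm (v x))\<^sup>2)"
 shows "L2 v = ennreal (vnrm v)" and "l2norm v = vnrm v"
proof -
 have "(\<integral>\<^sup>+x. ennreal ((norm (v x))\<^sup>2) \<partial>torus) = ennreal (\<integral>x. (norm (v x))\<^sup>2 \<partial>torus)"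
  by (rule nn_integral_eq_integral[OF assms]) simp
 then show 1: "L2 v = ennreal (vnrm v)"
  by (simp add: L2_def Lnorm_def epowr_numeral_norm epowr_ennreal vnrm_def nrm_def powr_half_sqrt)
 show "l2norm v = vnrm v" by (simp add: 1 vnrm_def)
qed

lemma nrm_square: "(nrm v)\<^sup>2 = (\<integral>x. (v x)\<^sup>2 \<partial>torus)"
 by (simp add: nrm_def)

lemma vnrm_nonneg [simp]: "0 \<le> vnrm v" by (simp add: vnrm_def)

lemma nrm_mono:
 assumes "in_Lp 2 w" "v \<in> borel_measurable borel" "\<And>x. \<bar>v x\<bar> \<le> \<bar>w x\<bar>"
 shows "nrm v \<le> nrm w" and "periodic v \<Longrightarrow> in_Lp 2 v"
proof -
 have le: "(v x)\<^sup>2 \<le> (w x)\<^sup>2" for x using assms(3)[of x] by (simp add: abs_le_square_iff)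
 have i: "integrable torus (\<lambda>x. (v x)\<^sup>2)"
  by (rule integrable_boundI[OF in_L2_integrable[OF assms(1)]]) (use assms le in \<open>auto intro!: borel_measurable_torus\<close>)
 show "nrm v \<le> nrm w" unfolding nrm_def by (intro real_sqrt_le_mono integral_mono i in_L2_integrable[OF assms(1)] le)
 show "in_Lp 2 v" if "periodic v" using i that assms(2) by (simp add: in_Lp_def)
qed

lemma nrm_add:
 assumes v: "in_Lp 2 v" and w: "in_Lp 2 w"
 shows "nrm (\<lambda>x. v x + w x) \<le> nrm v + nrm w"
proof -
 have i: "integrable torus (\<lambda>x. (v x)\<^sup>2)" "integrable torus (\<lambda>x. (w x)\<^sup>2)" "integrable torus (\<lambda>x. v x * w x)"
  using in_L2_integrable[OF v] in_L2_integrable[OF w] cauchy_schwarz_torus(1)[OF v w] by auto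
 have "(\<integral>x. (v x + w x)\<^sup>2 \<partial>torus) = (\<integral>x. ((v x)\<^sup>2 + 2 * (v x * w x)) + (w x)\<^sup>2 \<partial>torus)"
  by (simp add: power2_sum algebra_simps)
 also have "\<dots> = (\<integral>x. (v x)\<^sup>2 \<partial>torus) + 2 * (\<integral>x. v x * w x \<partial>torus) + (\<integral>x. (w x)\<^sup>2 \<partial>torus)"
  using i by simp
 also have "\<dots> \<le> (nrm v)\<^sup>2 + 2 * (nrm v * nrm w) + (nrm w)\<^sup>2"
  using cauchy_schwarz_torus(2)[OF v w] by (simp add: nrm_square)
 also have "\<dots> = (nrm v + nrm w)\<^sup>2" by (simp add: power2_sum)
 finally have "nrm (\<lambda>x. v x + w x) \<le> sqrt ((nrm v + nrm w)\<^sup>2)" unfolding nrm_def[of "\<lambda>x. v x + w x"] by (rule real_sqrt_le_mono)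
 then show ?thesis by simp
qed

lemma square_integrable_diff:
 fixes v w :: "real ^ 'n \<Rightarrow> 'b::{real_normed_vector, second_countable_topology}"
 assumes v: "square_integrable v" and w: "square_integrable w"
 shows "square_integrable (\<lambda>x. v x - w x)" and "vnrm (\<lambda>x. v x - w x) \<le> vnrm v + vnrm w"
proof -
 have [measurable]: "v \<in> borel_measurable borel" "w \<in> borel_measurable borel" using v w by (auto simp: square_integrable_def)
 have p: "periodic (\<lambda>x. v x - w x)" using v w by (auto simp: square_integrable_def periodic_def)
 have wm: "in_Lp 2 (\<lambda>x. - norm (w x))" using square_integrable_norm[OF w] by (simp add: in_Lp_def periodic_def)
 have s: "in_Lp 2 (\<lambda>x. norm (v x) + norm (w x))"
  using in_Lp_diff[OF square_integrable_norm[OF v] wm] by simp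
 have le: "\<bar>norm (v x - w x)\<bar> \<le> \<bar>norm (v x) + norm (w x)\<bar>" for x using norm_triangle_ineq4[of "v x" "w x"] by simp
 have m: "(\<lambda>x. norm (v x - w x)) \<in> borel_measurable borel" by measurable
 have "in_Lp 2 (\<lambda>x. norm (v x - w x))" by (rule nrm_mono(2)[OF s m le]) (use p in \<open>simp add: periodic_def\<close>)
 then show "square_integrable (\<lambda>x. v x - w x)" using p by (simp add: square_integrable_def in_Lp_def)
 have "vnrm (\<lambda>x. v x - w x) \<le> nrm (\<lambda>x. norm (v x) + norm (w x))" unfolding vnrm_def by (rule nrm_mono(1)[OF s m le])
 also have "\<dots> \<le> vnrm v + vnrm w"
  unfolding vnrm_def by (intro nrm_add square_integrable_norm v w)
 finally show "vnrm (\<lambda>x. v x - w x) \<le> vnrm v + vnrm w" .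
qed

lemma square_integrable_shift:
 fixes v :: "real ^ 'n \<Rightarrow> 'b::{real_normed_vector, second_countable_topology}"
 assumes v: "square_integrable v"
 shows "square_integrable (\<lambda>x. v (x - y))" and "vnrm (\<lambda>x. v (x - y)) = vnrm v"
proof -
 have [measurable]: "v \<in> borel_measurable borel" using v by (auto simp: square_integrable_def)
 show "square_integrable (\<lambda>x. v (x - y))"
  using in_Lp_shift'[OF square_integrable_norm[OF v], of y] v periodic_shift'[of v y]
  by (simp add: square_integrable_def in_Lp_def)
 show "vnrm (\<lambda>x. v (x - y)) = vnrm v" unfolding vnrm_def by (rule nrm_shift[OF square_integrable_norm[OF v]])
qed

lemma square_integrable_component:
 fixes v :: "real ^ 'n \<Rightarrow> real ^ 'm"
 assumes v: "square_integrable v"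
 shows "in_Lp 2 (\<lambda>x. v x $ i)" and "nrm (\<lambda>x. v x $ i) \<le> vnrm v"
proof -
 have [measurable]: "v \<in> borel_measurable borel" using v by (auto simp: square_integrable_def)
 have m: "(\<lambda>x. v x $ i) \<in> borel_measurable borel" by measurable
 have p: "periodic (\<lambda>x. v x $ i)" using v by (simp add: square_integrable_def periodic_def)
 have le: "\<bar>v x $ i\<bar> \<le> \<bar>norm (v x)\<bar>" for x using component_le_norm_cart[of "v x" i] by simp
 show "in_Lp 2 (\<lambda>x. v x $ i)" by (rule nrm_mono(2)[OF square_integrable_norm[OF v] m le p])
 show "nrm (\<lambda>x. v x $ i) \<le> vnrm v" unfolding vnrm_def by (rule nrm_mono(1)[OF square_integrable_norm[OF v] m le])
qed

lemma square_integrable_matrix_component: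
 fixes v :: "real ^ 'n \<Rightarrow> real ^ 'm ^ 'k"
 assumes v: "square_integrable v"
 shows "in_Lp 2 (\<lambda>x. v x $ i $ j)" and "nrm (\<lambda>x. v x $ i $ j) \<le> vnrm v"
proof -
 have [measurable]: "v \<in> borel_measurable borel" using v by (auto simp: square_integrable_def)
 have c: "continuous_on UNIV (\<lambda>z :: real ^ 'm ^ 'k. z $ i $ j)" by (intro continuous_intros)
 have m: "(\<lambda>x. v x $ i $ j) \<in> borel_measurable borel"
  by (rule measurable_compose[OF _ continuous_borel[OF c]]) measurable
 have p: "periodic (\<lambda>x. v x $ i $ j)" using v by (simp add: square_integrable_def periodic_def)
 have le: "\<bar>v x $ i $ j\<bar> \<le> \<bar>norm (v x)\<bar>" for x
  using component_le_norm_cart[of "v x $ i" j] Finite_Cartesian_Product.norm_nth_le[of "v x" i] by simp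
 show "in_Lp 2 (\<lambda>x. v x $ i $ j)" by (rule nrm_mono(2)[OF square_integrable_norm[OF v] m le p])
 show "nrm (\<lambda>x. v x $ i $ j) \<le> vnrm v" unfolding vnrm_def by (rule nrm_mono(1)[OF square_integrable_norm[OF v] m le])
qed

lemma vnrm_diff_le:
 fixes v w :: "real ^ 'n \<Rightarrow> 'b::{real_normed_vector, second_countable_topology}"
 assumes v: "square_integrable v" and w: "square_integrable w"
 shows "\<bar>vnrm v - vnrm w\<bar> \<le> vnrm (\<lambda>x. v x - w x)"
proof -
 have "vnrm a \<le> vnrm (\<lambda>x. a x - b x) + vnrm b"
  if a: "square_integrable a" and b: "square_integrable b" for a b :: "real ^ 'n \<Rightarrow> 'b"
 proof -
  have d: "square_integrable (\<lambda>x. a x - b x)" by (rule square_integrable_diff(1)[OF a b])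
  have b': "square_integrable (\<lambda>x. - b x)" "vnrm (\<lambda>x. - b x) = vnrm b"
   using b by (auto simp: square_integrable_def periodic_def vnrm_def)
  show ?thesis using square_integrable_diff(2)[OF d b'(1)] b'(2) by simp
 qed
 from this[OF v w] this[OF w v]
 show ?thesis by (simp add: vnrm_def norm_minus_commute)
qed

text \<open>A real supremum is meaningful here because for square-integrable \<open>v\<close> the
  set is bounded by twice the norm.\<close>

definition modulus :: "real \<Rightarrow> (real ^ 'n \<Rightarrow> real ^ 'n) \<Rightarrow> real" where
 "modulus l v = (SUP y\<in>cball 0 l. vnrm (\<lambda>x. v (x - y) - v x))"

lemma modulus_bounds:
 assumes v: "square_integrable v" and l: "0 \<le> l"
 shows "norm y \<le> l \<Longrightarrow> vnrm (\<lambda>x. v (x - y) - v x) \<le> modulus l v"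
  and "modulus l v \<le> 2 * vnrm v" and "0 \<le> modulus l v"
proof -
 have b: "vnrm (\<lambda>x. v (x - y) - v x) \<le> 2 * vnrm v" for y
  using square_integrable_diff(2)[OF square_integrable_shift(1)[OF v] v, of y] square_integrable_shift(2)[OF v, of y] by simp
 have bdd: "bdd_above ((\<lambda>y. vnrm (\<lambda>x. v (x - y) - v x)) ` cball 0 l)" by (rule bdd_aboveI2[where M="2 * vnrm v"]) (rule b)
 show le: "vnrm (\<lambda>x. v (x - y) - v x) \<le> modulus l v" if "norm y \<le> l" for y
  unfolding modulus_def by (rule cSUP_upper[OF _ bdd]) (use that in simp)
 show "modulus l v \<le> 2 * vnrm v" unfolding modulus_def by (rule cSUP_least) (use l b in auto)
 show "0 \<le> modulus l v" by (rule order_trans[OF vnrm_nonneg le[of 0]]) (use l in simp)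
qed

lemma modulus_least:
 assumes "0 \<le> l" "\<And>y. norm y \<le> l \<Longrightarrow> vnrm (\<lambda>x. v (x - y) - v x) \<le> B"
 shows "modulus l v \<le> B"
 unfolding modulus_def by (rule cSUP_least) (use assms in auto)

text \<open>Lipschitz dependence on the field makes the modulus of \<open>u t\<close> continuous in
  time, hence measurable and integrable without further argument.\<close>

lemma modulus_diff:
 assumes v: "square_integrable v" and w: "square_integrable w" and l: "0 \<le> l"
 shows "\<bar>modulus l v - modulus l w\<bar> \<le> 2 * vnrm (\<lambda>x. v x - w x)"
proof -
 have "modulus l a \<le> modulus l b + 2 * vnrm (\<lambda>x. a x - b x)"
  if a: "square_integrable a" and b: "square_integrable b" for a b :: "real ^ 'n \<Rightarrow> real ^ 'n"
 proof (rule modulus_least[OF l])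
  fix y :: "real ^ 'n" assume y: "norm y \<le> l"
  have d: "square_integrable (\<lambda>x. a x - b x)" by (rule square_integrable_diff(1)[OF a b])
  have sa: "square_integrable (\<lambda>x. a (x - y) - a x)" and sb: "square_integrable (\<lambda>x. b (x - y) - b x)"
   by (intro square_integrable_diff square_integrable_shift a b)+
  have "vnrm (\<lambda>x. a (x - y) - a x) \<le> vnrm (\<lambda>x. b (x - y) - b x) + vnrm (\<lambda>x. (a (x - y) - a x) - (b (x - y) - b x))"
   using vnrm_diff_le[OF sa sb] by simp
  also have "(\<lambda>x. (a (x - y) - a x) - (b (x - y) - b x)) = (\<lambda>x. (a (x - y) - b (x - y)) - (a x - b x))"
   by (simp add: fun_eq_iff)
  also have "vnrm \<dots> \<le> 2 * vnrm (\<lambda>x. a x - b x)"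
   using square_integrable_diff(2)[OF square_integrable_shift(1)[OF d, of y] d] square_integrable_shift(2)[OF d, of y] by simp
  finally show "vnrm (\<lambda>x. a (x - y) - a x) \<le> modulus l b + 2 * vnrm (\<lambda>x. a x - b x)"
   using modulus_bounds(1)[OF b l y] by simp
 qed
 from this[OF v w] this[OF w v] show ?thesis by (simp add: vnrm_def norm_minus_commute)
qed

section \<open>Weak solutions tested with trigonometric polynomials\<close>

text \<open>The constant \<open>c\<close> closes this family of functions under all partial
  derivatives: the time derivative multiplies it by \<open>k\<close>. The induction for
  \<open>Ck\<close> rests on this.\<close>

lemma test_has_derivative:
 fixes \<psi> :: "real ^ 'n \<Rightarrow> real"
 assumes \<psi>: "trig \<psi>"
 shows "((\<lambda>p. (c * fst p ^ k * \<psi> (snd p)) *\<^sub>R (axis i 1 :: real ^ 'n)) has_derivative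
   (\<lambda>h. (c * (real k * fst p ^ (k - 1) * fst h) * \<psi> (snd p) + c * fst p ^ k * (\<Sum>j\<in>UNIV. pd (axis j 1) \<psi> (snd p) * snd h $ j)) *\<^sub>R axis i 1)) (at p)"
proof -
 have d1: "((\<lambda>p :: real \<times> (real ^ 'n). c * fst p ^ k) has_derivative (\<lambda>h. c * (real k * fst p ^ (k - 1) * fst h))) (at p)"
  by (auto intro!: derivative_eq_intros simp: mult_ac)
 have d2: "((\<lambda>p :: real \<times> (real ^ 'n). \<psi> (snd p)) has_derivative (\<lambda>h. \<Sum>j\<in>UNIV. pd (axis j 1) \<psi> (snd p) * snd h $ j)) (at p)"
  by (rule has_derivative_compose[of snd snd p UNIV \<psi>, simplified])
    (auto intro!: derivative_eq_intros trig_pd(2)[OF \<psi>])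
 show ?thesis
  by (rule has_derivative_eq_rhs[OF has_derivative_scaleR_left[OF has_derivative_mult[OF d1 d2]]])
    (simp add: fun_eq_iff add.commute)
qed

lemma test_pd:
 fixes \<psi> :: "real ^ 'n \<Rightarrow> real"
 assumes \<psi>: "trig \<psi>"
 shows "pd (1, 0) (\<lambda>p. (c * fst p ^ k * \<psi> (snd p)) *\<^sub>R (axis i 1 :: real ^ 'n)) = (\<lambda>p. ((c * real k) * fst p ^ (k - 1) * \<psi> (snd p)) *\<^sub>R axis i 1)"
  and "pd (0, axis j 1) (\<lambda>p. (c * fst p ^ k * \<psi> (snd p)) *\<^sub>R (axis i 1 :: real ^ 'n)) = (\<lambda>p. (c * fst p ^ k * pd (axis j 1) \<psi> (snd p)) *\<^sub>R axis i 1)"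
 using pd_eqI[OF test_has_derivative[OF \<psi>, of c k i]] by (simp_all add: fun_eq_iff sum_axis mult.assoc)

lemma test_Ck:
 fixes \<psi> :: "real ^ 'n \<Rightarrow> real"
 shows "trig \<psi> \<Longrightarrow> Ck n (\<lambda>p. (c * fst p ^ k * \<psi> (snd p)) *\<^sub>R (axis i 1 :: real ^ 'n))"
proof (induction n arbitrary: c k \<psi>)
 case 0
 show ?case unfolding Ck.simps
  by (intro continuous_intros continuous_on_compose2[OF trig_continuous[OF 0]]) auto
next
 case (Suc n)
 show ?case
  unfolding Ck.simps
 proof (intro conjI allI ballI)
  show "(\<lambda>p. (c * fst p ^ k * \<psi> (snd p)) *\<^sub>R (axis i 1 :: real ^ 'n)) differentiable at p" for p
   using test_has_derivative[OF Suc.prems, of c k i p] by (auto simp: differentiable_def)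
  fix e :: "real \<times> (real ^ 'n)" assume "e \<in> Basis"
  then consider "e = (1, 0)" | j where "e = (0, axis j 1)" by (auto simp: Basis_prod_def Basis_vec_def)
  then show "Ck n (pd e (\<lambda>p. (c * fst p ^ k * \<psi> (snd p)) *\<^sub>R (axis i 1 :: real ^ 'n)))"
   by cases (simp_all add: test_pd[OF Suc.prems] Suc.IH[OF Suc.prems] Suc.IH[OF trig_pd(1)[OF Suc.prems]])
 qed
qed

lemma test_function_monomial:
 fixes \<psi> :: "real ^ 'n \<Rightarrow> real"
 assumes \<psi>: "trig \<psi>"
 shows "test_function (\<lambda>p. (1 * fst p ^ k * \<psi> (snd p)) *\<^sub>R (axis i 1 :: real ^ 'n))"
 using test_Ck[OF \<psi>, of _ 1 k i] trig_periodic[OF \<psi>] unfolding test_function_def smooth_def periodic_def by simp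

abbreviation spacetime :: "(real \<times> (real ^ 'n)) measure" where
 "spacetime \<equiv> unit_time \<Otimes>\<^sub>M torus"

lemma spacetime_sectionD:
 assumes "spacetime_field w" "t \<in> {0..1}"
 shows "w t \<in> borel_measurable borel" "periodic (w t)"
proof -
 have "(\<lambda>x. w t x) \<in> borel_measurable torus"
  using assms measurable_Pair2[of "\<lambda>(t, x). w t x" unit_time torus borel t] by (auto simp: spacetime_field_def)
 then have "torus_field (w t)" using assms by (auto simp: torus_field_def spacetime_field_def)
 then show "w t \<in> borel_measurable borel" "periodic (w t)" by (auto simp: torus_field_borel torus_field_def)
qed

lemma spacetime_integral:
 fixes H :: "real \<times> (real ^ 'n) \<Rightarrow> real"
 assumes H: "integrable spacetime H" and \<eta>: "continuous_on {0..1} \<eta>"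
 shows "integrable unit_time (\<lambda>t. \<integral>x. H (t, x) \<partial>torus)"
  and "integrable spacetime (\<lambda>p. \<eta> (fst p) * H p)"
  and "(\<integral>p. \<eta> (fst p) * H p \<partial>spacetime) = (\<integral>t. \<eta> t * (\<integral>x. H (t, x) \<partial>torus) \<partial>unit_time)"
proof -
 interpret P: pair_sigma_finite unit_time "torus :: (real ^ 'n) measure" ..
 show "integrable unit_time (\<lambda>t. \<integral>x. H (t, x) \<partial>torus)" by (rule P.integrable_fst'[OF H])
 have "bounded (\<eta> ` {0..1})" by (intro compact_imp_bounded compact_continuous_image \<eta>) auto
 then obtain B where "\<forall>y\<in>\<eta> ` {0..1}. norm y \<le> B" unfolding bounded_iff by blast
 then have B: "\<And>r. r \<in> {0..1} \<Longrightarrow> \<bar>\<eta> r\<bar> \<le> B" by auto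
 show i: "integrable spacetime (\<lambda>p. \<eta> (fst p) * H p)"
 proof (rule integrable_boundI[where g="\<lambda>p. B * \<bar>H p\<bar>"])
  show "(\<lambda>p. \<eta> (fst p) * H p) \<in> borel_measurable spacetime"
   by (intro borel_measurable_times measurable_compose[OF measurable_fst continuous_unit_time(1)[OF \<eta>]] borel_measurable_integrable[OF H])
  show "\<bar>\<eta> (fst p) * H p\<bar> \<le> B * \<bar>H p\<bar>" if "p \<in> space spacetime" for p
   using B[of "fst p"] that by (auto simp: abs_mult space_pair_measure intro!: mult_right_mono)
 qed (use H in auto)
 show "(\<integral>p. \<eta> (fst p) * H p \<partial>spacetime) = (\<integral>t. \<eta> t * (\<integral>x. H (t, x) \<partial>torus) \<partial>unit_time)"
  using P.integral_fst'[OF i] by simp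
qed

lemma spacetime_mult_trig:
 fixes H :: "real \<times> (real ^ 'n) \<Rightarrow> real"
 assumes H: "integrable spacetime H" and \<psi>: "trig \<psi>"
 shows "integrable spacetime (\<lambda>p. \<psi> (snd p) * H p)"
proof -
 obtain B where B: "\<And>x. \<bar>\<psi> x\<bar> \<le> B" using trig_bounded[OF \<psi>] by blast
 show ?thesis
 proof (rule integrable_boundI[where g="\<lambda>p. B * \<bar>H p\<bar>"])
  show "(\<lambda>p. \<psi> (snd p) * H p) \<in> borel_measurable spacetime"
   by (intro borel_measurable_times measurable_compose[OF measurable_snd borel_measurable_torus[OF trig_borel[OF \<psi>]]] borel_measurable_integrable[OF H])
  show "\<bar>\<psi> (snd p) * H p\<bar> \<le> B * \<bar>H p\<bar>" for p using B by (simp add: abs_mult mult_right_mono)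
 qed (use H in auto)
qed

text \<open>The hypotheses on extended-valued norms in the form of integrability statements;
  \<open>leray_hopf_ns\<close> supplies them. The energy inequality is not included and enters only
  through \<open>energy_bounds\<close>.\<close>

locale ns =
 fixes \<nu> :: real and u0 :: "real ^ 'n \<Rightarrow> real ^ 'n" and f u :: "real \<Rightarrow> real ^ 'n \<Rightarrow> real ^ 'n"
  and G :: "real \<Rightarrow> real ^ 'n \<Rightarrow> real ^ 'n ^ 'n" and q :: "real \<Rightarrow> real ^ 'n \<Rightarrow> real"
 assumes weak: "weak_solution \<nu> u0 f u G q"
  and viscosity: "0 \<le> \<nu>"
  and u0_L2: "square_integrable u0"
  and f_field: "spacetime_field f"
  and u_L3: "integrable spacetime (\<lambda>(t, x). (norm (u t x)) ^ 3)"
  and G_L2: "integrable spacetime (\<lambda>(t, x). (norm (G t x))\<^sup>2)"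
  and f_L2: "AE t in unit_time. square_integrable (f t)"
  and f_L1L2: "integrable unit_time (\<lambda>t. vnrm (f t))"
  and f_L1: "integrable spacetime (\<lambda>(t, x). norm (f t x))"
begin

lemma fields: "spacetime_field u" "spacetime_field G" "spacetime_field q"
 using weak by (auto simp: weak_solution_def)

lemma u_L2: "t \<in> {0..1} \<Longrightarrow> square_integrable (u t)"
 using weak spacetime_sectionD[OF fields(1), of t] L2_finite_iff[of "u t"]
 by (auto simp: weak_solution_def continuous_L2_def square_integrable_def)

lemma u_continuous:
 assumes t: "t \<in> {0..1}"
 shows "((\<lambda>s. vnrm (\<lambda>x. u s x - u t x)) \<longlongrightarrow> 0) (at t within {0..1})"
proof -
 have "((\<lambda>s. L2 (\<lambda>x. u s x - u t x)) \<longlongrightarrow> 0) (at t within {0..1})"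
  using weak t by (auto simp: weak_solution_def continuous_L2_def)
 then have "((\<lambda>s. ennreal (vnrm (\<lambda>x. u s x - u t x))) \<longlongrightarrow> 0) (at t within {0..1})"
 proof (rule Lim_transform_within[where d=1])
  fix s :: real assume "s \<in> {0..1}"
  from square_integrable_diff(1)[OF u_L2[OF this] u_L2[OF t]]
  show "L2 (\<lambda>x. u s x - u t x) = ennreal (vnrm (\<lambda>x. u s x - u t x))"
   by (intro L2_vnrm) (simp add: square_integrable_def)
 qed simp_all
 then have "((\<lambda>s. ennreal (vnrm (\<lambda>x. u s x - u t x))) \<longlongrightarrow> ennreal 0) (at t within {0..1})" by simp
 then show ?thesis by (rule tendsto_ennrealD) (auto intro: always_eventually)
qed

lemma continuous_from_vnrm:
 assumes "\<And>s t. s \<in> {0..1} \<Longrightarrow> t \<in> {0..1} \<Longrightarrow> \<bar>\<phi> s - \<phi> t\<bar> \<le> K * vnrm (\<lambda>x. u s x - u t x)"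
 shows "continuous_on {0..1} (\<phi> :: real \<Rightarrow> real)"
 unfolding continuous_on_def
proof
 fix t :: real assume t: "t \<in> {0..1}"
 have lim: "((\<lambda>s. K * vnrm (\<lambda>x. u s x - u t x)) \<longlongrightarrow> 0) (at t within {0..1})"
  by (rule tendsto_mult_right_zero[OF u_continuous[OF t]])
 have "((\<lambda>s. \<phi> s - \<phi> t) \<longlongrightarrow> 0) (at t within {0..1})"
  by (rule Lim_null_comparison[OF _ lim]) (use assms t in \<open>auto simp: eventually_at_filter\<close>)
 then show "(\<phi> \<longlongrightarrow> \<phi> t) (at t within {0..1})" by (rule LIM_zero_cancel)
qed

lemma continuous_vnrm: "continuous_on {0..1} (\<lambda>t. vnrm (u t))"
 by (rule continuous_from_vnrm[where K=1]) (use vnrm_diff_le u_L2 in auto)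

lemma continuous_modulus: "0 \<le> l \<Longrightarrow> continuous_on {0..1} (\<lambda>t. modulus l (u t))"
 by (rule continuous_from_vnrm[where K=2]) (use modulus_diff u_L2 in auto)

lemma continuous_inner:
 assumes \<psi>: "trig \<psi>"
 shows "continuous_on {0..1} (\<lambda>t. \<integral>x. \<psi> x * u t x $ i \<partial>torus)"
proof (rule continuous_from_vnrm[where K="nrm \<psi>"])
 fix s t :: real assume st: "s \<in> {0..1}" "t \<in> {0..1}"
 have p: "in_Lp 2 \<psi>"
  using trig_borel[OF \<psi>] trig_periodic[OF \<psi>] trig_integrable[OF trig_power[OF \<psi>, of 2]] by (simp add: in_Lp_def)
 have d: "square_integrable (\<lambda>x. u s x - u t x)" by (intro square_integrable_diff u_L2 st)
 have "(\<integral>x. \<psi> x * u s x $ i \<partial>torus) - (\<integral>x. \<psi> x * u t x $ i \<partial>torus) = (\<integral>x. \<psi> x * (u s x - u t x) $ i \<partial>torus)"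
  using cauchy_schwarz_torus(1)[OF p square_integrable_component(1)[OF u_L2[OF st(1)]]]
   cauchy_schwarz_torus(1)[OF p square_integrable_component(1)[OF u_L2[OF st(2)]]]
  by (simp add: right_diff_distrib)
 also have "\<bar>\<dots>\<bar> \<le> nrm \<psi> * nrm (\<lambda>x. (u s x - u t x) $ i)"
  by (rule cauchy_schwarz_torus(2)[OF p square_integrable_component(1)[OF d]])
 also have "\<dots> \<le> nrm \<psi> * vnrm (\<lambda>x. u s x - u t x)"
  by (intro mult_left_mono square_integrable_component(2)[OF d]) simp
 finally show "\<bar>(\<integral>x. \<psi> x * u s x $ i \<partial>torus) - (\<integral>x. \<psi> x * u t x $ i \<partial>torus)\<bar> \<le> nrm \<psi> * vnrm (\<lambda>x. u s x - u t x)" .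
qed

lemma joint_measurable:
 "(\<lambda>p. u (fst p) (snd p)) \<in> borel_measurable spacetime" "(\<lambda>p. G (fst p) (snd p)) \<in> borel_measurable spacetime"
 "(\<lambda>p. q (fst p) (snd p)) \<in> borel_measurable spacetime" "(\<lambda>p. f (fst p) (snd p)) \<in> borel_measurable spacetime"
 using fields f_field by (auto simp: spacetime_field_def split_def)

lemma matrix_component_borel:
 fixes g :: "'a \<Rightarrow> real ^ 'n ^ 'n"
 assumes "g \<in> borel_measurable M" shows "(\<lambda>p. g p $ i $ j) \<in> borel_measurable M"
proof -
 have c: "continuous_on UNIV (\<lambda>z :: real ^ 'n ^ 'n. z $ i $ j)" by (intro continuous_intros)
 show ?thesis by (rule measurable_compose[OF assms continuous_borel[OF c]])
qed

lemma spacetime_integrable: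
 "integrable spacetime (\<lambda>p. u (fst p) (snd p) $ i * u (fst p) (snd p) $ k)"
 "integrable spacetime (\<lambda>p. u (fst p) (snd p) $ i)"
 "integrable spacetime (\<lambda>p. G (fst p) (snd p) $ i $ k)"
 "integrable spacetime (\<lambda>p. q (fst p) (snd p))"
 "integrable spacetime (\<lambda>p. f (fst p) (snd p) $ i)"
proof -
 interpret P: pair_prob_space unit_time "torus :: (real ^ 'n) measure" ..
 note [measurable] = joint_measurable
 have iu: "integrable spacetime (\<lambda>p. 1 + (norm (u (fst p) (snd p))) ^ 3)" using u_L3 by (simp add: split_def)
 have iG: "integrable spacetime (\<lambda>p. 1 + (norm (G (fst p) (snd p)))\<^sup>2)" using G_L2 by (simp add: split_def)
 have pw: "a ^ k \<le> 1 + a ^ 3" if "0 \<le> a" "k \<le> 3" for a :: real and k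
  by (cases "a \<le> 1") (use that in \<open>auto simp: power_le_one power_increasing add_increasing add_increasing2\<close>)
 have sq: "a \<le> 1 + a\<^sup>2" for a :: real
  using zero_le_power2[of "a - 1 / 2"] by (simp add: power2_diff) (simp add: power2_eq_square)
 show "integrable spacetime (\<lambda>p. u (fst p) (snd p) $ i * u (fst p) (snd p) $ k)"
 proof (rule integrable_boundI[OF iu])
  fix p
  have "\<bar>u (fst p) (snd p) $ i\<bar> * \<bar>u (fst p) (snd p) $ k\<bar> \<le> norm (u (fst p) (snd p)) * norm (u (fst p) (snd p))"
   by (intro mult_mono component_le_norm_cart) auto
  also have "\<dots> \<le> 1 + (norm (u (fst p) (snd p))) ^ 3" using pw[of "norm (u (fst p) (snd p))" 2] by (simp add: power2_eq_square)
  finally show "\<bar>u (fst p) (snd p) $ i * u (fst p) (snd p) $ k\<bar> \<le> 1 + (norm (u (fst p) (snd p))) ^ 3" by (simp add: abs_mult)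
 qed measurable
 show "integrable spacetime (\<lambda>p. u (fst p) (snd p) $ i)"
 proof (rule integrable_boundI[OF iu])
  show "\<bar>u (fst p) (snd p) $ i\<bar> \<le> 1 + (norm (u (fst p) (snd p))) ^ 3" for p
   using component_le_norm_cart[of "u (fst p) (snd p)" i] pw[of "norm (u (fst p) (snd p))" 1] by simp
 qed measurable
 show "integrable spacetime (\<lambda>p. G (fst p) (snd p) $ i $ k)"
 proof (rule integrable_boundI[OF iG])
  show "\<bar>G (fst p) (snd p) $ i $ k\<bar> \<le> 1 + (norm (G (fst p) (snd p)))\<^sup>2" for p
   using component_le_norm_cart[of "G (fst p) (snd p) $ i" k] Finite_Cartesian_Product.norm_nth_le[of "G (fst p) (snd p)" i]
    sq[of "norm (G (fst p) (snd p))"] by linarith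
  show "(\<lambda>p. G (fst p) (snd p) $ i $ k) \<in> borel_measurable spacetime"
   by (rule matrix_component_borel[OF joint_measurable(2)])
 qed
 show "integrable spacetime (\<lambda>p. q (fst p) (snd p))" using weak by (simp add: weak_solution_def split_def)
 show "integrable spacetime (\<lambda>p. f (fst p) (snd p) $ i)"
  by (rule integrable_boundI[OF f_L1[unfolded split_def]]) (measurable, rule component_le_norm_cart)
qed

text \<open>The density of the time derivative of the pairing of component \<open>i\<close> with
  \<psi>, as read off from the weak formulation.\<close>

definition rate_density :: "'n \<Rightarrow> (real ^ 'n \<Rightarrow> real) \<Rightarrow> real \<times> (real ^ 'n) \<Rightarrow> real" where
 "rate_density i \<psi> p = (\<Sum>k\<in>UNIV. pd (axis k 1) \<psi> (snd p) * (u (fst p) (snd p) $ i * u (fst p) (snd p) $ k))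
   + pd (axis i 1) \<psi> (snd p) * q (fst p) (snd p)
   - \<nu> * (\<Sum>k\<in>UNIV. pd (axis k 1) \<psi> (snd p) * G (fst p) (snd p) $ i $ k)
   + \<psi> (snd p) * f (fst p) (snd p) $ i"

lemma rate_density_integrable: "trig \<psi> \<Longrightarrow> integrable spacetime (rate_density i \<psi>)"
 unfolding rate_density_def
 by (intro L1_add L1_diff L1_sum
   integrable_mult_right spacetime_mult_trig spacetime_integrable trig_pd(1))

definition rate :: "'n \<Rightarrow> (real ^ 'n \<Rightarrow> real) \<Rightarrow> real \<Rightarrow> real" where
 "rate i \<psi> t = (\<integral>x. rate_density i \<psi> (t, x) \<partial>torus)"

lemma rate_integrable: "trig \<psi> \<Longrightarrow> integrable unit_time (rate i \<psi>)"
 unfolding rate_def by (rule spacetime_integral(1)[OF rate_density_integrable continuous_on_const[of _ 1]])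

lemma sum_scaled_axis: "(\<Sum>m\<in>UNIV. (a *\<^sub>R axis i 1) $ m * w m) = a * (w i :: real)"
 by (simp add: axis_def if_distrib[of "\<lambda>b. b * _"] if_distrib[of "\<lambda>b. _ * b"] cong: if_cong)

text \<open>Insert t^k \<psi>(x) times a unit vector as test function for every \<open>k\<close>;
  \<open>integral_from_moments\<close> turns these identities into one at each time.\<close>

lemma weak_scalar:
 assumes \<psi>: "trig \<psi>" and t: "t \<in> {0..1}"
 shows "(\<integral>x. \<psi> x * u t x $ i \<partial>torus) = (\<integral>x. \<psi> x * u0 x $ i \<partial>torus) + tint t (rate i \<psi>)"
proof (rule integral_from_moments[OF continuous_inner[OF \<psi>] rate_integrable[OF \<psi>] _ t])
 fix k
 let ?\<phi> = "\<lambda>p :: real \<times> (real ^ 'n). (1 * fst p ^ k * \<psi> (snd p)) *\<^sub>R (axis i 1 :: real ^ 'n)"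
 let ?F = "\<lambda>p. \<psi> (snd p) * f (fst p) (snd p) $ i" and ?U = "\<lambda>p. \<psi> (snd p) * u (fst p) (snd p) $ i"
 let ?H = "\<lambda>p. rate_density i \<psi> p - ?F p"
 have cp: "continuous_on {0..1} (\<lambda>t :: real. t ^ k)" "continuous_on {0..1} (\<lambda>t :: real. real k * t ^ (k - 1))"
  by (intro continuous_intros)+
 have iF: "integrable spacetime ?F" and iU: "integrable spacetime ?U"
  by (intro spacetime_mult_trig spacetime_integrable \<psi>)+
 have iH: "integrable spacetime ?H" by (intro L1_diff rate_density_integrable iF \<psi>)
 have W: "(\<integral>x. (\<Sum>m\<in>UNIV. ?\<phi> (0, x) $ m * u0 x $ m - ?\<phi> (1, x) $ m * u 1 x $ m) \<partial>torus)
    + (\<integral>(t, x). (\<Sum>m\<in>UNIV. ?\<phi> (t, x) $ m * f t x $ m) \<partial>spacetime)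
    = (\<integral>(t, x).
       - (\<Sum>m\<in>UNIV. dt ?\<phi> (t, x) $ m * u t x $ m)
       - (\<Sum>m\<in>UNIV. \<Sum>j\<in>UNIV. dx j ?\<phi> (t, x) $ m * u t x $ m * u t x $ j)
       - (\<Sum>m\<in>UNIV. dx m ?\<phi> (t, x) $ m * q t x)
       + \<nu> * (\<Sum>m\<in>UNIV. \<Sum>j\<in>UNIV. dx j ?\<phi> (t, x) $ m * G t x $ m $ j)
      \<partial>spacetime)"
  using weak test_function_monomial[OF \<psi>, of k i] unfolding weak_solution_def by blast
 \<comment> \<open>At time 0 the factor t^k is 1 for k = 0 and 0 otherwise.\<close>
 have w1: "(\<integral>x. (\<Sum>m\<in>UNIV. ?\<phi> (0, x) $ m * u0 x $ m - ?\<phi> (1, x) $ m * u 1 x $ m) \<partial>torus)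
   = (if k = 0 then (\<integral>x. \<psi> x * u0 x $ i \<partial>torus) else 0) - (\<integral>x. \<psi> x * u 1 x $ i \<partial>torus)"
 proof -
  have p: "in_Lp 2 \<psi>"
   using trig_borel[OF \<psi>] trig_periodic[OF \<psi>] trig_integrable[OF trig_power[OF \<psi>, of 2]] by (simp add: in_Lp_def)
  have i0: "integrable torus (\<lambda>x. \<psi> x * u0 x $ i)" "integrable torus (\<lambda>x. \<psi> x * u 1 x $ i)"
   using u_L2[of 1] u0_L2 by (auto intro!: cauchy_schwarz_torus(1)[OF p] square_integrable_component(1))
  have "(\<integral>x. (\<Sum>m\<in>UNIV. ?\<phi> (0, x) $ m * u0 x $ m - ?\<phi> (1, x) $ m * u 1 x $ m) \<partial>torus)
   = (\<integral>x. 0 ^ k * (\<psi> x * u0 x $ i) - \<psi> x * u 1 x $ i \<partial>torus)"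
   by (simp only: sum_subtractf sum_scaled_axis) (simp add: mult.assoc)
  then show ?thesis using i0 by simp
 qed
 have w2: "(\<integral>(t, x). (\<Sum>m\<in>UNIV. ?\<phi> (t, x) $ m * f t x $ m) \<partial>spacetime) = (\<integral>p. fst p ^ k * ?F p \<partial>spacetime)"
  by (simp only: sum_scaled_axis split_def fst_conv snd_conv prod.collapse) (simp add: mult.assoc)
 have w3: "(\<integral>(t, x).
       - (\<Sum>m\<in>UNIV. dt ?\<phi> (t, x) $ m * u t x $ m)
       - (\<Sum>m\<in>UNIV. \<Sum>j\<in>UNIV. dx j ?\<phi> (t, x) $ m * u t x $ m * u t x $ j)
       - (\<Sum>m\<in>UNIV. dx m ?\<phi> (t, x) $ m * q t x)
       + \<nu> * (\<Sum>m\<in>UNIV. \<Sum>j\<in>UNIV. dx j ?\<phi> (t, x) $ m * G t x $ m $ j)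
      \<partial>spacetime) = (\<integral>p. - (real k * fst p ^ (k - 1) * ?U p) - fst p ^ k * ?H p \<partial>spacetime)"
 proof (rule lint_cong[OF refl], unfold split_def fst_conv snd_conv prod.collapse)
  fix p :: "real \<times> (real ^ 'n)"
  have s: "(\<Sum>m\<in>UNIV. \<Sum>j\<in>UNIV. (a j *\<^sub>R axis i 1) $ m * w m j) = (\<Sum>j\<in>UNIV. a j * w i j)" for a :: "'n \<Rightarrow> real" and w :: "'n \<Rightarrow> 'n \<Rightarrow> real"
   by (subst sum.swap) (simp only: sum_scaled_axis)
  have s': "(\<Sum>m\<in>UNIV. (a m *\<^sub>R axis i 1) $ m * w) = a i * w" for a :: "'n \<Rightarrow> real" and w :: real
   by (simp add: axis_def if_distrib[of "\<lambda>b. b * _"] if_distrib[of "\<lambda>b. _ * b"] cong: if_cong)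
  show "- (\<Sum>m\<in>UNIV. dt ?\<phi> p $ m * u (fst p) (snd p) $ m)
       - (\<Sum>m\<in>UNIV. \<Sum>j\<in>UNIV. dx j ?\<phi> p $ m * u (fst p) (snd p) $ m * u (fst p) (snd p) $ j)
       - (\<Sum>m\<in>UNIV. dx m ?\<phi> p $ m * q (fst p) (snd p))
       + \<nu> * (\<Sum>m\<in>UNIV. \<Sum>j\<in>UNIV. dx j ?\<phi> p $ m * G (fst p) (snd p) $ m $ j)
     = - (real k * fst p ^ (k - 1) * ?U p) - fst p ^ k * ?H p"
   unfolding test_pd[OF \<psi>] mult.assoc[of "(_ *\<^sub>R _) $ _"] s s' sum_scaled_axis rate_density_def
   by (simp add: algebra_simps sum_distrib_left)
 qed
 have w4: "(\<integral>p. - (real k * fst p ^ (k - 1) * ?U p) - fst p ^ k * ?H p \<partial>spacetime)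
   = - (\<integral>t. real k * t ^ (k - 1) * (\<integral>x. ?U (t, x) \<partial>torus) \<partial>unit_time) - (\<integral>p. fst p ^ k * ?H p \<partial>spacetime)"
  using spacetime_integral(2,3)[OF iU cp(2)] spacetime_integral(2)[OF iH cp(1)] by simp
 have w5: "(\<integral>p. fst p ^ k * ?F p \<partial>spacetime) + (\<integral>p. fst p ^ k * ?H p \<partial>spacetime) = (\<integral>t. t ^ k * rate i \<psi> t \<partial>unit_time)"
  using spacetime_integral(2,3)[OF rate_density_integrable[OF \<psi>, of i] cp(1)] spacetime_integral(2)[OF iH cp(1)] spacetime_integral(2)[OF iF cp(1)]
  by (simp add: rate_def algebra_simps flip: lint_add)
 show "(if k = 0 then (\<integral>x. \<psi> x * u0 x $ i \<partial>torus) else 0) - (\<integral>x. \<psi> x * u 1 x $ i \<partial>torus) + (\<integral>r. r ^ k * rate i \<psi> r \<partial>unit_time)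
   = - (\<integral>r. real k * r ^ (k - 1) * (\<integral>x. \<psi> x * u r x $ i \<partial>torus) \<partial>unit_time)"
  using W unfolding w1 w2 w3 w4 w5[symmetric] by simp
qed

end

section \<open>The mollified energy balance\<close>

lemma trig_mult_integrable:
 assumes "trig \<psi>" and H: "in_Lp 1 H"
 shows "integrable torus (\<lambda>x. \<psi> x * H x)"
proof -
 obtain B where B: "\<And>x. \<bar>\<psi> x\<bar> \<le> B" using trig_bounded[OF assms(1)] by blast
 show ?thesis
 proof (rule integrable_boundI[where g="\<lambda>x. B * \<bar>H x\<bar>"])
  show "(\<lambda>x. \<psi> x * H x) \<in> borel_measurable torus"
   by (intro borel_measurable_times borel_measurable_torus trig_borel assms in_LpD(1)[OF H])
  show "\<bar>\<psi> x * H x\<bar> \<le> B * \<bar>H x\<bar>" for x using B by (simp add: abs_mult mult_right_mono)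
 qed (use in_LpD(3)[OF H] in simp)
qed

lemma separated_pd:
 fixes g h :: "nat \<Rightarrow> real ^ 'n \<Rightarrow> real"
 assumes m: "trig m" and g: "\<And>s. s < n \<Longrightarrow> trig (g s)"
  and eq: "\<And>x y. m (x - y) = (\<Sum>s<n. g s x * h s y)"
 shows "pd (axis k 1) m (x - y) = (\<Sum>s<n. pd (axis k 1) (g s) x * h s y)"
proof -
 have 1: "((\<lambda>x. m (x - y)) has_derivative (\<lambda>v. \<Sum>k\<in>UNIV. pd (axis k 1) m (x - y) * v $ k)) (at x)"
  by (rule has_derivative_compose[of "\<lambda>x. x - y" _ _ _ m, simplified])
    (auto intro!: derivative_eq_intros trig_pd(2)[OF m])
 have 2: "((\<lambda>x. \<Sum>s<n. g s x * h s y) has_derivative (\<lambda>v. \<Sum>s<n. (\<Sum>k\<in>UNIV. pd (axis k 1) (g s) x * v $ k) * h s y)) (at x)"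
  using g by (intro has_derivative_sum has_derivative_mult_left trig_pd(2)) auto
 from pd_eqI[OF 1, of "axis k 1"] pd_eqI[OF 2, of "axis k 1"] show ?thesis by (simp add: eq sum_axis)
qed

text \<open>Expresses a mollified pairing as a finite sum of products of scalar moments, to which
  the product rule in time applies.\<close>

lemma separated_pairing:
 fixes g h :: "nat \<Rightarrow> real ^ 'n \<Rightarrow> real"
 assumes m: "trig m" and gh: "\<And>s. s < n \<Longrightarrow> trig (g s)" "\<And>s. s < n \<Longrightarrow> trig (h s)"
  and eq: "\<And>x y. m (x - y) = (\<Sum>s<n. g s x * h s y)" and H: "in_Lp 1 H" and w: "in_Lp 1 w"
 shows "(\<Sum>s<n. (\<integral>x. g s x * H x \<partial>torus) * (\<integral>x. h s x * w x \<partial>torus)) = (\<integral>x. H x * conv m w x \<partial>torus)"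
  and "(\<Sum>s<n. (\<integral>x. pd (axis k 1) (g s) x * H x \<partial>torus) * (\<integral>x. h s x * w x \<partial>torus)) = (\<integral>x. H x * conv (pd (axis k 1) m) w x \<partial>torus)"
proof -
 have gen: "(\<Sum>s<n. (\<integral>x. G s x * H x \<partial>torus) * (\<integral>x. h s x * w x \<partial>torus)) = (\<integral>x. H x * conv M w x \<partial>torus)"
  if G: "\<And>s. s < n \<Longrightarrow> trig (G s)" and M: "\<And>x y. M (x - y) = (\<Sum>s<n. G s x * h s y)" for G :: "nat \<Rightarrow> real ^ 'n \<Rightarrow> real" and M
 proof -
  have c: "conv M w x = (\<Sum>s<n. G s x * (\<integral>y. h s y * w y \<partial>torus))" for x
  proof -
   have "conv M w x = (\<integral>y. (\<Sum>s<n. G s x * (h s y * w y)) \<partial>torus)"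
    by (simp add: conv_def M sum_distrib_right mult.assoc)
   also have "\<dots> = (\<Sum>s<n. G s x * (\<integral>y. h s y * w y \<partial>torus))"
    using trig_mult_integrable[OF gh(2) w] by (subst lint_sum) auto
   finally show ?thesis .
  qed
  have "(\<integral>x. H x * conv M w x \<partial>torus) = (\<integral>x. (\<Sum>s<n. (\<integral>y. h s y * w y \<partial>torus) * (G s x * H x)) \<partial>torus)"
   by (simp add: c sum_distrib_left mult_ac)
  also have "\<dots> = (\<Sum>s<n. (\<integral>y. h s y * w y \<partial>torus) * (\<integral>x. G s x * H x \<partial>torus))"
   using trig_mult_integrable[OF G H] by (subst lint_sum) auto
  finally show ?thesis by (simp add: mult.commute)
 qed
 show "(\<Sum>s<n. (\<integral>x. g s x * H x \<partial>torus) * (\<integral>x. h s x * w x \<partial>torus)) = (\<integral>x. H x * conv m w x \<partial>torus)"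
  by (rule gen[OF gh(1) eq])
 show "(\<Sum>s<n. (\<integral>x. pd (axis k 1) (g s) x * H x \<partial>torus) * (\<integral>x. h s x * w x \<partial>torus)) = (\<integral>x. H x * conv (pd (axis k 1) m) w x \<partial>torus)"
  by (rule gen[OF trig_pd(1)[OF gh(1)] separated_pd[OF m gh(1) eq]])
qed

text \<open>The weights are of order l^(-d) on a ball of volume V l^d, so the mass bound does not
  depend on \<open>l\<close>; the derivative costs one factor 1 / l.\<close>

lemma kernel_constant:
 "\<exists>K\<ge>0. \<forall>l>0. \<forall>i j k. ball_functional l K (kint (kerA TYPE('n) b l) (kerC TYPE('n) b l) l i j)
   \<and> ball_functional l (K / l) (kbd (kerA TYPE('n) b l) (kerC TYPE('n) b l) l (k :: 'n::finite) i j)"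
proof -
 let ?V = "unit_ball_volume TYPE('n)" and ?d = "CARD('n)"
 define A where "A = \<bar>wt3 b (real ?d) * (wt1 b + wt2 b) / ?V\<bar>"
 define C where "C = \<bar>wt3 b (real ?d) * wt2 b / ?V\<bar>"
 define K where "K = (real ?d * (A + 2 * C) + 4 * C) * ?V"
 have V: "0 < ?V" by (rule unit_ball_volume_pos)
 have AC: "0 \<le> A" "0 \<le> C" by (auto simp: A_def C_def)
 have mono: "ball_functional l M \<Phi> \<Longrightarrow> M \<le> M' \<Longrightarrow> ball_functional l M' \<Phi>" for l M M' and \<Phi> :: "(real ^ 'n \<Rightarrow> real) \<Rightarrow> real"
  unfolding ball_functional_def by (meson order_trans)
 have "ball_functional l K (kint (kerA TYPE('n) b l) (kerC TYPE('n) b l) l i j)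
   \<and> ball_functional l (K / l) (kbd (kerA TYPE('n) b l) (kerC TYPE('n) b l) l k i j)" if l: "0 < l" for l and i j k :: 'n
 proof -
  have a: "\<bar>kerA TYPE('n) b l\<bar> = A / l ^ ?d" using l V by (simp add: kerA_def A_def abs_mult)
  have c: "\<bar>kerC TYPE('n) b l\<bar> * l\<^sup>2 = C / l ^ ?d" using l V by (simp add: kerC_def C_def abs_mult)
  have ld: "l ^ ?d = l ^ (?d - 1) * l" by (simp add: power_eq_if)
  have "(\<bar>kerA TYPE('n) b l\<bar> + 2 * \<bar>kerC TYPE('n) b l\<bar> * l\<^sup>2) * l ^ ?d * ?V = (A + 2 * C) * ?V"
   using l by (simp add: a c mult.assoc add_divide_distrib[symmetric])
  also have "\<dots> \<le> K"
  proof -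
   have "1 * (A + 2 * C) \<le> real ?d * (A + 2 * C)" using AC by (intro mult_right_mono) auto
   then have s1: "A + 2 * C \<le> real ?d * (A + 2 * C)" by (simp only: mult_1)
   have "A + 2 * C \<le> real ?d * (A + 2 * C) + 4 * C" by (rule add_increasing2[OF _ s1]) (use AC in simp)
   then show ?thesis unfolding K_def using V by (intro mult_right_mono) auto
  qed
  finally have 1: "(\<bar>kerA TYPE('n) b l\<bar> + 2 * \<bar>kerC TYPE('n) b l\<bar> * l\<^sup>2) * l ^ ?d * ?V \<le> K" .
  have e1: "real ?d * l ^ (?d - 1) * (\<bar>kerA TYPE('n) b l\<bar> + 2 * \<bar>kerC TYPE('n) b l\<bar> * l\<^sup>2) = real ?d * (A + 2 * C) / l"
   using l by (simp add: a c mult.assoc add_divide_distrib[symmetric] ld)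
  have e2: "4 * \<bar>kerC TYPE('n) b l\<bar> * l * l ^ ?d = 4 * C / l"
  proof -
   have "\<bar>kerC TYPE('n) b l\<bar> * l * l ^ ?d = (\<bar>kerC TYPE('n) b l\<bar> * l\<^sup>2) * l ^ ?d / l"
    using l by (simp add: power2_eq_square)
   also have "\<dots> = C / l" unfolding c using l by simp
   finally show ?thesis by simp
  qed
  have 2: "(real ?d * l ^ (?d - 1) * (\<bar>kerA TYPE('n) b l\<bar> + 2 * \<bar>kerC TYPE('n) b l\<bar> * l\<^sup>2) + 4 * \<bar>kerC TYPE('n) b l\<bar> * l * l ^ ?d) * ?V \<le> K / l"
   unfolding e1 e2 K_def by (simp add: add_divide_distrib[symmetric])
  show ?thesis using mono[OF kint_functional[OF l] 1] mono[OF kbd_functional[OF l] 2] by blast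
 qed
 moreover have "0 \<le> K" using AC V by (simp add: K_def)
 ultimately show ?thesis by blast
qed

lemma kbd_const: "0 < l \<Longrightarrow> kbd a c l k i j (\<lambda>_. r) = 0"
 using wint_derivative[OF partial_kmat partial_const[of k r], of l a c i j] by (simp add: wint_def)

text \<open>For the viscous and forcing terms the limit \<open>L\<close> is merely selected
  pointwise, with no measurability known; a measurable version is built from the sequence, and only
  a bound is claimed. With \<open>L\<close> measurable the limit is identified.\<close>

lemma tint_limit_bound:
 assumes s: "\<And>N. s N \<in> borel_measurable unit_time" and w: "integrable unit_time w" and g: "integrable unit_time g"
  and b: "\<And>N. AE r in unit_time. \<bar>s N r\<bar> \<le> w r"
  and lim: "AE r in unit_time. (\<lambda>N. s N r) \<longlonglongrightarrow> L r" and L: "AE r in unit_time. \<bar>L r\<bar> \<le> g r"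
 shows "\<exists>I. (\<lambda>N. tint t (s N)) \<longlonglongrightarrow> I \<and> \<bar>I\<bar> \<le> (\<integral>r. g r \<partial>unit_time) \<and>
   (L \<in> borel_measurable unit_time \<longrightarrow> I = tint t L)"
proof -
 define f where "f r = lim (\<lambda>N. s N r)" for r
 have [measurable]: "f \<in> borel_measurable unit_time" unfolding f_def by (rule borel_measurable_lim_metric[OF s])
 have f: "AE r in unit_time. f r = L r" using lim by eventually_elim (simp add: f_def limI)
 note [measurable] = s
 have "(\<lambda>N. \<integral>r. indicator {0..t} r * s N r \<partial>unit_time) \<longlonglongrightarrow> (\<integral>r. indicator {0..t} r * f r \<partial>unit_time)"
 proof (rule integral_dominated_convergence[where w=w])
  show "AE r in unit_time. (\<lambda>N. indicator {0..t} r * s N r) \<longlonglongrightarrow> indicator {0..t} r * f r"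
   using lim f by eventually_elim (auto intro!: tendsto_intros)
  show "AE r in unit_time. norm (indicator {0..t} r * s N r) \<le> w r" for N
   using b[of N] by eventually_elim (auto simp: abs_mult split: split_indicator)
 qed (use w in measurable)
 moreover have "\<bar>\<integral>r. indicator {0..t} r * f r \<partial>unit_time\<bar> \<le> (\<integral>r. g r \<partial>unit_time)"
 proof -
  have a: "AE r in unit_time. \<bar>indicator {0..t} r * f r\<bar> \<le> g r"
   using f L by eventually_elim (auto simp: abs_mult split: split_indicator)
  have i: "integrable unit_time (\<lambda>r. indicator {0..t} r * f r)"
  proof (rule L1_bound[OF g])
   show "AE r in unit_time. norm (indicator {0..t} r * f r) \<le> norm (g r)" using a by eventually_elim simp
  qed measurable
  have "\<bar>\<integral>r. indicator {0..t} r * f r \<partial>unit_time\<bar> \<le> (\<integral>r. \<bar>indicator {0..t} r * f r\<bar> \<partial>unit_time)" by (rule integral_abs_bound)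
  also have "\<dots> \<le> (\<integral>r. g r \<partial>unit_time)" using i g a by (intro integral_mono_AE) auto
  finally show ?thesis .
 qed
 moreover have "(\<integral>r. indicator {0..t} r * f r \<partial>unit_time) = tint t L" if [measurable]: "L \<in> borel_measurable unit_time"
  unfolding tint_def
 proof (rule integral_cong_AE)
  show "AE r in unit_time. indicator {0..t} r * f r = indicator {0..t} r * L r" using f by eventually_elim simp
 qed measurable
 ultimately show ?thesis unfolding tint_def by blast
qed

section \<open>Evolution of the mollified quadratic form\<close>

context ns
begin

text \<open>Times at which all instantaneous integrability conditions hold; the exceptional times
  form a null set.\<close>

definition good :: "real \<Rightarrow> bool" where
 "good t \<longleftrightarrow> t \<in> {0..1} \<and> cubic_field (u t) \<and> square_integrable (G t) \<and> square_integrable (f t) \<and> in_Lp 1 (q t)"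

lemma AE_good: "AE t in unit_time. good t"
proof -
 interpret P: pair_sigma_finite unit_time "torus :: (real ^ 'n) measure" ..
 have 1: "AE t in unit_time. integrable torus (\<lambda>x. (norm (u t x)) ^ 3)" using P.AE_integrable_fst'[OF u_L3] by simp
 have 2: "AE t in unit_time. integrable torus (\<lambda>x. (norm (G t x))\<^sup>2)" using P.AE_integrable_fst'[OF G_L2] by simp
 have 3: "AE t in unit_time. integrable torus (q t)"
  using P.AE_integrable_fst'[OF spacetime_integrable(4)] by simp
 have 4: "AE t in unit_time. t \<in> {0..1}" by (rule AE_I2) simp
 from 1 2 3 4 f_L2 show ?thesis
 proof eventually_elim
  case (elim t)
  have "weakly_divergence_free (u t)" using weak elim(4) by (simp add: weak_solution_def)
  then have "cubic_field (u t)" using elim spacetime_sectionD[OF fields(1) elim(4)] by unfold_locales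
  then show ?case
   using elim spacetime_sectionD[OF fields(2) elim(4)] spacetime_sectionD[OF fields(3) elim(4)]
   by (simp add: good_def square_integrable_def in_Lp_def)
 qed
qed

lemma comp_L2:
 assumes "t \<in> {0..1}"
 shows "in_Lp 2 (\<lambda>x. u t x $ i)" "in_Lp 1 (\<lambda>x. u t x $ i)" "nrm (\<lambda>x. u t x $ i) \<le> vnrm (u t)"
 using square_integrable_component[OF u_L2[OF assms]] in_Lp_mono[of 2 "\<lambda>x. u t x $ i" 1] by auto

definition nonlin :: "'n \<Rightarrow> 'n \<Rightarrow> 'n \<Rightarrow> (real ^ 'n \<Rightarrow> real) \<Rightarrow> real \<Rightarrow> real" where
 "nonlin i k j m r = (\<integral>x. (u r x $ i * u r x $ k) * conv m (\<lambda>x. u r x $ j) x \<partial>torus)"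
definition press :: "'n \<Rightarrow> (real ^ 'n \<Rightarrow> real) \<Rightarrow> real \<Rightarrow> real" where
 "press j m r = (\<integral>x. q r x * conv m (\<lambda>x. u r x $ j) x \<partial>torus)"
definition visc :: "'n \<Rightarrow> 'n \<Rightarrow> 'n \<Rightarrow> (real ^ 'n \<Rightarrow> real) \<Rightarrow> real \<Rightarrow> real" where
 "visc i k j m r = (\<integral>x. G r x $ i $ k * conv m (\<lambda>x. u r x $ j) x \<partial>torus)"
definition forc :: "'n \<Rightarrow> 'n \<Rightarrow> (real ^ 'n \<Rightarrow> real) \<Rightarrow> real \<Rightarrow> real" where
 "forc i j m r = (\<integral>x. f r x $ i * conv m (\<lambda>x. u r x $ j) x \<partial>torus)"

lemma conv_measurable:
 assumes m: "m \<in> borel_measurable borel"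
 shows "(\<lambda>p. conv m (\<lambda>x. u (fst p) x $ j) (snd p)) \<in> borel_measurable spacetime"
proof -
 have id: "(\<lambda>x. x) \<in> measurable (torus :: (real ^ 'n) measure) borel" by (rule borel_measurable_torus) simp
 have uj: "(\<lambda>p. u (fst p) (snd p) $ j) \<in> borel_measurable spacetime" using joint_measurable(1) by measurable
 have map: "(\<lambda>z. (fst (fst z), snd z)) \<in> measurable (spacetime \<Otimes>\<^sub>M (torus :: (real ^ 'n) measure)) spacetime" by measurable
 have w: "(\<lambda>z. u (fst (fst z)) (snd z) $ j) \<in> borel_measurable (spacetime \<Otimes>\<^sub>M torus)"
  using measurable_compose[OF map uj] by simp
 have s: "(\<lambda>z. snd (fst z) - snd z) \<in> borel_measurable ((spacetime :: (real \<times> (real ^ 'n)) measure) \<Otimes>\<^sub>M (torus :: (real ^ 'n) measure))"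
 proof (rule borel_measurable_diff)
  show "(\<lambda>z. snd (fst z) :: real ^ 'n) \<in> borel_measurable ((spacetime :: (real \<times> (real ^ 'n)) measure) \<Otimes>\<^sub>M (torus :: (real ^ 'n) measure))"
  proof -
   have "(\<lambda>z. snd (fst z) :: real ^ 'n) \<in> measurable ((spacetime :: (real \<times> (real ^ 'n)) measure) \<Otimes>\<^sub>M (torus :: (real ^ 'n) measure)) (torus :: (real ^ 'n) measure)" by measurable
   from measurable_compose[OF this id] show ?thesis .
  qed
  show "snd \<in> borel_measurable ((spacetime :: (real \<times> (real ^ 'n)) measure) \<Otimes>\<^sub>M (torus :: (real ^ 'n) measure))"
   by (rule measurable_compose[OF measurable_snd id])
 qed
 have "(\<lambda>(p, y). m (snd p - y) * u (fst p) y $ j) \<in> borel_measurable (spacetime \<Otimes>\<^sub>M torus)"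
  using borel_measurable_times[OF measurable_compose[OF s m] w] by (simp add: split_def)
 then show ?thesis unfolding conv_def by (rule torus.borel_measurable_lebesgue_integral)
qed

lemma time_measurable:
 assumes m: "m \<in> borel_measurable borel"
 shows "nonlin i k j m \<in> borel_measurable unit_time" "visc i k j m \<in> borel_measurable unit_time" "forc i j m \<in> borel_measurable unit_time"
proof -
 note [measurable] = joint_measurable conv_measurable[OF m]
 have g [measurable]: "(\<lambda>p. G (fst p) (snd p) $ i $ k) \<in> borel_measurable spacetime" by (rule matrix_component_borel[OF joint_measurable(2)])
 have 1: "(\<lambda>p. (u (fst p) (snd p) $ i * u (fst p) (snd p) $ k) * conv m (\<lambda>x. u (fst p) x $ j) (snd p)) \<in> borel_measurable spacetime"
  "(\<lambda>p. G (fst p) (snd p) $ i $ k * conv m (\<lambda>x. u (fst p) x $ j) (snd p)) \<in> borel_measurable spacetime"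
  "(\<lambda>p. f (fst p) (snd p) $ i * conv m (\<lambda>x. u (fst p) x $ j) (snd p)) \<in> borel_measurable spacetime"
  by measurable
 show "nonlin i k j m \<in> borel_measurable unit_time" "visc i k j m \<in> borel_measurable unit_time" "forc i j m \<in> borel_measurable unit_time"
  unfolding nonlin_def visc_def forc_def
  by (rule torus.borel_measurable_lebesgue_integral, use 1 in \<open>simp add: split_def\<close>)+
qed

text \<open>The part in which the first factor of the quadratic form is differentiated. For an even
  kernel the other part is the same expression with \<open>i\<close> and \<open>j\<close>
  exchanged.\<close>

definition pairing_rate :: "'n \<Rightarrow> 'n \<Rightarrow> (real ^ 'n \<Rightarrow> real) \<Rightarrow> real \<Rightarrow> real" where
 "pairing_rate i j m r = (\<Sum>k\<in>UNIV. nonlin i k j (pd (axis k 1) m) r) + press j (pd (axis i 1) m) r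
   - \<nu> * (\<Sum>k\<in>UNIV. visc i k j (pd (axis k 1) m) r) + forc i j m r"

lemma rate_split:
 assumes r: "good r" and \<psi>: "trig \<psi>"
 shows "rate i \<psi> r = (\<Sum>k\<in>UNIV. \<integral>x. pd (axis k 1) \<psi> x * (u r x $ i * u r x $ k) \<partial>torus) + (\<integral>x. pd (axis i 1) \<psi> x * q r x \<partial>torus)
   - \<nu> * (\<Sum>k\<in>UNIV. \<integral>x. pd (axis k 1) \<psi> x * G r x $ i $ k \<partial>torus) + (\<integral>x. \<psi> x * f r x $ i \<partial>torus)"
proof -
 interpret c: cubic_field "u r" using r by (simp add: good_def)
 have G: "in_Lp 1 (\<lambda>x. G r x $ i $ k)" for k
  using in_Lp_mono[OF square_integrable_matrix_component(1), of "G r" 1] r by (simp add: good_def)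
 have f: "in_Lp 1 (\<lambda>x. f r x $ i)" using in_Lp_mono[OF square_integrable_component(1), of "f r" 1] r by (simp add: good_def)
 have i: "integrable torus (\<lambda>x. pd (axis k 1) \<psi> x * (u r x $ i * u r x $ k))" "integrable torus (\<lambda>x. pd (axis i 1) \<psi> x * q r x)"
  "integrable torus (\<lambda>x. pd (axis k 1) \<psi> x * G r x $ i $ k)" "integrable torus (\<lambda>x. \<psi> x * f r x $ i)" for k
  using r by (auto intro!: trig_mult_integrable trig_pd(1) \<psi> c.prod_L1 G f simp: good_def)
 show ?thesis
  unfolding rate_def rate_density_def fst_conv snd_conv
  by (simp only: lint_add lint_diff L1_add
    L1_diff L1_sum lint_sum
    lint_mult_right_zero integrable_mult_right i)
qed

lemma separated_rate:
 assumes r: "good r" and m: "trig m" and gh: "\<And>s. s < n \<Longrightarrow> trig (g s)" "\<And>s. s < n \<Longrightarrow> trig (h s)"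
  and eq: "\<And>x y. m (x - y) = (\<Sum>s<n::nat. g s x * h s y)"
 shows "(\<Sum>s<n. rate i (g s) r * (\<integral>x. h s x * u r x $ j \<partial>torus)) = pairing_rate i j m r"
proof -
 interpret c: cubic_field "u r" using r by (simp add: good_def)
 have G: "in_Lp 1 (\<lambda>x. G r x $ i $ k)" for k
  using in_Lp_mono[OF square_integrable_matrix_component(1), of "G r" 1] r by (simp add: good_def)
 have f: "in_Lp 1 (\<lambda>x. f r x $ i)" using in_Lp_mono[OF square_integrable_component(1), of "f r" 1] r by (simp add: good_def)
 have q: "in_Lp 1 (q r)" and w: "in_Lp 1 (\<lambda>x. u r x $ j)" using r comp_L2(2)[of r j] by (auto simp: good_def)
 have sp1: "(\<Sum>s<n. (\<integral>x. g s x * H x \<partial>torus) * (\<integral>x. h s x * u r x $ j \<partial>torus)) = (\<integral>x. H x * conv m (\<lambda>x. u r x $ j) x \<partial>torus)"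
  if "in_Lp 1 H" for H
  by (rule separated_pairing(1)[OF m gh eq that w])
 have sp2: "(\<Sum>s<n. (\<integral>x. pd (axis k 1) (g s) x * H x \<partial>torus) * (\<integral>x. h s x * u r x $ j \<partial>torus)) = (\<integral>x. H x * conv (pd (axis k 1) m) (\<lambda>x. u r x $ j) x \<partial>torus)"
  if "in_Lp 1 H" for H k
  by (rule separated_pairing(2)[OF m gh eq that w])
 let ?b = "\<lambda>s. \<integral>x. h s x * u r x $ j \<partial>torus"
 have "(\<Sum>s<n. rate i (g s) r * ?b s)
   = (\<Sum>s<n. (\<Sum>k\<in>UNIV. (\<integral>x. pd (axis k 1) (g s) x * (u r x $ i * u r x $ k) \<partial>torus) * ?b s) + (\<integral>x. pd (axis i 1) (g s) x * q r x \<partial>torus) * ?b s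
   - \<nu> * (\<Sum>k\<in>UNIV. (\<integral>x. pd (axis k 1) (g s) x * G r x $ i $ k \<partial>torus) * ?b s) + (\<integral>x. g s x * f r x $ i \<partial>torus) * ?b s)"
  using gh by (intro sum.cong refl) (simp add: rate_split[OF r] distrib_right left_diff_distrib sum_distrib_right mult.assoc)
 also have "\<dots> = (\<Sum>k\<in>UNIV. \<Sum>s<n. (\<integral>x. pd (axis k 1) (g s) x * (u r x $ i * u r x $ k) \<partial>torus) * ?b s) + (\<Sum>s<n. (\<integral>x. pd (axis i 1) (g s) x * q r x \<partial>torus) * ?b s)
   - \<nu> * (\<Sum>k\<in>UNIV. \<Sum>s<n. (\<integral>x. pd (axis k 1) (g s) x * G r x $ i $ k \<partial>torus) * ?b s) + (\<Sum>s<n. (\<integral>x. g s x * f r x $ i \<partial>torus) * ?b s)"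
  unfolding sum.distrib sum_subtractf sum_distrib_left[symmetric] by (simp only: sum.swap[of _ UNIV "{..<n}"])
 also have "\<dots> = pairing_rate i j m r"
  unfolding sp2[OF c.prod_L1] sp2[OF q] sp2[OF G] sp1[OF f]
  by (simp add: pairing_rate_def nonlin_def press_def visc_def forc_def)
 finally show ?thesis .
qed

text \<open>Apply the product rule to each product in the separated form. The integrand is an
  auxiliary \<psi>, because the explicit rate is known to agree with it only at good times.\<close>

lemma pairing_balance:
 assumes m: "trig m" and even: "\<And>x. m (- x) = m x" and t: "t \<in> {0..1}"
 shows "\<exists>\<psi>. integrable unit_time \<psi> \<and> (AE r in unit_time. \<psi> r = pairing_rate i j m r + pairing_rate j i m r) \<and>
   (\<integral>x. u t x $ i * conv m (\<lambda>x. u t x $ j) x \<partial>torus) - (\<integral>x. u0 x $ i * conv m (\<lambda>x. u0 x $ j) x \<partial>torus) = tint t \<psi>"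
proof -
 obtain n g h where "\<And>k. k < n \<Longrightarrow> trig (g k) \<and> trig (h k)" and eq: "\<And>x y. m (x - y) = (\<Sum>k<n::nat. g k x * h k y)"
  using separable_sum[OF trig_separable[OF m]] by blast
 then have gh: "\<And>s. s < n \<Longrightarrow> trig (g s)" "\<And>s. s < n \<Longrightarrow> trig (h s)" by auto
 \<comment> \<open>Evenness lets \<open>g\<close> and \<open>h\<close> exchange their roles, so the
   second half of the product rule is again of the separated form.\<close>
 have eq': "m (x - y) = (\<Sum>k<n. h k x * g k y)" for x y
  using even[of "x - y"] eq[of y x] by (simp add: mult.commute)
 let ?a = "\<lambda>s r. \<integral>x. g s x * u r x $ i \<partial>torus" and ?b = "\<lambda>s r. \<integral>x. h s x * u r x $ j \<partial>torus"
 let ?za = "\<lambda>s. \<integral>x. g s x * u0 x $ i \<partial>torus" and ?zb = "\<lambda>s. \<integral>x. h s x * u0 x $ j \<partial>torus"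
 let ?\<psi> = "\<lambda>s r. rate i (g s) r * ?b s r + ?a s r * rate j (h s) r"
 have pr: "?a s t * ?b s t - ?za s * ?zb s = tint t (?\<psi> s)" "integrable unit_time (?\<psi> s)" if s: "s < n" for s
  by (rule product_rule[OF rate_integrable[OF gh(1)[OF s]] rate_integrable[OF gh(2)[OF s]] t weak_scalar[OF gh(1)[OF s]] weak_scalar[OF gh(2)[OF s]]]; assumption)+
 show ?thesis
 proof (intro exI[of _ "\<lambda>r. \<Sum>s<n. ?\<psi> s r"] conjI)
  show "integrable unit_time (\<lambda>r. \<Sum>s<n. ?\<psi> s r)" using pr(2) by (intro L1_sum) auto
  show "AE r in unit_time. (\<Sum>s<n. ?\<psi> s r) = pairing_rate i j m r + pairing_rate j i m r"
   using AE_good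
  proof eventually_elim
   case (elim r)
   show ?case
    using separated_rate[OF elim m gh eq, of i j] separated_rate[OF elim m gh(2) gh(1) eq', of j i]
    by (simp add: sum.distrib mult.commute)
  qed
  have u01: "in_Lp 1 (\<lambda>x. u0 x $ i)" for i
   using in_Lp_mono[OF square_integrable_component(1)[OF u0_L2], of 1] by simp
  have "tint t (\<lambda>r. \<Sum>s<n. ?\<psi> s r) = (\<Sum>s<n. tint t (?\<psi> s))"
  proof -
   have "tint t (\<lambda>r. \<Sum>s<n. ?\<psi> s r) = (\<integral>r. (\<Sum>s<n. indicator {0..t} r * ?\<psi> s r) \<partial>unit_time)"
    unfolding tint_def by (simp only: sum_distrib_left)
   also have "\<dots> = (\<Sum>s<n. tint t (?\<psi> s))"
    unfolding tint_def using integrable_tint[OF pr(2)] by (intro lint_sum) auto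
   finally show ?thesis .
  qed
  also have "\<dots> = (\<Sum>s<n. ?a s t * ?b s t) - (\<Sum>s<n. ?za s * ?zb s)" using pr(1) by (simp add: sum_subtractf[symmetric])
  also have "(\<Sum>s<n. ?a s t * ?b s t) = (\<integral>x. u t x $ i * conv m (\<lambda>x. u t x $ j) x \<partial>torus)"
   by (rule separated_pairing(1)[OF m gh eq comp_L2(2)[OF t] comp_L2(2)[OF t]])
  also have "(\<Sum>s<n. ?za s * ?zb s) = (\<integral>x. u0 x $ i * conv m (\<lambda>x. u0 x $ j) x \<partial>torus)"
   by (rule separated_pairing(1)[OF m gh eq u01 u01])
  finally show "(\<integral>x. u t x $ i * conv m (\<lambda>x. u t x $ j) x \<partial>torus) - (\<integral>x. u0 x $ i * conv m (\<lambda>x. u0 x $ j) x \<partial>torus)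
    = tint t (\<lambda>r. \<Sum>s<n. ?\<psi> s r)" by simp
 qed
qed

text \<open>Summed over \<open>i\<close>, the kernel derivatives form the gradient of one scalar
  kernel; summed over \<open>j\<close>, its convolution with \<open>u\<close> is a divergence of
  \<open>u\<close>.\<close>

lemma pressure_vanishes:
 assumes r: "good r" and l: "0 < l"
 shows "(\<Sum>i\<in>UNIV. \<Sum>j\<in>UNIV. press j (pd (axis i 1) (mol N l (kmat a c i j))) r) = 0"
proof -
 interpret cf: cubic_field "u r" using r by (simp add: good_def)
 have q: "in_Lp 1 (q r)" and w: "in_Lp 1 (\<lambda>x. u r x $ j)" for j using r comp_L2(2)[of r j] by (auto simp: good_def)
 have m: "trig (mol N l (kmat a c i j))" for i j by (rule trig_mol(1)[OF continuous_kmat])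
 have cg: "continuous_on UNIV (kgrad TYPE('n) a c l)" using partial_kgrad[of "undefined :: 'n" a c l] by (simp add: partial_derivative_def)
 have mg: "trig (mol N l (kgrad TYPE('n) a c l))" by (rule trig_mol(1)[OF cg])
 let ?P = "\<lambda>i j. pd (axis i 1) (mol N l (kmat a c i j))"
 have i: "integrable torus (\<lambda>x. q r x * conv (?P i j) (\<lambda>x. u r x $ j) x)" for i j
 proof -
  obtain B where "\<And>x. \<bar>?P i j x\<bar> \<le> B" using trig_bounded[OF trig_pd(1)[OF m]] by blast
  then show ?thesis
   by (rule pair_conv_corr(2)[OF q w trig_borel[OF trig_pd(1)[OF m]] trig_periodic[OF trig_pd(1)[OF m]]])
 qed
 have s: "(\<Sum>i\<in>UNIV. conv (?P i j) (\<lambda>x. u r x $ j) x) = conv (pd (axis j 1) (mol N l (kgrad TYPE('n) a c l))) (\<lambda>x. u r x $ j) x" for j x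
 proof -
  have "integrable torus (\<lambda>y. ?P i j (x - y) * u r y $ j)" for i
   by (rule trig_mult_integrable[OF trig_reflect[OF trig_pd(1)[OF m]] w])
  then have "(\<Sum>i\<in>UNIV. conv (?P i j) (\<lambda>x. u r x $ j) x) = (\<integral>y. (\<Sum>i\<in>UNIV. ?P i j (x - y) * u r y $ j) \<partial>torus)"
   unfolding conv_def by (intro lint_sum[symmetric])
  then show ?thesis by (simp add: conv_def kmol_divergence[OF l] flip: sum_distrib_right)
 qed
 have "(\<Sum>i\<in>UNIV. \<Sum>j\<in>UNIV. press j (?P i j) r) = (\<Sum>j\<in>UNIV. \<Sum>i\<in>UNIV. press j (?P i j) r)" by (rule sum.swap)
 also have "\<dots> = (\<integral>x. (\<Sum>j\<in>UNIV. \<Sum>i\<in>UNIV. q r x * conv (?P i j) (\<lambda>x. u r x $ j) x) \<partial>torus)"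
  unfolding press_def using i by (simp add: lint_sum L1_sum)
 also have "\<dots> = (\<integral>x. q r x * (\<Sum>j\<in>UNIV. conv (pd (axis j 1) (mol N l (kgrad TYPE('n) a c l))) (\<lambda>x. u r x $ j) x) \<partial>torus)"
  by (simp only: sum_distrib_left[symmetric] s)
 also have "\<dots> = 0" by (simp add: cf.divergence_conv[OF mg])
 finally show ?thesis .
qed

text \<open>Joint measurability of \<open>u\<close> is given only over the cell, so shifted points
  are first brought back by \<open>vfrac\<close>, which does not change periodic fields.\<close>

lemma structure_function_measurable:
 "(\<lambda>r. structure_function b (u r) l) \<in> borel_measurable unit_time"
proof -
 let ?g = "\<lambda>r x y. (increment (l *\<^sub>R y) (u r) x \<bullet> y) * (wt1 b * (norm (increment (l *\<^sub>R y) (u r) x))\<^sup>2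
   + wt2 b * ((increment (l *\<^sub>R y) (u r) x \<bullet> y)\<^sup>2 / (norm y)\<^sup>2))"
 have id: "(\<lambda>x. x) \<in> measurable (torus :: (real ^ 'n) measure) borel" by (rule borel_measurable_torus) simp
 let ?M = "(spacetime :: (real \<times> (real ^ 'n)) measure) \<Otimes>\<^sub>M (lborel :: (real ^ 'n) measure)"
 have sx [measurable]: "(\<lambda>z. snd (fst z)) \<in> borel_measurable ?M"
 proof -
  have "(\<lambda>z. snd (fst z) :: real ^ 'n) \<in> measurable ?M (torus :: (real ^ 'n) measure)" by measurable
  from measurable_compose[OF this id] show ?thesis .
 qed
 have wm [measurable]: "(\<lambda>z. snd z) \<in> borel_measurable ?M" by measurable
 have um: "(\<lambda>z. u (fst (fst z)) (vfrac (\<phi> z))) \<in> borel_measurable ?M" if "\<phi> \<in> borel_measurable ?M" for \<phi>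
 proof -
  have "(\<lambda>z. (fst (fst z), vfrac (\<phi> z))) \<in> measurable ?M spacetime"
   by (intro measurable_Pair measurable_compose[OF that vfrac_torus]) measurable
  from measurable_compose[OF this joint_measurable(1)] show ?thesis by simp
 qed
 have sw [measurable]: "(sphere_weight :: real ^ 'n \<Rightarrow> real) \<in> borel_measurable borel" unfolding sphere_weight_def by measurable
 define d where "d z = u (fst (fst z)) (vfrac (snd (fst z) + l *\<^sub>R (snd z /\<^sub>R norm (snd z)))) - u (fst (fst z)) (vfrac (snd (fst z)))" for z :: "(real \<times> (real ^ 'n)) \<times> (real ^ 'n)"
 have [measurable]: "d \<in> borel_measurable ?M"
  unfolding d_def by (intro borel_measurable_diff um) measurable
 have "(\<lambda>z. sphere_weight (snd z) * ((d z \<bullet> (snd z /\<^sub>R norm (snd z))) * (wt1 b * (norm (d z))\<^sup>2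
   + wt2 b * ((d z \<bullet> (snd z /\<^sub>R norm (snd z)))\<^sup>2 / (norm (snd z /\<^sub>R norm (snd z)))\<^sup>2)))) \<in> borel_measurable ?M" (is "?F \<in> _")
  by measurable
 then have "(\<lambda>p. \<integral>w. ?F (p, w) \<partial>lborel) \<in> borel_measurable spacetime"
  by (intro lborel.borel_measurable_lebesgue_integral) (simp add: split_def)
 then have meas: "(\<lambda>r. \<integral>x. \<integral>w. ?F ((r, x), w) \<partial>lborel \<partial>torus) \<in> borel_measurable unit_time"
  by (intro torus.borel_measurable_lebesgue_integral) (simp add: split_def)
 have eq: "structure_function b (u r) l = prefactor b (real CARD('n)) * (\<integral>x. 1 / measure sphere_measure (UNIV :: (real ^ 'n) set) * (\<integral>w. ?F ((r, x), w) \<partial>lborel) \<partial>torus)"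
  if r: "r \<in> {0..1}" for r
 proof -
  note [measurable] = spacetime_sectionD(1)[OF fields(1) r]
  have per: "u r (vfrac x) = u r x" for x by (rule periodic_vfrac[OF spacetime_sectionD(2)[OF fields(1) r]])
  have "(\<integral>y. ?g r x y \<partial>sphere_measure) = (\<integral>w. sphere_weight w * ?g r x (w /\<^sub>R norm w) \<partial>lborel)" for x
   unfolding increment_def by (rule sphere_integral_alt) measurable
  then show ?thesis
   unfolding structure_function_def sphere_average_def T_matrix_norm by (simp add: d_def per increment_def)
 qed
 have "(\<lambda>r. prefactor b (real CARD('n)) * (\<integral>x. 1 / measure sphere_measure (UNIV :: (real ^ 'n) set) * (\<integral>w. ?F ((r, x), w) \<partial>lborel) \<partial>torus)) \<in> borel_measurable unit_time"
  using meas by simp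
 then show ?thesis by (rule measurable_cong[THEN iffD1, rotated]) (simp add: eq)
qed

end

section \<open>Bounds and limits of the mollified pairings\<close>

abbreviation mollifier :: "nat \<Rightarrow> kind \<Rightarrow> real \<Rightarrow> 'n::finite \<Rightarrow> 'n \<Rightarrow> real ^ 'n \<Rightarrow> real" where
 "mollifier N b l i j \<equiv> mol N l (kmat (kerA TYPE('n) b l) (kerC TYPE('n) b l) i j)"

abbreviation kavg :: "kind \<Rightarrow> real \<Rightarrow> 'n::finite \<Rightarrow> 'n \<Rightarrow> (real ^ 'n \<Rightarrow> real) \<Rightarrow> real" where
 "kavg b l \<equiv> kint (kerA TYPE('n) b l) (kerC TYPE('n) b l) l"

abbreviation kavgd :: "kind \<Rightarrow> real \<Rightarrow> 'n::finite \<Rightarrow> 'n \<Rightarrow> 'n \<Rightarrow> (real ^ 'n \<Rightarrow> real) \<Rightarrow> real" where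
 "kavgd b l \<equiv> kbd (kerA TYPE('n) b l) (kerC TYPE('n) b l) l"

abbreviation fejer_mean :: "nat \<Rightarrow> (real ^ 'n \<Rightarrow> real) \<Rightarrow> real ^ 'n \<Rightarrow> real" where
 "fejer_mean N g \<equiv> \<lambda>z. \<integral>y. fejer N (y - z) * g y \<partial>torus"

definition kernel_bound :: "'n::finite itself \<Rightarrow> kind \<Rightarrow> real \<Rightarrow> bool" where
 "kernel_bound _ b K \<longleftrightarrow> 0 \<le> K \<and> (\<forall>l>0. \<forall>i j k.
   ball_functional l K (kavg b l i j)
   \<and> ball_functional l (K / l) (kavgd b l (k :: 'n) i j))"

lemma kernel_bound_exists: "\<exists>K. kernel_bound TYPE('n::finite) b K"
 using kernel_constant[where b=b] unfolding kernel_bound_def by blast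

lemma sum2_bound:
 fixes x :: "'n::finite \<Rightarrow> 'n \<Rightarrow> real"
 assumes "\<And>i j. \<bar>x i j\<bar> \<le> c"
 shows "\<bar>\<Sum>i\<in>UNIV. \<Sum>j\<in>UNIV. x i j\<bar> \<le> real CARD('n) ^ 2 * c"
proof -
 have "\<bar>\<Sum>i\<in>UNIV. \<Sum>j\<in>UNIV. x i j\<bar> \<le> (\<Sum>i\<in>UNIV. \<Sum>j\<in>UNIV. \<bar>x i j\<bar>)"
  by (intro order_trans[OF sum_abs] sum_mono sum_abs)
 also have "\<dots> \<le> (\<Sum>i\<in>(UNIV :: 'n set). \<Sum>j\<in>(UNIV :: 'n set). c)" by (intro sum_mono assms)
 finally show ?thesis by (simp add: power2_eq_square mult.assoc)
qed

lemma sum3_bound: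
 fixes x :: "'n::finite \<Rightarrow> 'n \<Rightarrow> 'n \<Rightarrow> real"
 assumes "\<And>i j k. \<bar>x i j k\<bar> \<le> c"
 shows "\<bar>\<Sum>i\<in>UNIV. \<Sum>j\<in>UNIV. \<Sum>k\<in>UNIV. x i j k\<bar> \<le> real CARD('n) ^ 3 * c"
proof -
 have "\<bar>\<Sum>k\<in>UNIV. x i j k\<bar> \<le> real CARD('n) * c" for i j
 proof -
  have "\<bar>\<Sum>k\<in>UNIV. x i j k\<bar> \<le> (\<Sum>k\<in>(UNIV :: 'n set). c)" by (rule order_trans[OF sum_abs sum_mono[OF assms]])
  then show ?thesis by simp
 qed
 from sum2_bound[of "\<lambda>i j. \<Sum>k\<in>UNIV. x i j k", OF this] show ?thesis
  by (simp add: power2_eq_square power3_eq_cube mult.assoc)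
qed

context
 fixes K l :: real and b :: kind and i j k :: "'n::finite" and H w :: "real ^ 'n \<Rightarrow> real"
 assumes K: "kernel_bound TYPE('n) b K" and l: "0 < l" and H: "in_Lp 2 H" and w: "in_Lp 2 w"
begin

lemma corr_facts: "continuous_on UNIV (corr H w)" "periodic (corr H w)"
proof -
 show "continuous_on UNIV (corr H w)" by (rule corr_L2(1)[OF H w])
 have "w (x - (y + axis i 1)) = w (x - y)" for x y i
 proof -
  have "w (x - (y + axis i 1)) = w (x - (y + axis i 1) + axis i 1)" using in_LpD(2)[OF w] by (simp only: periodic_def)
  then show ?thesis by (simp add: algebra_simps)
 qed
 then show "periodic (corr H w)" by (simp add: periodic_def corr_def)
qed

lemma pairing_eq:
 "(\<integral>x. H x * conv (mollifier N b l i j) w x \<partial>torus) = kavg b l i j (fejer_mean N (corr H w))"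
 "(\<integral>x. H x * conv (pd (axis k 1) (mollifier N b l i j)) w x \<partial>torus) = - kavgd b l k i j (fejer_mean N (corr H w))"
proof -
 have m: "trig (mollifier N b l i j)" by (rule trig_mol(1)[OF continuous_kmat])
 have e: "(\<integral>x. H x * conv M w x \<partial>torus) = (\<integral>y. M y * corr H w y \<partial>torus)" if M: "trig M" for M
 proof -
  obtain B where B: "\<And>x. \<bar>M x\<bar> \<le> B" using trig_bounded[OF M] by blast
  show ?thesis by (rule pair_conv_corr(1)[OF in_Lp_mono[OF H] in_Lp_mono[OF w] trig_borel[OF M] trig_periodic[OF M] B]) auto
 qed
 show "(\<integral>x. H x * conv (mollifier N b l i j) w x \<partial>torus) = kavg b l i j (fejer_mean N (corr H w))"
  "(\<integral>x. H x * conv (pd (axis k 1) (mollifier N b l i j)) w x \<partial>torus) = - kavgd b l k i j (fejer_mean N (corr H w))"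
  using kmol_pairing[OF l corr_facts] by (simp_all add: e m trig_pd(1)[OF m])
qed

lemma avg_bound: "\<bar>fejer_mean N (corr H w) z\<bar> \<le> nrm H * nrm w"
 by (rule fejer_average(3)[OF corr_facts corr_L2(2)[OF H w]])

lemma fK: "ball_functional l K (kavg b l i j)" "ball_functional l (K / l) (kavgd b l k i j)" and K0: "0 \<le> K"
 using K l by (auto simp: kernel_bound_def)

lemma avg_borel: "(fejer_mean N (corr H w)) \<in> borel_measurable borel"
 by (rule continuous_borel[OF continuous_average[OF trig_fejer corr_facts]])

text \<open>Independent of the mollification parameter, so these serve as majorants in the
  limit.\<close>

lemma pairing_bounds:
 "\<bar>\<integral>x. H x * conv (mollifier N b l i j) w x \<partial>torus\<bar> \<le> K * (nrm H * nrm w)"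
 "\<bar>\<integral>x. H x * conv (pd (axis k 1) (mollifier N b l i j)) w x \<partial>torus\<bar> \<le> K / l * (nrm H * nrm w)"
 unfolding pairing_eq abs_minus_cancel
 by (rule ball_functional_bound[OF fK(1) less_imp_le[OF l] avg_borel avg_bound],
   rule ball_functional_bound[OF fK(2) less_imp_le[OF l] avg_borel avg_bound])

lemma pairing_limits:
 "(\<lambda>N. \<integral>x. H x * conv (mollifier N b l i j) w x \<partial>torus) \<longlonglongrightarrow> kavg b l i j (corr H w)"
 "(\<lambda>N. \<integral>x. H x * conv (pd (axis k 1) (mollifier N b l i j)) w x \<partial>torus) \<longlonglongrightarrow> - kavgd b l k i j (corr H w)"
 unfolding pairing_eq
 by (rule ball_functional_limit[OF fK(1) corr_facts], rule tendsto_minus[OF ball_functional_limit[OF fK(2) corr_facts]])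

text \<open>Subtract the value of the correlation at displacement 0. The remainder is bounded by
  \<open>nrm H * \<omega>\<close> on the ball; on constants the first functional is the identity
  matrix and the second one vanishes.\<close>

lemma pairing_limit_bounds:
 assumes om: "\<And>y. norm y \<le> l \<Longrightarrow> nrm (\<lambda>x. w (x - y) - w x) \<le> \<omega>"
 shows "2 \<le> CARD('n) \<Longrightarrow> \<bar>kavg b l i j (corr H w) - (if i = j then \<integral>x. H x * w x \<partial>torus else 0)\<bar> \<le> K * (nrm H * \<omega>)"
  and "\<bar>- kavgd b l k i j (corr H w)\<bar> \<le> K / l * (nrm H * \<omega>)"
proof -
 define C0 where "C0 = (\<integral>x. H x * w x \<partial>torus)"
 have C0: "corr H w 0 = C0" by (simp add: C0_def corr_def)
 have c1: "continuous_on UNIV (\<lambda>_ :: real ^ 'n. 1 :: real)" by simp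
 have D: "(\<lambda>y. 1 * corr H w y + (- C0) * 1) \<in> borel_measurable borel"
  using continuous_borel[OF corr_facts(1)] by simp
 have b: "\<bar>1 * corr H w y + (- C0) * 1\<bar> \<le> nrm H * \<omega>" if "norm y \<le> l" for y
 proof -
  have "\<bar>corr H w y - corr H w 0\<bar> \<le> nrm H * nrm (\<lambda>x. w (x - y) - w x)" by (rule corr_L2(3)[OF H w])
  also have "\<dots> \<le> nrm H * \<omega>" using om[OF that] by (rule mult_left_mono) simp
  finally show ?thesis by (simp add: C0)
 qed
 have 1: "kavg b l i j (\<lambda>y. 1 * corr H w y + (- C0) * 1) = 1 * kavg b l i j (corr H w) + (- C0) * kavg b l i j (\<lambda>_. 1)"
  by (rule ball_functional_linear[OF fK(1) less_imp_le[OF l] corr_facts(1) c1])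
 have 2: "kavgd b l k i j (\<lambda>y. 1 * corr H w y + (- C0) * 1) = 1 * kavgd b l k i j (corr H w) + (- C0) * kavgd b l k i j (\<lambda>_. 1)"
  by (rule ball_functional_linear[OF fK(2) less_imp_le[OF l] corr_facts(1) c1])
 show "\<bar>kavg b l i j (corr H w) - (if i = j then \<integral>x. H x * w x \<partial>torus else 0)\<bar> \<le> K * (nrm H * \<omega>)" if d: "2 \<le> CARD('n)"
 proof -
  have "\<bar>kavg b l i j (\<lambda>y. 1 * corr H w y + (- C0) * 1)\<bar> \<le> K * (nrm H * \<omega>)"
   by (rule ball_functional_bound[OF fK(1) less_imp_le[OF l] D b])
  moreover have "kavg b l i j (\<lambda>_. 1) = (if i = j then 1 else 0)" by (rule kint_normalised[OF l d])
  ultimately show ?thesis unfolding 1 by (auto simp: C0_def split: if_splits)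
 qed
 have "\<bar>kavgd b l k i j (\<lambda>y. 1 * corr H w y + (- C0) * 1)\<bar> \<le> K / l * (nrm H * \<omega>)"
  by (rule ball_functional_bound[OF fK(2) less_imp_le[OF l] D b])
 then show "\<bar>- kavgd b l k i j (corr H w)\<bar> \<le> K / l * (nrm H * \<omega>)"
  unfolding 2 by (simp add: kbd_const[OF l])
qed

end

lemma inner_cauchy_schwarz:
 fixes v w :: "real ^ 'n \<Rightarrow> real ^ 'm"
 assumes v: "square_integrable v" and w: "square_integrable w"
 shows "integrable torus (\<lambda>x. v x \<bullet> w x)" and "\<bar>\<integral>x. v x \<bullet> w x \<partial>torus\<bar> \<le> vnrm v * vnrm w"
proof -
 have i: "integrable torus (\<lambda>x. v x $ i * w x $ i)" for i
  by (intro cauchy_schwarz_torus(1) square_integrable_component(1) v w)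
 show s: "integrable torus (\<lambda>x. v x \<bullet> w x)"
  unfolding inner_vec_def inner_real_def by (rule L1_sum) (rule i)
 have "\<bar>\<integral>x. v x \<bullet> w x \<partial>torus\<bar> \<le> (\<integral>x. \<bar>v x \<bullet> w x\<bar> \<partial>torus)" by (rule integral_abs_bound)
 also have "\<dots> \<le> (\<integral>x. norm (v x) * norm (w x) \<partial>torus)"
  by (intro integral_mono integrable_abs s cauchy_schwarz_torus(1) square_integrable_norm v w Cauchy_Schwarz_ineq2)
 also have "\<dots> \<le> vnrm v * vnrm w"
  using cauchy_schwarz_torus(2)[OF square_integrable_norm[OF v] square_integrable_norm[OF w]] by (simp add: vnrm_def)
 finally show "\<bar>\<integral>x. v x \<bullet> w x \<partial>torus\<bar> \<le> vnrm v * vnrm w" .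
qed

lemma component_modulus:
 assumes v: "square_integrable v" and l: "0 < l" "norm y \<le> l"
 shows "nrm (\<lambda>x. v (x - y) $ j - v x $ j) \<le> modulus l v"
proof -
 have d: "square_integrable (\<lambda>x. v (x - y) - v x)" by (intro square_integrable_diff square_integrable_shift v)
 have "nrm (\<lambda>x. v (x - y) $ j - v x $ j) \<le> vnrm (\<lambda>x. v (x - y) - v x)"
  using square_integrable_component(2)[OF d, of j] by simp
 also have "\<dots> \<le> modulus l v" using modulus_bounds(1)[OF v] l by simp
 finally show ?thesis .
qed

lemma sum_diagonal: "(\<Sum>i\<in>UNIV. \<Sum>j\<in>UNIV. if i = j then a i j else 0) = (\<Sum>i\<in>(UNIV :: 'n::finite set). a i i :: real)"
 by simp

text \<open>The identity mass singles out the diagonal, whose sum is the energy; each of the d^2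
  entries contributes an error with one modulus.\<close>

lemma quadratic_limit:
 fixes v :: "real ^ 'n \<Rightarrow> real ^ 'n"
 assumes K: "kernel_bound TYPE('n) b K" and l: "0 < l" and d: "2 \<le> CARD('n)" and v: "square_integrable v"
 shows "\<exists>L. (\<lambda>N. \<Sum>i\<in>UNIV. \<Sum>j\<in>UNIV. \<integral>x. v x $ i * conv (mollifier N b l i j) (\<lambda>x. v x $ j) x \<partial>torus) \<longlonglongrightarrow> L
   \<and> \<bar>L - (vnrm v)\<^sup>2\<bar> \<le> real CARD('n) ^ 2 * (K * (vnrm v * modulus l v))"
proof -
 let ?k = "\<lambda>i j. kavg b l i j (corr (\<lambda>x. v x $ i) (\<lambda>x. v x $ j))"
 note c = square_integrable_component[OF v]
 have K0: "0 \<le> K" using K by (simp add: kernel_bound_def)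
 have m0: "0 \<le> modulus l v" using modulus_bounds(3)[OF v] l by simp
 have sq: "(\<Sum>i\<in>UNIV. \<integral>x. v x $ i * v x $ i \<partial>torus) = (vnrm v)\<^sup>2"
 proof -
  have "(\<Sum>i\<in>UNIV. \<integral>x. v x $ i * v x $ i \<partial>torus) = (\<integral>x. (\<Sum>i\<in>UNIV. v x $ i * v x $ i) \<partial>torus)"
   using cauchy_schwarz_torus(1)[OF c(1) c(1)] by (intro lint_sum[symmetric])
  also have "\<dots> = (\<integral>x. (norm (v x))\<^sup>2 \<partial>torus)" by (simp only: power2_norm_eq_inner inner_vec_def inner_real_def)
  finally show ?thesis by (simp add: vnrm_def nrm_square)
 qed
 have "(\<Sum>i\<in>UNIV. \<Sum>j\<in>UNIV. ?k i j) - (vnrm v)\<^sup>2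
   = (\<Sum>i\<in>UNIV. \<Sum>j\<in>UNIV. ?k i j - (if i = j then \<integral>x. v x $ i * v x $ j \<partial>torus else 0))"
  unfolding sq[symmetric] sum_subtractf sum_diagonal ..
 also have "\<bar>\<dots>\<bar> \<le> real CARD('n) ^ 2 * (K * (vnrm v * modulus l v))"
 proof (rule sum2_bound)
  fix i j
  show "\<bar>?k i j - (if i = j then \<integral>x. v x $ i * v x $ j \<partial>torus else 0)\<bar> \<le> K * (vnrm v * modulus l v)"
   by (rule order_trans[OF pairing_limit_bounds(1)[OF K l c(1) c(1) component_modulus[OF v l] d]]) (assumption, use c(2) K0 m0 in \<open>(intro mult_left_mono mult_right_mono); auto\<close>)
 qed
 finally have "\<bar>(\<Sum>i\<in>UNIV. \<Sum>j\<in>UNIV. ?k i j) - (vnrm v)\<^sup>2\<bar> \<le> real CARD('n) ^ 2 * (K * (vnrm v * modulus l v))" .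
 moreover have "(\<lambda>N. \<Sum>i\<in>UNIV. \<Sum>j\<in>UNIV. \<integral>x. v x $ i * conv (mollifier N b l i j) (\<lambda>x. v x $ j) x \<partial>torus)
   \<longlonglongrightarrow> (\<Sum>i\<in>UNIV. \<Sum>j\<in>UNIV. ?k i j)"
  by (intro tendsto_sum pairing_limits(1)[OF K l] c)
 ultimately show ?thesis by blast
qed

lemma tint_cong_AE:
 assumes "AE r in unit_time. \<phi> r = \<psi> r" "\<phi> \<in> borel_measurable unit_time" "\<psi> \<in> borel_measurable unit_time"
 shows "tint t \<phi> = tint t \<psi>"
proof -
 note [measurable] = assms(2,3)
 show ?thesis unfolding tint_def
 proof (rule integral_cong_AE)
  show "AE r in unit_time. indicator {0..t} r * \<phi> r = indicator {0..t} r * \<psi> r" using assms(1) by eventually_elim simp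
 qed measurable
qed

context ns
begin

lemma vnrm_G_integrable: "integrable unit_time (\<lambda>r. vnrm (G r))" "integrable unit_time (\<lambda>r. (vnrm (G r))\<^sup>2)"
proof -
 have s: "integrable unit_time (\<lambda>r. \<integral>x. (norm (G r x))\<^sup>2 \<partial>torus)"
  using spacetime_integral(1)[OF G_L2 continuous_on_const[of _ 1]] by simp
 have e: "(\<integral>x. (norm (G r x))\<^sup>2 \<partial>torus) = (vnrm (G r))\<^sup>2" for r by (simp add: vnrm_def nrm_square)
 show s2: "integrable unit_time (\<lambda>r. (vnrm (G r))\<^sup>2)" using s by (simp only: e)
 have "(\<lambda>r. vnrm (G r)) \<in> borel_measurable unit_time"
  unfolding vnrm_def nrm_def using borel_measurable_integrable[OF s] by measurable
 moreover have "\<bar>vnrm (G r)\<bar> \<le> 1 + (vnrm (G r))\<^sup>2" for r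
  using zero_le_power2[of "vnrm (G r) - 1 / 2"] by (simp add: power2_diff) (simp add: power2_eq_square)
 ultimately show "integrable unit_time (\<lambda>r. vnrm (G r))"
  by (rule integrable_boundI[OF L1_add[OF unit_time.integrable_const[of 1] s2]])
qed

lemma integrable_mult_continuous:
 assumes "integrable unit_time \<phi>" "continuous_on {0..1} c"
 shows "integrable unit_time (\<lambda>r. \<phi> r * c r :: real)"
proof -
 have "bounded (c ` {0..1})" by (intro compact_imp_bounded compact_continuous_image assms) auto
 then obtain B where "\<forall>y\<in>c ` {0..1}. norm y \<le> B" unfolding bounded_iff by blast
 then have B: "\<And>r. r \<in> {0..1} \<Longrightarrow> \<bar>c r\<bar> \<le> B" by auto
 show ?thesis
 proof (rule integrable_boundI[where g="\<lambda>r. \<bar>\<phi> r\<bar> * B"])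
  show "(\<lambda>r. \<phi> r * c r) \<in> borel_measurable unit_time"
   using assms continuous_unit_time(1)[OF assms(2)] by (intro borel_measurable_times) auto
  show "\<bar>\<phi> r * c r\<bar> \<le> \<bar>\<phi> r\<bar> * B" if "r \<in> space unit_time" for r
   using B[of r] that by (simp add: abs_mult mult_left_mono)
 qed (use assms in auto)
qed

lemma inner_facts:
 "(\<lambda>r. l2inner (f r) (u r)) \<in> borel_measurable unit_time"
 "good r \<Longrightarrow> l2inner (f r) (u r) = (\<Sum>i\<in>UNIV. \<integral>x. f r x $ i * u r x $ i \<partial>torus)"
 "good r \<Longrightarrow> \<bar>l2inner (f r) (u r)\<bar> \<le> vnrm (f r) * vnrm (u r)"
proof -
 note [measurable] = joint_measurable
 have "(\<lambda>p. f (fst p) (snd p) \<bullet> u (fst p) (snd p)) \<in> borel_measurable spacetime" by measurable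
 then show "(\<lambda>r. l2inner (f r) (u r)) \<in> borel_measurable unit_time"
  unfolding l2inner_def by (intro torus.borel_measurable_lebesgue_integral) (simp add: split_def)
 assume r: "good r"
 then have fs: "square_integrable (f r)" and us: "square_integrable (u r)" using u_L2 by (auto simp: good_def)
 have i: "integrable torus (\<lambda>x. f r x $ i * u r x $ i)" for i
  by (intro cauchy_schwarz_torus(1) square_integrable_component(1) fs us)
 show "l2inner (f r) (u r) = (\<Sum>i\<in>UNIV. \<integral>x. f r x $ i * u r x $ i \<partial>torus)"
  unfolding l2inner_def inner_vec_def inner_real_def by (rule lint_sum) (rule i)
 show "\<bar>l2inner (f r) (u r)\<bar> \<le> vnrm (f r) * vnrm (u r)"
  unfolding l2inner_def by (rule inner_cauchy_schwarz(2)[OF fs us])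
qed

lemma inner_integrable: "integrable unit_time (\<lambda>r. l2inner (f r) (u r))"
 by (rule L1_bound[OF integrable_mult_continuous[OF f_L1L2 continuous_vnrm] inner_facts(1)])
   (use AE_good in eventually_elim, use inner_facts(3) in fastforce)

text \<open>The mollification is removed with \<open>l\<close> fixed. The flux has an exact limit,
  while energy, viscous and forcing terms are only estimated, each by a modulus at scale
  \<open>l\<close>. The factor 1/2 of the two energy errors is dropped.\<close>

theorem balance:
 assumes K: "kernel_bound TYPE('n) b K" and l: "0 < l" and d: "2 \<le> CARD('n)" and t: "t \<in> {0..1}"
 shows "\<bar>tint t (\<lambda>r. structure_function b (u r) l / l) + energy_defect u0 f u t\<bar>
  \<le> real CARD('n) ^ 2 * (K * (vnrm (u t) * modulus l (u t))) + real CARD('n) ^ 2 * (K * (vnrm u0 * modulus l u0))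
   + \<nu> * (\<integral>r. real CARD('n) ^ 3 * (K / l * (vnrm (G r) * modulus l (u r))) \<partial>unit_time)
   + (\<integral>r. real CARD('n) ^ 2 * (K * (vnrm (f r) * modulus l (u r))) \<partial>unit_time)"
proof -
 let ?n = "real CARD('n)"
 \<comment> \<open>The three functions named w are integrable majorants uniform in the
   mollification, for dominated convergence. The two named g bound the limits and carry the modulus
   in place of the norm.\<close>
 let ?wQ = "\<lambda>r. ?n ^ 3 * (K / l * (2 * (\<integral>x. (norm (u r x)) ^ 3 \<partial>torus)))"
 let ?wW = "\<lambda>r. ?n ^ 3 * (K / l * (vnrm (G r) * vnrm (u r)))"
 let ?wE = "\<lambda>r. (?n ^ 2 * K + 1) * (vnrm (f r) * vnrm (u r))"
 let ?gW = "\<lambda>r. ?n ^ 3 * (K / l * (vnrm (G r) * modulus l (u r)))"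
 let ?gE = "\<lambda>r. ?n ^ 2 * (K * (vnrm (f r) * modulus l (u r)))"
 define m where "m N i j = mollifier N b l i j" for N and i j :: 'n
 have mt: "trig (m N i j)" for N i j unfolding m_def by (rule trig_mol(1)[OF continuous_kmat])
 have me: "m N i j (- x) = m N i j x" for N i j x
  unfolding m_def by (rule mol_even[OF kmat_even continuous_borel[OF continuous_kmat]])
 have ms: "m N i j = m N j i" for N i j unfolding m_def by (simp add: kmat_sym[of _ _ i j])
 have K0: "0 \<le> K" using K by (simp add: kernel_bound_def)
 define Q where "Q N r = (\<Sum>i\<in>UNIV. \<Sum>j\<in>UNIV. \<Sum>k\<in>UNIV. nonlin i k j (pd (axis k 1) (m N i j)) r)" for N r
 define W where "W N r = (\<Sum>i\<in>UNIV. \<Sum>j\<in>UNIV. \<Sum>k\<in>UNIV. visc i k j (pd (axis k 1) (m N i j)) r)" for N r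
 define F where "F N r = (\<Sum>i\<in>UNIV. \<Sum>j\<in>UNIV. forc i j (m N i j) r)" for N r
 \<comment> \<open>The power input is subtracted, since it also occurs in the energy defect; only
   this difference is small.\<close>
 define E where "E N r = F N r - l2inner (f r) (u r)" for N r
 have meas: "Q N \<in> borel_measurable unit_time" "W N \<in> borel_measurable unit_time" "F N \<in> borel_measurable unit_time" "E N \<in> borel_measurable unit_time" for N
  unfolding Q_def[abs_def] W_def[abs_def] E_def[abs_def] F_def[abs_def]
  by (intro borel_measurable_sum borel_measurable_diff time_measurable trig_borel trig_pd(1) mt inner_facts(1))+
 have good_u: "square_integrable (u r)" "square_integrable (G r)" "square_integrable (f r)" "0 \<le> modulus l (u r)" if "good r" for r
  using that u_L2[of r] modulus_bounds(3)[OF u_L2[of r], of l] l by (auto simp: good_def)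

 have Qlim: "(\<lambda>N. Q N r) \<longlonglongrightarrow> structure_function b (u r) l / l"
  and Qb: "\<bar>Q N r\<bar> \<le> ?wQ r" if r: "good r" for r N
 proof -
  interpret cf: cubic_field "u r" using r by (simp add: good_def)
  have fk: "ball_functional l (K / l) (kavgd b l k i j)" for i j k :: 'n using K l by (simp add: kernel_bound_def)
  have e: "nonlin i k j (pd (axis k 1) (m N i j)) r = - kavgd b l k i j (fejer_mean N (cf.cub i k j))" for i j k N
  proof -
   have p: "trig (pd (axis k 1) (m N i j))" by (rule trig_pd(1)[OF mt])
   obtain B where B: "\<And>x. \<bar>pd (axis k 1) (m N i j) x\<bar> \<le> B" using trig_bounded[OF p] by blast
   have "nonlin i k j (pd (axis k 1) (m N i j)) r = (\<integral>y. pd (axis k 1) (m N i j) y * cf.cub i k j y \<partial>torus)"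
    unfolding nonlin_def cf.cub_def
    by (rule pair_conv_corr(1)[OF cf.prod_L1 in_Lp_mono[OF cf.comp_L3] trig_borel[OF p] trig_periodic[OF p] B]) simp
   then show ?thesis unfolding m_def by (simp add: kmol_pairing(2)[OF l cf.cub_continuous cf.cub_periodic])
  qed
  have "(\<lambda>N. Q N r) \<longlonglongrightarrow> (\<Sum>i\<in>UNIV. \<Sum>j\<in>UNIV. \<Sum>k\<in>UNIV. - kavgd b l k i j (cf.cub i k j))"
   unfolding Q_def e by (intro tendsto_sum tendsto_minus ball_functional_limit[OF fk] cf.cub_continuous cf.cub_periodic)
  then show "(\<lambda>N. Q N r) \<longlonglongrightarrow> structure_function b (u r) l / l"
   using cf.flux_structure_function[OF l d, of b] by (simp add: cf.flux_def sum_negf)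
  show "\<bar>Q N r\<bar> \<le> ?wQ r"
   unfolding Q_def e
  proof (rule sum3_bound, unfold abs_minus_cancel)
   fix i j k :: 'n
   show "\<bar>kavgd b l k i j (fejer_mean N (cf.cub i k j))\<bar> \<le> K / l * (2 * (\<integral>x. (norm (u r x)) ^ 3 \<partial>torus))"
    by (rule ball_functional_bound[OF fk less_imp_le[OF l]
       continuous_borel[OF continuous_average[OF trig_fejer cf.cub_continuous cf.cub_periodic]]
       fejer_average(3)[OF cf.cub_continuous cf.cub_periodic cf.cub_bound]])
  qed
 qed

 have Wlim: "\<exists>L. (\<lambda>N. W N r) \<longlonglongrightarrow> L \<and> \<bar>L\<bar> \<le> ?gW r"
  and Wb: "\<bar>W N r\<bar> \<le> ?wW r" if r: "good r" for r N
 proof -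
  note g = good_u[OF r]
  note cG = square_integrable_matrix_component[OF g(2)] and cu = square_integrable_component[OF g(1)]
  have Kl: "0 \<le> K / l" using K0 l by simp
  let ?L = "\<Sum>i\<in>UNIV. \<Sum>j\<in>UNIV. \<Sum>k\<in>UNIV. - kavgd b l k i j (corr (\<lambda>x. G r x $ i $ k) (\<lambda>x. u r x $ j))"
  have "(\<lambda>N. W N r) \<longlonglongrightarrow> ?L"
   unfolding W_def visc_def m_def by (intro tendsto_sum pairing_limits(2)[OF K l cG(1) cu(1)])
  moreover have "\<bar>?L\<bar> \<le> ?gW r"
  proof (rule sum3_bound)
   fix i j k :: 'n
   show "\<bar>- kavgd b l k i j (corr (\<lambda>x. G r x $ i $ k) (\<lambda>x. u r x $ j))\<bar> \<le> K / l * (vnrm (G r) * modulus l (u r))"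
    by (rule order_trans[OF pairing_limit_bounds(2)[OF K l cG(1) cu(1) component_modulus[OF g(1) l]]]) (assumption, use cG(2) g(4) Kl in \<open>(intro mult_left_mono mult_right_mono); auto\<close>)
  qed
  ultimately show "\<exists>L. (\<lambda>N. W N r) \<longlonglongrightarrow> L \<and> \<bar>L\<bar> \<le> ?gW r" by blast
  show "\<bar>W N r\<bar> \<le> ?wW r"
   unfolding W_def visc_def m_def
  proof (rule sum3_bound)
   fix i j k :: 'n
   show "\<bar>\<integral>x. G r x $ i $ k * conv (pd (axis k 1) (mollifier N b l i j)) (\<lambda>x. u r x $ j) x \<partial>torus\<bar> \<le> K / l * (vnrm (G r) * vnrm (u r))"
    by (rule order_trans[OF pairing_bounds(2)[OF K l cG(1) cu(1)]]) (use cG(2) cu(2) Kl in \<open>(intro mult_left_mono mult_mono); auto\<close>)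
  qed
 qed

 have Elim: "\<exists>L. (\<lambda>N. E N r) \<longlonglongrightarrow> L \<and> \<bar>L\<bar> \<le> ?gE r"
  and Eb: "\<bar>E N r\<bar> \<le> ?wE r" if r: "good r" for r N
 proof -
  note g = good_u[OF r]
  note cf = square_integrable_component[OF g(3)] and cu = square_integrable_component[OF g(1)]
  let ?k = "\<lambda>i j. kavg b l i j (corr (\<lambda>x. f r x $ i) (\<lambda>x. u r x $ j))"
  let ?L = "(\<Sum>i\<in>UNIV. \<Sum>j\<in>UNIV. ?k i j) - l2inner (f r) (u r)"
  have lim: "(\<lambda>N. E N r) \<longlonglongrightarrow> ?L"
   unfolding E_def F_def forc_def m_def by (intro tendsto_diff tendsto_const tendsto_sum pairing_limits(1)[OF K l cf(1) cu(1)])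
  have eq: "?L = (\<Sum>i\<in>UNIV. \<Sum>j\<in>UNIV. ?k i j - (if i = j then \<integral>x. f r x $ i * u r x $ j \<partial>torus else 0))"
   unfolding inner_facts(2)[OF r] sum_subtractf sum_diagonal ..
  have bd: "\<bar>\<Sum>i\<in>UNIV. \<Sum>j\<in>UNIV. ?k i j - (if i = j then \<integral>x. f r x $ i * u r x $ j \<partial>torus else 0)\<bar>
    \<le> ?gE r"
  proof (rule sum2_bound)
   fix i j :: 'n
   show "\<bar>?k i j - (if i = j then \<integral>x. f r x $ i * u r x $ j \<partial>torus else 0)\<bar> \<le> K * (vnrm (f r) * modulus l (u r))"
    by (rule order_trans[OF pairing_limit_bounds(1)[OF K l cf(1) cu(1) component_modulus[OF g(1) l] d]]) (assumption, use cf(2) g(4) K0 in \<open>(intro mult_left_mono mult_right_mono); auto\<close>)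
  qed
  show "\<exists>L. (\<lambda>N. E N r) \<longlonglongrightarrow> L \<and> \<bar>L\<bar> \<le> ?gE r"
   by (intro exI[of _ ?L] conjI lim) (unfold eq, rule bd)
  have "\<bar>F N r\<bar> \<le> ?n ^ 2 * (K * (vnrm (f r) * vnrm (u r)))"
   unfolding F_def forc_def m_def
  proof (rule sum2_bound)
   fix i j :: 'n
   show "\<bar>\<integral>x. f r x $ i * conv (mollifier N b l i j) (\<lambda>x. u r x $ j) x \<partial>torus\<bar> \<le> K * (vnrm (f r) * vnrm (u r))"
    by (rule order_trans[OF pairing_bounds(1)[OF K l cf(1) cu(1)]]) (use cf(2) cu(2) K0 in \<open>(intro mult_left_mono mult_mono); auto\<close>)
  qed
  then show "\<bar>E N r\<bar> \<le> ?wE r"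
   using inner_facts(3)[OF r] by (simp add: E_def algebra_simps abs_le_iff)
 qed

 have iu3: "integrable unit_time (\<lambda>r. \<integral>x. (norm (u r x)) ^ 3 \<partial>torus)"
  using spacetime_integral(1)[OF u_L3 continuous_on_const[of _ 1]] by simp
 have cm: "continuous_on {0..1} (\<lambda>r. modulus l (u r))" using l by (intro continuous_modulus) simp
 have iw: "integrable unit_time ?wQ" "integrable unit_time ?wW" "integrable unit_time ?wE" "integrable unit_time ?gW" "integrable unit_time ?gE"
  by (intro integrable_mult_right iu3 integrable_mult_continuous vnrm_G_integrable(1) f_L1L2 continuous_vnrm cm)+

 have iQWE: "integrable unit_time (Q N)" "integrable unit_time (W N)" "integrable unit_time (E N)" for N
 proof -
  have h: "integrable unit_time s" if "integrable unit_time w" "s \<in> borel_measurable unit_time" "\<And>r. good r \<Longrightarrow> \<bar>s r\<bar> \<le> w r" for s w :: "real \<Rightarrow> real"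
   by (rule L1_bound[OF that(1,2)]) (use AE_good in eventually_elim, use that(3) in fastforce)
  show "integrable unit_time (Q N)" "integrable unit_time (W N)" "integrable unit_time (E N)"
   by (rule h[OF iw(1) meas(1) Qb] h[OF iw(2) meas(2) Wb] h[OF iw(3) meas(4) Eb]; assumption)+
 qed

 let ?P = "\<lambda>N v. \<Sum>i\<in>UNIV. \<Sum>j\<in>UNIV. \<integral>x. v x $ i * conv (m N i j) (\<lambda>x. v x $ j) x \<partial>torus"
 \<comment> \<open>The factor 2 comes from the two halves of the product rule, equal after summation
   because the kernel matrix is symmetric.\<close>
 have bal: "?P N (u t) - ?P N u0 = 2 * (tint t (Q N) - \<nu> * tint t (W N) + tint t (E N) + tint t (\<lambda>r. l2inner (f r) (u r)))" for N
 proof -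
  define R where "R i j \<psi> \<longleftrightarrow> integrable unit_time \<psi> \<and> (AE r in unit_time. \<psi> r = pairing_rate i j (m N i j) r + pairing_rate j i (m N i j) r) \<and>
    (\<integral>x. u t x $ i * conv (m N i j) (\<lambda>x. u t x $ j) x \<partial>torus) - (\<integral>x. u0 x $ i * conv (m N i j) (\<lambda>x. u0 x $ j) x \<partial>torus) = tint t \<psi>" for i j \<psi>
  have "\<exists>\<psi>. R i j \<psi>" for i j unfolding R_def by (rule pairing_balance[OF mt me t])
  then obtain \<psi> where "\<And>i j. R i j (\<psi> i j)" by metis
  then have p: "\<And>i j. integrable unit_time (\<psi> i j)"
   "\<And>i j. AE r in unit_time. \<psi> i j r = pairing_rate i j (m N i j) r + pairing_rate j i (m N i j) r"
   "\<And>i j. (\<integral>x. u t x $ i * conv (m N i j) (\<lambda>x. u t x $ j) x \<partial>torus) - (\<integral>x. u0 x $ i * conv (m N i j) (\<lambda>x. u0 x $ j) x \<partial>torus) = tint t (\<psi> i j)"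
   unfolding R_def by blast+
  have "?P N (u t) - ?P N u0 = (\<Sum>i\<in>UNIV. \<Sum>j\<in>UNIV. tint t (\<psi> i j))"
   by (simp add: p(3) flip: sum_subtractf)
  also have "\<dots> = tint t (\<lambda>r. \<Sum>i\<in>UNIV. \<Sum>j\<in>UNIV. \<psi> i j r)"
   unfolding tint_def sum_distrib_left
   by (simp only: lint_sum L1_sum integrable_tint[OF p(1)])
  also have "\<dots> = tint t (\<lambda>r. 2 * (Q N r - \<nu> * W N r + (E N r + l2inner (f r) (u r))))"
  proof (rule tint_cong_AE)
   have "AE r in unit_time. \<forall>i j. \<psi> i j r = pairing_rate i j (m N i j) r + pairing_rate j i (m N i j) r"
    using p(2) by (simp add: AE_all_countable)
   with AE_good show "AE r in unit_time. (\<Sum>i\<in>UNIV. \<Sum>j\<in>UNIV. \<psi> i j r) = 2 * (Q N r - \<nu> * W N r + (E N r + l2inner (f r) (u r)))"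
   proof eventually_elim
    case (elim r)
    let ?R = "\<Sum>i\<in>UNIV. \<Sum>j\<in>UNIV. pairing_rate i j (m N i j) r"
    have sw: "(\<Sum>i\<in>UNIV. \<Sum>j\<in>UNIV. pairing_rate j i (m N i j) r) = ?R"
     by (subst sum.swap) (simp add: ms[of N])
    have "(\<Sum>i\<in>UNIV. \<Sum>j\<in>UNIV. \<psi> i j r) = ?R + (\<Sum>i\<in>UNIV. \<Sum>j\<in>UNIV. pairing_rate j i (m N i j) r)"
     using elim(2) by (simp add: sum.distrib)
    also have "\<dots> = 2 * ?R" unfolding sw by simp
    also have "?R = Q N r + (\<Sum>i\<in>UNIV. \<Sum>j\<in>UNIV. press j (pd (axis i 1) (m N i j)) r) - \<nu> * W N r + F N r"
     unfolding pairing_rate_def Q_def W_def F_def by (simp only: sum.distrib sum_subtractf sum_distrib_left[symmetric])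
    also have "(\<Sum>i\<in>UNIV. \<Sum>j\<in>UNIV. press j (pd (axis i 1) (m N i j)) r) = 0"
     unfolding m_def by (rule pressure_vanishes[OF elim(1) l])
    finally show ?case by (simp add: E_def)
   qed
   show "(\<lambda>r. \<Sum>i\<in>UNIV. \<Sum>j\<in>UNIV. \<psi> i j r) \<in> borel_measurable unit_time" using p(1) by (intro borel_measurable_sum) auto
   show "(\<lambda>r. 2 * (Q N r - \<nu> * W N r + (E N r + l2inner (f r) (u r)))) \<in> borel_measurable unit_time"
    using meas inner_facts(1) by measurable
  qed
  also have "\<dots> = (\<integral>r. 2 * (indicator {0..t} r * Q N r - \<nu> * (indicator {0..t} r * W N r) + (indicator {0..t} r * E N r + indicator {0..t} r * l2inner (f r) (u r))) \<partial>unit_time)"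
   unfolding tint_def by (intro lint_cong refl) (simp add: algebra_simps)
  also have "\<dots> = 2 * (tint t (Q N) - \<nu> * tint t (W N) + (tint t (E N) + tint t (\<lambda>r. l2inner (f r) (u r))))"
   unfolding tint_def
   by (simp only: lint_mult_right_zero lint_add lint_diff
     L1_add L1_diff integrable_mult_right integrable_tint iQWE inner_integrable)
  finally show ?thesis by (simp add: add.assoc)
 qed

 obtain L1 where L1: "(\<lambda>N. ?P N (u t)) \<longlonglongrightarrow> L1" "\<bar>L1 - (vnrm (u t))\<^sup>2\<bar> \<le> ?n ^ 2 * (K * (vnrm (u t) * modulus l (u t)))"
  using quadratic_limit[OF K l d u_L2[OF t]] unfolding m_def by blast
 obtain L0 where L0: "(\<lambda>N. ?P N u0) \<longlonglongrightarrow> L0" "\<bar>L0 - (vnrm u0)\<^sup>2\<bar> \<le> ?n ^ 2 * (K * (vnrm u0 * modulus l u0))"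
  using quadratic_limit[OF K l d u0_L2] unfolding m_def by blast
 obtain LW where LW: "\<And>r. good r \<Longrightarrow> (\<lambda>N. W N r) \<longlonglongrightarrow> LW r" "\<And>r. good r \<Longrightarrow> \<bar>LW r\<bar> \<le> ?gW r" using Wlim by metis
 obtain LE where LE: "\<And>r. good r \<Longrightarrow> (\<lambda>N. E N r) \<longlonglongrightarrow> LE r" "\<And>r. good r \<Longrightarrow> \<bar>LE r\<bar> \<le> ?gE r" using Elim by metis
 have aeg: "AE r in unit_time. X r" if "\<And>r. good r \<Longrightarrow> X r" for X
  using AE_good by eventually_elim (rule that)
 have SQ: "\<bar>structure_function b (u r) l / l\<bar> \<le> ?wQ r" if "good r" for r
 proof (rule LIMSEQ_le_const2)
  show "(\<lambda>N. \<bar>Q N r\<bar>) \<longlonglongrightarrow> \<bar>structure_function b (u r) l / l\<bar>" by (intro tendsto_rabs Qlim that)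
 qed (use Qb[OF that] in blast)
 have Sm: "(\<lambda>r. structure_function b (u r) l / l) \<in> borel_measurable unit_time"
  using structure_function_measurable[of b l] by simp
 have TQ: "(\<lambda>N. tint t (Q N)) \<longlonglongrightarrow> tint t (\<lambda>r. structure_function b (u r) l / l)"
  using tint_limit_bound[OF meas(1) iw(1) iw(1) aeg[OF Qb] aeg[OF Qlim] aeg[OF SQ], of t] Sm by blast
 obtain IW where IW: "(\<lambda>N. tint t (W N)) \<longlonglongrightarrow> IW" "\<bar>IW\<bar> \<le> (\<integral>r. ?gW r \<partial>unit_time)"
  using tint_limit_bound[OF meas(2) iw(2) iw(4) aeg[OF Wb] aeg[OF LW(1)] aeg[OF LW(2)], of t] by blast
 obtain IE where IE: "(\<lambda>N. tint t (E N)) \<longlonglongrightarrow> IE" "\<bar>IE\<bar> \<le> (\<integral>r. ?gE r \<partial>unit_time)"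
  using tint_limit_bound[OF meas(4) iw(3) iw(5) aeg[OF Eb] aeg[OF LE(1)] aeg[OF LE(2)], of t] by blast
 have "(\<lambda>N. ?P N (u t) - ?P N u0) \<longlonglongrightarrow> L1 - L0" by (intro tendsto_diff L1 L0)
 moreover have "(\<lambda>N. ?P N (u t) - ?P N u0) \<longlonglongrightarrow> 2 * (tint t (\<lambda>r. structure_function b (u r) l / l) - \<nu> * IW + IE + tint t (\<lambda>r. l2inner (f r) (u r)))"
  unfolding bal by (intro tendsto_intros TQ IW IE)
 ultimately have lim: "L1 - L0 = 2 * (tint t (\<lambda>r. structure_function b (u r) l / l) - \<nu> * IW + IE + tint t (\<lambda>r. l2inner (f r) (u r)))"
  by (rule LIMSEQ_unique)
 have n: "l2norm u0 = vnrm u0" "l2norm (u t) = vnrm (u t)"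
  using u0_L2 u_L2[OF t] by (auto simp: square_integrable_def intro!: L2_vnrm(2))
 have en: "energy_defect u0 f u t = 1 / 2 * (vnrm u0)\<^sup>2 - 1 / 2 * (vnrm (u t))\<^sup>2 + tint t (\<lambda>r. l2inner (f r) (u r))"
  unfolding energy_defect_def n set_integral_tint[OF t] ..
 \<comment> \<open>The power input cancels between the balance and the energy defect.\<close>
 have id: "tint t (\<lambda>r. structure_function b (u r) l / l) + energy_defect u0 f u t
   = (L1 - (vnrm (u t))\<^sup>2) / 2 - (L0 - (vnrm u0)\<^sup>2) / 2 + \<nu> * IW - IE"
  using lim en by (simp add: field_simps)
 have nW: "\<bar>\<nu> * IW\<bar> \<le> \<nu> * (\<integral>r. ?gW r \<partial>unit_time)"
  using IW(2) viscosity by (simp only: abs_mult abs_of_nonneg) (rule mult_left_mono)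
 have "\<bar>a / 2 - b / 2 + w - e\<bar> \<le> A + B + W + E" if "\<bar>a\<bar> \<le> A" "\<bar>b\<bar> \<le> B" "\<bar>w\<bar> \<le> W" "\<bar>e\<bar> \<le> E" for a b w e A B W E :: real
  using that by linarith
 from this[OF L1(2) L0(2) nW IE(2)] show ?thesis unfolding id .
qed

end

section \<open>Moduli of smoothness\<close>

lemma increment_square_integrable:
 fixes v :: "real ^ 'n \<Rightarrow> real ^ 'm"
 assumes v: "square_integrable v"
 shows "square_integrable (increment y v)" and "vnrm (increment y v) \<le> 2 * vnrm v"
 using square_integrable_diff[OF square_integrable_shift(1)[OF v, of "- y"] v] square_integrable_shift(2)[OF v, of "- y"]
 by (simp_all add: increment_def[abs_def])

lemma iterated_increment:
 fixes v :: "real ^ 'n \<Rightarrow> real ^ 'm"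
 assumes v: "square_integrable v"
 shows "square_integrable ((increment y ^^ j) v)" and "vnrm ((increment y ^^ j) v) \<le> 2 ^ j * vnrm v"
proof (induction j)
 case (Suc j)
 { case 1 show ?case using increment_square_integrable(1)[OF Suc(1)] by simp }
 { case 2 show ?case using increment_square_integrable(2)[OF Suc(1), of y] Suc(2) by simp }
qed (use v in simp_all)

text \<open>The first difference is paired with its own adjoint, so second differences control it.\<close>

lemma increment_log_convex:
 fixes w :: "real ^ 'n \<Rightarrow> real ^ 'm"
 assumes w: "square_integrable w"
 shows "(vnrm (increment y w))\<^sup>2 \<le> vnrm w * vnrm (increment y (increment y w))"
proof -
 let ?d = "increment y w" and ?e = "\<lambda>x. increment y w (x - y)"
 have d: "square_integrable ?d" by (rule increment_square_integrable(1)[OF w])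
 have e: "square_integrable ?e" by (rule square_integrable_shift(1)[OF d])
 have ws: "square_integrable (\<lambda>x. w (x + y))" using square_integrable_shift(1)[OF w, of "- y"] by simp
 have b: "(\<lambda>x. w x \<bullet> ?e x) \<in> borel_measurable borel" and p: "periodic (\<lambda>x. w x \<bullet> ?e x)"
  using w e by (auto simp: square_integrable_def periodic_def)
 have "(vnrm ?d)\<^sup>2 = (\<integral>x. ?d x \<bullet> ?d x \<partial>torus)" by (simp add: vnrm_def nrm_square power2_norm_eq_inner)
 also have "\<dots> = (\<integral>x. w (x + y) \<bullet> ?d x - w x \<bullet> ?d x \<partial>torus)"
  by (rule lint_cong) (simp_all add: increment_def inner_diff_left)
 also have "\<dots> = (\<integral>x. w (x + y) \<bullet> ?d x \<partial>torus) - (\<integral>x. w x \<bullet> ?d x \<partial>torus)"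
  by (intro lint_diff inner_cauchy_schwarz(1) ws w d)
 also have "(\<integral>x. w (x + y) \<bullet> ?d x \<partial>torus) = (\<integral>x. w x \<bullet> ?e x \<partial>torus)"
  using integral_torus_shift(1)[OF b p, of y] by simp
 also have "\<dots> - (\<integral>x. w x \<bullet> ?d x \<partial>torus) = (\<integral>x. w x \<bullet> (?e x - ?d x) \<partial>torus)"
  unfolding inner_diff_right
  by (rule lint_diff[symmetric]) (intro inner_cauchy_schwarz(1) w d e)+
 also have "\<dots> \<le> vnrm w * vnrm (\<lambda>x. ?e x - ?d x)"
  using inner_cauchy_schwarz(2)[OF w square_integrable_diff(1)[OF e d]] by simp
 also have "vnrm (\<lambda>x. ?e x - ?d x) = vnrm (\<lambda>x. increment y ?d (x - y))"
  by (simp add: vnrm_def increment_def[of y ?d] norm_minus_commute)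
 also have "\<dots> = vnrm (increment y ?d)" by (rule square_integrable_shift(2)[OF increment_square_integrable(1)[OF d]])
 finally show ?thesis .
qed

text \<open>Each application of log-convexity lowers the order of the difference by one, replacing
  the bound \<open>z\<close> by the square root of \<open>C * z\<close>.\<close>

lemma increment_from_higher:
 fixes v :: "real ^ 'n \<Rightarrow> real ^ 'm"
 assumes v: "square_integrable v" and C: "\<And>j. j \<le> k \<Longrightarrow> vnrm ((increment y ^^ j) v) \<le> C" and h: "vnrm ((increment y ^^ Suc k) v) \<le> h"
 shows "vnrm (increment y v) \<le> ((\<lambda>z. sqrt (C * z)) ^^ k) h"
 using C h
proof (induction k arbitrary: h)
 case (Suc k)
 let ?w = "(increment y ^^ k) v"
 have "(vnrm (increment y ?w))\<^sup>2 \<le> vnrm ?w * vnrm (increment y (increment y ?w))"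
  by (rule increment_log_convex[OF iterated_increment(1)[OF v]])
 also have "\<dots> \<le> C * h"
 proof (rule mult_mono)
  show "vnrm ?w \<le> C" by (rule Suc.prems(1)) simp
  then show "0 \<le> C" by (rule order_trans[OF vnrm_nonneg])
 qed (use Suc.prems(2) in simp_all)
 finally have "vnrm ((increment y ^^ Suc k) v) \<le> sqrt (C * h)" by (simp add: real_le_rsqrt)
 from Suc.IH[OF Suc.prems(1) this] show ?case by (simp only: funpow_Suc_right o_apply le_SucI)
qed simp

lemma besov_increment:
 fixes v :: "real ^ 'n \<Rightarrow> real ^ 'm"
 assumes v: "square_integrable v" and y: "y \<noteq> 0"
 shows "ennreal (norm y powr - \<alpha> * vnrm ((increment y ^^ (nat \<lfloor>\<alpha>\<rfloor> + 1)) v)) \<le> besov \<alpha> v"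
proof -
 have "L2 ((increment y ^^ (nat \<lfloor>\<alpha>\<rfloor> + 1)) v) = ennreal (vnrm ((increment y ^^ (nat \<lfloor>\<alpha>\<rfloor> + 1)) v))"
  using iterated_increment(1)[OF v] by (intro L2_vnrm(1)) (simp add: square_integrable_def del: funpow.simps)
 then have "ennreal (norm y powr - \<alpha> * vnrm ((increment y ^^ (nat \<lfloor>\<alpha>\<rfloor> + 1)) v))
   = ennreal (norm y powr - \<alpha>) * L2 ((increment y ^^ (nat \<lfloor>\<alpha>\<rfloor> + 1)) v)"
  by (simp add: ennreal_mult)
 also have "\<dots> \<le> besov \<alpha> v"
  unfolding besov_def using y by (intro add_increasing[OF zero_le] SUP_upper) simp
 finally show ?thesis .
qed

text \<open>With k the integer part of the exponent, the norm controls differences of order k + 1.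
  Those of order at most k are bounded by 2^k M, and k square-root steps lead down to first order.
  The zero shift is separate because the Besov supremum omits it.\<close>

lemma besov_modulus_higher:
 fixes v :: "real ^ 'n \<Rightarrow> real ^ 'n"
 assumes v: "square_integrable v" and M: "vnrm v \<le> M" and C: "besov \<alpha> v \<le> ennreal C" "0 \<le> C" and l: "0 < l" and \<alpha>: "0 < \<alpha>"
 shows "modulus l v \<le> ((\<lambda>z. sqrt (2 ^ nat \<lfloor>\<alpha>\<rfloor> * M * z)) ^^ nat \<lfloor>\<alpha>\<rfloor>) (C * l powr \<alpha>)"
proof (rule modulus_least)
 fix y :: "real ^ 'n" assume y: "norm y \<le> l"
 let ?k = "nat \<lfloor>\<alpha>\<rfloor>"
 have Cj: "vnrm ((increment (- y) ^^ j) v) \<le> 2 ^ ?k * M" if "j \<le> ?k" for j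
 proof -
  have "vnrm ((increment (- y) ^^ j) v) \<le> 2 ^ j * vnrm v" by (rule iterated_increment(2)[OF v])
  also have "\<dots> \<le> 2 ^ ?k * M" by (intro mult_mono M power_increasing that) auto
  finally show ?thesis .
 qed
 have h: "vnrm ((increment (- y) ^^ Suc ?k) v) \<le> C * l powr \<alpha>"
 proof (cases "y = 0")
  case True
  then have "(increment (- y) ^^ Suc ?k) v = (\<lambda>x. 0)" by (simp add: increment_def[abs_def])
  then have "vnrm ((increment (- y) ^^ Suc ?k) v) = 0" by (simp add: vnrm_def nrm_def)
  then show ?thesis using C by simp
 next
  case False
  have "ennreal (norm (- y) powr - \<alpha> * vnrm ((increment (- y) ^^ (?k + 1)) v)) \<le> ennreal C"
   by (rule order_trans[OF besov_increment[OF v] C(1)]) (use False in simp)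
  then have "norm y powr - \<alpha> * vnrm ((increment (- y) ^^ Suc ?k) v) \<le> C"
   using C(2) by (simp del: funpow.simps)
  then have "vnrm ((increment (- y) ^^ Suc ?k) v) \<le> C * norm y powr \<alpha>"
   using False by (simp add: powr_minus divide_simps del: funpow.simps)
  also have "\<dots> \<le> C * l powr \<alpha>" using y \<alpha> C(2) by (intro mult_left_mono powr_mono2) auto
  finally show ?thesis .
 qed
 have "vnrm (increment (- y) v) \<le> ((\<lambda>z. sqrt (2 ^ ?k * M * z)) ^^ ?k) (C * l powr \<alpha>)"
  by (rule increment_from_higher[OF v Cj h])
 then show "vnrm (\<lambda>x. v (x - y) - v x) \<le> ((\<lambda>z. sqrt (2 ^ ?k * M * z)) ^^ ?k) (C * l powr \<alpha>)"
  by (simp add: increment_def[abs_def])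
qed (use l in simp)

text \<open>Below 1 no square-root step occurs, so the full power of \<open>l\<close> is
  kept.\<close>

lemma besov_modulus:
 fixes v :: "real ^ 'n \<Rightarrow> real ^ 'n"
 assumes v: "square_integrable v" and l: "0 < l" and \<alpha>: "0 < \<alpha>" "\<alpha> < 1"
 shows "ennreal (l powr - \<alpha> * modulus l v) \<le> besov \<alpha> v"
proof (cases "besov \<alpha> v")
 case (real C)
 have "\<lfloor>\<alpha>\<rfloor> = 0" using \<alpha> by (simp add: floor_eq_iff)
 then have "modulus l v \<le> C * l powr \<alpha>"
  using besov_modulus_higher[OF v order_refl _ real(1) l \<alpha>(1)] real by simp
 then have "l powr - \<alpha> * modulus l v \<le> C" using l by (simp add: powr_minus divide_simps)
 then show ?thesis using real by (simp add: ennreal_leI)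
qed simp

lemma funpow_sqrt:
 assumes "0 \<le> C" "0 \<le> z"
 shows "0 \<le> ((\<lambda>z. sqrt (C * z)) ^^ k) z" and "z \<le> z' \<Longrightarrow> ((\<lambda>z. sqrt (C * z)) ^^ k) z \<le> ((\<lambda>z. sqrt (C * z)) ^^ k) z'"
proof -
 show "0 \<le> ((\<lambda>z. sqrt (C * z)) ^^ k) z" by (induction k) (use assms in auto)
 show "((\<lambda>z. sqrt (C * z)) ^^ k) z \<le> ((\<lambda>z. sqrt (C * z)) ^^ k) z'" if "z \<le> z'"
  using that assms by (intro funpow_mono) (auto intro!: monoI mult_left_mono)
qed

lemma funpow_sqrt_tendsto:
 assumes "(h \<longlongrightarrow> 0) F"
 shows "((\<lambda>l. ((\<lambda>z. sqrt (C * z)) ^^ k) (h l)) \<longlongrightarrow> 0) F"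
proof (induction k)
 case (Suc k)
 have "((\<lambda>l. sqrt (C * ((\<lambda>z. sqrt (C * z)) ^^ k) (h l))) \<longlongrightarrow> sqrt (C * 0)) F" by (intro tendsto_intros Suc)
 then show ?case by simp
qed (use assms in simp)

lemma modulus_mono: "square_integrable v \<Longrightarrow> 0 \<le> l \<Longrightarrow> l \<le> l' \<Longrightarrow> modulus l v \<le> modulus l' v"
 by (rule modulus_least) (auto intro!: modulus_bounds(1))

text \<open>The initial datum is only square-integrable, so no rate is claimed; continuity of
  translations is applied to each component.\<close>

lemma modulus_tendsto:
 fixes v :: "real ^ 'n \<Rightarrow> real ^ 'n"
 assumes v: "square_integrable v"
 shows "((\<lambda>l. modulus l v) \<longlongrightarrow> 0) (at_right 0)"
proof (rule order_tendstoI)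
 fix a :: real assume "a < 0"
 then show "\<forall>\<^sub>F l in at_right 0. a < modulus l v"
  using modulus_bounds(3)[OF v] by (intro eventually_at_rightI[of 0 1]) (auto intro: less_le_trans)
next
 fix e :: real assume e: "0 < e"
 \<comment> \<open>Chosen so that d components add up to the square of e / 2.\<close>
 define \<eta> where "\<eta> = (e / 2)\<^sup>2 / real CARD('n)"
 have \<eta>: "0 < \<eta>" using e by (simp add: \<eta>_def)
 define R where "R i d \<longleftrightarrow> 0 < d \<and> (\<forall>y. norm y < d \<longrightarrow> (\<integral>x. \<bar>v (x - y) $ i - v x $ i\<bar> ^ Suc 1 \<partial>torus) < \<eta>)" for i d
 have "\<exists>d. R i d" for i
  unfolding R_def by (rule translation_continuous[OF _ \<eta>]) (use square_integrable_component(1)[OF v, of i] in \<open>simp only: numeral_2_eq_2 One_nat_def\<close>)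
 then obtain d where "\<And>i. R i (d i)" by metis
 then have d: "\<And>i. 0 < d i" "\<And>i y. norm y < d i \<Longrightarrow> (\<integral>x. \<bar>v (x - y) $ i - v x $ i\<bar> ^ Suc 1 \<partial>torus) < \<eta>"
  unfolding R_def by blast+
 define \<delta> where "\<delta> = Min (range d)"
 have \<delta>: "0 < \<delta>" "\<And>i. \<delta> \<le> d i" using d(1) by (auto simp: \<delta>_def)
 have "modulus l v \<le> e / 2" if l: "0 < l" "l < \<delta>" for l
 proof (rule modulus_least)
  fix y :: "real ^ 'n" assume y: "norm y \<le> l"
  let ?w = "\<lambda>x. v (x - y) - v x"
  have w: "square_integrable ?w" by (intro square_integrable_diff(1) square_integrable_shift(1) v)
  have "(vnrm ?w)\<^sup>2 = (\<integral>x. (\<Sum>i\<in>UNIV. (?w x $ i)\<^sup>2) \<partial>torus)"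
   by (simp add: vnrm_def nrm_square norm_vec_def L2_set_def sum_nonneg)
  also have "\<dots> = (\<Sum>i\<in>UNIV. \<integral>x. (?w x $ i)\<^sup>2 \<partial>torus)"
   by (intro lint_sum in_L2_integrable square_integrable_component(1) w)
  also have "\<dots> \<le> (\<Sum>i\<in>(UNIV :: 'n set). \<eta>)"
  proof (rule sum_mono)
   fix i
   have "norm y < d i" using y l \<delta>(2)[of i] by linarith
   from d(2)[OF this] show "(\<integral>x. (?w x $ i)\<^sup>2 \<partial>torus) \<le> \<eta>" by (simp add: power2_eq_square flip: abs_mult)
  qed
  also have "\<dots> = (e / 2)\<^sup>2" by (simp add: \<eta>_def)
  finally show "vnrm ?w \<le> e / 2" by (rule power2_le_imp_le) (use e in simp)
 qed (use l in simp)
 then have "modulus l v < e" if "0 < l" "l < \<delta>" for l using that e by fastforce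
 then show "\<forall>\<^sub>F l in at_right 0. modulus l v < e"
  using \<delta>(1) by (intro eventually_at_rightI[of 0 \<delta>]) auto
qed

section \<open>Uniform estimates for Leray--Hopf solutions\<close>

lemma torus_field_square_integrable:
 fixes v :: "real ^ 'n \<Rightarrow> 'b::{real_normed_vector, second_countable_topology}"
 assumes "torus_field v" "L2 v < \<infinity>" shows "square_integrable v"
 using assms L2_finite_iff[OF torus_field_borel[OF assms(1)]] torus_field_borel[OF assms(1)]
 by (simp add: square_integrable_def torus_field_def)

lemma epowr_measurable [measurable]: "(\<lambda>a. epowr a q) \<in> borel_measurable borel"
 unfolding epowr_def[abs_def] by measurable

lemma L2_time_measurable:
 fixes w :: "real \<Rightarrow> real ^ 'n \<Rightarrow> 'b::{real_normed_vector, second_countable_topology}"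
 assumes "spacetime_field w"
 shows "(\<lambda>t. L2 (w t)) \<in> borel_measurable unit_time" and "(\<lambda>t. vnrm (w t)) \<in> borel_measurable unit_time"
proof -
 have [measurable]: "(\<lambda>p. w (fst p) (snd p)) \<in> borel_measurable spacetime"
  using assms by (simp add: spacetime_field_def split_def)
 have "(\<lambda>p. epowr (ennreal (norm (w (fst p) (snd p)))) 2) \<in> borel_measurable spacetime" by measurable
 then have "(\<lambda>t. \<integral>\<^sup>+x. epowr (ennreal (norm (w t x))) 2 \<partial>torus) \<in> borel_measurable unit_time"
  by (intro torus.borel_measurable_nn_integral) (simp add: split_def)
 then show "(\<lambda>t. L2 (w t)) \<in> borel_measurable unit_time"
  unfolding L2_def Lnorm_def by measurable
 have "(\<lambda>p. (norm (w (fst p) (snd p)))\<^sup>2) \<in> borel_measurable spacetime" by measurable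
 then have "(\<lambda>t. \<integral>x. (norm (w t x))\<^sup>2 \<partial>torus) \<in> borel_measurable unit_time"
  by (intro torus.borel_measurable_lebesgue_integral) (simp add: split_def)
 then show "(\<lambda>t. vnrm (w t)) \<in> borel_measurable unit_time" unfolding vnrm_def nrm_def by measurable
qed

lemma Lnorm_le:
 assumes "Lnorm M q g \<le> ennreal B" "0 < q" "0 \<le> B"
 shows "(\<integral>\<^sup>+x. epowr (g x) q \<partial>M) \<le> ennreal (B powr q)"
 using epowr_mono[OF assms(1)[unfolded Lnorm_def], of q] assms(2,3) by (simp add: epowr_inverse epowr_ennreal)

section \<open>Energy bounds and the size of the error terms\<close>

context ns
begin

text \<open>The norm attains its maximum X by continuity. The energy inequality at that time gives
  X^2 at most |u0|^2 + 2 X \<Phi>, which forces X to be at most |u0| + 2 \<Phi>; the time 1 then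
  bounds the dissipation.\<close>

lemma energy_bounds:
 assumes en: "\<And>t. t \<in> {0..1} \<Longrightarrow> 1 / 2 * (l2norm (u t))\<^sup>2 + \<nu> * (LINT r:{0..t}|lborel. (l2norm (G r))\<^sup>2)
    \<le> 1 / 2 * (l2norm u0)\<^sup>2 + (LINT r:{0..t}|lborel. l2inner (f r) (u r))"
  and \<Phi>: "(\<integral>r. vnrm (f r) \<partial>unit_time) \<le> \<Phi>"
 shows "t \<in> {0..1} \<Longrightarrow> vnrm (u t) \<le> vnrm u0 + 2 * \<Phi>"
  and "\<nu> * (\<integral>r. (vnrm (G r))\<^sup>2 \<partial>unit_time) \<le> (vnrm u0)\<^sup>2 + (vnrm u0 + 2 * \<Phi>) * \<Phi>"
proof -
 obtain tm where tm: "tm \<in> {0..1}" "\<And>t. t \<in> {0..1} \<Longrightarrow> vnrm (u t) \<le> vnrm (u tm)"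
  using continuous_attains_sup[OF _ _ continuous_vnrm] by auto
 define X where "X = vnrm (u tm)"
 have X0: "0 \<le> X" by (simp add: X_def)
 have \<Phi>0: "0 \<le> \<Phi>" using \<Phi> by (rule order_trans[rotated]) (simp add: integral_nonneg_AE)
 have rhs: "tint t (\<lambda>r. l2inner (f r) (u r)) \<le> X * \<Phi>" for t
 proof -
  have "tint t (\<lambda>r. l2inner (f r) (u r)) \<le> (\<integral>r. \<bar>l2inner (f r) (u r)\<bar> \<partial>unit_time)" using tint_abs_le[OF inner_integrable, of t] by simp
  also have "\<dots> \<le> (\<integral>r. X * vnrm (f r) \<partial>unit_time)"
  proof (rule integral_mono_AE)
   show "AE r in unit_time. \<bar>l2inner (f r) (u r)\<bar> \<le> X * vnrm (f r)" using AE_good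
   proof eventually_elim
    case (elim r)
    have "\<bar>l2inner (f r) (u r)\<bar> \<le> vnrm (f r) * vnrm (u r)" by (rule inner_facts(3)[OF elim])
    also have "\<dots> \<le> vnrm (f r) * X" unfolding X_def using elim by (intro mult_left_mono tm(2)) (auto simp: good_def)
    finally show ?case by (simp add: mult.commute)
   qed
  qed (intro integrable_abs inner_integrable integrable_mult_right f_L1L2)+
  also have "\<dots> \<le> X * \<Phi>" using \<Phi> X0 by (simp add: mult_left_mono)
  finally show ?thesis .
 qed
 have lG: "tint t (\<lambda>r. (l2norm (G r))\<^sup>2) = tint t (\<lambda>r. (vnrm (G r))\<^sup>2)" for t
 proof (rule tint_cong_AE)
  show "AE r in unit_time. (l2norm (G r))\<^sup>2 = (vnrm (G r))\<^sup>2" using AE_good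
  proof eventually_elim
   case (elim r)
   then have "l2norm (G r) = vnrm (G r)" by (intro L2_vnrm(2)) (simp add: good_def square_integrable_def)
   then show ?case by simp
  qed
 qed (use L2_time_measurable[OF fields(2)] in measurable)
 have n: "l2norm u0 = vnrm u0" "t \<in> {0..1} \<Longrightarrow> l2norm (u t) = vnrm (u t)" for t
  using u0_L2 u_L2[of t] by (auto simp: square_integrable_def intro!: L2_vnrm(2))
 have e: "1 / 2 * (vnrm (u t))\<^sup>2 + \<nu> * tint t (\<lambda>r. (vnrm (G r))\<^sup>2) \<le> 1 / 2 * (vnrm u0)\<^sup>2 + X * \<Phi>" if "t \<in> {0..1}" for t
  using en[OF that] rhs[of t] unfolding set_integral_tint[OF that] n(1) n(2)[OF that] lG by linarith
 have tG: "0 \<le> \<nu> * tint t (\<lambda>r. (vnrm (G r))\<^sup>2)" for t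
  unfolding tint_def using viscosity by (intro mult_nonneg_nonneg integral_nonneg_AE AE_I2) auto
 have X: "X \<le> vnrm u0 + 2 * \<Phi>"
 proof (rule ccontr)
  assume c: "\<not> ?thesis"
  have "(vnrm u0)\<^sup>2 \<le> X * vnrm u0" using c \<Phi>0 by (simp add: power2_eq_square mult_right_mono)
  moreover have "X * (vnrm u0 + 2 * \<Phi>) < X * X" using c \<Phi>0 vnrm_nonneg[of u0] by (intro mult_strict_left_mono) linarith+
  ultimately show False using e[OF tm(1)] tG[of tm] by (simp add: X_def[symmetric] power2_eq_square algebra_simps)
 qed
 show "vnrm (u t) \<le> vnrm u0 + 2 * \<Phi>" if "t \<in> {0..1}" using tm(2)[OF that] X by (simp add: X_def)
 have "X * \<Phi> \<le> (vnrm u0 + 2 * \<Phi>) * \<Phi>" using X \<Phi>0 by (rule mult_right_mono)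
 moreover have "1 / 2 * (vnrm (u 1))\<^sup>2 + \<nu> * (\<integral>r. (vnrm (G r))\<^sup>2 \<partial>unit_time) \<le> 1 / 2 * (vnrm u0)\<^sup>2 + X * \<Phi>"
  using e[of 1] by (simp add: tint_1)
 ultimately show "\<nu> * (\<integral>r. (vnrm (G r))\<^sup>2 \<partial>unit_time) \<le> (vnrm u0)\<^sup>2 + (vnrm u0 + 2 * \<Phi>) * \<Phi>"
  using zero_le_power2[of "vnrm (u 1)"] zero_le_power2[of "vnrm u0"] by linarith
qed

text \<open>The viscous factor \<nu> / l |G| \<omega> is written as \<nu>^(1/2) l^(\<alpha>-1) times
  (\<nu>^(1/2) |G|) (l^(-\<alpha>) \<omega>). The last two factors are square integrable in time,
  with bounds from the dissipation and from the Besov norm.\<close>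

lemma discrepancy_bound:
 assumes K: "kernel_bound TYPE('n) b K" and l: "0 < l" and d: "2 \<le> CARD('n)" and t: "t \<in> {0..1}"
  and \<nu>: "0 < \<nu>" and M: "\<And>r. r \<in> {0..1} \<Longrightarrow> vnrm (u r) \<le> M"
  and E: "\<nu> * (\<integral>r. (vnrm (G r))\<^sup>2 \<partial>unit_time) \<le> E"
  and B: "(\<integral>r. (l powr - \<alpha> * modulus l (u r))\<^sup>2 \<partial>unit_time) \<le> B"
 shows "discrepancy b u0 f u l t \<le> real CARD('n) ^ 3 * K * (M * modulus l (u t) + vnrm u0 * modulus l u0
   + \<nu> powr (1 / 2) * l powr (\<alpha> - 1) * (E + B) + (\<integral>r. vnrm (f r) * modulus l (u r) \<partial>unit_time))"
proof -
 let ?n = "real CARD('n)" and ?m = "\<lambda>r. modulus l (u r)" and ?w = "\<lambda>r. l powr - \<alpha> * modulus l (u r)" and ?q = "sqrt \<nu>"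
 have K0: "0 \<le> K" using K by (simp add: kernel_bound_def)
 have cm: "continuous_on {0..1} ?m" using l by (intro continuous_modulus) simp
 have iw: "integrable unit_time (\<lambda>r. (?w r)\<^sup>2)" by (intro continuous_unit_time(2) continuous_intros cm)
 have igm: "integrable unit_time (\<lambda>r. vnrm (G r) * ?m r)" by (intro integrable_mult_continuous vnrm_G_integrable(1) cm)
 have pw: "\<nu> / l * (vnrm (G r) * ?m r) \<le> ?q * l powr (\<alpha> - 1) * (\<nu> * (vnrm (G r))\<^sup>2 + (?w r)\<^sup>2)" for r
 proof -
  have m: "?m r = l powr \<alpha> * ?w r" using l by (simp add: powr_minus)
  have lp: "l powr (\<alpha> - 1) = l powr \<alpha> / l" using l by (simp add: powr_diff)
  have qq: "\<nu> = ?q * ?q" using \<nu> by simp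
  have gen: "q * q / l * (g * (P * w)) = q * (P / l) * ((q * g) * w)" for q g P w :: real by (simp add: divide_inverse mult_ac)
  have "\<nu> / l * (vnrm (G r) * ?m r) = ?q * l powr (\<alpha> - 1) * ((?q * vnrm (G r)) * ?w r)"
   using gen[of ?q "vnrm (G r)" "l powr \<alpha>" "?w r"] by (simp only: m[symmetric] qq[symmetric] lp)
  also have "\<dots> \<le> ?q * l powr (\<alpha> - 1) * ((?q * vnrm (G r))\<^sup>2 + (?w r)\<^sup>2)"
  proof (rule mult_left_mono)
   have "2 * (a * c) \<le> a\<^sup>2 + c\<^sup>2" for a c :: real using zero_le_power2[of "a - c"] by (simp add: power2_diff)
   from this[of "?q * vnrm (G r)" "?w r"] zero_le_power2[of "?q * vnrm (G r)"] zero_le_power2[of "?w r"]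
   show "(?q * vnrm (G r)) * ?w r \<le> (?q * vnrm (G r))\<^sup>2 + (?w r)\<^sup>2" by linarith
  qed (use \<nu> in simp)
  finally show ?thesis using \<nu> by (simp add: power_mult_distrib)
 qed
 have "(\<integral>r. \<nu> / l * (vnrm (G r) * ?m r) \<partial>unit_time) \<le> (\<integral>r. ?q * l powr (\<alpha> - 1) * (\<nu> * (vnrm (G r))\<^sup>2 + (?w r)\<^sup>2) \<partial>unit_time)"
  by (intro integral_mono integrable_mult_right L1_add igm vnrm_G_integrable(2) iw pw)
 also have "\<dots> = ?q * l powr (\<alpha> - 1) * (\<nu> * (\<integral>r. (vnrm (G r))\<^sup>2 \<partial>unit_time) + (\<integral>r. (?w r)\<^sup>2 \<partial>unit_time))"
  using vnrm_G_integrable(2) iw by simp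
 also have "\<dots> \<le> ?q * l powr (\<alpha> - 1) * (E + B)" using E B \<nu> by (intro mult_left_mono add_mono) auto
 finally have V: "\<nu> / l * (\<integral>r. vnrm (G r) * ?m r \<partial>unit_time) \<le> \<nu> powr (1 / 2) * l powr (\<alpha> - 1) * (E + B)"
  using \<nu> by (simp add: powr_half_sqrt)
 have "1 \<le> ?n" using d by simp
 \<comment> \<open>A common factor d^3 for all error terms, at the cost of weakening those that come
   with d^2.\<close>
 then have nn: "?n ^ 2 * K \<le> ?n ^ 3 * K" using K0 by (intro mult_right_mono power_increasing) auto
 have up: "?n ^ 2 * (K * a) \<le> ?n ^ 3 * K * a" if "0 \<le> a" for a using mult_right_mono[OF nn that] by (simp add: mult.assoc)
 have m0: "r \<in> {0..1} \<Longrightarrow> 0 \<le> ?m r" "0 \<le> modulus l u0" for r using modulus_bounds(3)[OF u_L2] modulus_bounds(3)[OF u0_L2] l by auto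
 have 1: "?n ^ 2 * (K * (vnrm (u t) * ?m t)) \<le> ?n ^ 3 * K * (M * ?m t)"
  by (rule order_trans[OF up mult_left_mono[OF mult_right_mono[OF M[OF t] m0(1)[OF t]]]]) (use m0(1)[OF t] K0 in simp_all)
 have 2: "?n ^ 2 * (K * (vnrm u0 * modulus l u0)) \<le> ?n ^ 3 * K * (vnrm u0 * modulus l u0)" by (rule up) (use m0(2) in simp)
 have "\<nu> * (\<integral>r. ?n ^ 3 * (K / l * (vnrm (G r) * ?m r)) \<partial>unit_time) = ?n ^ 3 * K * (\<nu> / l * (\<integral>r. vnrm (G r) * ?m r \<partial>unit_time))"
  by (simp add: divide_inverse)
 also have "\<dots> \<le> ?n ^ 3 * K * (\<nu> powr (1 / 2) * l powr (\<alpha> - 1) * (E + B))" by (rule mult_left_mono[OF V]) (use K0 in simp)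
 finally have 3: "\<nu> * (\<integral>r. ?n ^ 3 * (K / l * (vnrm (G r) * ?m r)) \<partial>unit_time) \<le> \<dots>" .
 have 4: "(\<integral>r. ?n ^ 2 * (K * (vnrm (f r) * ?m r)) \<partial>unit_time) \<le> ?n ^ 3 * K * (\<integral>r. vnrm (f r) * ?m r \<partial>unit_time)"
  unfolding lint_mult_right_zero
  by (rule up, rule integral_nonneg_AE, rule AE_I2) (use m0(1) in simp)
 show ?thesis
  using balance[OF K l d t] 1 2 3 4 unfolding discrepancy_def set_integral_tint[OF t] distrib_left by linarith
qed

text \<open>Below the height l^(-\<alpha>/2) the product is at most l^(\<alpha>/2) times the
  normalised modulus. Above it, |f| is at most |f|^(1+\<sigma>) l^(\<alpha>\<sigma>/2), and the
  modulus is bounded by 2 M.\<close>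

lemma force_split:
 assumes l: "0 < l" and M: "\<And>r. r \<in> {0..1} \<Longrightarrow> vnrm (u r) \<le> M" and \<sigma>: "0 < \<sigma>"
  and F: "integrable unit_time (\<lambda>r. vnrm (f r) powr (1 + \<sigma>))" "(\<integral>r. vnrm (f r) powr (1 + \<sigma>) \<partial>unit_time) \<le> A"
  and B: "(\<integral>r. (l powr - \<alpha> * modulus l (u r))\<^sup>2 \<partial>unit_time) \<le> B"
 shows "(\<integral>r. vnrm (f r) * modulus l (u r) \<partial>unit_time) \<le> l powr (\<alpha> / 2) * (1 + B) + 2 * M * A * l powr (\<alpha> / 2 * \<sigma>)"
proof -
 let ?m = "\<lambda>r. modulus l (u r)" and ?w = "\<lambda>r. l powr - \<alpha> * modulus l (u r)" and ?L = "l powr - (\<alpha> / 2)"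
 have cm: "continuous_on {0..1} ?m" using l by (intro continuous_modulus) simp
 have iw: "integrable unit_time (\<lambda>r. (?w r)\<^sup>2)" by (intro continuous_unit_time(2) continuous_intros cm)
 have M0: "0 \<le> M" using order_trans[OF vnrm_nonneg M[of 0]] by simp
 have "vnrm (f r) * ?m r \<le> l powr (\<alpha> / 2) * (1 + (?w r)\<^sup>2) + 2 * M * l powr (\<alpha> / 2 * \<sigma>) * vnrm (f r) powr (1 + \<sigma>)" if r: "r \<in> {0..1}" for r
 proof -
  have m: "0 \<le> ?m r" "?m r \<le> 2 * M" using modulus_bounds[OF u_L2[OF r], of l] l M[OF r] by auto
  have Lm: "?L * ?m r \<le> l powr (\<alpha> / 2) * (1 + (?w r)\<^sup>2)"
  proof -
   have e: "?L = l powr (\<alpha> / 2) * l powr - \<alpha>" by (simp flip: powr_add)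
   have "?L * ?m r = l powr (\<alpha> / 2) * ?w r" unfolding e by (rule mult.assoc)
   also have "\<dots> \<le> l powr (\<alpha> / 2) * (1 + (?w r)\<^sup>2)"
    using zero_le_power2[of "?w r - 1 / 2"] by (intro mult_left_mono) (simp_all add: power2_diff, simp add: power2_eq_square)
   finally show ?thesis .
  qed
  show ?thesis
  proof (cases "vnrm (f r) \<le> ?L")
   case True
   have "vnrm (f r) * ?m r \<le> ?L * ?m r" by (rule mult_right_mono[OF True m(1)])
   also note Lm
   finally show ?thesis by (rule order_trans) (use M0 in simp)
  next
   case False
   have Lp: "0 < ?L" using l by simp
   then have p: "0 < vnrm (f r)" using False by linarith
   have "vnrm (f r) = vnrm (f r) powr (1 + \<sigma>) * vnrm (f r) powr - \<sigma>" using p by (simp flip: powr_add)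
   also have "\<dots> \<le> vnrm (f r) powr (1 + \<sigma>) * ?L powr - \<sigma>"
    using False Lp \<sigma> by (intro mult_left_mono powr_mono2') auto
   also have "?L powr - \<sigma> = l powr (\<alpha> / 2 * \<sigma>)" by (simp add: powr_powr)
   finally have le: "vnrm (f r) \<le> vnrm (f r) powr (1 + \<sigma>) * l powr (\<alpha> / 2 * \<sigma>)" .
   have "vnrm (f r) * ?m r \<le> (vnrm (f r) powr (1 + \<sigma>) * l powr (\<alpha> / 2 * \<sigma>)) * (2 * M)"
    by (rule mult_mono[OF le m(2)]) (use m(1) in simp_all)
   then show ?thesis by (rule order_trans) (simp add: mult_ac)
  qed
 qed
 then have "(\<integral>r. vnrm (f r) * ?m r \<partial>unit_time)
   \<le> (\<integral>r. l powr (\<alpha> / 2) * (1 + (?w r)\<^sup>2) + 2 * M * l powr (\<alpha> / 2 * \<sigma>) * vnrm (f r) powr (1 + \<sigma>) \<partial>unit_time)"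
  by (intro integral_mono integrable_mult_continuous f_L1L2 cm L1_add integrable_mult_right
    unit_time.integrable_const iw F(1)) simp
 also have "\<dots> = l powr (\<alpha> / 2) * (1 + (\<integral>r. (?w r)\<^sup>2 \<partial>unit_time)) + 2 * M * l powr (\<alpha> / 2 * \<sigma>) * (\<integral>r. vnrm (f r) powr (1 + \<sigma>) \<partial>unit_time)"
  using iw F(1) unit_time.prob_space by simp
 also have "\<dots> \<le> l powr (\<alpha> / 2) * (1 + B) + 2 * M * l powr (\<alpha> / 2 * \<sigma>) * A"
  using B F(2) M0 by (intro add_mono mult_left_mono) auto
 finally show ?thesis by (simp add: mult_ac)
qed

text \<open>The square bound suffices because w is at most 1 + w^2 and time has total measure 1.
  This makes the energy error at a single time small on average.\<close>

lemma integral_modulus: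
 assumes l: "0 < l" and B: "(\<integral>r. (l powr - \<alpha> * modulus l (u r))\<^sup>2 \<partial>unit_time) \<le> B"
 shows "(\<integral>r. modulus l (u r) \<partial>unit_time) \<le> l powr \<alpha> * (1 + B)"
proof -
 let ?m = "\<lambda>r. modulus l (u r)" and ?w = "\<lambda>r. l powr - \<alpha> * modulus l (u r)"
 have cm: "continuous_on {0..1} ?m" using l by (intro continuous_modulus) simp
 have iw: "integrable unit_time (\<lambda>r. (?w r)\<^sup>2)" by (intro continuous_unit_time(2) continuous_intros cm)
 have "?m r \<le> l powr \<alpha> * (1 + (?w r)\<^sup>2)" for r
 proof -
  have "a \<le> 1 + a\<^sup>2" for a :: real using zero_le_power2[of "a - 1 / 2"] by (simp add: power2_diff) (simp add: power2_eq_square)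
  then have le: "l powr \<alpha> * ?w r \<le> l powr \<alpha> * (1 + (?w r)\<^sup>2)" by (simp add: mult_left_mono)
  have "?m r = l powr \<alpha> * ?w r" using l by (simp add: powr_minus)
  from order_trans[OF eq_refl[OF this] le] show ?thesis .
 qed
 then have "(\<integral>r. ?m r \<partial>unit_time) \<le> (\<integral>r. l powr \<alpha> * (1 + (?w r)\<^sup>2) \<partial>unit_time)"
  by (intro integral_mono continuous_unit_time(2) cm integrable_mult_right L1_add unit_time.integrable_const iw)
 also have "\<dots> = l powr \<alpha> * (1 + (\<integral>r. (?w r)\<^sup>2 \<partial>unit_time))" using iw unit_time.prob_space by simp
 also have "\<dots> \<le> l powr \<alpha> * (1 + B)" using B by (intro mult_left_mono) auto
 finally show ?thesis .
qed

lemma besov_integral: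
 assumes l: "0 < l" and \<alpha>: "\<alpha> \<in> {0<..<1}" and B: "Lnorm unit_time 2 (\<lambda>t. besov \<alpha> (u t)) \<le> ennreal B" "0 \<le> B"
 shows "(\<integral>r. (l powr - \<alpha> * modulus l (u r))\<^sup>2 \<partial>unit_time) \<le> B\<^sup>2"
proof -
 let ?w = "\<lambda>r. l powr - \<alpha> * modulus l (u r)"
 have cm: "continuous_on {0..1} (\<lambda>r. modulus l (u r))" using l by (intro continuous_modulus) simp
 have iw: "integrable unit_time (\<lambda>r. (?w r)\<^sup>2)" by (intro continuous_unit_time(2) continuous_intros cm)
 have "ennreal (\<integral>r. (?w r)\<^sup>2 \<partial>unit_time) = (\<integral>\<^sup>+r. ennreal ((?w r)\<^sup>2) \<partial>unit_time)"
  by (rule nn_integral_eq_integral[symmetric, OF iw]) simp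
 also have "\<dots> \<le> (\<integral>\<^sup>+r. epowr (besov \<alpha> (u r)) 2 \<partial>unit_time)"
 proof (rule nn_integral_mono)
  fix r assume "r \<in> space unit_time"
  then have v: "square_integrable (u r)" using u_L2 by simp
  have "ennreal ((?w r)\<^sup>2) = epowr (ennreal (?w r)) 2"
   using modulus_bounds(3)[OF v, of l] l by (simp add: epowr_numeral_norm)
  also have "\<dots> \<le> epowr (besov \<alpha> (u r)) 2" using \<alpha> by (intro epowr_mono besov_modulus[OF v l]) auto
  finally show "ennreal ((?w r)\<^sup>2) \<le> epowr (besov \<alpha> (u r)) 2" .
 qed
 also have "\<dots> \<le> ennreal (B powr 2)" by (rule Lnorm_le[OF B(1) _ B(2)]) simp
 finally show ?thesis using B(2) by (simp add: powr_numeral)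
qed

end

text \<open>Translates finite nested norms into integrability on spacetime and in time. The forcing
  is integrable on spacetime by Cauchy-Schwarz on the torus, which has volume 1.\<close>

lemma leray_hopf_ns:
 fixes u0 :: "real ^ 'n \<Rightarrow> real ^ 'n"
 assumes u0: "torus_field u0" "L2 u0 < \<infinity>" and f: "spacetime_field f" and u: "leray_hopf \<nu> u0 f u" and \<nu>: "0 \<le> \<nu>"
  and u3: "Lnorm spacetime 3 (\<lambda>(t, x). ennreal (norm (u t x))) < \<infinity>"
  and A: "Lnorm unit_time (1 + \<sigma>) (\<lambda>t. L2 (f t)) \<le> ennreal A" "0 \<le> A" and \<sigma>: "0 \<le> \<sigma>"
 obtains G q where "ns \<nu> u0 f u G q"
  "\<And>t. t \<in> {0..1} \<Longrightarrow> 1 / 2 * (l2norm (u t))\<^sup>2 + \<nu> * (LINT r:{0..t}|lborel. (l2norm (G r))\<^sup>2)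
    \<le> 1 / 2 * (l2norm u0)\<^sup>2 + (LINT r:{0..t}|lborel. l2inner (f r) (u r))"
  "integrable unit_time (\<lambda>r. vnrm (f r) powr (1 + \<sigma>))" "(\<integral>r. vnrm (f r) powr (1 + \<sigma>) \<partial>unit_time) \<le> A powr (1 + \<sigma>)"
  "(\<integral>r. vnrm (f r) \<partial>unit_time) \<le> 1 + A powr (1 + \<sigma>)"
proof -
 obtain G q where W: "weak_solution \<nu> u0 f u G q"
  and en: "\<And>t. t \<in> {0..1} \<Longrightarrow> 1 / 2 * (l2norm (u t))\<^sup>2 + \<nu> * (LINT r:{0..t}|lborel. (l2norm (G r))\<^sup>2)
    \<le> 1 / 2 * (l2norm u0)\<^sup>2 + (LINT r:{0..t}|lborel. l2inner (f r) (u r))"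
  using u unfolding leray_hopf_def by blast
 interpret P: pair_sigma_finite unit_time "torus :: (real ^ 'n) measure" ..
 have sf: "spacetime_field u" "spacetime_field G" and LG: "Lnorm unit_time 2 (\<lambda>t. L2 (G t)) < \<infinity>"
  using W by (auto simp: weak_solution_def)
 have [measurable]: "(\<lambda>p. u (fst p) (snd p)) \<in> borel_measurable spacetime" "(\<lambda>p. G (fst p) (snd p)) \<in> borel_measurable spacetime"
  "(\<lambda>p. f (fst p) (snd p)) \<in> borel_measurable spacetime"
  using sf f by (auto simp: spacetime_field_def split_def)
 note s0 = torus_field_square_integrable[OF u0]
 have "(\<integral>\<^sup>+p. ennreal ((norm (u (fst p) (snd p))) ^ 3) \<partial>spacetime) < \<infinity>"
  using u3 by (simp add: Lnorm_def epowr_less_top epowr_numeral_norm split_def)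
 then have iu: "integrable spacetime (\<lambda>(t, x). (norm (u t x)) ^ 3)"
  by (simp add: integrable_iff_bounded split_def)
 have "(\<integral>\<^sup>+p. ennreal ((norm (G (fst p) (snd p)))\<^sup>2) \<partial>spacetime) = (\<integral>\<^sup>+t. \<integral>\<^sup>+x. ennreal ((norm (G t x))\<^sup>2) \<partial>torus \<partial>unit_time)"
  by (subst torus.nn_integral_fst[symmetric]) simp_all
 also have "\<dots> = (\<integral>\<^sup>+t. epowr (L2 (G t)) 2 \<partial>unit_time)"
  by (simp add: L2_def Lnorm_def epowr_inverse epowr_numeral_norm)
 also have "\<dots> < \<infinity>" using LG by (simp add: Lnorm_def epowr_less_top)
 finally have iG: "integrable spacetime (\<lambda>(t, x). (norm (G t x))\<^sup>2)"
  by (simp add: integrable_iff_bounded split_def)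
 note mf = L2_time_measurable[OF f]
 have fA: "(\<integral>\<^sup>+t. epowr (L2 (f t)) (1 + \<sigma>) \<partial>unit_time) \<le> ennreal (A powr (1 + \<sigma>))"
  by (rule Lnorm_le[OF A(1) _ A(2)]) (use \<sigma> in simp)
 have mp: "(\<lambda>t. epowr (L2 (f t)) (1 + \<sigma>)) \<in> borel_measurable unit_time" using mf(1) by measurable
 have "AE t in unit_time. epowr (L2 (f t)) (1 + \<sigma>) \<noteq> \<infinity>"
  by (rule nn_integral_PInf_AE[OF mp]) (use fA in \<open>auto simp: top_unique\<close>)
 moreover have "AE t in unit_time. t \<in> {0..1}" by (rule AE_I2) simp
 ultimately have fL2: "AE t in unit_time. square_integrable (f t)"
 proof eventually_elim
  case (elim t)
  have b: "f t \<in> borel_measurable borel" "periodic (f t)" using spacetime_sectionD[OF f elim(2)] by auto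
  have "L2 (f t) < \<infinity>" using elim(1) epowr_less_top[of "L2 (f t)" "1 + \<sigma>"] by (simp add: less_top)
  then show ?case using L2_finite_iff[OF b(1)] b by (simp add: square_integrable_def)
 qed
 have "(\<integral>\<^sup>+t. ennreal (vnrm (f t) powr (1 + \<sigma>)) \<partial>unit_time) = (\<integral>\<^sup>+t. epowr (L2 (f t)) (1 + \<sigma>) \<partial>unit_time)"
 proof (rule nn_integral_cong_AE, use fL2 in eventually_elim)
  case (elim t)
  then have "L2 (f t) = ennreal (vnrm (f t))" by (intro L2_vnrm(1)) (simp add: square_integrable_def)
  then show ?case by (simp add: epowr_ennreal)
 qed
 with fA have fA': "(\<integral>\<^sup>+t. ennreal (vnrm (f t) powr (1 + \<sigma>)) \<partial>unit_time) \<le> ennreal (A powr (1 + \<sigma>))" by simp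
 have mF: "(\<lambda>t. vnrm (f t) powr (1 + \<sigma>)) \<in> borel_measurable unit_time" using mf(2) by measurable
 have iF: "integrable unit_time (\<lambda>t. vnrm (f t) powr (1 + \<sigma>))"
  using mF fA' by (auto simp: integrable_iff_bounded intro: le_less_trans)
 have FA: "(\<integral>t. vnrm (f t) powr (1 + \<sigma>) \<partial>unit_time) \<le> A powr (1 + \<sigma>)"
  using fA' nn_integral_eq_integral[OF iF] by simp
 \<comment> \<open>Also valid for \<sigma> = 0, so one bound on the time integral of the force
   serves both parts of the theorem.\<close>
 have le1: "a \<le> 1 + a powr (1 + \<sigma>)" if "0 \<le> a" for a :: real
 proof (cases "a \<le> 1")
  case False
  then have "a powr 1 \<le> a powr (1 + \<sigma>)" using \<sigma> by (intro powr_mono) auto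
  then show ?thesis using False by simp
 qed (simp add: add_increasing2)
 have i1: "integrable unit_time (\<lambda>t. 1 + vnrm (f t) powr (1 + \<sigma>))"
  by (intro L1_add unit_time.integrable_const iF)
 have if1: "integrable unit_time (\<lambda>t. vnrm (f t))" by (rule integrable_boundI[OF i1 mf(2)]) (simp add: le1)
 have "(\<integral>t. vnrm (f t) \<partial>unit_time) \<le> (\<integral>t. 1 + vnrm (f t) powr (1 + \<sigma>) \<partial>unit_time)"
  by (intro integral_mono if1 i1 le1) simp
 also have "\<dots> = 1 + (\<integral>t. vnrm (f t) powr (1 + \<sigma>) \<partial>unit_time)" using iF unit_time.prob_space by simp
 finally have f1: "(\<integral>t. vnrm (f t) \<partial>unit_time) \<le> 1 + A powr (1 + \<sigma>)" using FA by simp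
 have "(\<integral>\<^sup>+p. ennreal (norm (f (fst p) (snd p))) \<partial>spacetime) = (\<integral>\<^sup>+t. \<integral>\<^sup>+x. ennreal (norm (f t x)) \<partial>torus \<partial>unit_time)"
  by (subst torus.nn_integral_fst[symmetric]) simp_all
 also have "\<dots> \<le> (\<integral>\<^sup>+t. ennreal (vnrm (f t)) \<partial>unit_time)"
 proof (rule nn_integral_mono_AE, use fL2 in eventually_elim)
  case (elim t)
  have one: "in_Lp 2 (\<lambda>x :: real ^ 'n. 1)" by (simp add: in_Lp_def periodic_def)
  note cs = cauchy_schwarz_torus[OF square_integrable_norm[OF elim] one]
  have "(\<integral>\<^sup>+x. ennreal (norm (f t x)) \<partial>torus) = ennreal (\<integral>x. norm (f t x) \<partial>torus)"
   by (rule nn_integral_eq_integral) (use cs(1) in simp_all)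
  also have "\<dots> \<le> ennreal (vnrm (f t))"
   using cs(2) by (intro ennreal_leI) (simp add: vnrm_def nrm_def[of "\<lambda>_. 1"] torus.prob_space)
  finally show ?case .
 qed
 also have "\<dots> < \<infinity>" using if1 by (simp add: integrable_iff_bounded)
 finally have if2: "integrable spacetime (\<lambda>(t, x). norm (f t x))"
  by (simp add: integrable_iff_bounded split_def)
 show ?thesis
  by (rule that[OF ns.intro[OF W \<nu> s0 f iu iG fL2 if1 if2] en iF FA f1])
qed

text \<open>The positive part of g - c is continuous with all moments 0. This upgrades an essential
  bound to every time.\<close>

lemma continuous_AE_bound:
 assumes g: "continuous_on {0..1} g" and ae: "AE r in unit_time. g r \<le> (c :: real)" and t: "t \<in> {0..1}"
 shows "g t \<le> c"
proof -
 have "max 0 (g t - c) = 0"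
 proof (rule vanishing_moments[OF _ _ t])
  show "continuous_on {0..1} (\<lambda>r. max 0 (g r - c))" by (intro continuous_intros g)
  show "(\<integral>r. r ^ k * max 0 (g r - c) \<partial>unit_time) = 0" for k
   by (rule integral_eq_zero_AE) (use ae in eventually_elim, simp)
 qed
 then show ?thesis by simp
qed

text \<open>\<open>M\<close>, \<open>A\<close>, \<open>E\<close>, \<open>B\<close> bound velocity,
  force, dissipation and Besov norm. They are parameters of the locale so that one choice can serve
  all viscosities.\<close>

locale uniform_ns = ns \<nu> u0 f u G q
 for \<nu> :: real and u0 :: "real ^ 'n \<Rightarrow> real ^ 'n" and f u G q +
 fixes \<alpha> \<sigma> M A E B :: real
 assumes \<nu>: "\<nu> \<in> {0<..<1}" and \<alpha>: "\<alpha> \<in> {0<..<1}"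
  and u_bound: "\<And>r. r \<in> {0..1} \<Longrightarrow> vnrm (u r) \<le> M"
  and G_bound: "\<nu> * (\<integral>r. (vnrm (G r))\<^sup>2 \<partial>unit_time) \<le> E"
  and f_power: "integrable unit_time (\<lambda>r. vnrm (f r) powr (1 + \<sigma>))" "(\<integral>r. vnrm (f r) powr (1 + \<sigma>) \<partial>unit_time) \<le> A"
  and f_bound: "(\<integral>r. vnrm (f r) \<partial>unit_time) \<le> A"
  and besov_bound: "\<And>l. 0 < l \<Longrightarrow> (\<integral>r. (l powr - \<alpha> * modulus l (u r))\<^sup>2 \<partial>unit_time) \<le> B"
begin

lemma constants_nonneg: "0 \<le> M" "0 \<le> A" "0 \<le> E" "0 \<le> B"
proof -
 show "0 \<le> M" using order_trans[OF vnrm_nonneg u_bound[of 0]] by simp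
 show "0 \<le> A" using f_bound by (rule order_trans[rotated]) (simp add: integral_nonneg_AE)
 show "0 \<le> E" using G_bound by (rule order_trans[rotated]) (use \<nu> in \<open>simp add: integral_nonneg_AE\<close>)
 show "0 \<le> B" using besov_bound[of 1] by (rule order_trans[rotated]) (simp_all add: integral_nonneg_AE)
qed

text \<open>The exponent \<alpha> - 1 is negative, so the smallest admissible \<open>l\<close> is
  the worst. The resulting power of \<nu> tends to 0 exactly when L < 1 / (2 (1 -
  \<alpha>)).\<close>

lemma viscous_scale:
 assumes "\<nu> powr L \<le> l"
 shows "\<nu> powr (1 / 2) * l powr (\<alpha> - 1) * (E + B) \<le> \<nu> powr (1 / 2 - L * (1 - \<alpha>)) * (E + B)"
proof (rule mult_right_mono)
 have "l powr (\<alpha> - 1) \<le> (\<nu> powr L) powr (\<alpha> - 1)" using \<alpha> \<nu> assms by (intro powr_mono2') auto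
 then have "\<nu> powr (1 / 2) * l powr (\<alpha> - 1) \<le> \<nu> powr (1 / 2) * (\<nu> powr L) powr (\<alpha> - 1)" by (rule mult_left_mono) simp
 also have "\<dots> = \<nu> powr (1 / 2 + L * (\<alpha> - 1))" unfolding powr_powr by (rule powr_add[symmetric])
 also have "1 / 2 + L * (\<alpha> - 1) = 1 / 2 - L * (1 - \<alpha>)" by (simp add: algebra_simps)
 finally show "\<nu> powr (1 / 2) * l powr (\<alpha> - 1) \<le> \<nu> powr (1 / 2 - L * (1 - \<alpha>))" .
qed (use constants_nonneg in simp)

text \<open>Removes the dependence on \<open>l\<close> from the terms of the initial datum and of
  viscosity; the velocity modulus is left for the two cases to treat differently.\<close>

lemma discrepancy_le:
 assumes K: "kernel_bound TYPE('n) b K" and d: "2 \<le> CARD('n)" and t: "t \<in> {0..1}"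
  and l: "l \<in> {\<nu> powr L..lI}"
 shows "discrepancy b u0 f u l t \<le> real CARD('n) ^ 3 * K * (M * modulus l (u t) + vnrm u0 * modulus lI u0
   + \<nu> powr (1 / 2 - L * (1 - \<alpha>)) * (E + B) + (\<integral>r. vnrm (f r) * modulus l (u r) \<partial>unit_time))"
proof -
 have l0: "0 < l" using l \<nu> by (auto intro: less_le_trans[rotated])
 have \<nu>0: "0 < \<nu>" using \<nu> by simp
 have K0: "0 \<le> real CARD('n) ^ 3 * K" using K by (simp add: kernel_bound_def)
 have m: "vnrm u0 * modulus l u0 \<le> vnrm u0 * modulus lI u0"
  using l l0 by (intro mult_left_mono modulus_mono u0_L2) auto
 have v: "\<nu> powr (1 / 2) * l powr (\<alpha> - 1) * (E + B) \<le> \<nu> powr (1 / 2 - L * (1 - \<alpha>)) * (E + B)"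
  using l by (intro viscous_scale) simp
 show ?thesis
  by (rule order_trans[OF discrepancy_bound[OF K l0 d t \<nu>0 u_bound G_bound besov_bound[OF l0]]])
    (assumption, intro mult_left_mono add_mono order_refl m v K0)
qed

text \<open>The discrepancy is bounded by the constant \<open>N * (...)\<close> whose power appears
  in \<open>C\<close>, using that powers of lI and \<nu> are at most 1 and moduli at most twice the
  norm. Hence its p-th power is at most that constant to the power p - 1 times a first power, and
  the time integral of the modulus is small.\<close>

lemma moment_bound:
 fixes p L :: real
 defines "\<beta> \<equiv> 1 / 2 - L * (1 - \<alpha>)"
 assumes K: "kernel_bound TYPE('n) b K" and d: "2 \<le> CARD('n)" and \<sigma>: "0 < \<sigma>" and p: "1 \<le> p"
  and \<beta>: "0 < \<beta>" and lI: "lI \<in> {0<..<1}" and l: "l \<in> {\<nu> powr L..lI}"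
  and N: "N = real CARD('n) ^ 3 * K"
  and C: "C = (N * (M * (2 * M) + (vnrm u0 * (2 * vnrm u0) + (E + B) + (1 + B) + 2 * M * A))) powr (p - 1) * N"
 shows "(\<integral>\<^sup>+t. ennreal (discrepancy b u0 f u l t powr p) \<partial>unit_time)
   \<le> ennreal (C * (M * (lI powr \<alpha> * (1 + B)) + vnrm u0 * modulus lI u0
     + lI powr (\<alpha> / 2) * (1 + B) + 2 * M * A * lI powr (\<alpha> / 2 * \<sigma>)) + C * (E + B) * \<nu> powr \<beta>)"
proof -
 note nn = constants_nonneg
 let ?D = "discrepancy b u0 f u l" and ?m = "\<lambda>t. modulus l (u t)"
 define R where "R = vnrm u0 * modulus lI u0 + \<nu> powr \<beta> * (E + B) + (lI powr (\<alpha> / 2) * (1 + B) + 2 * M * A * lI powr (\<alpha> / 2 * \<sigma>))"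
 define C0 where "C0 = N * (M * (2 * M) + (vnrm u0 * (2 * vnrm u0) + (E + B) + (1 + B) + 2 * M * A))"
 have l0: "0 < l" "l \<le> lI" using l \<nu> by (auto intro: less_le_trans[rotated])
 have N0: "0 \<le> N" using K by (simp add: N kernel_bound_def)
 have C1: "C = C0 powr (p - 1) * N" by (simp add: C C0_def)
 have Cn: "0 \<le> C" using N0 by (simp add: C1)
 have M2: "0 \<le> 2 * M * A" using nn by simp
 have F: "(\<integral>r. vnrm (f r) * ?m r \<partial>unit_time) \<le> lI powr (\<alpha> / 2) * (1 + B) + 2 * M * A * lI powr (\<alpha> / 2 * \<sigma>)"
 proof (rule order_trans[OF force_split[OF l0(1) u_bound \<sigma> f_power besov_bound[OF l0(1)]]])
  show "l powr (\<alpha> / 2) * (1 + B) + 2 * M * A * l powr (\<alpha> / 2 * \<sigma>) \<le> lI powr (\<alpha> / 2) * (1 + B) + 2 * M * A * lI powr (\<alpha> / 2 * \<sigma>)"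
   using l0 \<alpha> \<sigma> nn by (intro add_mono mult_left_mono mult_right_mono powr_mono2 M2) auto
 qed
 have D: "?D t \<le> N * (M * ?m t + R)" if "t \<in> {0..1}" for t
 proof (rule order_trans[OF discrepancy_le[OF K d that l]])
  show "real CARD('n) ^ 3 * K * (M * ?m t + vnrm u0 * modulus lI u0 + \<nu> powr (1 / 2 - L * (1 - \<alpha>)) * (E + B) + (\<integral>r. vnrm (f r) * ?m r \<partial>unit_time))
   \<le> N * (M * ?m t + R)"
   unfolding N[symmetric] using F N0 by (intro mult_left_mono) (simp_all add: R_def \<beta>_def)
 qed
 have "R \<le> vnrm u0 * (2 * vnrm u0) + 1 * (E + B) + (1 * (1 + B) + 2 * M * A * 1)"
  unfolding R_def using lI \<alpha> \<sigma> \<beta> \<nu> nn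
  by (intro add_mono mult_left_mono mult_right_mono modulus_bounds(2) u0_L2 powr_le1 M2) auto
 then have R0: "R \<le> vnrm u0 * (2 * vnrm u0) + (E + B) + (1 + B) + 2 * M * A" by simp
 have Rn: "0 \<le> R" unfolding R_def using nn lI modulus_bounds(3)[OF u0_L2, of lI] by (intro add_nonneg_nonneg mult_nonneg_nonneg) auto
 have m: "0 \<le> ?m t" "?m t \<le> 2 * M" if "t \<in> {0..1}" for t
  using modulus_bounds[OF u_L2[OF that], of l] l0 u_bound[OF that] by auto
 have pw: "?D t powr p \<le> C * (M * ?m t + R)" if t: "t \<in> {0..1}" for t
 proof -
  have D0: "0 \<le> ?D t" by (simp add: discrepancy_def)
  have "?D t \<le> C0" unfolding C0_def
   using m[OF t] nn R0 N0 by (intro order_trans[OF D[OF t]] mult_left_mono add_mono) auto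
  then have "?D t powr (p - 1) \<le> C0 powr (p - 1)" using D0 p by (intro powr_mono2) auto
  then have "?D t powr (p - 1) * ?D t \<le> C0 powr (p - 1) * (N * (M * ?m t + R))" using D[OF t] D0 by (intro mult_mono) auto
  moreover have "?D t powr p = ?D t powr (p - 1) * ?D t"
  proof (cases "?D t = 0")
   case False
   then have "0 < ?D t" using D0 by simp
   then show ?thesis using powr_add[of "?D t" "p - 1" 1] by simp
  qed simp
  ultimately show ?thesis by (simp add: C1 mult.assoc)
 qed
 have cm: "continuous_on {0..1} ?m" using l0 by (intro continuous_modulus) simp
 have im: "integrable unit_time ?m" by (rule continuous_unit_time(2)[OF cm])
 have ii: "integrable unit_time (\<lambda>t. C * (M * ?m t + R))"
  by (intro integrable_mult_right L1_add im unit_time.integrable_const)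
 have "(\<integral>\<^sup>+t. ennreal (?D t powr p) \<partial>unit_time) \<le> (\<integral>\<^sup>+t. ennreal (C * (M * ?m t + R)) \<partial>unit_time)"
  by (intro nn_integral_mono ennreal_leI pw) simp
 also have "\<dots> = ennreal (\<integral>t. C * (M * ?m t + R) \<partial>unit_time)"
  by (rule nn_integral_eq_integral[OF ii], rule AE_I2) (use m(1) Cn Rn nn in simp)
 also have "(\<integral>t. C * (M * ?m t + R) \<partial>unit_time) = C * (M * (\<integral>t. ?m t \<partial>unit_time) + R)"
  using im unit_time.prob_space by simp
 also have "ennreal \<dots> \<le> ennreal (C * (M * (lI powr \<alpha> * (1 + B)) + R))"
 proof (intro ennreal_leI mult_left_mono add_right_mono Cn)
  have "(\<integral>t. ?m t \<partial>unit_time) \<le> l powr \<alpha> * (1 + B)" by (rule integral_modulus[OF l0(1) besov_bound[OF l0(1)]])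
  also have "\<dots> \<le> lI powr \<alpha> * (1 + B)" using l0 \<alpha> nn by (intro mult_right_mono powr_mono2) auto
  finally show "(\<integral>t. ?m t \<partial>unit_time) \<le> lI powr \<alpha> * (1 + B)" .
 qed (rule nn(1))
 also have "C * (M * (lI powr \<alpha> * (1 + B)) + R) = C * (M * (lI powr \<alpha> * (1 + B)) + vnrm u0 * modulus lI u0
     + lI powr (\<alpha> / 2) * (1 + B) + 2 * M * A * lI powr (\<alpha> / 2 * \<sigma>)) + C * (E + B) * \<nu> powr \<beta>"
  unfolding R_def by (simp add: algebra_simps)
 finally show ?thesis .
qed

text \<open>The Besov bound holds for almost every time only, but it gives a bound on the modulus,
  which is continuous in time; so the bound holds at every time and the force need only be
  integrable.\<close>

lemma uniform_bound:
 fixes L :: real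
 defines "\<beta> \<equiv> 1 / 2 - L * (1 - \<alpha>)"
 assumes K: "kernel_bound TYPE('n) b K" and d: "2 \<le> CARD('n)" and \<alpha>': "0 < \<alpha>'"
  and C: "AE r in unit_time. besov \<alpha>' (u r) \<le> ennreal C" "0 \<le> C"
  and l: "l \<in> {\<nu> powr L..lI}" and t: "t \<in> {0..1}"
  and \<eta>: "\<eta> = ((\<lambda>z. sqrt (2 ^ nat \<lfloor>\<alpha>'\<rfloor> * M * z)) ^^ nat \<lfloor>\<alpha>'\<rfloor>) (C * lI powr \<alpha>')"
  and N: "N = real CARD('n) ^ 3 * K"
 shows "discrepancy b u0 f u l t \<le> N * (M * \<eta> + vnrm u0 * modulus lI u0 + \<eta> * A) + N * (E + B) * \<nu> powr \<beta>"
proof -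
 note nn = constants_nonneg
 let ?m = "\<lambda>t. modulus l (u t)"
 have l0: "0 < l" "l \<le> lI" using l \<nu> by (auto intro: less_le_trans[rotated])
 have N0: "0 \<le> N" using K by (simp add: N kernel_bound_def)
 have cm: "continuous_on {0..1} ?m" using l0 by (intro continuous_modulus) simp
 have "AE r in unit_time. r \<in> {0..1}" by (rule AE_I2) simp
 with C(1) have "AE r in unit_time. ?m r \<le> \<eta>"
 proof eventually_elim
  case (elim r)
  have "?m r \<le> ((\<lambda>z. sqrt (2 ^ nat \<lfloor>\<alpha>'\<rfloor> * M * z)) ^^ nat \<lfloor>\<alpha>'\<rfloor>) (C * l powr \<alpha>')"
   by (rule besov_modulus_higher[OF u_L2[OF elim(2)] u_bound[OF elim(2)] elim(1) C(2) l0(1) \<alpha>'])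
  also have "\<dots> \<le> \<eta>"
   unfolding \<eta> using nn C(2) l0 \<alpha>' by (intro funpow_sqrt(2) mult_left_mono powr_mono2) auto
  finally show ?case .
 qed
 then have m: "?m r \<le> \<eta>" if "r \<in> {0..1}" for r using continuous_AE_bound[OF cm _ that] by blast
 have \<eta>0: "0 \<le> \<eta>" using m[of 0] modulus_bounds(3)[OF u_L2[of 0], of l] l0 by simp
 have "(\<integral>r. vnrm (f r) * ?m r \<partial>unit_time) \<le> (\<integral>r. vnrm (f r) * \<eta> \<partial>unit_time)"
  by (intro integral_mono integrable_mult_continuous f_L1L2 cm integrable_mult_left mult_left_mono m) auto
 also have "\<dots> \<le> \<eta> * A" using mult_left_mono[OF f_bound \<eta>0] by (simp add: mult.commute)
 finally have F: "(\<integral>r. vnrm (f r) * ?m r \<partial>unit_time) \<le> \<eta> * A" .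
 have "discrepancy b u0 f u l t \<le> N * (M * ?m t + vnrm u0 * modulus lI u0 + \<nu> powr \<beta> * (E + B) + (\<integral>r. vnrm (f r) * ?m r \<partial>unit_time))"
  unfolding N \<beta>_def by (rule discrepancy_le[OF K d t l])
 also have "\<dots> \<le> N * (M * \<eta> + vnrm u0 * modulus lI u0 + \<nu> powr \<beta> * (E + B) + \<eta> * A)"
  using N0 nn(1) m[OF t] F by (intro mult_left_mono add_mono order_refl) auto
 also have "\<dots> = N * (M * \<eta> + vnrm u0 * modulus lI u0 + \<eta> * A) + N * (E + B) * \<nu> powr \<beta>"
  by (simp add: algebra_simps)
 finally show ?thesis .
qed

end

text \<open>The bound separates the two limits: for fixed lI the power of \<nu> disappears in the
  upper limit, leaving \<theta> lI. An empty supremum is 0 in the extended nonnegative reals, so the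
  range with \<nu>^L > lI needs no separate treatment.\<close>

lemma limsup_sup_tendsto:
 fixes \<Phi> :: "real \<Rightarrow> real \<Rightarrow> ennreal"
 assumes le: "\<And>\<nu> l lI. \<nu> \<in> {0<..<1} \<Longrightarrow> lI \<in> {0<..<1} \<Longrightarrow> l \<in> {\<nu> powr L..lI} \<Longrightarrow> \<Phi> \<nu> l \<le> ennreal (\<theta> lI + C * \<nu> powr \<beta>)"
  and \<theta>: "(\<theta> \<longlongrightarrow> 0) (at_right 0)" and \<beta>: "0 < \<beta>"
 shows "((\<lambda>lI. Limsup (at_right 0) (\<lambda>\<nu>. SUP l\<in>{\<nu> powr L..lI}. \<Phi> \<nu> l)) \<longlongrightarrow> 0) (at_right 0)"
proof (rule tendsto_sandwich[where f="\<lambda>_. 0" and h="\<lambda>lI. ennreal (\<theta> lI)"])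
 show "((\<lambda>lI. ennreal (\<theta> lI)) \<longlongrightarrow> 0) (at_right 0)" using tendsto_ennrealI[OF \<theta>] by simp
 show "\<forall>\<^sub>F lI in at_right 0. Limsup (at_right 0) (\<lambda>\<nu>. SUP l\<in>{\<nu> powr L..lI}. \<Phi> \<nu> l) \<le> ennreal (\<theta> lI)"
 proof (rule eventually_at_rightI[of 0 1])
  fix lI :: real assume lI: "lI \<in> {0<..<1}"
  have "Limsup (at_right 0) (\<lambda>\<nu>. SUP l\<in>{\<nu> powr L..lI}. \<Phi> \<nu> l) \<le> Limsup (at_right 0) (\<lambda>\<nu>. ennreal (\<theta> lI + C * \<nu> powr \<beta>))"
  proof (rule Limsup_mono, rule eventually_at_rightI[of 0 1])
   fix \<nu> :: real assume "\<nu> \<in> {0<..<1}"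
   then show "(SUP l\<in>{\<nu> powr L..lI}. \<Phi> \<nu> l) \<le> ennreal (\<theta> lI + C * \<nu> powr \<beta>)" by (intro SUP_least le lI)
  qed simp
  also have "\<dots> = ennreal (\<theta> lI)"
  proof (rule lim_imp_Limsup)
   have "((\<lambda>\<nu>::real. \<nu> powr \<beta>) \<longlongrightarrow> 0) (at_right 0)" using \<beta> by real_asymp
   then have "((\<lambda>\<nu>. \<theta> lI + C * \<nu> powr \<beta>) \<longlongrightarrow> \<theta> lI + C * 0) (at_right 0)" by (intro tendsto_intros)
   then show "((\<lambda>\<nu>. ennreal (\<theta> lI + C * \<nu> powr \<beta>)) \<longlongrightarrow> ennreal (\<theta> lI)) (at_right 0)"
    by (intro tendsto_ennrealI) simp
  qed simp
  finally show "Limsup (at_right 0) (\<lambda>\<nu>. SUP l\<in>{\<nu> powr L..lI}. \<Phi> \<nu> l) \<le> ennreal (\<theta> lI)" .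
 qed simp
qed simp_all

text \<open>One finite supremum bounds velocity and force for all viscosities; the energy inequality
  then yields the remaining constants, which depend only on it, on \<sigma> and on the common
  initial datum.\<close>

lemma uniform_family:
 fixes u0 :: "real ^ 'n \<Rightarrow> real ^ 'n" and f u :: "real \<Rightarrow> real \<Rightarrow> real ^ 'n \<Rightarrow> real ^ 'n"
 assumes u0: "torus_field u0" "L2 u0 < \<infinity>"
  and f: "\<And>\<nu>. \<nu> \<in> {0<..<1} \<Longrightarrow> spacetime_field (f \<nu>)"
  and u: "\<And>\<nu>. \<nu> \<in> {0<..<1} \<Longrightarrow> leray_hopf \<nu> u0 (f \<nu>) (u \<nu>)"
  and u_L3: "\<And>\<nu>. \<nu> \<in> {0<..<1} \<Longrightarrow>
   Lnorm (unit_time \<Otimes>\<^sub>M torus) 3 (\<lambda>(t, x). ennreal (norm (u \<nu> t x))) < \<infinity>"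
  and \<alpha>: "\<alpha> \<in> {0<..<1}" and \<sigma>: "0 \<le> \<sigma>"
  and fin: "(SUP \<nu>\<in>{0<..<1}. Lnorm unit_time 2 (\<lambda>t. besov \<alpha> (u \<nu> t)) + Lnorm unit_time (1 + \<sigma>) (\<lambda>t. L2 (f \<nu> t))) < \<infinity>"
 obtains M A E B where "\<And>\<nu>. \<nu> \<in> {0<..<1} \<Longrightarrow> \<exists>G q. uniform_ns \<nu> u0 (f \<nu>) (u \<nu>) G q \<alpha> \<sigma> M A E B"
proof -
 let ?S = "\<lambda>\<nu>. Lnorm unit_time 2 (\<lambda>t. besov \<alpha> (u \<nu> t)) + Lnorm unit_time (1 + \<sigma>) (\<lambda>t. L2 (f \<nu> t))"
 obtain b where b: "0 \<le> b" "(SUP \<nu>\<in>{0<..<1}. ?S \<nu>) = ennreal b"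
  using fin by (cases "SUP \<nu>\<in>{0<..<1}. ?S \<nu>") auto
 have S: "?S \<nu> \<le> ennreal b" if "\<nu> \<in> {0<..<1}" for \<nu> unfolding b(2)[symmetric] by (rule SUP_upper[OF that])
 have S1: "Lnorm unit_time 2 (\<lambda>t. besov \<alpha> (u \<nu> t)) \<le> ennreal b" if "\<nu> \<in> {0<..<1}" for \<nu>
  by (rule order_trans[OF _ S[OF that]]) (simp add: add_increasing2)
 have S2: "Lnorm unit_time (1 + \<sigma>) (\<lambda>t. L2 (f \<nu> t)) \<le> ennreal b" if "\<nu> \<in> {0<..<1}" for \<nu>
  by (rule order_trans[OF _ S[OF that]]) (simp add: add_increasing)
 \<comment> \<open>The added 1 is the one from \<open>leray_hopf_ns\<close>; this single number
   bounds both the first and the (1 + \<sigma>)-th moment of the force.\<close>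
 let ?A = "1 + b powr (1 + \<sigma>)"
 let ?M = "vnrm u0 + 2 * ?A"
 show ?thesis
 proof (rule that[of ?M ?A "(vnrm u0)\<^sup>2 + ?M * ?A" "b\<^sup>2"])
  fix \<nu> :: real assume \<nu>: "\<nu> \<in> {0<..<1}"
  then have \<nu>0: "0 \<le> \<nu>" by simp
  show "\<exists>G q. uniform_ns \<nu> u0 (f \<nu>) (u \<nu>) G q \<alpha> \<sigma> ?M ?A ((vnrm u0)\<^sup>2 + ?M * ?A) (b\<^sup>2)"
  proof (rule leray_hopf_ns[OF u0 f[OF \<nu>] u[OF \<nu>] \<nu>0 u_L3[OF \<nu>] S2[OF \<nu>] b(1) \<sigma>])
   fix G q assume G: "ns \<nu> u0 (f \<nu>) (u \<nu>) G q"
    "\<And>t. t \<in> {0..1} \<Longrightarrow> 1 / 2 * (l2norm (u \<nu> t))\<^sup>2 + \<nu> * (LINT r:{0..t}|lborel. (l2norm (G r))\<^sup>2)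
      \<le> 1 / 2 * (l2norm u0)\<^sup>2 + (LINT r:{0..t}|lborel. l2inner (f \<nu> r) (u \<nu> r))"
    "integrable unit_time (\<lambda>r. vnrm (f \<nu> r) powr (1 + \<sigma>))" "(\<integral>r. vnrm (f \<nu> r) powr (1 + \<sigma>) \<partial>unit_time) \<le> b powr (1 + \<sigma>)"
    "(\<integral>r. vnrm (f \<nu> r) \<partial>unit_time) \<le> ?A"
   interpret ns \<nu> u0 "f \<nu>" "u \<nu>" G q by (rule G(1))
   have "uniform_ns \<nu> u0 (f \<nu>) (u \<nu>) G q \<alpha> \<sigma> ?M ?A ((vnrm u0)\<^sup>2 + ?M * ?A) (b\<^sup>2)"
   proof
    show "\<nu> \<in> {0<..<1}" "\<alpha> \<in> {0<..<1}" by (rule \<nu> \<alpha>)+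
    show "vnrm (u \<nu> r) \<le> ?M" if "r \<in> {0..1}" for r by (rule energy_bounds(1)[OF G(2,5) that])
    show "\<nu> * (\<integral>r. (vnrm (G r))\<^sup>2 \<partial>unit_time) \<le> (vnrm u0)\<^sup>2 + ?M * ?A" by (rule energy_bounds(2)[OF G(2,5)])
    show "(\<integral>r. vnrm (f \<nu> r) powr (1 + \<sigma>) \<partial>unit_time) \<le> ?A" using G(4) by simp
    show "(\<integral>r. (l powr - \<alpha> * modulus l (u \<nu> r))\<^sup>2 \<partial>unit_time) \<le> b\<^sup>2" if "0 < l" for l
     by (rule besov_integral[OF that \<alpha> S1[OF \<nu>] b(1)])
   qed (rule G(3) G(5))+
   then show "\<exists>G q. uniform_ns \<nu> u0 (f \<nu>) (u \<nu>) G q \<alpha> \<sigma> ?M ?A ((vnrm u0)\<^sup>2 + ?M * ?A) (b\<^sup>2)" by blast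
  qed
 qed
qed

theorem corollary1p6:
  fixes u0 :: "real ^ 'n \<Rightarrow> real ^ 'n"
    and f u :: "real \<Rightarrow> real \<Rightarrow> real ^ 'n \<Rightarrow> real ^ 'n"
    and \<alpha> L :: real
  assumes dim: "CARD('n) \<ge> 2"
    and u0: "torus_field u0" "L2 u0 < \<infinity>"
    and f: "\<And>\<nu>. \<nu> \<in> {0<..<1} \<Longrightarrow> spacetime_field (f \<nu>)"
    and u: "\<And>\<nu>. \<nu> \<in> {0<..<1} \<Longrightarrow> leray_hopf \<nu> u0 (f \<nu>) (u \<nu>)"
    and u_L3: "\<And>\<nu>. \<nu> \<in> {0<..<1} \<Longrightarrow>
      Lnorm (unit_time \<Otimes>\<^sub>M torus) 3 (\<lambda>(t, x). ennreal (norm (u \<nu> t x))) < \<infinity>"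
    and \<alpha>: "\<alpha> \<in> {0<..<1}"
    and L: "L < 1 / (2 * (1 - \<alpha>))"
  shows
    "(\<forall>\<sigma>>0.
        (SUP \<nu>\<in>{0<..<1}. Lnorm unit_time 2 (\<lambda>t. besov \<alpha> (u \<nu> t))
                          + Lnorm unit_time (1 + \<sigma>) (\<lambda>t. L2 (f \<nu> t))) < \<infinity>
        \<longrightarrow> (\<forall>p\<ge>1. \<forall>b.
              ((\<lambda>lI. Limsup (at_right 0) (\<lambda>\<nu>. SUP l\<in>{\<nu> powr L..lI}.
                  \<integral>\<^sup>+ t. ennreal (discrepancy b u0 (f \<nu>) (u \<nu>) l t powr p) \<partial>unit_time))
                \<longlongrightarrow> 0) (at_right 0)))
     \<and>
     (\<forall>\<sigma>\<ge>0. \<forall>\<alpha>'>0.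
        (SUP \<nu>\<in>{0<..<1}. Lnorm unit_time 2 (\<lambda>t. besov \<alpha> (u \<nu> t))
                          + Lnorm unit_time (1 + \<sigma>) (\<lambda>t. L2 (f \<nu> t))) < \<infinity>
        \<longrightarrow> (SUP \<nu>\<in>{0<..<1}. esssup unit_time (\<lambda>t. besov \<alpha>' (u \<nu> t))) < \<infinity>
        \<longrightarrow> (\<forall>b.
              ((\<lambda>lI. Limsup (at_right 0) (\<lambda>\<nu>. SUP l\<in>{\<nu> powr L..lI}.
                  SUP t\<in>{0..1}. ennreal (discrepancy b u0 (f \<nu>) (u \<nu>) l t)))
                \<longlongrightarrow> 0) (at_right 0)))"
proof -
 \<comment> \<open>The power of \<nu> left in the viscous term; the assumption on \<open>L\<close>
   says precisely that it is positive.\<close>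
 define \<beta> where "\<beta> = 1 / 2 - L * (1 - \<alpha>)"
 have "L * (1 - \<alpha>) < 1 / (2 * (1 - \<alpha>)) * (1 - \<alpha>)" using L \<alpha> by (intro mult_strict_right_mono) auto
 also have "\<dots> = 1 / 2" using \<alpha> by simp
 finally have \<beta>: "0 < \<beta>" by (simp add: \<beta>_def)
 note om = modulus_tendsto[OF torus_field_square_integrable[OF u0]]
 have pt: "((\<lambda>l :: real. l powr a) \<longlongrightarrow> 0) (at_right 0)" if "0 < a" for a :: real using that by real_asymp
 show ?thesis
 proof (intro conjI allI impI)
  fix \<sigma> p :: real and b
  assume \<sigma>: "0 < \<sigma>" and p: "1 \<le> p" and fin: "(SUP \<nu>\<in>{0<..<1}. Lnorm unit_time 2 (\<lambda>t. besov \<alpha> (u \<nu> t)) + Lnorm unit_time (1 + \<sigma>) (\<lambda>t. L2 (f \<nu> t))) < \<infinity>"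
  obtain M A E B where fam: "\<And>\<nu>. \<nu> \<in> {0<..<1} \<Longrightarrow> \<exists>G q. uniform_ns \<nu> u0 (f \<nu>) (u \<nu>) G q \<alpha> \<sigma> M A E B"
   using uniform_family[OF u0 f u u_L3 \<alpha> less_imp_le[OF \<sigma>] fin] by blast
  obtain K where K: "kernel_bound TYPE('n) b K" using kernel_bound_exists by blast
  define N where "N = real CARD('n) ^ 3 * K"
  define C where "C = (N * (M * (2 * M) + (vnrm u0 * (2 * vnrm u0) + (E + B) + (1 + B) + 2 * M * A))) powr (p - 1) * N"
  let ?\<theta> = "\<lambda>l. C * (M * (l powr \<alpha> * (1 + B)) + vnrm u0 * modulus l u0 + l powr (\<alpha> / 2) * (1 + B) + 2 * M * A * l powr (\<alpha> / 2 * \<sigma>))"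
  show "((\<lambda>lI. Limsup (at_right 0) (\<lambda>\<nu>. SUP l\<in>{\<nu> powr L..lI}.
         \<integral>\<^sup>+ t. ennreal (discrepancy b u0 (f \<nu>) (u \<nu>) l t powr p) \<partial>unit_time)) \<longlongrightarrow> 0) (at_right 0)"
  proof (rule limsup_sup_tendsto[where \<theta>="?\<theta>" and C="C * (E + B)", OF _ _ \<beta>])
   fix \<nu> l lI :: real assume \<nu>: "\<nu> \<in> {0<..<1}" and lI: "lI \<in> {0<..<1}" and l: "l \<in> {\<nu> powr L..lI}"
   obtain G q where "uniform_ns \<nu> u0 (f \<nu>) (u \<nu>) G q \<alpha> \<sigma> M A E B" using fam[OF \<nu>] by blast
   then interpret uniform_ns \<nu> u0 "f \<nu>" "u \<nu>" G q \<alpha> \<sigma> M A E B .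
   show "(\<integral>\<^sup>+ t. ennreal (discrepancy b u0 (f \<nu>) (u \<nu>) l t powr p) \<partial>unit_time) \<le> ennreal (?\<theta> lI + C * (E + B) * \<nu> powr \<beta>)"
    unfolding \<beta>_def by (rule moment_bound[OF K dim \<sigma> p \<beta>[unfolded \<beta>_def] lI l N_def C_def])
  next
   have "(?\<theta> \<longlongrightarrow> C * (M * (0 * (1 + B)) + vnrm u0 * 0 + 0 * (1 + B) + 2 * M * A * 0)) (at_right 0)"
    using \<alpha> \<sigma> by (intro tendsto_intros pt om) auto
   then show "(?\<theta> \<longlongrightarrow> 0) (at_right 0)" by simp
  qed
 next
  fix \<sigma> \<alpha>' :: real and b
  assume \<sigma>: "0 \<le> \<sigma>" and \<alpha>': "0 < \<alpha>'"
   and fin: "(SUP \<nu>\<in>{0<..<1}. Lnorm unit_time 2 (\<lambda>t. besov \<alpha> (u \<nu> t)) + Lnorm unit_time (1 + \<sigma>) (\<lambda>t. L2 (f \<nu> t))) < \<infinity>"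
   and fin': "(SUP \<nu>\<in>{0<..<1}. esssup unit_time (\<lambda>t. besov \<alpha>' (u \<nu> t))) < \<infinity>"
  obtain M A E B where fam: "\<And>\<nu>. \<nu> \<in> {0<..<1} \<Longrightarrow> \<exists>G q. uniform_ns \<nu> u0 (f \<nu>) (u \<nu>) G q \<alpha> \<sigma> M A E B"
   using uniform_family[OF u0 f u u_L3 \<alpha> \<sigma> fin] by blast
  obtain K where K: "kernel_bound TYPE('n) b K" using kernel_bound_exists by blast
  define N where "N = real CARD('n) ^ 3 * K"
  obtain C where C: "0 \<le> C" "(SUP \<nu>\<in>{0<..<1}. esssup unit_time (\<lambda>t. besov \<alpha>' (u \<nu> t))) = ennreal C"
   using fin' by (cases "SUP \<nu>\<in>{0<..<1}. esssup unit_time (\<lambda>t. besov \<alpha>' (u \<nu> t))") auto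
  have ae: "AE r in unit_time. besov \<alpha>' (u \<nu> r) \<le> ennreal C" if "\<nu> \<in> {0<..<1}" for \<nu>
  proof -
   have "esssup unit_time (\<lambda>t. besov \<alpha>' (u \<nu> t)) \<le> ennreal C" unfolding C(2)[symmetric] by (rule SUP_upper[OF that])
   then show ?thesis using esssup_AE[of "\<lambda>t. besov \<alpha>' (u \<nu> t)" unit_time] by (auto elim!: eventually_mono intro: order_trans)
  qed
  let ?\<eta> = "\<lambda>l. ((\<lambda>z. sqrt (2 ^ nat \<lfloor>\<alpha>'\<rfloor> * M * z)) ^^ nat \<lfloor>\<alpha>'\<rfloor>) (C * l powr \<alpha>')"
  let ?\<theta> = "\<lambda>l. N * (M * ?\<eta> l + vnrm u0 * modulus l u0 + ?\<eta> l * A)"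
  show "((\<lambda>lI. Limsup (at_right 0) (\<lambda>\<nu>. SUP l\<in>{\<nu> powr L..lI}.
         SUP t\<in>{0..1}. ennreal (discrepancy b u0 (f \<nu>) (u \<nu>) l t))) \<longlongrightarrow> 0) (at_right 0)"
  proof (rule limsup_sup_tendsto[where \<theta>="?\<theta>" and C="N * (E + B)", OF _ _ \<beta>])
   fix \<nu> l lI :: real assume \<nu>: "\<nu> \<in> {0<..<1}" and l: "l \<in> {\<nu> powr L..lI}"
   obtain G q where "uniform_ns \<nu> u0 (f \<nu>) (u \<nu>) G q \<alpha> \<sigma> M A E B" using fam[OF \<nu>] by blast
   then interpret uniform_ns \<nu> u0 "f \<nu>" "u \<nu>" G q \<alpha> \<sigma> M A E B .
   show "(SUP t\<in>{0..1}. ennreal (discrepancy b u0 (f \<nu>) (u \<nu>) l t)) \<le> ennreal (?\<theta> lI + N * (E + B) * \<nu> powr \<beta>)"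
    unfolding \<beta>_def by (intro SUP_least ennreal_leI uniform_bound[OF K dim \<alpha>' ae[OF \<nu>] C(1) l _ refl N_def])
  next
   have "((\<lambda>l. C * l powr \<alpha>') \<longlongrightarrow> C * 0) (at_right 0)" using \<alpha>' by (intro tendsto_intros pt)
   then have \<eta>: "(?\<eta> \<longlongrightarrow> 0) (at_right 0)" by (intro funpow_sqrt_tendsto) simp
   have "(?\<theta> \<longlongrightarrow> N * (M * 0 + vnrm u0 * 0 + 0 * A)) (at_right 0)" by (intro tendsto_intros \<eta> om)
   then show "(?\<theta> \<longlongrightarrow> 0) (at_right 0)" by simp
  qed
 qed
qed

end
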